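(* Let $\omega$ be a non-quasianalytic subadditive weight function, and let $$L=\frac{\partial}{\partial t}+\sum_{j=1}^{N}(a_j+ib_j)(t)\frac{\partial}{\partial x_j}$$ on $\mathbb{T}^{N+1}$, where $a_j,b_j$ are real-valued functions in $\mathcal{E}_{\{\omega\}}(\mathbb{T}^1)$. \begin{itemize} \item[(I)] Assume $b_{j0}=0$ for every $j$. \begin{itemize} \item[(I.1)] If $b_j\equiv 0$ for every $j$, then $L$ is globally $\{\omega\}$-solvable if and only if the pair $(\alpha_0,0)$ satisfies $(EDC)_2^{\{\omega\}}$. \item[(I.2)] If $b_j\not\equiv 0$ for at least one $j$, then $L$ is globally $\{\omega\}$-solvable if and only if $(a_{10},\dots,a_{N0})\in\mathbb{Z}^N$ and all the sublevel sets $\Omega_r^{\xi}$ ($r\in\mathbb{R}$, $\xi\in\mathbb{Z}^N$) are connected. \end{itemize} \item[(II)] If $b_{j0}\neq 0$ for some $j$, then $L$ is globally $\{\omega\}$-solvable if and only if: (II.1) $\dim\mathrm{span}\{b_1,\dots,b_N\}=1$; (II.2) the functions $b_j$ do not change sign; (II.3) the pair $(\alpha_0,\beta_0)$ satisfies $(EDC)_2^{\{\omega\}}$. \end{itemize}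
   Context: $\mathbb{T}^n=(\mathbb{R}/2\pi\mathbb{Z})^n$; coordinates on $\mathbb{T}^{N+1}=\mathbb{T}^1\times\mathbb{T}^N$ are $(t,x)=(t,x_1,\dots,x_N)$. A weight function is an increasing continuous $\omega:[0,\infty)\to[0,\infty)$ such that: there is $K\ge0$ with $\omega(2t)\le K(\omega(t)+1)$ for all $t\ge0$; $\omega(t)=O(t)$ as $t\to\infty$; $\log t=o(\omega(t))$ as $t\to\infty$; $\varphi(t)=\omega(e^t)$ is convex on $[0,\infty)$. One may assume $\omega=0$ on $[0,1]$. $\omega$ is subadditive if $\omega(s+t)\le\omega(s)+\omega(t)$; it is non-quasianalytic if $\int_1^\infty\omega(t)t^{-2}dt<\infty$ (quasianalytic otherwise). The Young conjugate is $\varphi^*(t)=\sup_{s\ge0}\{st-\varphi(s)\}$. For $\lambda>0$ and $f\in C^\infty(\mathbb{T}^n)$ put $\|f\|_\lambda=\sup_{x\in\mathbb{T}^n}\sup_{\alpha\in\mathbb{Z}_+^n}|\partial^\alpha f(x)|\exp(-\lambda\varphi^*(|\alpha|/\lambda))$. $\mathcal{E}_{\{\omega\}}(\mathbb{T}^n)=\{f\in C^\infty(\mathbb{T}^n):\|f\|_\lambda<\infty$ for some $\lambda>0\}$, endowed with the inductive limit topology of the Banach spaces $\mathcal{E}_{\{\omega\},k}(\mathbb{T}^n)=\{f:\|f\|_{1/k}<\infty\}$, $k\in\mathbb{N}$; $\mathcal{E}'_{\{\omega\}}(\mathbb{T}^n)$ is its strong dual. The transpose ${}^tL:\mathcal{E}'_{\{\omega\}}(\mathbb{T}^{N+1})\to\mathcal{E}'_{\{\omega\}}(\mathbb{T}^{N+1})$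 is defined by $\langle{}^tL\mu,\phi\rangle=\langle\mu,L\phi\rangle$ (here ${}^tL=-L$). $(\ker{}^tL)^\circ=\{f\in\mathcal{E}_{\{\omega\}}(\mathbb{T}^{N+1}):\langle\mu,f\rangle=0$ for all $\mu\in\mathcal{E}'_{\{\omega\}}(\mathbb{T}^{N+1})$ with ${}^tL\mu=0\}$. $L$ is globally $\{\omega\}$-solvable if $L\mathcal{E}_{\{\omega\}}(\mathbb{T}^{N+1})=(\ker{}^tL)^\circ$ (equivalently, the range of $L$ on $\mathcal{E}_{\{\omega\}}(\mathbb{T}^{N+1})$ is closed). Notation: $a_{j0}=\frac1{2\pi}\int_0^{2\pi}a_j$, $b_{j0}=\frac1{2\pi}\int_0^{2\pi}b_j$, $\alpha_0=(a_{10},\dots,a_{N0})$, $\beta_0=(b_{10},\dots,b_{N0})$, $\alpha(t)=(a_1(t),\dots,a_N(t))$, $\beta(t)=(b_1(t),\dots,b_N(t))$. Sublevel sets: $\Omega_r^\xi=\{t\in\mathbb{T}^1:\int_0^t\langle\xi,\beta(\tau)\rangle d\tau<r\}$, $r\in\mathbb{R}$, $\xi\in\mathbb{Z}^N$. A pair $(\alpha,\beta)\in\mathbb{R}^N\times\mathbb{R}^N$ satisfies $(EDC)_2^{\{\omega\}}$ if for every $\epsilon>0$ there is $C_\epsilon>0$ with $|\tau+\langle\xi,\alpha+i\beta\rangle|\ge C_\epsilon\exp\{-\epsilon\omega(|(\tau,\xi)|)\}$ for all $(\tau,\xi)\in\mathbb{Z}\times\mathbb{Z}^N$ with $\tau+\langle\xi,\alpha+i\beta\rangle\ne0$.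 A real function changes sign if it takes both strictly positive and strictly negative values. *)

theory Defs
  imports "HOL-Analysis.Analysis" "HOL-Library.Landau_Symbols" "HOL-Library.Function_Algebras"
begin

definition weight_function :: "(real \<Rightarrow> real) \<Rightarrow> bool" where
  "weight_function \<omega> \<longleftrightarrow>
     mono_on {0..} \<omega> \<and> continuous_on {0..} \<omega> \<and> (\<forall>t\<ge>0. \<omega> t \<ge> 0) \<and>
     (\<exists>K\<ge>0. \<forall>t\<ge>0. \<omega> (2 * t) \<le> K * (\<omega> t + 1)) \<and>
     \<omega> \<in> O[at_top](\<lambda>t. t) \<and>
     (\<lambda>t. ln t) \<in> o[at_top](\<omega>) \<and>
     convex_on {0..} (\<lambda>t. \<omega> (exp t))"

definition subadditive_weight :: "(real \<Rightarrow> real) \<Rightarrow> bool" where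
  "subadditive_weight \<omega> \<longleftrightarrow> (\<forall>s\<ge>0. \<forall>t\<ge>0. \<omega> (s + t) \<le> \<omega> s + \<omega> t)"

definition non_quasianalytic :: "(real \<Rightarrow> real) \<Rightarrow> bool" where
  "non_quasianalytic \<omega> \<longleftrightarrow> (\<lambda>t. \<omega> t / t\<^sup>2) integrable_on {1..}"

definition young_conj :: "(real \<Rightarrow> real) \<Rightarrow> real \<Rightarrow> real" where
  "young_conj \<omega> t = (SUP s\<in>{0..}. s * t - \<omega> (exp s))"

text \<open>The torus \<open>T^n\<close> is represented by \<open>2\<pi>\<close>-periodic functions on a Euclidean space;
  \<open>T^1\<close> by the type real and \<open>T^(N+1) = T^1 \<times> T^N\<close> by \<open>real \<times> real^'n\<close>.\<close>

definition periodic_fn :: "('a::euclidean_space \<Rightarrow> 'b) \<Rightarrow> bool" where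
  "periodic_fn f \<longleftrightarrow> (\<forall>x. \<forall>e\<in>Basis. f (x + (2 * pi) *\<^sub>R e) = f x)"

definition pderiv_dir :: "'a::euclidean_space \<Rightarrow> ('a \<Rightarrow> 'b::real_normed_vector) \<Rightarrow> 'a \<Rightarrow> 'b" where
  "pderiv_dir e f = (\<lambda>x. frechet_derivative f (at x) e)"

text \<open>Iterated partial derivative along a list of coordinate directions;
  a list of length \<open>k\<close> corresponds to a multi-index \<open>\<alpha>\<close> with \<open>|\<alpha>| = k\<close>.\<close>
fun iter_pderiv :: "'a::euclidean_space list \<Rightarrow> ('a \<Rightarrow> 'b::real_normed_vector) \<Rightarrow> 'a \<Rightarrow> 'b" where
  "iter_pderiv [] f = f"
| "iter_pderiv (e # es) f = pderiv_dir e (iter_pderiv es f)"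

definition smooth_fn :: "('a::euclidean_space \<Rightarrow> 'b::real_normed_vector) \<Rightarrow> bool" where
  "smooth_fn f \<longleftrightarrow> (\<forall>es. set es \<subseteq> Basis \<longrightarrow> (\<forall>x. iter_pderiv es f differentiable (at x)))"

definition ultra_norm :: "(real \<Rightarrow> real) \<Rightarrow> real \<Rightarrow> ('a::euclidean_space \<Rightarrow> 'b::real_normed_vector) \<Rightarrow> real" where
  "ultra_norm \<omega> lam f =
     Sup {norm (iter_pderiv es f x) * exp (- lam * young_conj \<omega> (real (length es) / lam)) | es x.
          set es \<subseteq> Basis}"

definition ultra_bounded :: "(real \<Rightarrow> real) \<Rightarrow> real \<Rightarrow> ('a::euclidean_space \<Rightarrow> 'b::real_normed_vector) \<Rightarrow> bool" where
  "ultra_bounded \<omega> lam f \<longleftrightarrow>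
     bdd_above {norm (iter_pderiv es f x) * exp (- lam * young_conj \<omega> (real (length es) / lam)) | es x.
          set es \<subseteq> Basis}"

definition ultra_step :: "(real \<Rightarrow> real) \<Rightarrow> nat \<Rightarrow> ('a::euclidean_space \<Rightarrow> 'b::real_normed_vector) set" where
  "ultra_step \<omega> k = {f. smooth_fn f \<and> periodic_fn f \<and> ultra_bounded \<omega> (1 / real k) f}"

definition ultra_space :: "(real \<Rightarrow> real) \<Rightarrow> ('a::euclidean_space \<Rightarrow> 'b::real_normed_vector) set" where
  "ultra_space \<omega> = {f. smooth_fn f \<and> periodic_fn f \<and> (\<exists>lam>0. ultra_bounded \<omega> lam f)}"

text \<open>The dual \<open>E'_{\<omega>}(T^n)\<close>: linear functionals on \<open>E_{\<omega>}\<close> that are continuous for the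
  inductive limit topology, i.e. continuous on every step space \<open>E_{\<omega>},k\<close>.
  Functionals are represented by total functions; only their values on \<open>E_{\<omega>}\<close> matter.\<close>
definition ultra_dual :: "(real \<Rightarrow> real) \<Rightarrow> ((('a::euclidean_space) \<Rightarrow> complex) \<Rightarrow> complex) set" where
  "ultra_dual \<omega> = {\<mu>.
     (\<forall>f\<in>ultra_space \<omega>. \<forall>g\<in>ultra_space \<omega>. \<mu> (\<lambda>x. f x + g x) = \<mu> f + \<mu> g) \<and>
     (\<forall>f\<in>ultra_space \<omega>. \<forall>c. \<mu> (\<lambda>x. c * f x) = c * \<mu> f) \<and>
     (\<forall>k\<ge>1. \<exists>C. \<forall>f\<in>ultra_step \<omega> k. norm (\<mu> f) \<le> C * ultra_norm \<omega> (1 / real k) f)}"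

definition opL :: "('n::finite \<Rightarrow> real \<Rightarrow> real) \<Rightarrow> ('n \<Rightarrow> real \<Rightarrow> real) \<Rightarrow>
    (real \<times> (real^'n) \<Rightarrow> complex) \<Rightarrow> real \<times> (real^'n) \<Rightarrow> complex" where
  "opL a b u = (\<lambda>(t, x). pderiv_dir (1, 0) u (t, x) +
      (\<Sum>j\<in>UNIV. (complex_of_real (a j t) + \<i> * complex_of_real (b j t)) * pderiv_dir (0, axis j 1) u (t, x)))"

definition ker_transpose where
  "ker_transpose \<omega> a b = {\<mu> \<in> ultra_dual \<omega>. \<forall>\<phi>\<in>ultra_space \<omega>. \<mu> (opL a b \<phi>) = 0}"

definition annihilator_ker where
  "annihilator_ker \<omega> a b = {f \<in> ultra_space \<omega>. \<forall>\<mu>\<in>ker_transpose \<omega> a b. \<mu> f = 0}"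

definition globally_solvable :: "(real \<Rightarrow> real) \<Rightarrow> ('n::finite \<Rightarrow> real \<Rightarrow> real) \<Rightarrow> ('n \<Rightarrow> real \<Rightarrow> real) \<Rightarrow> bool" where
  "globally_solvable \<omega> a b \<longleftrightarrow> opL a b ` ultra_space \<omega> = annihilator_ker \<omega> a b"

definition mean :: "(real \<Rightarrow> real) \<Rightarrow> real" where
  "mean f = integral {0..2*pi} f / (2 * pi)"

definition EDC2 :: "(real \<Rightarrow> real) \<Rightarrow> ('n::finite \<Rightarrow> real) \<Rightarrow> ('n \<Rightarrow> real) \<Rightarrow> bool" where
  "EDC2 \<omega> \<alpha> \<beta> \<longleftrightarrow> (\<forall>\<epsilon>>0. \<exists>C>0. \<forall>(\<tau>::int) (\<xi>::'n \<Rightarrow> int).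
     (let z = of_int \<tau> + (\<Sum>j\<in>UNIV. of_int (\<xi> j) * Complex (\<alpha> j) (\<beta> j)) in
      z \<noteq> 0 \<longrightarrow>
      cmod z \<ge> C * exp (- \<epsilon> * \<omega> (sqrt (real_of_int (\<tau>\<^sup>2) + (\<Sum>j\<in>UNIV. real_of_int ((\<xi> j)\<^sup>2)))))))"

text \<open>Sublevel set \<open>\<Omega>_r^\<xi>\<close> as a subset of \<open>T^1\<close>, the latter identified with the unit circle in
  \<open>\<complex>\<close> via \<open>t \<mapsto> e^{it}\<close> (so connectedness is w.r.t. the circle topology).\<close>
definition sublevel :: "('n::finite \<Rightarrow> real \<Rightarrow> real) \<Rightarrow> ('n \<Rightarrow> int) \<Rightarrow> real \<Rightarrow> complex set" where
  "sublevel b \<xi> r = {cis t | t. t \<in> {0..2*pi} \<and>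
      integral {0..t} (\<lambda>\<tau>. \<Sum>j\<in>UNIV. real_of_int (\<xi> j) * b j \<tau>) < r}"

definition changes_sign :: "(real \<Rightarrow> real) \<Rightarrow> bool" where
  "changes_sign f \<longleftrightarrow> (\<exists>s t. f s > 0 \<and> f t < 0)"

definition dim_span_fun :: "(real \<Rightarrow> real) set \<Rightarrow> nat" where
  "dim_span_fun S = vector_space.dim (\<lambda>c f x. c * f x) (module.span (\<lambda>c f x. c * f x) S)"

end

theory Submission
  imports Defs
begin

text \<open>Expanding in \<open>x\<close> turns \<open>L u = f\<close> into the equations \<open>u' + i \<langle>\<xi>, a + i b\<rangle> u = f\<close> for periodic
  functions of \<open>t\<close>, one for each frequency \<open>\<xi>\<close>. With \<open>Q\<close> a primitive of \<open>i \<langle>\<xi>, a + i b\<rangle>\<close> the solutions are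
  explicit integrals of \<open>e^{Q(s) - Q(t)} f(s)\<close>. If \<open>\<langle>\<xi>, b\<rangle>\<close> has constant sign, one of the two periodic
  kernels is bounded and the Diophantine condition controls the denominator \<open>e^{Q(2\<pi>)} - 1\<close>. If all modes
  are resonant, connected sublevel sets allow one to integrate from the maximum of \<open>\<integral>\<langle>\<xi>, b\<rangle>\<close> to any \<open>t\<close>
  inside a region where \<open>e^{Q(s) - Q(t)}\<close> stays bounded.

  Conversely, a series \<open>\<Sum> L u\<^sub>n\<close> of single modes whose terms decay like \<open>e^{-\<delta> \<omega>(|\<xi>\<^sub>n|)}\<close> lies in the
  annihilator of the kernel of the transpose, whatever the size of the \<open>u\<^sub>n\<close>. Solvability thus produces
  small \<open>v\<^sub>n\<close> with \<open>L v\<^sub>n = L u\<^sub>n\<close>, which fails for normalised eigenfunctions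
  \<open>u\<^sub>n\<close> with eigenvalues too close to 0, and for
  \<open>u\<^sub>n = e^{-Q} \<psi>\<close> with a cutoff \<open>\<psi>\<close> that drops to 0 only in the valleys on either side of a hill of
  \<open>\<integral>\<langle>\<xi>, b\<rangle>\<close>.\<close>

subsection \<open>Weight functions\<close>

text \<open>Orders of differentiation and sizes of frequencies are exchanged through one sequence,
  \<open>M lam k\<close>, the supremum of r^k exp(- lam \<omega>(r)) over r \<ge> 1. Exchanges and
  products worsen lam or a decay rate by a fixed factor, which is harmless because the space asks
  only for some lam > 0. The factor must not depend on the frequency, and this is the main analytic
  obstacle: the coefficient of the mode equation grows like |\<xi>|. Subadditivity of \<omega> makes
  \<open>M lam k / fact k\<close> supermultiplicative, and a majorant argument then bounds all
  derivatives of a solution by its size times exp(\<mu> \<omega>(|\<xi>|)), with \<mu> as small as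
  desired. Hence only sup norms of solutions have to be estimated.

  For necessity, L v = L u in one mode determines v up to a multiple of e^{-Q}. In a nonresonant
  mode periodicity forces v = u, and one hill suffices. In a resonant mode the multiple is free, and
  a second hill, where u vanishes, is needed to bound it; this is why disconnected sublevel sets,
  rather than mere changes of sign, are the obstruction there. Non-quasianalyticity enters through
  the cutoffs.\<close>

locale subadd_weight =
  fixes \<omega> :: "real \<Rightarrow> real"
  assumes weight: "weight_function \<omega>" and subadd: "subadditive_weight \<omega>"
begin

lemma omega_mono: "0 \<le> s \<Longrightarrow> s \<le> t \<Longrightarrow> \<omega> s \<le> \<omega> t"
  using weight unfolding weight_function_def mono_on_def by auto

lemma omega_nonneg: "0 \<le> t \<Longrightarrow> 0 \<le> \<omega> t"
  using weight unfolding weight_function_def by auto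

lemma omega_add: "0 \<le> s \<Longrightarrow> 0 \<le> t \<Longrightarrow> \<omega> (s + t) \<le> \<omega> s + \<omega> t"
  using subadd unfolding subadditive_weight_def by auto

lemma omega_mult_nat:
  assumes "0 \<le> x" "1 \<le> n" shows "\<omega> (real n * x) \<le> real n * \<omega> x"
  using assms(2)
proof (induction n rule: dec_induct)
  case (step n)
  have "\<omega> (real (Suc n) * x) = \<omega> (real n * x + x)" by (simp add: algebra_simps)
  also have "\<dots> \<le> \<omega> (real n * x) + \<omega> x" using assms by (intro omega_add) auto
  also have "\<dots> \<le> real (Suc n) * \<omega> x" using step by (simp add: algebra_simps)
  finally show ?case .
qed simp

lemma ln_le_omega:
  assumes "\<delta> > 0" shows "\<exists>C. \<forall>x\<ge>1. ln x \<le> C + \<delta> * \<omega> x"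
proof -
  have "(\<lambda>t. ln t) \<in> o[at_top](\<omega>)" using weight unfolding weight_function_def by auto
  from landau_o.smallD[OF this assms]
  obtain X where X: "\<And>x. x \<ge> X \<Longrightarrow> norm (ln x) \<le> \<delta> * norm (\<omega> x)"
    unfolding eventually_at_top_linorder by auto
  have "ln x \<le> ln (max X 1) + \<delta> * \<omega> x" if "x \<ge> 1" for x
  proof (cases "x \<ge> X")
    case True
    have "ln x \<le> \<delta> * \<omega> x" using X[OF True] omega_nonneg[of x] that by auto
    moreover have "ln (max X 1) \<ge> 0" by simp
    ultimately show ?thesis by linarith
  next
    case False
    then have "ln x \<le> ln (max X 1)" using that by (subst ln_le_cancel_iff) auto
    moreover have "\<delta> * \<omega> x \<ge> 0" using assms omega_nonneg[of x] that by auto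
    ultimately show ?thesis by linarith
  qed
  then show ?thesis by blast
qed

lemma power_le_exp_omega:
  assumes "\<delta> > 0" shows "\<exists>C>0. \<forall>x\<ge>1. x ^ m \<le> C * exp (\<delta> * \<omega> x)"
proof -
  obtain C where C: "\<And>x. x \<ge> 1 \<Longrightarrow> ln x \<le> C + (\<delta> / (real m + 1)) * \<omega> x"
    using ln_le_omega[of "\<delta> / (real m + 1)"] assms by auto
  have "x ^ m \<le> exp (real m * C) * exp (\<delta> * \<omega> x)" if "x \<ge> 1" for x
  proof -
    have "x ^ m = exp (real m * ln x)" using that by (simp add: exp_of_nat_mult)
    also have "\<dots> \<le> exp (real m * (C + (\<delta> / (real m + 1)) * \<omega> x))"
      using C[OF that] by (simp add: mult_left_mono)
    also have "\<dots> \<le> exp (real m * C + \<delta> * \<omega> x)"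
    proof -
      have "real m / (real m + 1) * (\<delta> * \<omega> x) \<le> 1 * (\<delta> * \<omega> x)"
        using assms omega_nonneg[of x] that by (intro mult_right_mono) auto
      then show ?thesis by (simp add: algebra_simps)
    qed
    finally show ?thesis by (simp add: exp_add)
  qed
  then show ?thesis by (intro exI[of _ "exp (real m * C)"]) auto
qed

text \<open>The condition log r = o(\<omega>(r)), used with the constant 1/(t + 1) at r = exp s,
  bounds the set. Without such a bound the real \<open>SUP\<close> in \<open>young_conj\<close>
  would carry no information.\<close>

lemma young_bdd:
  assumes "t \<ge> 0" shows "bdd_above ((\<lambda>s. s * t - \<omega> (exp s)) ` {0..})"
proof -
  obtain C where C: "\<And>x. x \<ge> 1 \<Longrightarrow> ln x \<le> C + (1 / (t + 1)) * \<omega> x"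
    using ln_le_omega[of "1 / (t + 1)"] assms by auto
  have "s * t - \<omega> (exp s) \<le> C * (t + 1)" if "s \<ge> 0" for s
  proof -
    have "s \<le> C + (1 / (t + 1)) * \<omega> (exp s)" using C[of "exp s"] that by simp
    then have "s * (t + 1) \<le> C * (t + 1) + \<omega> (exp s)" using assms by (simp add: field_simps)
    then show ?thesis using that by (simp add: algebra_simps)
  qed
  then show ?thesis by (intro bdd_aboveI[of _ "C * (t + 1)"]) auto
qed

section \<open>The sequence of admissible derivative growth\<close>

text \<open>Substituting r = exp s in the Young conjugate, this is the supremum of r^k exp(- lam
  \<omega>(r)) over r \<ge> 1. The facts \<open>power_le_M\<close> and \<open>M_le\<close> say that
  it is an upper bound and the least one; later estimates argue with this supremum.\<close>

definition M :: "real \<Rightarrow> nat \<Rightarrow> real" where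
  "M lam k = exp (lam * young_conj \<omega> (real k / lam))"

lemma M_pos[simp]: "0 < M lam k" by (simp add: M_def)

lemma M_nonneg[simp]: "0 \<le> M lam k" by (simp add: M_def)

lemma power_le_M:
  assumes "lam > 0" "r \<ge> 1" shows "r ^ k * exp (- lam * \<omega> r) \<le> M lam k"
proof -
  have "ln r * (real k / lam) - \<omega> (exp (ln r)) \<le> young_conj \<omega> (real k / lam)"
    unfolding young_conj_def using assms by (intro cSUP_upper young_bdd) auto
  then have "lam * (ln r * (real k / lam) - \<omega> r) \<le> lam * young_conj \<omega> (real k / lam)"
    using assms by (intro mult_left_mono) auto
  then have "real k * ln r - lam * \<omega> r \<le> lam * young_conj \<omega> (real k / lam)"
    using assms by (simp add: algebra_simps)
  then have "exp (real k * ln r - lam * \<omega> r) \<le> M lam k" by (simp add: M_def)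
  moreover have "exp (real k * ln r - lam * \<omega> r) = r ^ k * exp (- lam * \<omega> r)"
    using assms by (simp add: exp_diff exp_minus field_simps flip: exp_of_nat_mult)
      (simp add: exp_of_nat_mult)
  ultimately show ?thesis by simp
qed

lemma M_le:
  assumes "lam > 0" "\<And>r. r \<ge> 1 \<Longrightarrow> r ^ k * exp (- lam * \<omega> r) \<le> X" shows "M lam k \<le> X"
proof -
  have X: "0 < X" using assms(2)[of 1] by (smt (verit) exp_gt_zero mult_pos_pos power_one)
  have "young_conj \<omega> (real k / lam) \<le> ln X / lam"
    unfolding young_conj_def
  proof (rule cSUP_least)
    fix s :: real assume "s \<in> {0..}"
    then have "exp s ^ k * exp (- lam * \<omega> (exp s)) \<le> X" by (intro assms(2)) auto
    then have "exp (real k * s - lam * \<omega> (exp s)) \<le> X"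
      by (simp add: exp_diff exp_minus field_simps exp_of_nat_mult exp_of_nat2_mult)
    then have "real k * s - lam * \<omega> (exp s) \<le> ln X" using X by (simp add: ln_ge_iff)
    then have "(s * (real k / lam) - \<omega> (exp s)) * lam \<le> ln X"
      using assms(1) by (simp add: algebra_simps)
    then show "s * (real k / lam) - \<omega> (exp s) \<le> ln X / lam"
      using assms(1) by (simp add: pos_le_divide_eq)
  qed auto
  then have "M lam k \<le> exp (ln X)" unfolding M_def using assms(1) by (simp add: field_simps)
  then show ?thesis using X by simp
qed

text \<open>One term of the binomial expansion of (r + s)^(j + k) is at most the whole, and
  subadditivity gives exp(- lam \<omega>(r)) exp(- lam \<omega>(s)) \<le> exp(- lam \<omega>(r +
  s)). The binomial factor on the left is what keeps the Leibniz sums and the recursion of the mode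
  equations under control.\<close>

lemma M_submult:
  assumes "lam > 0"
  shows "real ((j + k) choose j) * (M lam j * M lam k) \<le> M lam (j + k)"
proof -
  let ?b = "real ((j + k) choose j)"
  have b: "?b > 0" by simp
  have *: "r ^ j * exp (- lam * \<omega> r) * (s ^ k * exp (- lam * \<omega> s)) \<le> M lam (j + k) / ?b"
    if "r \<ge> 1" "s \<ge> 1" for r s
  proof -
    have "?b * r ^ j * s ^ k \<le> (r + s) ^ (j + k)"
    proof -
      have "?b * r ^ j * s ^ k = (\<lambda>i. real ((j + k) choose i) * r ^ i * s ^ (j + k - i)) j" by simp
      also have "\<dots> \<le> (\<Sum>i\<le>j+k. real ((j + k) choose i) * r ^ i * s ^ (j + k - i))"
        using that by (intro member_le_sum) auto
      finally show ?thesis by (simp add: binomial_ring)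
    qed
    moreover have "exp (- lam * \<omega> r) * exp (- lam * \<omega> s) \<le> exp (- lam * \<omega> (r + s))"
    proof -
      have "lam * \<omega> (r + s) \<le> lam * (\<omega> r + \<omega> s)"
        using omega_add[of r s] that assms by (intro mult_left_mono) auto
      then show ?thesis by (simp add: algebra_simps flip: exp_add)
    qed
    ultimately have "(?b * r ^ j * s ^ k) * (exp (- lam * \<omega> r) * exp (- lam * \<omega> s))
        \<le> (r + s) ^ (j + k) * exp (- lam * \<omega> (r + s))"
      using that by (intro mult_mono) auto
    also have "\<dots> \<le> M lam (j + k)" using that assms by (intro power_le_M) auto
    finally show ?thesis using b by (simp add: field_simps)
  qed
  \<comment> \<open>The suprema over r and over s are taken one after the other, the remaining
    factor being moved to the right each time.\<close>
  have "M lam j \<le> M lam (j + k) / ?b / M lam k"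
  proof (rule M_le[OF assms])
    fix r :: real assume r: "1 \<le> r"
    have "M lam k \<le> M lam (j + k) / ?b / (r ^ j * exp (- lam * \<omega> r))"
    proof (rule M_le[OF assms])
      fix s :: real assume s: "1 \<le> s"
      have "0 < r ^ j * exp (- lam * \<omega> r)" using r by simp
      then show "s ^ k * exp (- lam * \<omega> s) \<le> M lam (j + k) / ?b / (r ^ j * exp (- lam * \<omega> r))"
        using *[OF r s] by (simp only: pos_le_divide_eq mult.commute)
    qed
    moreover have "0 < r ^ j * exp (- lam * \<omega> r)" using r by simp
    ultimately show "r ^ j * exp (- lam * \<omega> r) \<le> M lam (j + k) / ?b / M lam k"
      by (simp only: pos_le_divide_eq M_pos mult.commute)
  qed
  then show ?thesis using b by (simp add: field_simps)
qed

lemma M_mult_le: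
  assumes "lam > 0" shows "M lam j * M lam k \<le> M lam (j + k)"
proof -
  have "1 \<le> real ((j + k) choose j)" by (simp add: Suc_leI)
  then have "1 * (M lam j * M lam k) \<le> real ((j + k) choose j) * (M lam j * M lam k)"
    by (intro mult_right_mono) auto
  also have "\<dots> \<le> M lam (j + k)" by (rule M_submult[OF assms])
  finally show ?thesis by simp
qed

text \<open>Halving lam splits the exponential into one factor for each order. This is how mixed
  derivatives are separated into orders in t and orders in x.\<close>

lemma M_add_le:
  assumes "lam > 0" shows "M lam (j + k) \<le> M (lam / 2) j * M (lam / 2) k"
proof (rule M_le[OF assms])
  fix r :: real assume r: "1 \<le> r"
  have "exp (- lam * \<omega> r) = exp (- (lam/2) * \<omega> r) * exp (- (lam/2) * \<omega> r)"
    by (simp flip: exp_add)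
  then have "r ^ (j + k) * exp (- lam * \<omega> r) =
      (r ^ j * exp (- (lam/2) * \<omega> r)) * (r ^ k * exp (- (lam/2) * \<omega> r))"
    by (simp add: power_add)
  also have "\<dots> \<le> M (lam / 2) j * M (lam / 2) k"
    using r assms by (intro mult_mono power_le_M) auto
  finally show "r ^ (j + k) * exp (- lam * \<omega> r) \<le> M (lam / 2) j * M (lam / 2) k" .
qed

lemma M_antimono:
  assumes "0 < lam'" "lam' \<le> lam" shows "M lam k \<le> M lam' k"
proof (rule M_le)
  fix r :: real assume r: "1 \<le> r"
  have "r ^ k * exp (- lam * \<omega> r) \<le> r ^ k * exp (- lam' * \<omega> r)"
    using r assms omega_nonneg[of r] by (simp add: mult_right_mono)
  also have "\<dots> \<le> M lam' k" using r assms by (intro power_le_M) auto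
  finally show "r ^ k * exp (- lam * \<omega> r) \<le> M lam' k" .
qed (use assms in auto)

text \<open>Replacing r by B r merges B^k and r^k, and \<omega>(B r) \<le> B \<omega>(r) charges the
  change to lam. Geometric factors can therefore always be absorbed.\<close>

lemma M_power_mult:
  assumes "lam > 0" "1 \<le> B" shows "real B ^ k * M lam k \<le> M (lam / real B) k"
proof -
  have B: "real B \<ge> 1" using assms by simp
  have "M lam k \<le> M (lam / real B) k / real B ^ k"
  proof (rule M_le[OF assms(1)])
    fix r :: real assume r: "1 \<le> r"
    have Br: "1 \<le> real B * r" using B r by (metis mult_mono mult_1 zero_le_one order_trans)
    have "- lam * \<omega> r \<le> - (lam / real B) * \<omega> (real B * r)"
    proof -
      have "(lam / real B) * \<omega> (real B * r) \<le> (lam / real B) * (real B * \<omega> r)"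
        using omega_mult_nat[of r B] r assms by (intro mult_left_mono) auto
      then show ?thesis using B by simp
    qed
    then have "r ^ k * exp (- lam * \<omega> r) \<le> r ^ k * exp (- (lam / real B) * \<omega> (real B * r))"
      using r by (intro mult_left_mono) auto
    also have "\<dots> = (real B * r) ^ k * exp (- (lam / real B) * \<omega> (real B * r)) / real B ^ k"
      using B by (simp add: power_mult_distrib)
    also have "\<dots> \<le> M (lam / real B) k / real B ^ k"
      using Br assms by (intro divide_right_mono power_le_M) auto
    finally show "r ^ k * exp (- lam * \<omega> r) \<le> M (lam / real B) k / real B ^ k" .
  qed
  then show ?thesis using B by (simp add: field_simps)
qed

lemma M_Suc_mono: "lam > 0 \<Longrightarrow> M lam k \<le> M lam (Suc k)"
proof (rule M_le)
  fix r :: real assume "lam > 0" and r: "1 \<le> r"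
  have "r ^ k * exp (- lam * \<omega> r) \<le> r ^ Suc k * exp (- lam * \<omega> r)"
    using r by (intro mult_right_mono power_increasing) auto
  also have "\<dots> \<le> M lam (Suc k)" using r \<open>lam > 0\<close> by (intro power_le_M) auto
  finally show "r ^ k * exp (- lam * \<omega> r) \<le> M lam (Suc k)" .
qed

text \<open>The order \<open>l\<close> is the integer part of the slope of a supporting line of the convex function
  \<open>\<lambda> \<omega> (exp s)\<close> at \<open>s = ln x\<close>; the rounding costs the factor \<open>x\<close>.\<close>
lemma M_le_exp_omega:
  assumes "lam > 0" "x \<ge> 1"
  shows "\<exists>l. M lam l \<le> x ^ l * (x * exp (- lam * \<omega> x))"
proof (cases "x = 1")
  case True
  have "M lam 0 \<le> x ^ 0 * (x * exp (- lam * \<omega> x))"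
    using assms True by (intro M_le) (auto intro!: mult_left_mono omega_mono)
  then show ?thesis by blast
next
  case False
  then have x: "x > 1" using assms by simp
  define \<phi> where "\<phi> = (\<lambda>s. lam * \<omega> (exp s))"
  define p where "p = Inf ((\<lambda>t. (\<phi> (ln x) - \<phi> t) / (ln x - t)) ` ({ln x<..} \<inter> {0..}))"
  have conv: "convex_on {0..} \<phi>"
    unfolding \<phi>_def using weight assms unfolding weight_function_def
    by (intro convex_on_cmul) auto
  have supp: "\<phi> s \<ge> \<phi> (ln x) + p * (s - ln x)" if "s \<ge> 0" for s
    unfolding p_def using conv x that by (intro convex_le_Inf_differential) auto
  have p0: "p \<ge> 0"
  proof -
    have "\<phi> 0 \<le> \<phi> (ln x)" unfolding \<phi>_def using assms by (intro mult_left_mono omega_mono) auto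
    then have "p * ln x \<ge> 0" using supp[of 0] by simp
    then show ?thesis using x by (simp add: zero_le_mult_iff)
  qed
  define l where "l = nat \<lfloor>p\<rfloor>"
  have l: "real l \<le> p" "p \<le> real l + 1" using p0 unfolding l_def by linarith+
  have "M lam l \<le> x ^ l * (x * exp (- lam * \<omega> x))"
  proof (rule M_le[OF assms(1)])
    fix r :: real assume r: "1 \<le> r"
    define s where "s = ln r"
    have s: "s \<ge> 0" "r = exp s" using r by (auto simp: s_def)
    have "real l * s - \<phi> s \<le> real l * ln x + ln x - \<phi> (ln x)"
    proof (cases "s \<ge> ln x")
      case True
      have "(p - real l) * (s - ln x) \<ge> 0" using True l by auto
      moreover have "ln x \<ge> 0" using x by simp
      ultimately show ?thesis using supp[OF s(1)] by (simp add: algebra_simps)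
    next
      case False
      have "(p - real l) * (ln x - s) \<le> 1 * (ln x - s)" using False l by (intro mult_right_mono) auto
      then show ?thesis using supp[OF s(1)] s by (simp add: algebra_simps)
    qed
    then have "exp (real l * s - \<phi> s) \<le> exp (real l * ln x + ln x - \<phi> (ln x))" by simp
    then show "r ^ l * exp (- lam * \<omega> r) \<le> x ^ l * (x * exp (- lam * \<omega> x))"
      using x s by (simp add: \<phi>_def exp_diff exp_add exp_of_nat_mult exp_of_nat2_mult exp_minus field_simps)
  qed
  then show ?thesis by blast
qed

text \<open>The hypothesis is used for the order l at which the supremum defining
  \<open>M lam l\<close> is nearly attained at r = x, and x^l is cancelled. It recovers decay in the
  frequency from bounds on derivatives of all orders.\<close>

lemma decay_from_moments:
  assumes "lam > 0" "x \<ge> 1" "\<And>l. x ^ l * y \<le> A * M lam l" "A \<ge> 0"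
  shows "y \<le> A * (x * exp (- lam * \<omega> x))"
proof -
  obtain l where l: "M lam l \<le> x ^ l * (x * exp (- lam * \<omega> x))"
    using M_le_exp_omega[OF assms(1,2)] by auto
  have "x ^ l * y \<le> A * (x ^ l * (x * exp (- lam * \<omega> x)))"
    using assms(3)[of l] mult_left_mono[OF l assms(4)] by linarith
  then have "x ^ l * y \<le> x ^ l * (A * (x * exp (- lam * \<omega> x)))" by (simp add: algebra_simps)
  then show ?thesis using assms(2) by (subst (asm) mult_le_cancel_left_pos) auto
qed

section \<open>Frequencies and lattice sums\<close>

text \<open>The l1 norm is convenient because it adds up coordinate by coordinate. It differs from
  the Euclidean norm in \<open>EDC2\<close> by a dimensional factor, which \<omega> turns into a
  constant multiple.\<close>

definition nrm :: "('n::finite \<Rightarrow> int) \<Rightarrow> real" where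
  "nrm \<xi> = (\<Sum>j\<in>UNIV. \<bar>real_of_int (\<xi> j)\<bar>)"

lemma nrm_nonneg[simp]: "0 \<le> nrm \<xi>" by (simp add: nrm_def sum_nonneg)

lemma abs_le_nrm: "\<bar>real_of_int (\<xi> j)\<bar> \<le> nrm \<xi>"
  unfolding nrm_def by (rule member_le_sum) auto

text \<open>The exponential beats (1 + |\<xi>|)^(-2N), which is at most the product over the
  coordinates of (1 + |\<xi>_j|)^(-2); over a cube the sum of these products factorises into N
  convergent one-dimensional sums. A bound for finite sets serves every injective enumeration of
  frequencies.\<close>

lemma sum_exp_omega_bounded:
  assumes "\<delta> > 0"
  shows "\<exists>S. \<forall>F::('n::finite \<Rightarrow> int) set. finite F \<longrightarrow> (\<Sum>\<xi>\<in>F. exp (- \<delta> * \<omega> (nrm \<xi>))) \<le> S"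
proof -
  let ?N = "CARD('n)"
  define h :: "int \<Rightarrow> real" where "h k = 1 / (1 + \<bar>real_of_int k\<bar>) ^ 2" for k
  \<comment> \<open>The exponent 2 N provides one inverse square for each of the N
    coordinates.\<close>
  obtain C where C: "C > 0" "\<And>x. x \<ge> 1 \<Longrightarrow> x ^ (2 * ?N) \<le> C * exp (\<delta> * \<omega> x)"
    using power_le_exp_omega[OF assms] by blast
  let ?C = "exp (\<delta> * \<omega> 1) * C"
  have le: "exp (- \<delta> * \<omega> (nrm \<xi>)) \<le> ?C * (\<Prod>j\<in>UNIV. h (\<xi> j))" for \<xi> :: "'n \<Rightarrow> int"
  proof -
    let ?x = "1 + nrm \<xi>"
    have x: "?x \<ge> 1" by simp
    have "\<delta> * \<omega> ?x \<le> \<delta> * (\<omega> 1 + \<omega> (nrm \<xi>))" using assms by (intro mult_left_mono omega_add) auto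
    then have "exp (\<delta> * \<omega> ?x) \<le> exp (\<delta> * \<omega> 1) * exp (\<delta> * \<omega> (nrm \<xi>))"
      by (simp add: distrib_left flip: exp_add)
    then have "C * exp (\<delta> * \<omega> ?x) \<le> C * (exp (\<delta> * \<omega> 1) * exp (\<delta> * \<omega> (nrm \<xi>)))"
      using C(1) by (intro mult_left_mono) auto
    with C(2)[OF x] have *: "?x ^ (2 * ?N) \<le> C * (exp (\<delta> * \<omega> 1) * exp (\<delta> * \<omega> (nrm \<xi>)))"
      by linarith
    then have "exp (- \<delta> * \<omega> (nrm \<xi>)) \<le> ?C * (1 / ?x ^ (2 * ?N))"
    proof -
      have p: "?x ^ (2 * ?N) > 0" by (simp add: add_pos_nonneg)
      have "1 * ?x ^ (2 * ?N) \<le> ?C * exp (\<delta> * \<omega> (nrm \<xi>))"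
        using * by (simp add: mult_ac)
      then have "1 \<le> ?C * exp (\<delta> * \<omega> (nrm \<xi>)) / ?x ^ (2 * ?N)"
        using p by (simp only: pos_le_divide_eq)
      then have "1 * exp (- \<delta> * \<omega> (nrm \<xi>)) \<le>
          ?C * exp (\<delta> * \<omega> (nrm \<xi>)) / ?x ^ (2 * ?N) * exp (- \<delta> * \<omega> (nrm \<xi>))"
        by (intro mult_right_mono) auto
      then show ?thesis by (simp add: exp_minus mult.assoc)
    qed
    also have "1 / ?x ^ (2 * ?N) = (\<Prod>j\<in>(UNIV::'n set). 1 / ?x ^ 2)"
      by (simp add: power_mult power_divide)
    also have "\<dots> \<le> (\<Prod>j\<in>UNIV. h (\<xi> j))"
      unfolding h_def using abs_le_nrm[of \<xi>]
      by (intro prod_mono conjI divide_left_mono power_mono) (auto intro!: mult_pos_pos zero_less_power add_pos_nonneg)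
    finally show ?thesis using C(1) by (simp add: mult_left_mono)
  qed
  have hb: "\<exists>H. \<forall>K::nat. (\<Sum>k\<in>{- int K..int K}. h k) \<le> H"
  proof -
    have s: "summable (\<lambda>n. 1 / (1 + real n) ^ 2)"
      using inverse_power_summable[of 2, where 'a=real] summable_Suc_iff[of "\<lambda>n. inverse (real n ^ 2)"]
      by (simp add: inverse_eq_divide add.commute)
    have "(\<Sum>k\<in>{- int K..int K}. h k) \<le> 2 * (\<Sum>n. 1 / (1 + real n) ^ 2)" for K :: nat
    proof -
      have pos: "(\<Sum>k\<in>{0..int K}. h k) = (\<Sum>n\<le>K. 1 / (1 + real n) ^ 2)"
        by (rule sum.reindex_bij_witness[of _ int nat]) (auto simp: h_def)
      have neg: "(\<Sum>k\<in>{- int K..0}. h k) = (\<Sum>n\<le>K. 1 / (1 + real n) ^ 2)"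
        by (rule sum.reindex_bij_witness[of _ "\<lambda>n. - int n" "\<lambda>k. nat (- k)"]) (auto simp: h_def)
      have "{- int K..int K} = {- int K..0} \<union> {0..int K}" by auto
      then have "(\<Sum>k\<in>{- int K..int K}. h k) \<le> (\<Sum>k\<in>{- int K..0}. h k) + (\<Sum>k\<in>{0..int K}. h k)"
        by (simp add: h_def sum_Un sum_nonneg)
      also have "\<dots> \<le> 2 * (\<Sum>n. 1 / (1 + real n) ^ 2)"
        unfolding pos neg using sum_le_suminf[OF s, of "{..K}"] by auto
      finally show ?thesis .
    qed
    then show ?thesis by blast
  qed
  then obtain H where H: "\<And>K::nat. (\<Sum>k\<in>{- int K..int K}. h k) \<le> H" by blast
  have "(\<Sum>\<xi>\<in>F. exp (- \<delta> * \<omega> (nrm \<xi>))) \<le> ?C * H ^ ?N" if "finite F" for F :: "('n \<Rightarrow> int) set"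
  proof -
    define K where "K = nat (Max (insert 0 ((\<lambda>(\<xi>, j). \<bar>\<xi> j\<bar>) ` (F \<times> UNIV))))"
    have K: "\<bar>\<xi> j\<bar> \<le> int K" if "\<xi> \<in> F" for \<xi> j
    proof -
      have "\<bar>\<xi> j\<bar> \<le> Max (insert 0 ((\<lambda>(\<xi>, j). \<bar>\<xi> j\<bar>) ` (F \<times> UNIV)))"
        using that \<open>finite F\<close> by (intro Max_ge) (auto intro!: image_eqI[of _ _ "(\<xi>, j)"])
      then show ?thesis unfolding K_def by linarith
    qed
    have sub: "F \<subseteq> PiE UNIV (\<lambda>_. {- int K..int K})"
      using K by (force simp: PiE_UNIV_domain abs_le_iff)
    have "(\<Sum>\<xi>\<in>F. \<Prod>j\<in>UNIV. h (\<xi> j)) \<le> (\<Sum>\<xi>\<in>PiE (UNIV::'n set) (\<lambda>_. {- int K..int K}). \<Prod>j\<in>UNIV. h (\<xi> j))"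
      by (rule sum_mono2[OF _ sub]) (auto simp: h_def intro!: prod_nonneg finite_PiE)
    also have "\<dots> = (\<Prod>j\<in>(UNIV::'n set). \<Sum>k\<in>{- int K..int K}. h k)"
      by (rule prod_sum_PiE[symmetric]) auto
    also have "\<dots> \<le> H ^ ?N"
      using H by (simp add: power_mono sum_nonneg h_def)
    finally have "(\<Sum>\<xi>\<in>F. ?C * (\<Prod>j\<in>UNIV. h (\<xi> j))) \<le> ?C * H ^ ?N"
      using C(1) by (simp add: mult_left_mono flip: sum_distrib_left)
    then show ?thesis using sum_mono[of F, OF le] by (rule order_trans[rotated])
  qed
  then show ?thesis by blast
qed

lemma summable_exp_omega:
  fixes \<xi> :: "nat \<Rightarrow> 'n::finite \<Rightarrow> int"
  assumes "\<delta> > 0" "inj \<xi>" shows "summable (\<lambda>n. exp (- \<delta> * \<omega> (nrm (\<xi> n))))"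
proof -
  obtain S where S: "\<And>F::('n \<Rightarrow> int) set. finite F \<Longrightarrow> (\<Sum>\<xi>\<in>F. exp (- \<delta> * \<omega> (nrm \<xi>))) \<le> S"
    using sum_exp_omega_bounded[OF assms(1)] by blast
  show ?thesis
  proof (rule summableI_nonneg_bounded)
    fix n
    have "(\<Sum>i<n. exp (- \<delta> * \<omega> (nrm (\<xi> i)))) = (\<Sum>\<eta>\<in>\<xi> ` {..<n}. exp (- \<delta> * \<omega> (nrm \<eta>)))"
      using assms(2) by (subst sum.reindex) (auto intro: inj_on_subset)
    then show "(\<Sum>i<n. exp (- \<delta> * \<omega> (nrm (\<xi> i)))) \<le> S" using S by simp
  qed auto
qed

end

subsection \<open>Derivatives of all orders\<close>

lemma iter_pderiv_append: "iter_pderiv (es @ fs) f = iter_pderiv es (iter_pderiv fs f)"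
  by (induction es) auto

lemma pderiv_dir_eqI: "(\<And>x. \<exists>f'. (f has_derivative f') (at x) \<and> f' e = g x) \<Longrightarrow> pderiv_dir e f = g"
proof
  fix x assume "\<And>x. \<exists>f'. (f has_derivative f') (at x) \<and> f' e = g x"
  then obtain f' where "(f has_derivative f') (at x)" "f' e = g x" by blast
  then show "pderiv_dir e f x = g x" unfolding pderiv_dir_def using frechet_derivative_at by metis
qed

lemma smooth_iter: "smooth_fn f \<Longrightarrow> set es \<subseteq> Basis \<Longrightarrow> smooth_fn (iter_pderiv es f)"
  unfolding smooth_fn_def by (metis iter_pderiv_append le_sup_iff set_append)

lemma smooth_pderiv: "smooth_fn f \<Longrightarrow> e \<in> Basis \<Longrightarrow> smooth_fn (pderiv_dir e f)"
  using smooth_iter[of f "[e]"] by simp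

lemma smooth_differentiable: "smooth_fn f \<Longrightarrow> f differentiable (at x)"
  unfolding smooth_fn_def by (metis empty_subsetI iter_pderiv.simps(1) list.set(1))

lemma smooth_continuous: "smooth_fn f \<Longrightarrow> continuous_on S f"
  by (meson continuous_at_imp_continuous_on differentiable_imp_continuous_within smooth_differentiable)

lemma smooth_has_derivative: "smooth_fn f \<Longrightarrow> (f has_derivative frechet_derivative f (at x)) (at x)"
  using smooth_differentiable frechet_derivative_works by blast

lemma frechet_eq_sum_pderiv:
  fixes f :: "'a::euclidean_space \<Rightarrow> 'b::real_normed_vector"
  assumes "f differentiable (at x)"
  shows "frechet_derivative f (at x) h = (\<Sum>e\<in>Basis. (h \<bullet> e) *\<^sub>R pderiv_dir e f x)"
proof -
  have lin: "linear (frechet_derivative f (at x))"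
    using assms linear_frechet_derivative by blast
  have "frechet_derivative f (at x) h = frechet_derivative f (at x) (\<Sum>e\<in>Basis. (h \<bullet> e) *\<^sub>R e)"
    by (simp add: euclidean_representation)
  also have "\<dots> = (\<Sum>e\<in>Basis. (h \<bullet> e) *\<^sub>R pderiv_dir e f x)"
    using lin by (simp add: linear_sum linear_cmul pderiv_dir_def o_def)
  finally show ?thesis .
qed

text \<open>Iterated derivatives never leave a family that is closed under single partial
  derivatives, so no formula for higher derivatives has to be found.\<close>

lemma smooth_coinduct:
  assumes "f \<in> \<F>" and diff: "\<And>g x. g \<in> \<F> \<Longrightarrow> g differentiable (at x)"
    and step: "\<And>g e. g \<in> \<F> \<Longrightarrow> e \<in> Basis \<Longrightarrow> pderiv_dir e g \<in> \<F>"
  shows "smooth_fn f"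
proof -
  have "iter_pderiv es f \<in> \<F>" if "set es \<subseteq> Basis" for es
    using that by (induction es) (auto intro: step assms(1))
  then show ?thesis unfolding smooth_fn_def using diff by blast
qed

section \<open>Sums, products and linear images of smooth functions\<close>

lemma pderiv_add:
  "f differentiable (at x) \<Longrightarrow> g differentiable (at x) \<Longrightarrow>
    pderiv_dir e (\<lambda>x. f x + g x) x = pderiv_dir e f x + pderiv_dir e g x"
  unfolding pderiv_dir_def
  by (subst frechet_derivative_at[symmetric, OF has_derivative_add])
     (auto simp: frechet_derivative_works)

lemma smooth_add:
  fixes f g :: "'a::euclidean_space \<Rightarrow> 'b::real_normed_vector"
  assumes "smooth_fn f" "smooth_fn g" shows "smooth_fn (\<lambda>x. f x + g x)"
proof (rule smooth_coinduct[where \<F> = "{\<lambda>x. f x + g x |f g. smooth_fn f \<and> smooth_fn g}"])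
  fix h :: "'a \<Rightarrow> 'b" and e assume "h \<in> {\<lambda>x. f x + g x |f g. smooth_fn f \<and> smooth_fn g}" and e: "(e::'a) \<in> Basis"
  then obtain f g :: "'a \<Rightarrow> 'b" where *: "h = (\<lambda>x. f x + g x)" "smooth_fn f" "smooth_fn g" by blast
  then have "pderiv_dir e h = (\<lambda>x. pderiv_dir e f x + pderiv_dir e g x)"
    by (auto simp: pderiv_add smooth_differentiable)
  then show "pderiv_dir e h \<in> {\<lambda>x. f x + g x |f g. smooth_fn f \<and> smooth_fn g}"
    using smooth_pderiv[OF _ e] * by blast
qed (use assms smooth_differentiable in \<open>auto intro!: derivative_intros\<close>)

lemma iter_pderiv_add:
  assumes "smooth_fn f" "smooth_fn g" "set es \<subseteq> Basis"
  shows "iter_pderiv es (\<lambda>x. f x + g x) = (\<lambda>x. iter_pderiv es f x + iter_pderiv es g x)"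
  using assms(3)
proof (induction es)
  case (Cons e es)
  then show ?case
    using assms by (auto simp: pderiv_add smooth_iter smooth_differentiable)
qed auto

lemma pderiv_mult:
  fixes f g :: "'a::euclidean_space \<Rightarrow> complex"
  assumes "f differentiable (at x)" "g differentiable (at x)"
  shows "pderiv_dir e (\<lambda>x. f x * g x) x = pderiv_dir e f x * g x + f x * pderiv_dir e g x"
  unfolding pderiv_dir_def
  using assms by (subst frechet_derivative_at[symmetric, OF has_derivative_mult])
     (auto simp: frechet_derivative_works)

text \<open>Products alone are not stable under differentiation; by the Leibniz rule their finite
  sums are. This is the family to which \<open>smooth_coinduct\<close> is applied for
  products.\<close>

inductive_set sum_of_prods :: "('a::euclidean_space \<Rightarrow> complex) set" where
  prod: "smooth_fn f \<Longrightarrow> smooth_fn g \<Longrightarrow> (\<lambda>x. f x * g x) \<in> sum_of_prods"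
| plus: "u \<in> sum_of_prods \<Longrightarrow> v \<in> sum_of_prods \<Longrightarrow> (\<lambda>x. u x + v x) \<in> sum_of_prods"

lemma sum_of_prods_diff: "u \<in> sum_of_prods \<Longrightarrow> u differentiable (at x)"
proof (induction rule: sum_of_prods.induct)
  case (prod f g)
  then show ?case using smooth_differentiable[of f x] smooth_differentiable[of g x] by simp
qed simp

lemma sum_of_prods_pderiv:
  assumes "u \<in> sum_of_prods" "e \<in> Basis" shows "pderiv_dir e u \<in> sum_of_prods"
  using assms(1)
proof (induction rule: sum_of_prods.induct)
  case (prod f g)
  then have "pderiv_dir e (\<lambda>x. f x * g x) = (\<lambda>x. pderiv_dir e f x * g x + f x * pderiv_dir e g x)"
    by (intro ext pderiv_mult smooth_differentiable)
  also have "\<dots> \<in> sum_of_prods"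
    using prod smooth_pderiv[OF _ assms(2)]
    by (intro sum_of_prods.plus[of "\<lambda>x. pderiv_dir e f x * g x"] sum_of_prods.prod) auto
  finally show ?case .
next
  case (plus u v)
  then have "pderiv_dir e (\<lambda>x. u x + v x) = (\<lambda>x. pderiv_dir e u x + pderiv_dir e v x)"
    by (intro ext pderiv_add sum_of_prods_diff)
  then show ?case using sum_of_prods.plus[OF plus.IH] by simp
qed

lemma smooth_mult:
  fixes f g :: "'a::euclidean_space \<Rightarrow> complex"
  assumes "smooth_fn f" "smooth_fn g" shows "smooth_fn (\<lambda>x. f x * g x)"
  by (rule smooth_coinduct[OF sum_of_prods.prod[OF assms]])
     (auto intro: sum_of_prods_diff sum_of_prods_pderiv)

text \<open>Pascal's rule in the shape of the inductive step of the Leibniz formula: letting one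
  more derivative fall on either factor of the expansion of order k gives the expansion of order k +
  1.\<close>

lemma pascal_sum:
  fixes F G :: "nat \<Rightarrow> 'a::comm_ring_1"
  shows "(\<Sum>j\<le>k. of_nat (k choose j) * (F (Suc j) * G (k - j))) + (\<Sum>j\<le>k. of_nat (k choose j) * (F j * G (Suc (k - j))))
    = (\<Sum>j\<le>Suc k. of_nat (Suc k choose j) * (F j * G (Suc k - j)))"
proof -
  have "(\<Sum>j\<le>Suc k. of_nat (Suc k choose j) * (F j * G (Suc k - j)))
     = F 0 * G (Suc k) + (\<Sum>j\<le>k. of_nat (Suc k choose Suc j) * (F (Suc j) * G (k - j)))"
    by (subst sum.atMost_Suc_shift) simp
  also have "(\<Sum>j\<le>k. of_nat (Suc k choose Suc j) * (F (Suc j) * G (k - j))) =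
     (\<Sum>j\<le>k. of_nat (k choose j) * (F (Suc j) * G (k - j))) + (\<Sum>j\<le>k. of_nat (k choose Suc j) * (F (Suc j) * G (k - j)))"
    by (simp add: distrib_right sum.distrib)
  also have "F 0 * G (Suc k) + (\<dots>) = (\<Sum>j\<le>k. of_nat (k choose j) * (F (Suc j) * G (k - j))) +
     (\<Sum>j\<le>Suc k. of_nat (k choose j) * (F j * G (Suc k - j)))"
    by (subst sum.atMost_Suc_shift) simp
  also have "(\<Sum>j\<le>Suc k. of_nat (k choose j) * (F j * G (Suc k - j))) = (\<Sum>j\<le>k. of_nat (k choose j) * (F j * G (Suc (k - j))))"
    by (simp add: binomial_eq_0 Suc_diff_le)
  finally show ?thesis by simp
qed

text \<open>The bounds depend on the order alone, so the ways of distributing a list of directions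
  between the two factors are counted by binomial coefficients. The induction removes the innermost
  derivative: it falls on f or on g and shifts \<open>F\<close> or \<open>G\<close> by one.\<close>

lemma norm_iter_pderiv_mult_le:
  fixes f g :: "'a::euclidean_space \<Rightarrow> complex"
  assumes "smooth_fn f" "smooth_fn g" "set es \<subseteq> Basis"
    and "\<And>es. set es \<subseteq> Basis \<Longrightarrow> norm (iter_pderiv es f x) \<le> F (length es)"
    and "\<And>es. set es \<subseteq> Basis \<Longrightarrow> norm (iter_pderiv es g x) \<le> G (length es)"
  shows "norm (iter_pderiv es (\<lambda>x. f x * g x) x)
    \<le> (\<Sum>j\<le>length es. real (length es choose j) * (F j * G (length es - j)))"
  using assms
proof (induction es arbitrary: f g F G rule: rev_induct)
  case Nil
  have "norm (f x) \<le> F 0" "norm (g x) \<le> G 0" using Nil(4)[of "[]"] Nil(5)[of "[]"] by auto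
  then show ?case by (simp add: norm_mult) (meson mult_mono norm_ge_zero order_trans)
next
  case (snoc e es)
  let ?k = "length es"
  have e: "e \<in> Basis" "set es \<subseteq> Basis" using snoc by auto
  have f': "smooth_fn (pderiv_dir e f)" "smooth_fn (pderiv_dir e g)"
    using snoc e by (auto intro: smooth_pderiv)
  have "pderiv_dir e (\<lambda>x. f x * g x) = (\<lambda>x. pderiv_dir e f x * g x + f x * pderiv_dir e g x)"
    using snoc by (intro ext pderiv_mult smooth_differentiable)
  then have "iter_pderiv (es @ [e]) (\<lambda>x. f x * g x) x =
     iter_pderiv es (\<lambda>x. pderiv_dir e f x * g x) x + iter_pderiv es (\<lambda>x. f x * pderiv_dir e g x) x"
    using snoc e f' by (simp add: iter_pderiv_append iter_pderiv_add smooth_mult)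
  also have "norm \<dots> \<le> (\<Sum>j\<le>?k. real (?k choose j) * (F (Suc j) * G (?k - j)))
     + (\<Sum>j\<le>?k. real (?k choose j) * (F j * G (Suc (?k - j))))"
  proof (rule order_trans[OF norm_triangle_ineq add_mono])
    show "norm (iter_pderiv es (\<lambda>x. pderiv_dir e f x * g x) x) \<le> (\<Sum>j\<le>?k. real (?k choose j) * (F (Suc j) * G (?k - j)))"
    proof (rule snoc.IH[OF f'(1) snoc.prems(2) e(2), where F = "\<lambda>j. F (Suc j)"])
      fix es assume "set es \<subseteq> (Basis::'a set)"
      then show "norm (iter_pderiv es (pderiv_dir e f) x) \<le> F (Suc (length es))"
        using snoc.prems(4)[of "es @ [e]"] e by (simp add: iter_pderiv_append)
    qed (use snoc.prems in auto)
    show "norm (iter_pderiv es (\<lambda>x. f x * pderiv_dir e g x) x) \<le> (\<Sum>j\<le>?k. real (?k choose j) * (F j * G (Suc (?k - j))))"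
    proof (rule snoc.IH[OF snoc.prems(1) f'(2) e(2), where G = "\<lambda>j. G (Suc j)"])
      fix es assume "set es \<subseteq> (Basis::'a set)"
      then show "norm (iter_pderiv es (pderiv_dir e g) x) \<le> G (Suc (length es))"
        using snoc.prems(5)[of "es @ [e]"] e by (simp add: iter_pderiv_append)
    qed (use snoc.prems in auto)
  qed
  also have "\<dots> = (\<Sum>j\<le>Suc ?k. real (Suc ?k choose j) * (F j * G (Suc ?k - j)))"
    by (rule pascal_sum)
  finally show ?case by simp
qed

lemma pderiv_bounded_linear:
  assumes "bounded_linear L" "f differentiable (at x)"
  shows "pderiv_dir e (\<lambda>x. L (f x)) x = L (pderiv_dir e f x)"
  unfolding pderiv_dir_def
  using assms by (subst frechet_derivative_at[symmetric, OF bounded_linear.has_derivative[OF assms(1)]])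
     (auto simp: frechet_derivative_works)

lemma smooth_bounded_linear:
  fixes f :: "'a::euclidean_space \<Rightarrow> 'b::real_normed_vector" and L :: "'b \<Rightarrow> 'c::real_normed_vector"
  assumes "bounded_linear L" "smooth_fn f"
  shows "smooth_fn (\<lambda>x. L (f x))"
proof (rule smooth_coinduct[where \<F> = "{\<lambda>x. L (f x) |f. smooth_fn f}"])
  fix h :: "'a \<Rightarrow> 'c" and e assume "h \<in> {\<lambda>x. L (f x) |f. smooth_fn f}" and e: "(e::'a) \<in> Basis"
  then obtain f :: "'a \<Rightarrow> 'b" where *: "h = (\<lambda>x. L (f x))" "smooth_fn f" by blast
  then have "pderiv_dir e h = (\<lambda>x. L (pderiv_dir e f x))"
    by (auto simp: pderiv_bounded_linear[OF assms(1)] smooth_differentiable)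
  then show "pderiv_dir e h \<in> {\<lambda>x. L (f x) |f. smooth_fn f}"
    using smooth_pderiv[OF _ e] * by blast
next
  fix h :: "'a \<Rightarrow> 'c" and x assume "h \<in> {\<lambda>x. L (f x) |f. smooth_fn f}"
  then obtain f :: "'a \<Rightarrow> 'b" where *: "h = (\<lambda>x. L (f x))" "smooth_fn f" by blast
  then show "h differentiable (at x)"
    using bounded_linear.has_derivative[OF assms(1) smooth_has_derivative] differentiable_def by blast
qed (use assms in auto)

lemma iter_pderiv_bounded_linear:
  assumes "bounded_linear L" "smooth_fn f" "set es \<subseteq> Basis"
  shows "iter_pderiv es (\<lambda>x. L (f x)) = (\<lambda>x. L (iter_pderiv es f x))"
  using assms(3)
proof (induction es)
  case (Cons e es)
  then show ?case
    using assms by (auto simp: pderiv_bounded_linear[OF assms(1)] smooth_iter smooth_differentiable)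
qed auto

section \<open>Termwise differentiation of series\<close>

text \<open>The derivatives of the partial sums must converge uniformly as linear maps. This holds
  coordinate by coordinate, since the tail of W bounds the error in every direction independently of
  the point.\<close>

lemma has_derivative_suminf:
  fixes g :: "nat \<Rightarrow> 'a::euclidean_space \<Rightarrow> 'b::banach"
  assumes diff: "\<And>n x. g n differentiable (at x)"
    and W: "summable W" and V: "summable V"
    and gV: "\<And>n x. norm (g n x) \<le> V n"
    and gW: "\<And>n e x. e \<in> Basis \<Longrightarrow> norm (pderiv_dir e (g n) x) \<le> W n"
  shows "((\<lambda>x. \<Sum>n. g n x) has_derivative (\<lambda>h. \<Sum>e\<in>Basis. (h \<bullet> e) *\<^sub>R (\<Sum>n. pderiv_dir e (g n) x))) (at x)"
proof -
  let ?g' = "\<lambda>x h. \<Sum>e\<in>Basis. (h \<bullet> e) *\<^sub>R (\<Sum>n. pderiv_dir e (g n) x)"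
  have sg: "summable (\<lambda>n. g n x)" for x
    by (rule summable_comparison_test'[OF V]) (use gV in auto)
  have sp: "summable (\<lambda>n. pderiv_dir e (g n) x)" if "e \<in> Basis" for e x
    by (rule summable_comparison_test'[OF W]) (use gW that in auto)
  have W0: "0 \<le> W n" for n
    using gW[of _ n] nonempty_Basis by (meson equals0I norm_ge_zero order_trans)
  have tail: "norm ((\<Sum>i<n. pderiv_dir e (g i) x) - (\<Sum>i. pderiv_dir e (g i) x)) \<le> (\<Sum>i. W (i + n))"
    if e: "e \<in> Basis" for e x n
  proof -
    have sn: "summable (\<lambda>i. W (i + n))" using W by (rule summable_ignore_initial_segment)
    have s': "summable (\<lambda>i. norm (pderiv_dir e (g (i + n)) x))"
      by (rule summable_comparison_test'[OF sn]) (use gW e in auto)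
    have "(\<Sum>i<n. pderiv_dir e (g i) x) - (\<Sum>i. pderiv_dir e (g i) x) = - (\<Sum>i. pderiv_dir e (g (i + n)) x)"
      using suminf_minus_initial_segment[OF sp[OF e, of x], of n] by simp
    also have "norm \<dots> \<le> (\<Sum>i. norm (pderiv_dir e (g (i + n)) x))"
      using summable_norm[OF s'] by simp
    also have "\<dots> \<le> (\<Sum>i. W (i + n))" using s' sn gW e by (intro suminf_le) auto
    finally show ?thesis .
  qed
  have T: "(\<lambda>n. \<Sum>i. W (i + n)) \<longlonglongrightarrow> 0" using suminf_exist_split2[OF W] .
  have "\<exists>G. \<forall>x\<in>UNIV. (\<lambda>n. g n x) sums (G x) \<and> (G has_derivative ?g' x) (at x within UNIV)"
  proof (rule has_derivative_series[where x = x and l = "\<Sum>n. g n x"])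
    show "(g n has_derivative frechet_derivative (g n) (at x)) (at x within UNIV)" for n x
      using diff frechet_derivative_works by blast
    show "(\<lambda>n. g n x) sums (\<Sum>n. g n x)" using sg by (simp add: summable_sums)
    fix e :: real assume "e > 0"
    \<comment> \<open>The tolerance is shared equally among the coordinate directions.\<close>
    let ?d = "real DIM('a)"
    have "\<forall>\<^sub>F n in sequentially. (\<Sum>i. W (i + n)) < e / ?d"
      using T \<open>e > 0\<close> by (intro order_tendstoD) auto
    then show "\<forall>\<^sub>F n in sequentially. \<forall>x\<in>UNIV. \<forall>h.
        norm ((\<Sum>i<n. frechet_derivative (g i) (at x) h) - ?g' x h) \<le> e * norm h"
    proof eventually_elim
      case (elim n)
      have "norm ((\<Sum>i<n. frechet_derivative (g i) (at x) h) - ?g' x h) \<le> e * norm h" for x h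
      proof -
        have "(\<Sum>i<n. frechet_derivative (g i) (at x) h) - ?g' x h =
          (\<Sum>b\<in>Basis. (h \<bullet> b) *\<^sub>R ((\<Sum>i<n. pderiv_dir b (g i) x) - (\<Sum>i. pderiv_dir b (g i) x)))"
          by (simp add: frechet_eq_sum_pderiv[OF diff] sum.swap[of _ "{..<n}"] scaleR_right_diff_distrib
              sum_subtractf scaleR_sum_right)
        also have "norm \<dots> \<le> (\<Sum>b\<in>(Basis::'a set). norm h * (e / ?d))"
        proof (rule sum_norm_le)
          fix b :: 'a assume b: "b \<in> Basis"
          show "norm ((h \<bullet> b) *\<^sub>R ((\<Sum>i<n. pderiv_dir b (g i) x) - (\<Sum>i. pderiv_dir b (g i) x))) \<le> norm h * (e / ?d)"
            unfolding norm_scaleR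
            using tail[OF b, of x n] elim Basis_le_norm[OF b, of h] by (intro mult_mono) auto
        qed
        also have "\<dots> = e * norm h" by simp
        finally show ?thesis .
      qed
      then show ?case by blast
    qed
  qed auto
  then obtain G where G: "\<And>x. (\<lambda>n. g n x) sums (G x)" "\<And>x. (G has_derivative ?g' x) (at x)" by auto
  have "G = (\<lambda>x. \<Sum>n. g n x)" using G(1) by (auto simp: sums_iff)
  then show ?thesis using G(2)[of x] by simp
qed

text \<open>The bound separates the index from the order in the product of \<open>w n\<close> and
  \<open>m k\<close>, so one summable sequence justifies termwise differentiation at every
  order.\<close>

lemma smooth_suminf:
  fixes v :: "nat \<Rightarrow> 'a::euclidean_space \<Rightarrow> 'b::banach"
  assumes sm: "\<And>n. smooth_fn (v n)" and w: "summable w"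
    and bd: "\<And>n es x. set es \<subseteq> Basis \<Longrightarrow> norm (iter_pderiv es (v n) x) \<le> w n * m (length es)"
  shows "smooth_fn (\<lambda>x. \<Sum>n. v n x)"
    and "set es \<subseteq> Basis \<Longrightarrow> iter_pderiv es (\<lambda>x. \<Sum>n. v n x) = (\<lambda>x. \<Sum>n. iter_pderiv es (v n) x)"
proof -
  have hd: "((\<lambda>x. \<Sum>n. iter_pderiv es (v n) x) has_derivative
     (\<lambda>h. \<Sum>e\<in>Basis. (h \<bullet> e) *\<^sub>R (\<Sum>n. iter_pderiv (e # es) (v n) x))) (at x)"
    if es: "set es \<subseteq> Basis" for es x
    unfolding iter_pderiv.simps
  proof (rule has_derivative_suminf)
    show "iter_pderiv es (v n) differentiable (at x)" for n x
      using sm es by (intro smooth_differentiable smooth_iter)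
    show "summable (\<lambda>n. w n * m (Suc (length es)))" "summable (\<lambda>n. w n * m (length es))"
      using w by (auto intro: summable_mult2)
    show "norm (iter_pderiv es (v n) x) \<le> w n * m (length es)" for n x using bd es by auto
    show "norm (pderiv_dir e (iter_pderiv es (v n)) x) \<le> w n * m (Suc (length es))"
      if "e \<in> Basis" for n e x using bd[of "e # es" n x] that es by auto
  qed
  have pd: "pderiv_dir e (\<lambda>x. \<Sum>n. iter_pderiv es (v n) x) = (\<lambda>x. \<Sum>n. iter_pderiv (e # es) (v n) x)"
    if es: "set es \<subseteq> Basis" "e \<in> Basis" for es e
  proof (rule pderiv_dir_eqI)
    fix x
    have "(\<Sum>b\<in>Basis. (e \<bullet> b) *\<^sub>R (\<Sum>n. iter_pderiv (b # es) (v n) x)) =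
       (\<Sum>b\<in>Basis. if b = e then (\<Sum>n. iter_pderiv (b # es) (v n) x) else 0)"
      using es by (intro sum.cong) (auto simp: inner_Basis)
    also have "\<dots> = (\<Sum>n. iter_pderiv (e # es) (v n) x)" using es by simp
    finally show "\<exists>f'. ((\<lambda>x. \<Sum>n. iter_pderiv es (v n) x) has_derivative f') (at x) \<and>
        f' e = (\<Sum>n. iter_pderiv (e # es) (v n) x)" using hd[OF es(1), of x] by blast
  qed
  show it: "iter_pderiv es (\<lambda>x. \<Sum>n. v n x) = (\<lambda>x. \<Sum>n. iter_pderiv es (v n) x)"
    if "set es \<subseteq> Basis" for es
    using that by (induction es) (auto simp: pd)
  show "smooth_fn (\<lambda>x. \<Sum>n. v n x)"
    unfolding smooth_fn_def using it hd by (metis (no_types, lifting) differentiable_def)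
qed

section \<open>Functions of one variable\<close>

definition nderiv :: "nat \<Rightarrow> (real \<Rightarrow> 'b::real_normed_vector) \<Rightarrow> real \<Rightarrow> 'b" where
  "nderiv k u = iter_pderiv (replicate k 1) u"

lemma nderiv_0[simp]: "nderiv 0 u = u" by (simp add: nderiv_def)

lemma set_subset_Basis_real: "set es \<subseteq> (Basis :: real set) \<Longrightarrow> es = replicate (length es) 1"
  by (induction es) auto

lemma iter_pderiv_real: "set es \<subseteq> (Basis :: real set) \<Longrightarrow> iter_pderiv es u = nderiv (length es) u"
  unfolding nderiv_def using set_subset_Basis_real by metis

lemma nderiv_add: "nderiv j (nderiv k u) = nderiv (j + k) u"
  unfolding nderiv_def by (simp add: iter_pderiv_append replicate_add)

lemma smooth_nderiv: "smooth_fn u \<Longrightarrow> smooth_fn (nderiv k u)"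
  unfolding nderiv_def by (rule smooth_iter) auto

lemma differentiable_has_vector_derivative:
  fixes f :: "real \<Rightarrow> 'b::real_normed_vector"
  assumes "f differentiable (at t)" shows "(f has_vector_derivative pderiv_dir 1 f t) (at t)"
proof -
  have "frechet_derivative f (at t) = (\<lambda>h. h *\<^sub>R pderiv_dir 1 f t)"
    using frechet_eq_sum_pderiv[OF assms] by auto
  then show ?thesis using assms unfolding has_vector_derivative_def frechet_derivative_works by simp
qed

lemma nderiv_has_vector_derivative:
  assumes "smooth_fn u" shows "(nderiv k u has_vector_derivative nderiv (Suc k) u t) (at t)"
  using differentiable_has_vector_derivative[OF smooth_differentiable[OF smooth_nderiv[OF assms]], of k t]
  by (simp add: nderiv_def)

lemma pderiv_dir_1_eq: "(\<And>t. (f has_vector_derivative f' t) (at t)) \<Longrightarrow> pderiv_dir 1 f = f'"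
  by (rule pderiv_dir_eqI) (auto simp: has_vector_derivative_def intro!: exI)

text \<open>A guessed sequence of derivatives is verified through the relation between neighbours,
  and smoothness follows at the same time. It is applied to Fourier coefficients, to solutions of
  the mode equation and to the mollified cutoff.\<close>

lemma nderiv_eqI:
  assumes "\<And>k t. (D k has_vector_derivative D (Suc k) t) (at t)"
  shows "smooth_fn (D 0)" "nderiv k (D 0) = D k"
proof -
  have nderiv: "nderiv k (D 0) = D k" for k
  proof (induction k)
    case (Suc k)
    have "nderiv (Suc k) (D 0) = pderiv_dir 1 (D k)" using Suc by (simp add: nderiv_def)
    also have "\<dots> = D (Suc k)" using assms by (rule pderiv_dir_1_eq)
    finally show ?case .
  qed simp
  show "nderiv k (D 0) = D k" by (rule nderiv)
  have "iter_pderiv es (D 0) differentiable (at x)" if "set es \<subseteq> Basis" for es x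
    using that assms[of "length es" x] unfolding iter_pderiv_real[OF that] nderiv
    by (auto simp: has_vector_derivative_def differentiable_def)
  then show "smooth_fn (D 0)" unfolding smooth_fn_def by blast
qed

lemma smooth_const: "smooth_fn (\<lambda>x. c)"
  by (rule smooth_coinduct[where \<F> = "range (\<lambda>c x. c)"])
     (auto simp: pderiv_dir_def)

lemma iter_pderiv_cmult:
  "smooth_fn f \<Longrightarrow> set es \<subseteq> Basis \<Longrightarrow> iter_pderiv es (\<lambda>x. (c::complex) * f x) = (\<lambda>x. c * iter_pderiv es f x)"
  by (rule iter_pderiv_bounded_linear[OF bounded_linear_mult_right])

section \<open>Derivative bounds with explicit constants\<close>

context subadd_weight begin

text \<open>An inequality with an explicit constant replaces the \<open>Sup\<close> of
  \<open>ultra_norm\<close>; it passes through sums, products and series without any prior knowledge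
  that a supremum is finite.\<close>

definition ultra_bnd :: "real \<Rightarrow> real \<Rightarrow> ('a::euclidean_space \<Rightarrow> 'b::real_normed_vector) \<Rightarrow> bool" where
  "ultra_bnd lam C f \<longleftrightarrow> smooth_fn f \<and> (\<forall>es x. set es \<subseteq> Basis \<longrightarrow> norm (iter_pderiv es f x) \<le> C * M lam (length es))"

lemma ultra_bnd_nonneg:
  fixes f :: "'a::euclidean_space \<Rightarrow> 'b::real_normed_vector"
  assumes "ultra_bnd lam C f" shows "0 \<le> C"
proof -
  have "norm (iter_pderiv [] f (0::'a)) \<le> C * M lam (length ([]::'a list))"
    using assms unfolding ultra_bnd_def by (metis empty_subsetI list.set(1))
  then have "0 \<le> C * M lam 0" by (smt (verit) list.size(3) norm_ge_zero)
  then show ?thesis using M_pos[of lam 0] by (auto simp: zero_le_mult_iff)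
qed

lemma exp_young: "lam > 0 \<Longrightarrow> exp (- lam * young_conj \<omega> (real k / lam)) = 1 / M lam k"
  by (simp add: M_def exp_minus inverse_eq_divide)

lemma ultra_bounded_iff: "lam > 0 \<Longrightarrow> smooth_fn f \<Longrightarrow> ultra_bounded \<omega> lam f \<longleftrightarrow> (\<exists>C. ultra_bnd lam C f)"
proof -
  assume lam: "lam > 0" and sm: "smooth_fn f"
  have "ultra_bounded \<omega> lam f \<longleftrightarrow>
      (\<exists>C. \<forall>es x. set es \<subseteq> Basis \<longrightarrow> norm (iter_pderiv es f x) * (1 / M lam (length es)) \<le> C)"
    unfolding ultra_bounded_def bdd_above_def exp_young[OF lam] by blast
  then show ?thesis using sm by (simp add: ultra_bnd_def divide_le_eq)
qed

lemma ultra_norm_le: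
  fixes f :: "'a::euclidean_space \<Rightarrow> 'b::real_normed_vector"
  assumes "lam > 0" "ultra_bnd lam C f" shows "ultra_norm \<omega> lam f \<le> C"
  unfolding ultra_norm_def exp_young[OF assms(1)]
proof (rule cSup_least)
  show "{norm (iter_pderiv es f x) * (1 / M lam (length es)) | es x. set es \<subseteq> Basis} \<noteq> {}"
    by (auto intro!: exI[of _ "[]"])
qed (use assms(2) in \<open>auto simp: ultra_bnd_def divide_le_eq\<close>)

lemma norm_le_ultra_norm:
  assumes "lam > 0" "smooth_fn f" "ultra_bounded \<omega> lam f" "set es \<subseteq> Basis"
  shows "norm (iter_pderiv es f x) \<le> ultra_norm \<omega> lam f * M lam (length es)"
proof -
  have "norm (iter_pderiv es f x) * (1 / M lam (length es)) \<le> ultra_norm \<omega> lam f"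
    unfolding ultra_norm_def exp_young[OF assms(1)]
    using assms(3,4) unfolding ultra_bounded_def exp_young[OF assms(1)]
    by (intro cSup_upper) auto
  then show ?thesis by (simp add: divide_le_eq)
qed

lemma ultra_bnd_smooth: "ultra_bnd lam C f \<Longrightarrow> smooth_fn f" by (simp add: ultra_bnd_def)

lemma bndD: "ultra_bnd lam C f \<Longrightarrow> set es \<subseteq> Basis \<Longrightarrow> norm (iter_pderiv es f x) \<le> C * M lam (length es)"
  by (simp add: ultra_bnd_def)

lemma ultra_bnd_norm: "ultra_bnd lam C f \<Longrightarrow> norm (f x) \<le> C * M lam 0"
  using bndD[of lam C f "[]" x] by simp

lemma ultra_space_iff: "f \<in> ultra_space \<omega> \<longleftrightarrow> periodic_fn f \<and> (\<exists>lam>0. \<exists>C. ultra_bnd lam C f)"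
  unfolding ultra_space_def using ultra_bounded_iff ultra_bnd_smooth by blast

lemma ultra_bnd_antimono:
  assumes "ultra_bnd lam C f" "0 < lam'" "lam' \<le> lam" shows "ultra_bnd lam' C f"
  unfolding ultra_bnd_def
proof safe
  show "smooth_fn f" using assms by (simp add: ultra_bnd_def)
  fix es x assume "set es \<subseteq> (Basis :: 'a set)"
  then have "norm (iter_pderiv es f x) \<le> C * M lam (length es)" by (rule bndD[OF assms(1)])
  also have "\<dots> \<le> C * M lam' (length es)"
    using assms ultra_bnd_nonneg[OF assms(1)] by (intro mult_left_mono M_antimono) auto
  finally show "norm (iter_pderiv es f x) \<le> C * M lam' (length es)" .
qed

lemma ultra_bnd_mono: "ultra_bnd lam C f \<Longrightarrow> C \<le> D \<Longrightarrow> ultra_bnd lam D f"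
  unfolding ultra_bnd_def by (meson M_nonneg mult_right_mono order_trans)

lemma ultra_bnd_add: "ultra_bnd lam C f \<Longrightarrow> ultra_bnd lam D g \<Longrightarrow> ultra_bnd lam (C + D) (\<lambda>x. f x + g x)"
  unfolding ultra_bnd_def
  by (auto simp: smooth_add iter_pderiv_add distrib_right intro!: order_trans[OF norm_triangle_ineq] add_mono)

lemma ultra_bnd_sum:
  fixes f :: "'i \<Rightarrow> 'a::euclidean_space \<Rightarrow> 'b::real_normed_vector"
  assumes "finite I" "\<And>i. i \<in> I \<Longrightarrow> ultra_bnd lam (C i) (f i)"
  shows "ultra_bnd lam (\<Sum>i\<in>I. C i) (\<lambda>x. \<Sum>i\<in>I. f i x)"
  using assms
proof (induction I rule: finite_induct)
  case empty
  have "iter_pderiv es (\<lambda>x. 0 :: 'b) = (\<lambda>x. 0)" for es :: "'a list"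
    by (induction es) (auto simp: pderiv_dir_def)
  then show ?case by (simp add: ultra_bnd_def smooth_const)
next
  case (insert i I)
  then show ?case using ultra_bnd_add[of lam "C i" "f i" "\<Sum>i\<in>I. C i"] by simp
qed

lemma ultra_bnd_bounded_linear:
  assumes "bounded_linear L" "\<And>y. norm (L y) \<le> K * norm y" "K \<ge> 0" "ultra_bnd lam C f"
  shows "ultra_bnd lam (K * C) (\<lambda>x. L (f x))"
  unfolding ultra_bnd_def
proof safe
  show "smooth_fn (\<lambda>x. L (f x))" using assms smooth_bounded_linear ultra_bnd_smooth by blast
  fix es x assume es: "set es \<subseteq> (Basis :: 'c set)"
  have "norm (L (iter_pderiv es f x)) \<le> K * norm (iter_pderiv es f x)" by (rule assms(2))
  also have "\<dots> \<le> K * (C * M lam (length es))" using bndD[OF assms(4) es] assms(3) by (intro mult_left_mono) auto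
  finally show "norm (iter_pderiv es (\<lambda>x. L (f x)) x) \<le> K * C * M lam (length es)"
    using iter_pderiv_bounded_linear[OF assms(1) ultra_bnd_smooth[OF assms(4)] es] by simp
qed

lemma ultra_bnd_cmult: "ultra_bnd lam C f \<Longrightarrow> ultra_bnd lam (norm c * C) (\<lambda>x. (c::complex) * f x)"
  by (rule ultra_bnd_bounded_linear[OF bounded_linear_mult_right]) (auto simp: norm_mult)

lemma ultra_bnd_of_real:
  assumes "ultra_bnd lam C f" shows "ultra_bnd lam C (\<lambda>x. complex_of_real (f x))"
proof -
  have "ultra_bnd lam (1 * C) (\<lambda>x. complex_of_real (f x))"
    using assms by (intro ultra_bnd_bounded_linear[OF bounded_linear_of_real]) auto
  then show ?thesis by simp
qed

text \<open>Each summand is at most \<open>M lam k\<close> by \<open>M_submult\<close>, and the k +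
  1 \<le> 2^k summands are paid for by halving lam.\<close>

lemma sum_binom_M_le:
  assumes "lam > 0"
  shows "(\<Sum>j\<le>k. real (k choose j) * (M lam j * M lam (k - j))) \<le> M (lam / 2) k"
proof -
  have "(\<Sum>j\<le>k. real (k choose j) * (M lam j * M lam (k - j))) \<le> (\<Sum>j\<le>k. M lam k)"
  proof (rule sum_mono)
    fix j assume "j \<in> {..k}"
    then show "real (k choose j) * (M lam j * M lam (k - j)) \<le> M lam k"
      using M_submult[OF assms, of j "k - j"] by simp
  qed
  also have "\<dots> = real (k + 1) * M lam k" by simp
  also have "\<dots> \<le> real 2 ^ k * M lam k"
  proof (rule mult_right_mono)
    have "k + 1 \<le> 2 ^ k" by (induction k) auto
    then show "real (k + 1) \<le> real 2 ^ k" by (metis of_nat_mono of_nat_power)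
  qed auto
  also have "\<dots> \<le> M (lam / 2) k" using M_power_mult[OF assms, of 2 k] by simp
  finally show ?thesis .
qed

lemma sum_binom_bound:
  assumes "lam > 0" "C \<ge> 0" "D \<ge> 0"
  shows "(\<Sum>j\<le>k. real (k choose j) * ((C * M lam j) * (D * M lam (k - j)))) \<le> C * D * M (lam / 2) k"
proof -
  have "(\<Sum>j\<le>k. real (k choose j) * ((C * M lam j) * (D * M lam (k - j))))
     = C * D * (\<Sum>j\<le>k. real (k choose j) * (M lam j * M lam (k - j)))"
    by (simp add: sum_distrib_left mult_ac)
  then show ?thesis using sum_binom_M_le[OF assms(1), of k] assms by (simp add: mult_left_mono)
qed

lemma ultra_bnd_mult:
  fixes f g :: "'a::euclidean_space \<Rightarrow> complex"
  assumes "lam > 0" "ultra_bnd lam C f" "ultra_bnd lam D g"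
  shows "ultra_bnd (lam / 2) (C * D) (\<lambda>x. f x * g x)"
  unfolding ultra_bnd_def
proof safe
  show "smooth_fn (\<lambda>x. f x * g x)" using assms smooth_mult ultra_bnd_smooth by blast
  fix es x assume es: "set es \<subseteq> (Basis :: 'a set)"
  show "norm (iter_pderiv es (\<lambda>x. f x * g x) x) \<le> C * D * M (lam / 2) (length es)"
    by (rule order_trans[OF norm_iter_pderiv_mult_le sum_binom_bound])
       (use assms es ultra_bnd_smooth bndD ultra_bnd_nonneg in auto)
qed

lemma ultra_bnd_pderiv:
  assumes "lam > 0" "ultra_bnd lam C f" "e \<in> Basis"
  shows "ultra_bnd (lam / 2) (C * M (lam / 2) 1) (pderiv_dir e f)"
  unfolding ultra_bnd_def
proof safe
  show "smooth_fn (pderiv_dir e f)" using assms smooth_pderiv ultra_bnd_smooth by blast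
  fix es x assume es: "set es \<subseteq> (Basis :: 'a set)"
  have "norm (iter_pderiv es (pderiv_dir e f) x) \<le> C * M lam (length (es @ [e]))"
    using bndD[OF assms(2), of "es @ [e]" x] es assms(3) by (simp add: iter_pderiv_append)
  also have "\<dots> \<le> C * (M (lam / 2) 1 * M (lam / 2) (length es))"
    using M_add_le[OF assms(1), of 1 "length es"] ultra_bnd_nonneg[OF assms(2)] by (simp add: mult_left_mono)
  finally show "norm (iter_pderiv es (pderiv_dir e f) x) \<le> C * M (lam / 2) 1 * M (lam / 2) (length es)"
    by (simp add: mult_ac)
qed

lemma ultra_bnd_suminf:
  fixes v :: "nat \<Rightarrow> 'a::euclidean_space \<Rightarrow> 'b::banach"
  assumes "summable w" "\<And>n. ultra_bnd lam (w n) (v n)"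
  shows "ultra_bnd lam (suminf w) (\<lambda>x. \<Sum>n. v n x)"
    and "set es \<subseteq> Basis \<Longrightarrow> iter_pderiv es (\<lambda>x. \<Sum>n. v n x) = (\<lambda>x. \<Sum>n. iter_pderiv es (v n) x)"
proof -
  have bd: "norm (iter_pderiv es (v n) x) \<le> w n * M lam (length es)" if "set es \<subseteq> Basis" for n es x
    using bndD[OF assms(2)] that by blast
  note s = smooth_suminf[OF ultra_bnd_smooth[OF assms(2)] assms(1) bd]
  show it: "iter_pderiv es (\<lambda>x. \<Sum>n. v n x) = (\<lambda>x. \<Sum>n. iter_pderiv es (v n) x)"
    if "set es \<subseteq> Basis" for es using s(2) that by blast
  show "ultra_bnd lam (suminf w) (\<lambda>x. \<Sum>n. v n x)"
    unfolding ultra_bnd_def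
  proof safe
    show "smooth_fn (\<lambda>x. \<Sum>n. v n x)" using s(1) by blast
    fix es x assume es: "set es \<subseteq> (Basis :: 'a set)"
    have sw: "summable (\<lambda>n. w n * M lam (length es))" using assms(1) by (rule summable_mult2)
    have sn: "summable (\<lambda>n. norm (iter_pderiv es (v n) x))"
      by (rule summable_comparison_test'[OF sw]) (use bd es in auto)
    have "norm (\<Sum>n. iter_pderiv es (v n) x) \<le> (\<Sum>n. norm (iter_pderiv es (v n) x))"
      by (rule summable_norm[OF sn])
    also have "\<dots> \<le> (\<Sum>n. w n * M lam (length es))" using sn sw bd es by (intro suminf_le) auto
    also have "\<dots> = suminf w * M lam (length es)" using assms(1) by (simp add: suminf_mult2)
    finally show "norm (iter_pderiv es (\<lambda>x. \<Sum>n. v n x) x) \<le> suminf w * M lam (length es)"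
      using it[OF es] by simp
  qed
qed

end

subsection \<open>Fourier modes\<close>

definition ip :: "('n::finite \<Rightarrow> int) \<Rightarrow> real^'n \<Rightarrow> real" where
  "ip \<xi> x = (\<Sum>j\<in>UNIV. real_of_int (\<xi> j) * x $ j)"

definition wave :: "('n::finite \<Rightarrow> int) \<Rightarrow> real^'n \<Rightarrow> complex" where
  "wave \<xi> x = exp (\<i> * of_real (ip \<xi> x))"

definition sep :: "(real \<Rightarrow> complex) \<Rightarrow> ('n::finite \<Rightarrow> int) \<Rightarrow> real \<times> (real^'n) \<Rightarrow> complex" where
  "sep u \<xi> = (\<lambda>(t, x). u t * wave \<xi> x)"

lemma ip_add: "ip \<xi> (x + y) = ip \<xi> x + ip \<xi> y"
  by (simp add: ip_def distrib_left sum.distrib)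

lemma ip_scaleR: "ip \<xi> (c *\<^sub>R x) = c * ip \<xi> x"
  by (simp add: ip_def sum_distrib_left mult_ac)

lemma ip_uminus: "ip (- \<xi>) x = - ip \<xi> x"
  by (simp add: ip_def sum_negf)

lemma bounded_linear_ip: "bounded_linear (ip \<xi>)"
  by (simp add: linear_conv_bounded_linear[symmetric] linear_iff ip_add ip_scaleR)

lemma ip_axis: "ip \<xi> (axis j 1) = real_of_int (\<xi> j)"
proof -
  have "ip \<xi> (axis j 1) = (\<Sum>i\<in>UNIV. if i = j then real_of_int (\<xi> i) else 0)"
    unfolding ip_def by (rule sum.cong) (auto simp: axis_def)
  then show ?thesis by simp
qed

lemma norm_wave[simp]: "norm (wave \<xi> x) = 1"
  by (simp add: wave_def)

lemma wave_0[simp]: "wave 0 x = 1" "wave (\<lambda>_. 0) x = 1"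
  by (simp_all add: wave_def ip_def)

lemma wave_mult: "wave \<xi> x * wave \<eta> x = wave (\<xi> + \<eta>) x"
proof -
  have "ip (\<xi> + \<eta>) x = ip \<xi> x + ip \<eta> x"
    unfolding ip_def by (simp add: distrib_right sum.distrib)
  then show ?thesis by (simp add: wave_def distrib_left exp_add)
qed

lemma wave_shift: "wave \<xi> (x + (2 * pi) *\<^sub>R axis j 1) = wave \<xi> x"
proof -
  have "\<i> * of_real (ip \<xi> (x + (2 * pi) *\<^sub>R axis j 1)) = \<i> * of_real (ip \<xi> x) + (of_int (2 * \<xi> j) * pi) * \<i>"
    by (simp add: ip_add ip_scaleR ip_axis algebra_simps)
  then show ?thesis unfolding wave_def exp_eq by blast
qed

lemma wave_has_derivative:
  "(wave \<xi> has_derivative (\<lambda>h. wave \<xi> x * (\<i> * of_real (ip \<xi> h)))) (at x)"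
proof -
  have 1: "((\<lambda>x. \<i> * of_real (ip \<xi> x)) has_derivative (\<lambda>h. \<i> * of_real (ip \<xi> h))) (at x)"
    by (intro has_derivative_mult_right has_derivative_of_real bounded_linear_imp_has_derivative bounded_linear_ip)
  have 2: "(exp has_derivative (*) (exp (\<i> * of_real (ip \<xi> x)))) (at (\<i> * of_real (ip \<xi> x)))"
    using DERIV_exp has_field_derivative_def by blast
  from has_derivative_compose[OF 1 2] show ?thesis unfolding wave_def .
qed

lemma continuous_on_wave[continuous_intros]:
  assumes "continuous_on S f" shows "continuous_on S (\<lambda>x. wave \<xi> (f x))"
  unfolding wave_def ip_def by (intro continuous_intros assms)

lemma Basis_prod_vec:
  "(Basis :: (real \<times> (real^'n)) set) = insert (1, 0) (range (\<lambda>j. (0, axis j 1)))"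
  by (auto simp: Basis_prod_def Basis_vec_def)

lemma Basis_t[simp]: "(1, 0) \<in> (Basis :: (real \<times> (real^'n)) set)"
  and Basis_x[simp]: "(0, axis j 1) \<in> (Basis :: (real \<times> (real^'n)) set)"
  by (auto simp: Basis_prod_vec)

lemma sep_has_derivative:
  assumes "smooth_fn u"
  shows "(sep u \<xi> has_derivative
     (\<lambda>h. u (fst p) * (wave \<xi> (snd p) * (\<i> * of_real (ip \<xi> (snd h)))) + (fst h *\<^sub>R nderiv 1 u (fst p)) * wave \<xi> (snd p))) (at p)"
proof -
  have "(u has_derivative (\<lambda>h. h *\<^sub>R nderiv 1 u (fst p))) (at (fst p))"
    using nderiv_has_vector_derivative[OF assms, of 0] by (simp add: has_vector_derivative_def)
  then have 1: "((\<lambda>p. u (fst p)) has_derivative (\<lambda>h. fst h *\<^sub>R nderiv 1 u (fst p))) (at p)"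
    by (rule has_derivative_compose[OF bounded_linear_imp_has_derivative[OF bounded_linear_fst]])
  have 2: "((\<lambda>p. wave \<xi> (snd p)) has_derivative (\<lambda>h. wave \<xi> (snd p) * (\<i> * of_real (ip \<xi> (snd h))))) (at p)"
    by (rule has_derivative_compose[OF bounded_linear_imp_has_derivative[OF bounded_linear_snd] wave_has_derivative])
  from has_derivative_mult[OF 1 2] show ?thesis
    unfolding sep_def case_prod_unfold .
qed

lemma pderiv_sep_t: "smooth_fn u \<Longrightarrow> pderiv_dir (1, 0) (sep u \<xi>) = sep (nderiv 1 u) \<xi>"
  by (rule pderiv_dir_eqI, rule exI, rule conjI, rule sep_has_derivative)
     (auto simp: sep_def ip_def split: prod.splits)

lemma pderiv_sep_x:
  "smooth_fn u \<Longrightarrow> pderiv_dir (0, axis j 1) (sep u \<xi>) = (\<lambda>p. (\<i> * of_int (\<xi> j)) * sep u \<xi> p)"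
  by (rule pderiv_dir_eqI, rule exI, rule conjI, rule sep_has_derivative)
     (auto simp: sep_def ip_axis split: prod.splits)

lemma smooth_sep:
  fixes \<xi> :: "'n::finite \<Rightarrow> int"
  assumes "smooth_fn u" shows "smooth_fn (sep u \<xi>)"
proof (rule smooth_coinduct[where \<F> = "{\<lambda>p. c * sep u \<xi> p |c u. smooth_fn u}"])
  show "sep u \<xi> \<in> {\<lambda>p. c * sep u \<xi> p |c u. smooth_fn u}"
    using assms by (intro CollectI exI[of _ 1] exI[of _ u]) simp
next
  fix g :: "real \<times> (real^'n) \<Rightarrow> complex" and x assume "g \<in> {\<lambda>p. c * sep u \<xi> p |c u. smooth_fn u}"
  then obtain c u where g: "g = (\<lambda>p. c * sep u \<xi> p)" "smooth_fn u" by blast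
  then show "g differentiable (at x)"
    using has_derivative_mult_right[OF sep_has_derivative[OF g(2)], of c] differentiable_def by blast
next
  fix g :: "real \<times> (real^'n) \<Rightarrow> complex" and e
  assume "g \<in> {\<lambda>p. c * sep u \<xi> p |c u. smooth_fn u}" and e: "(e :: real \<times> (real^'n)) \<in> Basis"
  then obtain c u where g: "g = (\<lambda>p. c * sep u \<xi> p)" "smooth_fn u" by blast
  have "sep u \<xi> differentiable (at x)" for x
    using sep_has_derivative[OF g(2)] differentiable_def by blast
  then have *: "pderiv_dir e g = (\<lambda>p. c * pderiv_dir e (sep u \<xi>) p)"
    unfolding g by (intro ext pderiv_bounded_linear[OF bounded_linear_mult_right])
  from e consider "e = (1, 0)" | j where "e = (0, axis j 1)" by (auto simp: Basis_prod_vec)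
  then show "pderiv_dir e g \<in> {\<lambda>p. c * sep u \<xi> p |c u. smooth_fn u}"
  proof cases
    case 1
    then show ?thesis unfolding * using pderiv_sep_t[OF g(2), of \<xi>] smooth_nderiv[OF g(2)] by auto
  next
    case (2 j)
    have "pderiv_dir e g = (\<lambda>p. (c * (\<i> * of_int (\<xi> j))) * sep u \<xi> p)"
      using * pderiv_sep_x[OF g(2), of j \<xi>] 2 by (simp add: mult.assoc)
    then show ?thesis using g(2) by blast
  qed
qed

text \<open>Real polynomial functions on complex n-space are generated by real-linear functionals;
  this writes such a functional in the real and imaginary parts of the coordinates, which become
  cosines and sines on the torus.\<close>

lemma sum_inner_axis_cis:
  "bounded_linear (r :: complex^'n \<Rightarrow> real) \<Longrightarrow>
    r z = (\<Sum>i\<in>UNIV. Re (z $ i) * r (axis i 1) + Im (z $ i) * r (axis i \<i>))"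
proof -
  assume r: "bounded_linear r"
  interpret bounded_linear r by fact
  have "z = (\<Sum>i\<in>UNIV. Re (z $ i) *\<^sub>R axis i 1 + Im (z $ i) *\<^sub>R axis i \<i>)"
  proof (rule vec_eq_iff[THEN iffD2], rule allI)
    fix k
    have "(\<Sum>i\<in>UNIV. Re (z $ i) *\<^sub>R axis i 1 + Im (z $ i) *\<^sub>R axis i \<i>) $ k =
        (\<Sum>i\<in>UNIV. if i = k then z $ i else 0)"
      unfolding sum_component by (rule sum.cong) (auto simp: axis_def complex_eq_iff)
    then show "z $ k = (\<Sum>i\<in>UNIV. Re (z $ i) *\<^sub>R axis i 1 + Im (z $ i) *\<^sub>R axis i \<i>) $ k" by simp
  qed
  then have "r z = r (\<Sum>i\<in>UNIV. Re (z $ i) *\<^sub>R axis i 1 + Im (z $ i) *\<^sub>R axis i \<i>)" by simp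
  also have "\<dots> = (\<Sum>i\<in>UNIV. Re (z $ i) * r (axis i 1) + Im (z $ i) * r (axis i \<i>))"
    by (simp add: sum add scaleR)
  finally show ?thesis .
qed

section \<open>Integration over a period cell\<close>

definition tbox :: "(real^'n) set" where "tbox = cbox 0 (\<chi> i. 2 * pi)"

lemma content_tbox: "0 < measure lborel (tbox :: (real^'n) set)"
  unfolding tbox_def by (rule content_pos_lt) (auto simp: Basis_vec_def inner_axis)

lemma norm_integral_tbox_le:
  fixes g :: "real^'n \<Rightarrow> complex"
  assumes "continuous_on tbox g" "\<And>x. x \<in> tbox \<Longrightarrow> norm (g x) \<le> B"
  shows "norm (integral tbox g) \<le> B * measure lborel (tbox :: (real^'n) set)"
proof -
  have "0 \<in> (tbox :: (real^'n) set)" by (simp add: tbox_def mem_box_cart)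
  then have "0 \<le> B" using assms(2) norm_ge_zero order_trans by blast
  moreover have "(g has_integral integral (cbox 0 (\<chi> i. 2 * pi)) g) (cbox 0 (\<chi> i. 2 * pi))"
    using assms(1) unfolding tbox_def by (intro integrable_integral integrable_continuous)
  ultimately show ?thesis using assms(2) unfolding tbox_def by (rule has_integral_bound)
qed

definition per_fn :: "(real^'n \<Rightarrow> 'b) \<Rightarrow> bool" where
  "per_fn g \<longleftrightarrow> (\<forall>x j. g (x + (2 * pi) *\<^sub>R axis j 1) = g x)"

lemma per_fn_wave: "per_fn (wave \<xi>)" by (simp add: per_fn_def wave_shift)

lemma per_fn_mult: "per_fn f \<Longrightarrow> per_fn g \<Longrightarrow> per_fn (\<lambda>x. f x * g x)"
  by (simp add: per_fn_def)

lemma per_fn_int: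
  assumes "per_fn g" shows "g (x + of_int k *\<^sub>R ((2 * pi) *\<^sub>R axis j 1)) = g x"
proof (induction k rule: int_induct[of _ 0])
  case base then show ?case by simp
next
  case (step1 i)
  have "g (x + of_int i *\<^sub>R ((2 * pi) *\<^sub>R axis j 1)) =
    g (x + of_int i *\<^sub>R ((2 * pi) *\<^sub>R axis j 1) + (2 * pi) *\<^sub>R axis j 1)"
    using assms unfolding per_fn_def by metis
  also have "\<dots> = g (x + of_int (i + 1) *\<^sub>R ((2 * pi) *\<^sub>R axis j 1))"
    by (simp add: algebra_simps)
  finally show ?case using step1 by simp
next
  case (step2 i)
  have "g (x + of_int (i - 1) *\<^sub>R ((2 * pi) *\<^sub>R axis j 1)) =
    g (x + of_int (i - 1) *\<^sub>R ((2 * pi) *\<^sub>R axis j 1) + (2 * pi) *\<^sub>R axis j 1)"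
    using assms unfolding per_fn_def by metis
  also have "\<dots> = g (x + of_int i *\<^sub>R ((2 * pi) *\<^sub>R axis j 1))"
    by (simp add: algebra_simps)
  finally show ?case using step2 by simp
qed

lemma per_fn_lattice:
  assumes "per_fn g" shows "g (x + (\<chi> j. 2 * pi * of_int (k j))) = g x"
proof -
  have "g (x + (\<Sum>j\<in>J. of_int (k j) *\<^sub>R ((2 * pi) *\<^sub>R axis j 1))) = g x" if "finite J" for J
    using that
  proof (induction J rule: finite_induct)
    case (insert i J)
    have "g (x + (\<Sum>j\<in>insert i J. of_int (k j) *\<^sub>R ((2 * pi) *\<^sub>R axis j 1))) =
       g ((x + (\<Sum>j\<in>J. of_int (k j) *\<^sub>R ((2 * pi) *\<^sub>R axis j 1))) + of_int (k i) *\<^sub>R ((2 * pi) *\<^sub>R axis i 1))"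
      using insert by (simp add: add_ac)
    then show ?case using insert per_fn_int[OF assms] by simp
  qed simp
  from this[of UNIV] have "g (x + (\<Sum>j\<in>UNIV. of_int (k j) *\<^sub>R ((2 * pi) *\<^sub>R axis j 1))) = g x" by simp
  moreover have "(\<Sum>j\<in>UNIV. of_int (k j) *\<^sub>R ((2 * pi) *\<^sub>R axis j 1)) = (\<chi> j. 2 * pi * of_int (k j))"
  proof (rule vec_eq_iff[THEN iffD2], rule allI)
    fix i
    have "(\<Sum>j\<in>UNIV. of_int (k j) *\<^sub>R ((2 * pi) *\<^sub>R axis j (1::real))) $ i =
      (\<Sum>j\<in>UNIV. if j = i then 2 * pi * of_int (k j) else 0)"
      unfolding sum_component by (rule sum.cong) (auto simp: axis_def)
    then show "(\<Sum>j\<in>UNIV. of_int (k j) *\<^sub>R ((2 * pi) *\<^sub>R axis j (1::real))) $ i = (\<chi> j. 2 * pi * of_int (k j)) $ i"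
      by simp
  qed
  ultimately show ?thesis by simp
qed

lemma tbox_representative: "\<exists>y\<in>tbox. \<exists>k. x = y + (\<chi> j. 2 * pi * real_of_int (k j))"
proof -
  define k where "k j = \<lfloor>x $ j / (2 * pi)\<rfloor>" for j
  define y where "y = x - (\<chi> j. 2 * pi * real_of_int (k j))"
  have "0 \<le> y $ j \<and> y $ j \<le> 2 * pi" for j
  proof -
    have "real_of_int (k j) \<le> x $ j / (2 * pi)" "x $ j / (2 * pi) \<le> real_of_int (k j) + 1"
      unfolding k_def by linarith+
    then show ?thesis unfolding y_def by (simp add: field_simps)
  qed
  then have "y \<in> tbox" by (simp add: tbox_def mem_box_cart)
  then show ?thesis by (intro bexI[of _ y] exI[of _ k]) (auto simp: y_def)
qed

text \<open>The translated cell is cut along the hyperplane where the j-th coordinate equals 2 pi;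
  the part beyond it, moved back by one period, is exactly the slab of the original cell that the
  translation has left.\<close>

lemma integral_tbox_translate:
  fixes g :: "real^'n \<Rightarrow> complex"
  assumes g: "continuous_on UNIV g" "per_fn g" and s: "0 \<le> s" "s \<le> 2 * pi"
  shows "integral tbox (\<lambda>x. g (x + s *\<^sub>R axis j 1)) = integral tbox g"
proof -
  let ?e = "axis j 1 :: real^'n"
  let ?b = "(\<chi> i. 2 * pi) :: real^'n"
  have e: "?e \<in> Basis" by (simp add: axis_in_Basis_iff)
  have int: "g integrable_on cbox u v" for u v
    using g(1) continuous_on_subset integrable_continuous by blast
  \<comment> \<open>\<open>A\<close> is the slab that the translated cell leaves uncovered,
    \<open>B\<close> the part that both cells share.\<close>
  define A where "A = cbox 0 ?b \<inter> {x. x \<bullet> ?e \<le> s}"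
  define B where "B = cbox 0 ?b \<inter> {x. x \<bullet> ?e \<ge> s}"
  have A': "A = cbox 0 (\<chi> i. if i = j then s else 2 * pi)"
    using s by (auto simp: A_def mem_box_cart inner_axis split: if_splits) (metis order_trans)+
  have B': "cbox (s *\<^sub>R ?e) (?b + s *\<^sub>R ?e) \<inter> {x. x \<bullet> ?e \<le> 2 * pi} = B"
  proof (rule set_eqI)
    fix x
    have pt: "(\<forall>i. P i) \<longleftrightarrow> P j \<and> (\<forall>i. i \<noteq> j \<longrightarrow> P i)" for P by metis
    have "(\<forall>i. (s *\<^sub>R ?e) $ i \<le> x $ i \<and> x $ i \<le> (?b + s *\<^sub>R ?e) $ i) \<and> x $ j \<le> 2 * pi \<longleftrightarrow>
      (\<forall>i. 0 \<le> x $ i \<and> x $ i \<le> 2 * pi) \<and> s \<le> x $ j"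
      unfolding pt[of "\<lambda>i. 0 \<le> x $ i \<and> x $ i \<le> 2 * pi"]
        pt[of "\<lambda>i. (s *\<^sub>R ?e) $ i \<le> x $ i \<and> x $ i \<le> (?b + s *\<^sub>R ?e) $ i"]
      using s by (auto simp: axis_def)
    then show "x \<in> cbox (s *\<^sub>R ?e) (?b + s *\<^sub>R ?e) \<inter> {x. x \<bullet> ?e \<le> 2 * pi} \<longleftrightarrow> x \<in> B"
      by (auto simp: B_def mem_box_cart inner_axis)
  qed
  have C': "cbox (s *\<^sub>R ?e) (?b + s *\<^sub>R ?e) \<inter> {x. x \<bullet> ?e \<ge> 2 * pi} =
     cbox (0 + (2 * pi) *\<^sub>R ?e) ((\<chi> i. if i = j then s else 2 * pi) + (2 * pi) *\<^sub>R ?e)"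
  proof (rule set_eqI)
    fix x
    have pt: "(\<forall>i. P i) \<longleftrightarrow> P j \<and> (\<forall>i. i \<noteq> j \<longrightarrow> P i)" for P by metis
    have "(\<forall>i. (s *\<^sub>R ?e) $ i \<le> x $ i \<and> x $ i \<le> (?b + s *\<^sub>R ?e) $ i) \<and> x $ j \<ge> 2 * pi \<longleftrightarrow>
      (\<forall>i. (0 + (2 * pi) *\<^sub>R ?e) $ i \<le> x $ i \<and> x $ i \<le> ((\<chi> i. if i = j then s else 2 * pi) + (2 * pi) *\<^sub>R ?e) $ i)"
      unfolding pt[of "\<lambda>i. (s *\<^sub>R ?e) $ i \<le> x $ i \<and> x $ i \<le> (?b + s *\<^sub>R ?e) $ i"]
        pt[of "\<lambda>i. (0 + (2 * pi) *\<^sub>R ?e) $ i \<le> x $ i \<and> x $ i \<le> ((\<chi> i. if i = j then s else 2 * pi) + (2 * pi) *\<^sub>R ?e) $ i"]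
      using s by (auto simp: axis_def)
    then show "x \<in> cbox (s *\<^sub>R ?e) (?b + s *\<^sub>R ?e) \<inter> {x. x \<bullet> ?e \<ge> 2 * pi} \<longleftrightarrow>
       x \<in> cbox (0 + (2 * pi) *\<^sub>R ?e) ((\<chi> i. if i = j then s else 2 * pi) + (2 * pi) *\<^sub>R ?e)"
      by (auto simp: mem_box_cart inner_axis)
  qed
  have per: "g \<circ> (+) ((2 * pi) *\<^sub>R ?e) = g"
    using g(2) by (auto simp: per_fn_def add.commute o_def)
  have "integral tbox (\<lambda>x. g (x + s *\<^sub>R ?e)) = integral (cbox 0 ?b) (g \<circ> (+) (s *\<^sub>R ?e))"
    by (simp add: tbox_def o_def add.commute)
  also have "\<dots> = integral (cbox (s *\<^sub>R ?e) (?b + s *\<^sub>R ?e)) g"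
    using integral_shift_cbox_plus[of 0 ?b g "s *\<^sub>R ?e"] by simp
  also have "\<dots> = integral B g + integral (cbox (0 + (2 * pi) *\<^sub>R ?e) ((\<chi> i. if i = j then s else 2 * pi) + (2 * pi) *\<^sub>R ?e)) g"
    using integral_split[OF int e, of "s *\<^sub>R ?e" "?b + s *\<^sub>R ?e" "2 * pi"] unfolding B' C' .
  also have "\<dots> = integral B g + integral A g"
    unfolding A' integral_shift_cbox_plus[symmetric] per ..
  also have "\<dots> = integral (cbox 0 ?b) g"
    using integral_split[OF int e, of 0 ?b s] by (simp add: A_def B_def)
  finally show ?thesis by (simp add: tbox_def)
qed

text \<open>All translates of g have the same integral, so differentiation under the integral sign
  gives zero. This takes the place of integration by parts on the torus.\<close>

lemma integral_tbox_derivative: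
  fixes g g' :: "real^'n \<Rightarrow> complex"
  assumes g: "continuous_on UNIV g" "per_fn g" and g': "continuous_on UNIV g'" "per_fn g'"
    and deriv: "\<And>x s. ((\<lambda>s. g (x + s *\<^sub>R axis j 1)) has_vector_derivative g' (x + s *\<^sub>R axis j 1)) (at s)"
  shows "integral tbox g' = 0"
proof -
  let ?F = "\<lambda>s. integral (cbox 0 (\<chi> i. 2 * pi)) (\<lambda>x. g (x + s *\<^sub>R axis j 1))"
  \<comment> \<open>The derivative is taken at pi, an interior point of the range of shifts for
    which invariance is available.\<close>
  have "(?F has_vector_derivative integral (cbox 0 (\<chi> i. 2 * pi)) (\<lambda>x. g' (x + pi *\<^sub>R axis j 1))) (at pi within UNIV)"
  proof (rule leibniz_rule_vector_derivative)
    fix s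
    show "(\<lambda>x. g (x + s *\<^sub>R axis j 1)) integrable_on cbox 0 (\<chi> i. 2 * pi)"
      by (intro integrable_continuous continuous_on_compose2[OF g(1)] continuous_intros) auto
    show "continuous_on (UNIV \<times> cbox 0 (\<chi> i. 2 * pi)) (\<lambda>(s, x). g' (x + s *\<^sub>R axis j 1))"
      unfolding case_prod_unfold
      by (intro continuous_on_compose2[OF g'(1)] continuous_intros) auto
  qed (use deriv in auto)
  then have 1: "(?F has_vector_derivative integral tbox (\<lambda>x. g' (x + pi *\<^sub>R axis j 1))) (at pi)"
    by (simp add: tbox_def)
  have "((\<lambda>_. integral tbox g) has_vector_derivative 0) (at pi)" by simp
  then have "(?F has_vector_derivative 0) (at pi)"
    by (rule has_vector_derivative_transform_within_open[of _ _ _ "{0<..<2*pi}"])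
       (use integral_tbox_translate[OF g, of _ j] in \<open>auto simp: tbox_def\<close>)
  with 1 have "integral tbox (\<lambda>x. g' (x + pi *\<^sub>R axis j 1)) = 0"
    using vector_derivative_unique_at by blast
  then show ?thesis using integral_tbox_translate[OF g', of pi j] by simp
qed

lemma wave_line_derivative:
  "((\<lambda>s. wave \<xi> (x + s *\<^sub>R axis j 1)) has_vector_derivative
     \<i> * of_int (\<xi> j) * wave \<xi> (x + s *\<^sub>R axis j 1)) (at s)"
proof -
  have "((\<lambda>s. x + s *\<^sub>R axis j 1) has_derivative (\<lambda>h. h *\<^sub>R axis j 1)) (at s)"
    by (auto intro!: derivative_eq_intros)
  from has_derivative_compose[OF this wave_has_derivative] show ?thesis
    unfolding has_vector_derivative_def
    by (rule has_derivative_eq_rhs) (auto simp: fun_eq_iff ip_scaleR ip_axis scaleR_conv_of_real[where 'a = complex])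
qed

lemma integral_wave:
  assumes "\<xi> \<noteq> 0" shows "integral tbox (wave \<xi>) = 0"
proof -
  obtain j where j: "\<xi> j \<noteq> 0" using assms by (auto simp: fun_eq_iff)
  have "integral tbox (\<lambda>x. \<i> * of_int (\<xi> j) * wave \<xi> x) = 0"
    by (rule integral_tbox_derivative[where g = "wave \<xi>" and j = j])
       (auto intro!: continuous_intros wave_line_derivative simp: per_fn_wave per_fn_mult per_fn_def wave_shift)
  then show ?thesis using j by simp
qed

section \<open>Trigonometric polynomials and completeness of the waves\<close>

inductive_set trig_poly :: "(real^'n \<Rightarrow> complex) set" where
  mono: "(\<lambda>x. c * wave \<xi> x) \<in> trig_poly"
| plus: "f \<in> trig_poly \<Longrightarrow> g \<in> trig_poly \<Longrightarrow> (\<lambda>x. f x + g x) \<in> trig_poly"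

lemma trig_poly_const: "(\<lambda>x. c) \<in> trig_poly"
  using trig_poly.mono[of c 0] by simp

lemma trig_poly_mult:
  assumes "f \<in> trig_poly" "g \<in> trig_poly" shows "(\<lambda>x. f x * g x) \<in> trig_poly"
  using assms(1)
proof induction
  case (mono c \<xi>)
  show ?case using assms(2)
  proof induction
    case (mono d \<eta>)
    have "(\<lambda>x. c * wave \<xi> x * (d * wave \<eta> x)) = (\<lambda>x. (c * d) * wave (\<xi> + \<eta>) x)"
      by (simp add: mult_ac flip: wave_mult)
    then show ?case by (simp add: trig_poly.mono)
  next
    case (plus f g)
    then show ?case using trig_poly.plus by (simp add: distrib_left)
  qed
next
  case (plus f h)
  then show ?case using trig_poly.plus by (simp add: distrib_right)
qed

lemma trig_poly_sum:
  "finite I \<Longrightarrow> (\<And>i. i \<in> I \<Longrightarrow> f i \<in> trig_poly) \<Longrightarrow> (\<lambda>x. \<Sum>i\<in>I. f i x) \<in> trig_poly"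
  by (induction I rule: finite_induct) (auto intro: trig_poly.plus trig_poly_const)

text \<open>This map realises the torus as a compact subset of a finite-dimensional space, where the
  Stone-Weierstrass theorem for polynomial functions applies.\<close>

definition torus_map :: "real^'n \<Rightarrow> complex^'n" where "torus_map x = (\<chi> j. cis (x $ j))"

lemma trig_poly_coordinate:
  fixes j :: "'n::finite"
  shows "(\<lambda>x. complex_of_real (cos (x $ j))) \<in> trig_poly" "(\<lambda>x. complex_of_real (sin (x $ j))) \<in> (trig_poly :: (real^'n \<Rightarrow> complex) set)"
proof -
  define \<eta> :: "'n \<Rightarrow> int" where "\<eta> = (\<lambda>i. if i = j then 1 else 0)"
  have ip: "ip \<eta> x = x $ j" for x
    unfolding ip_def by (simp add: \<eta>_def if_distrib[of "\<lambda>z. z * _"] if_distrib[of real_of_int] cong: if_cong)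
  have c: "(\<lambda>x. complex_of_real (cos (x $ j))) = (\<lambda>x. (1/2) * wave \<eta> x + (1/2) * wave (- \<eta>) x)"
    by (auto simp: wave_def ip ip_uminus complex_eq_iff Re_exp Im_exp)
  have s: "(\<lambda>x. complex_of_real (sin (x $ j))) = (\<lambda>x. (-\<i>/2) * wave \<eta> x + (\<i>/2) * wave (- \<eta>) x)"
    by (auto simp: wave_def ip ip_uminus complex_eq_iff Re_exp Im_exp)
  show "(\<lambda>x. complex_of_real (cos (x $ j))) \<in> trig_poly" "(\<lambda>x. complex_of_real (sin (x $ j))) \<in> trig_poly"
    unfolding c s by (intro trig_poly.plus trig_poly.mono)+
qed

lemma real_polynomial_trig_poly:
  assumes "real_polynomial_function r" shows "(\<lambda>x. complex_of_real (r (torus_map x))) \<in> trig_poly"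
  using assms
proof induction
  case (linear r)
  have "(\<lambda>x. complex_of_real (r (torus_map x))) =
    (\<lambda>x. \<Sum>i\<in>UNIV. complex_of_real (cos (x $ i)) * of_real (r (axis i 1)) + complex_of_real (sin (x $ i)) * of_real (r (axis i \<i>)))"
    by (rule ext, subst sum_inner_axis_cis[OF linear]) (simp add: torus_map_def)
  also have "\<dots> \<in> trig_poly"
    by (intro trig_poly_sum trig_poly.plus trig_poly_mult trig_poly_coordinate trig_poly_const) auto
  finally show ?case .
qed (auto intro: trig_poly_const trig_poly.plus trig_poly_mult)

lemma polynomial_trig_poly:
  fixes p :: "complex^'n \<Rightarrow> complex"
  assumes "polynomial_function p" shows "(\<lambda>x. p (torus_map x)) \<in> trig_poly"
proof -
  have "real_polynomial_function (Re \<circ> p)" "real_polynomial_function (Im \<circ> p)"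
    using assms bounded_linear_Re bounded_linear_Im unfolding polynomial_function_def by blast+
  from this[THEN real_polynomial_trig_poly]
  have "(\<lambda>x. complex_of_real (Re (p (torus_map x))) + \<i> * complex_of_real (Im (p (torus_map x)))) \<in> trig_poly"
    unfolding o_def by (intro trig_poly.plus trig_poly_mult[OF trig_poly_const])
  then show ?thesis by (simp flip: complex_eq)
qed

text \<open>A periodic f descends to the compact image of the cell under \<open>torus_map\<close>,
  and polynomials on that image pull back to trigonometric polynomials. The descended function is
  continuous because its graph is a continuous image of the compact cell, hence closed.\<close>

lemma trig_poly_approx:
  fixes f :: "real^'n \<Rightarrow> complex"
  assumes f: "continuous_on UNIV f" "per_fn f" and "0 < e"
  shows "\<exists>p\<in>trig_poly. \<forall>x\<in>tbox. norm (f x - p x) < e"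
proof -
  have cq: "continuous_on UNIV (torus_map :: real^'n \<Rightarrow> complex^'n)"
    unfolding torus_map_def cis_conv_exp by (intro continuous_intros)
  define S where "S = torus_map ` (tbox :: (real^'n) set)"
  have ct: "compact (tbox :: (real^'n) set)" by (simp add: tbox_def)
  have S: "compact S" unfolding S_def
    by (intro compact_continuous_image ct) (use cq continuous_on_subset in blast)
  have eq: "f x = f y" if "torus_map x = torus_map y" for x y
  proof -
    have "\<exists>n::int. x $ j = y $ j + 2 * pi * n" for j
    proof -
      have "exp (\<i> * of_real (x $ j)) = exp (\<i> * of_real (y $ j))"
        using that by (simp add: torus_map_def vec_eq_iff cis_conv_exp)
      then obtain n :: int where "\<i> * complex_of_real (x $ j) = \<i> * of_real (y $ j) + (of_int (2 * n) * pi) * \<i>"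
        unfolding exp_eq by blast
      then have "Im (\<i> * complex_of_real (x $ j)) = Im (\<i> * of_real (y $ j) + (of_int (2 * n) * pi) * \<i>)" by simp
      then have "x $ j = y $ j + 2 * pi * n" by simp
      then show ?thesis by blast
    qed
    then obtain k where "\<And>j. x $ j = y $ j + 2 * pi * real_of_int (k j)" by metis
    then have "x = y + (\<chi> j. 2 * pi * real_of_int (k j))" by (simp add: vec_eq_iff)
    then show ?thesis using per_fn_lattice[OF f(2)] by simp
  qed
  \<comment> \<open>The choice of the preimage is immaterial: two points with the same image differ
    by a vector of the period lattice.\<close>
  define F where "F z = f (SOME x. x \<in> tbox \<and> torus_map x = z)" for z
  have F: "F (torus_map x) = f x" if "x \<in> tbox" for x
    unfolding F_def
  proof (rule someI2[of _ x])
    show "x \<in> tbox \<and> torus_map x = torus_map x" using that by simp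
    show "f y = f x" if "y \<in> tbox \<and> torus_map y = torus_map x" for y using that eq by blast
  qed
  have "continuous_on S F"
  proof (rule continuous_from_closed_graph)
    show "compact (f ` tbox)"
      by (intro compact_continuous_image ct) (use f continuous_on_subset in blast)
    show "F \<in> S \<rightarrow> f ` tbox" using F by (auto simp: S_def)
    have "(\<lambda>z. (z, F z)) ` S = (\<lambda>x. (torus_map x, f x)) ` tbox"
      unfolding S_def image_image using F by (intro image_cong) auto
    also have "compact \<dots>"
      by (intro compact_continuous_image ct continuous_on_Pair)
         (use f cq continuous_on_subset in blast)+
    finally show "closed ((\<lambda>z. (z, F z)) ` S)" by (rule compact_imp_closed)
  qed
  from Stone_Weierstrass_polynomial_function[OF S this \<open>0 < e\<close>]
  obtain p where p: "polynomial_function p" "\<And>z. z \<in> S \<Longrightarrow> norm (F z - p z) < e" by blast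
  show ?thesis
  proof (intro bexI ballI)
    show "(\<lambda>x. p (torus_map x)) \<in> trig_poly" by (rule polynomial_trig_poly[OF p(1)])
    fix x :: "real^'n" assume "x \<in> tbox"
    then show "norm (f x - p (torus_map x)) < e" using p(2)[of "torus_map x"] F by (auto simp: S_def)
  qed
qed

text \<open>The function annihilates all trigonometric polynomials, hence by approximation its own
  conjugate, so the integral of its squared modulus vanishes.\<close>

lemma fourier_injective:
  fixes f :: "real^'n \<Rightarrow> complex"
  assumes f: "continuous_on UNIV f" "per_fn f" and zero: "\<And>\<xi>. integral tbox (\<lambda>x. f x * wave \<xi> x) = 0"
  shows "f x = 0"
proof -
  have cf: "continuous_on tbox f" using f(1) continuous_on_subset by blast
  have cont_int: "g integrable_on tbox" if "continuous_on tbox g" for g :: "real^'n \<Rightarrow> complex"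
    using that unfolding tbox_def by (rule integrable_continuous)
  have cp: "p \<in> trig_poly \<Longrightarrow> continuous_on tbox p" for p :: "real^'n \<Rightarrow> complex"
    by (induction rule: trig_poly.induct) (auto intro!: continuous_intros)
  have zp: "integral tbox (\<lambda>x. f x * p x) = 0" if "p \<in> trig_poly" for p
    using that
  proof induction
    case (mono c \<xi>)
    have "integral tbox (\<lambda>x. f x * (c * wave \<xi> x)) = integral tbox (\<lambda>x. c * (f x * wave \<xi> x))"
      by (simp add: mult_ac)
    then show ?case using zero by simp
  next
    case (plus p q)
    have "integral tbox (\<lambda>x. f x * p x + f x * q x) = integral tbox (\<lambda>x. f x * p x) + integral tbox (\<lambda>x. f x * q x)"
      using plus by (intro integral_add cont_int continuous_intros cf cp)
    then show ?case using plus by (simp add: distrib_left)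
  qed
  have ccf: "continuous_on UNIV (\<lambda>x. cnj (f x))" using f by (intro continuous_intros)
  have pcf: "per_fn (\<lambda>x. cnj (f x))" using f by (simp add: per_fn_def)
  have "compact (f ` tbox)" by (intro compact_continuous_image cf) (simp add: tbox_def)
  then obtain B where B: "B > 0" "\<And>x. x \<in> tbox \<Longrightarrow> norm (f x) \<le> B"
    by (metis bounded_pos compact_imp_bounded imageI)
  let ?I = "integral tbox (\<lambda>x. f x * cnj (f x))"
  have "norm ?I \<le> e" if "e > 0" for e
  proof -
    let ?e = "e / (B * measure lborel (tbox :: (real^'n) set))"
    have "?e > 0" using that B content_tbox[where 'n='n] by simp
    from trig_poly_approx[OF ccf pcf this] obtain p where
      p: "p \<in> trig_poly" "\<And>x. x \<in> tbox \<Longrightarrow> norm (cnj (f x) - p x) < ?e" by blast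
    have "?I = integral tbox (\<lambda>x. f x * cnj (f x)) - integral tbox (\<lambda>x. f x * p x)"
      using zp[OF p(1)] by simp
    also have "\<dots> = integral tbox (\<lambda>x. f x * (cnj (f x) - p x))"
      unfolding right_diff_distrib
      using p by (intro integral_diff[symmetric] cont_int continuous_intros cf cp)
    finally have I: "?I = integral tbox (\<lambda>x. f x * (cnj (f x) - p x))" .
    have "norm ?I \<le> (B * ?e) * measure lborel (tbox :: (real^'n) set)"
      unfolding I
    proof (rule norm_integral_tbox_le)
      show "continuous_on tbox (\<lambda>x. f x * (cnj (f x) - p x))"
        using p(1) by (intro continuous_intros cf cp)
      show "norm (f x * (cnj (f x) - p x)) \<le> B * ?e" if "x \<in> tbox" for x
        unfolding norm_mult using B(2)[of x] p(2)[of x] B(1) that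
        by (intro mult_mono) (auto intro: less_imp_le)
    qed
    also have "\<dots> = e" using B content_tbox[where 'n='n] by simp
    finally show ?thesis .
  qed
  then have "norm ?I \<le> 0 + e" if "e > 0" for e using that by (metis add_0)
  then have "norm ?I \<le> 0" by (rule field_le_epsilon)
  then have I0: "?I = 0" by simp
  have nint: "(\<lambda>x. (norm (f x))\<^sup>2) integrable_on tbox"
    using cf unfolding tbox_def by (intro integrable_continuous continuous_intros)
  have "?I = integral tbox (\<lambda>x. complex_of_real ((norm (f x))\<^sup>2))"
    by (simp only: complex_norm_square)
  also have "\<dots> = of_real (integral tbox (\<lambda>x. (norm (f x))\<^sup>2))"
    using integral_linear[OF nint bounded_linear_of_real] by (simp add: o_def)
  finally have "integral tbox (\<lambda>x. (norm (f x))\<^sup>2) = 0" using I0 by simp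
  then have z: "\<forall>x\<in>tbox. (norm (f x))\<^sup>2 = 0"
    unfolding tbox_def
    by (subst (asm) integral_cbox_eq_0_iff)
       (use cf in \<open>auto simp: tbox_def box_ne_empty Basis_vec_def inner_axis intro!: continuous_intros\<close>)
  obtain y k where "y \<in> tbox" "x = y + (\<chi> j. 2 * pi * real_of_int (k j))"
    using tbox_representative by metis
  then show ?thesis using z per_fn_lattice[OF f(2)] by simp
qed

subsection \<open>Partial Fourier series\<close>

lemma smooth_line_derivative:
  assumes "smooth_fn f"
  shows "((\<lambda>s. f (p + s *\<^sub>R e)) has_vector_derivative pderiv_dir e f (p + s *\<^sub>R e)) (at s)"
proof -
  let ?F = "frechet_derivative f (at (p + s *\<^sub>R e))"
  have F: "(f has_derivative ?F) (at (p + s *\<^sub>R e))" by (rule smooth_has_derivative[OF assms])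
  have 1: "((\<lambda>s. p + s *\<^sub>R e) has_derivative (\<lambda>h. h *\<^sub>R e)) (at s)"
    by (auto intro!: derivative_eq_intros)
  have "linear ?F" using F has_derivative_linear by blast
  then show ?thesis
    using has_derivative_compose[OF 1 F]
    by (simp add: has_vector_derivative_def pderiv_dir_def linear_cmul)
qed

lemma periodic_pderiv:
  assumes "smooth_fn f" "periodic_fn f" shows "periodic_fn (pderiv_dir e f)"
  unfolding periodic_fn_def
proof (intro allI ballI)
  fix x b :: 'a assume b: "b \<in> Basis"
  let ?c = "(2 * pi) *\<^sub>R b"
  have "((\<lambda>y. y + ?c) has_derivative (\<lambda>h. h)) (at x)" by (auto intro!: derivative_eq_intros)
  from has_derivative_compose[OF this smooth_has_derivative[OF assms(1)]]
  have "((\<lambda>y. f (y + ?c)) has_derivative frechet_derivative f (at (x + ?c))) (at x)" by simp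
  moreover have "(\<lambda>y. f (y + ?c)) = f" using assms(2) b by (auto simp: periodic_fn_def)
  ultimately have "(f has_derivative frechet_derivative f (at (x + ?c))) (at x)" by simp
  then have "frechet_derivative f (at (x + ?c)) = frechet_derivative f (at x)"
    by (rule frechet_derivative_at)
  then show "pderiv_dir e f (x + ?c) = pderiv_dir e f x" by (simp add: pderiv_dir_def)
qed

lemma periodic_iter:
  "smooth_fn f \<Longrightarrow> periodic_fn f \<Longrightarrow> set es \<subseteq> Basis \<Longrightarrow> periodic_fn (iter_pderiv es f)"
  by (induction es) (auto intro: periodic_pderiv smooth_iter)

lemma periodic_real: "periodic_fn (u :: real \<Rightarrow> 'b) \<longleftrightarrow> (\<forall>t. u (t + 2 * pi) = u t)"
  by (simp add: periodic_fn_def)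

lemma periodic_prod:
  fixes f :: "real \<times> (real^'n) \<Rightarrow> 'b"
  shows "periodic_fn f \<longleftrightarrow> (\<forall>t x. f (t + 2 * pi, x) = f (t, x)) \<and> (\<forall>t. per_fn (\<lambda>x. f (t, x)))"
  by (auto simp: periodic_fn_def per_fn_def Basis_prod_vec)

lemma periodic_sep: "periodic_fn u \<Longrightarrow> periodic_fn (sep u \<xi>)"
  by (auto simp: periodic_prod periodic_real sep_def per_fn_def wave_shift)

definition coef :: "('n::finite \<Rightarrow> int) \<Rightarrow> (real \<times> (real^'n) \<Rightarrow> complex) \<Rightarrow> real \<Rightarrow> complex" where
  "coef \<xi> f t = integral tbox (\<lambda>x. f (t, x) * wave (- \<xi>) x) / of_real (measure lborel (tbox :: (real^'n) set))"

lemma smooth_slice: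
  fixes f :: "real \<times> (real^'n) \<Rightarrow> complex"
  assumes "smooth_fn f"
  shows "continuous_on S (\<lambda>x. f (t, x))"
  by (rule continuous_on_compose2[OF smooth_continuous[OF assms]]) (auto intro!: continuous_intros)

lemma coef_integrable:
  fixes f :: "real \<times> (real^'n) \<Rightarrow> complex"
  assumes "smooth_fn f" shows "(\<lambda>x. f (t, x) * wave \<xi> x) integrable_on tbox"
  unfolding tbox_def by (intro integrable_continuous continuous_intros smooth_slice assms)

lemma norm_coef_le:
  assumes "smooth_fn f" "\<And>x. norm (f (t, x)) \<le> B"
  shows "norm (coef \<xi> f t) \<le> B"
proof -
  have "norm (integral tbox (\<lambda>x. f (t, x) * wave (- \<xi>) x)) \<le> B * measure lborel (tbox :: (real^'a) set)"
    using assms by (intro norm_integral_tbox_le continuous_intros smooth_slice) (auto simp: norm_mult)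
  then show ?thesis
    using content_tbox[where 'n='a] by (simp add: coef_def norm_divide divide_le_eq)
qed

lemma coef_add:
  assumes "smooth_fn f" "smooth_fn g"
  shows "coef \<xi> (\<lambda>p. f p + g p) t = coef \<xi> f t + coef \<xi> g t"
  unfolding coef_def distrib_right
  by (subst integral_add) (auto simp: add_divide_distrib coef_integrable assms)

lemma coef_cmult: "coef \<xi> (\<lambda>p. c * f p) t = c * coef \<xi> f t"
  by (simp add: coef_def mult.assoc)

lemma coef_has_vector_derivative:
  assumes "smooth_fn f"
  shows "(coef \<xi> f has_vector_derivative coef \<xi> (pderiv_dir (1, 0) f) t) (at t)"
proof -
  let ?b = "(\<chi> i. 2 * pi) :: real^'a"
  have sp: "smooth_fn (pderiv_dir (1, 0) f)" using assms by (intro smooth_pderiv) auto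
  have "((\<lambda>t. integral (cbox 0 ?b) (\<lambda>x. f (t, x) * wave (- \<xi>) x)) has_vector_derivative
    integral (cbox 0 ?b) (\<lambda>x. pderiv_dir (1, 0) f (t, x) * wave (- \<xi>) x)) (at t within UNIV)"
  proof (rule leibniz_rule_vector_derivative)
    fix s x
    have "((\<lambda>s. f (s, x)) has_vector_derivative pderiv_dir (1, 0) f (s, x)) (at s)"
      using smooth_line_derivative[OF assms, of "(0, x)" "(1, 0)" s] by simp
    then show "((\<lambda>s. f (s, x) * wave (- \<xi>) x) has_vector_derivative pderiv_dir (1, 0) f (s, x) * wave (- \<xi>) x) (at s within UNIV)"
      by (intro has_vector_derivative_mult_left) simp
  next
    show "continuous_on (UNIV \<times> cbox 0 ?b) (\<lambda>(s, x). pderiv_dir (1, 0) f (s, x) * wave (- \<xi>) x)"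
      unfolding case_prod_unfold
      by (intro continuous_intros continuous_on_compose2[OF smooth_continuous[OF sp, of UNIV]]) auto
  qed (use coef_integrable[OF assms] in \<open>auto simp: tbox_def\<close>)
  then have "((\<lambda>t. integral tbox (\<lambda>x. f (t, x) * wave (- \<xi>) x) * (1 / of_real (measure lborel (tbox :: (real^'a) set)))) has_vector_derivative
    integral tbox (\<lambda>x. pderiv_dir (1, 0) f (t, x) * wave (- \<xi>) x) * (1 / of_real (measure lborel (tbox :: (real^'a) set)))) (at t)"
    unfolding tbox_def by (intro has_vector_derivative_mult_left) simp
  then show ?thesis unfolding coef_def by simp
qed

lemma nderiv_coef:
  assumes "smooth_fn f"
  shows "smooth_fn (coef \<xi> f)" "nderiv k (coef \<xi> f) = coef \<xi> (iter_pderiv (replicate k (1, 0)) f)"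
proof -
  have "(coef \<xi> (iter_pderiv (replicate k (1, 0)) f) has_vector_derivative
     coef \<xi> (iter_pderiv (replicate (Suc k) (1, 0)) f) t) (at t)" for k t
    using coef_has_vector_derivative[OF smooth_iter[OF assms, of "replicate k (1, 0)"], of \<xi> t]
    by (simp add: set_replicate_conv_if)
  from nderiv_eqI[of "\<lambda>k. coef \<xi> (iter_pderiv (replicate k (1, 0)) f)", OF this]
  show "smooth_fn (coef \<xi> f)" "nderiv k (coef \<xi> f) = coef \<xi> (iter_pderiv (replicate k (1, 0)) f)"
    by auto
qed

lemma periodic_coef: "periodic_fn f \<Longrightarrow> periodic_fn (coef \<xi> f)"
  by (simp add: periodic_prod periodic_real coef_def)

text \<open>The x_j-derivative of f times the conjugate wave integrates to zero, and its two Leibniz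
  terms are the two sides of the identity.\<close>

lemma coef_pderiv_x:
  fixes f :: "real \<times> (real^'n) \<Rightarrow> complex"
  assumes "smooth_fn f" "periodic_fn f"
  shows "coef \<xi> (pderiv_dir (0, axis j 1) f) t = \<i> * of_int (\<xi> j) * coef \<xi> f t"
proof -
  let ?g = "\<lambda>x. f (t, x) * wave (- \<xi>) x"
  let ?g' = "\<lambda>x. pderiv_dir (0, axis j 1) f (t, x) * wave (- \<xi>) x - (\<i> * of_int (\<xi> j)) * (f (t, x) * wave (- \<xi>) x)"
  have sp: "smooth_fn (pderiv_dir (0, axis j 1) f)" using assms(1) by (intro smooth_pderiv) auto
  have pp: "periodic_fn (pderiv_dir (0, axis j 1) f)" using assms periodic_pderiv by blast
  have z: "integral tbox ?g' = 0"
  proof (rule integral_tbox_derivative[where g = ?g and j = j])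
    fix x s
    have "((\<lambda>s. f (t, x + s *\<^sub>R axis j 1)) has_vector_derivative pderiv_dir (0, axis j 1) f (t, x + s *\<^sub>R axis j 1)) (at s)"
      using smooth_line_derivative[OF assms(1), of "(t, x)" "(0, axis j 1)" s] by simp
    from has_vector_derivative_mult[OF this wave_line_derivative[of "- \<xi>" x j s]]
    show "((\<lambda>s. ?g (x + s *\<^sub>R axis j 1)) has_vector_derivative ?g' (x + s *\<^sub>R axis j 1)) (at s)"
      by (rule has_vector_derivative_eq_rhs) (simp add: algebra_simps)
  qed (use assms pp in \<open>auto intro!: continuous_intros smooth_slice sp simp: periodic_prod per_fn_def wave_shift\<close>)
  have "integral tbox ?g' = integral tbox (\<lambda>x. pderiv_dir (0, axis j 1) f (t, x) * wave (- \<xi>) x)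
      - integral tbox (\<lambda>x. (\<i> * of_int (\<xi> j)) * (f (t, x) * wave (- \<xi>) x))"
    by (rule integral_diff) (auto intro!: integrable_on_mult_right coef_integrable sp assms simp del: mult.assoc)
  with z show ?thesis by (simp add: coef_def)
qed

lemma coef_iter_x:
  fixes f :: "real \<times> (real^'n) \<Rightarrow> complex"
  assumes "smooth_fn f" "periodic_fn f"
  shows "coef \<xi> (iter_pderiv (replicate l (0, axis j 1)) f) t = (\<i> * of_int (\<xi> j)) ^ l * coef \<xi> f t"
proof (induction l)
  case (Suc l)
  have "set (replicate l (0, axis j 1)) \<subseteq> (Basis :: (real \<times> (real^'n)) set)"
    by (simp add: set_replicate_conv_if)
  then show ?case
    using Suc coef_pderiv_x[OF smooth_iter[OF assms(1)] periodic_iter[OF assms]] by simp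
qed simp

lemma coef_sep:
  "coef \<eta> (sep u \<xi>) t = (if \<xi> = \<eta> then u t else 0)"
proof -
  have "coef \<eta> (sep u \<xi>) t = u t * (integral tbox (wave (\<xi> + - \<eta>)) / of_real (measure lborel (tbox :: (real^'a) set)))"
    by (simp add: coef_def sep_def mult.assoc wave_mult)
  moreover have "integral tbox (wave (0 :: 'a \<Rightarrow> int)) = of_real (measure lborel (tbox :: (real^'a) set))"
  proof -
    have "wave (0 :: 'a \<Rightarrow> int) = (\<lambda>x. 1)" by auto
    then show ?thesis unfolding tbox_def by (simp add: scaleR_conv_of_real)
  qed
  moreover have "\<xi> + - \<eta> \<noteq> 0" if "\<xi> \<noteq> \<eta>" using that by (metis add.right_neutral add_eq_0_iff2 add_uminus_conv_diff eq_iff_diff_eq_0)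
  ultimately show ?thesis using content_tbox[where 'n='a] integral_wave[of "\<xi> + - \<eta>"] by auto
qed

lemma exists_enumeration: "\<exists>en :: nat \<Rightarrow> ('n::finite \<Rightarrow> int). bij en"
proof -
  have "infinite (UNIV :: ('n \<Rightarrow> int) set)"
    using finite_fun_UNIVD2 infinite_UNIV_int by blast
  then show ?thesis using bij_betw_from_nat_into[of "UNIV :: ('n \<Rightarrow> int) set"] by (auto simp: bij_def bij_betw_def)
qed

lemma fourier_ext:
  fixes f g :: "real \<times> (real^'n) \<Rightarrow> complex"
  assumes "smooth_fn f" "smooth_fn g" "periodic_fn f" "periodic_fn g"
    and eq: "\<And>\<xi> t. coef \<xi> f t = coef \<xi> g t"
  shows "f = g"
proof
  fix p :: "real \<times> (real^'n)"
  obtain t x where p: "p = (t, x)" by (cases p)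
  have "f (t, x) - g (t, x) = 0"
  proof (rule fourier_injective[where f = "\<lambda>x. f (t, x) - g (t, x)"])
    show "continuous_on UNIV (\<lambda>x. f (t, x) - g (t, x))"
      using assms by (intro continuous_intros smooth_slice)
    show "per_fn (\<lambda>x. f (t, x) - g (t, x))" using assms by (auto simp: periodic_prod per_fn_def)
    fix \<xi> :: "'n \<Rightarrow> int"
    have "integral tbox (\<lambda>x. f (t, x) * wave \<xi> x) = integral tbox (\<lambda>x. g (t, x) * wave \<xi> x)"
      using eq[of "- \<xi>" t] content_tbox[where 'n='n] by (simp add: coef_def)
    then show "integral tbox (\<lambda>x. (f (t, x) - g (t, x)) * wave \<xi> x) = 0"
      unfolding left_diff_distrib by (subst integral_diff) (auto intro: coef_integrable assms)
  qed
  then show "f p = g p" using p by simp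
qed

section \<open>Fourier analysis and synthesis in the ultradifferentiable class\<close>

context subadd_weight begin

lemma ultra_space_smooth: "f \<in> ultra_space \<omega> \<Longrightarrow> smooth_fn f"
  by (simp add: ultra_space_def)

lemma ultra_space_periodic: "f \<in> ultra_space \<omega> \<Longrightarrow> periodic_fn f"
  by (simp add: ultra_space_def)

lemma ultra_space_common:
  assumes "f \<in> ultra_space \<omega>" "g \<in> ultra_space \<omega>"
  obtains lam C D where "lam > 0" "ultra_bnd lam C f" "ultra_bnd lam D g"
proof -
  obtain l1 C l2 D where "l1 > 0" "ultra_bnd l1 C f" "l2 > 0" "ultra_bnd l2 D g"
    using assms unfolding ultra_space_iff by blast
  then show ?thesis using that[of "min l1 l2" C D] ultra_bnd_antimono[of l1 C f "min l1 l2"] ultra_bnd_antimono[of l2 D g "min l1 l2"]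
    by auto
qed

lemma ultra_space_add:
  assumes "f \<in> ultra_space \<omega>" "g \<in> ultra_space \<omega>" shows "(\<lambda>x. f x + g x) \<in> ultra_space \<omega>"
proof -
  obtain lam C D where "lam > 0" "ultra_bnd lam C f" "ultra_bnd lam D g" using ultra_space_common[OF assms] .
  moreover have "periodic_fn (\<lambda>x. f x + g x)" using assms by (simp add: ultra_space_def periodic_fn_def)
  ultimately show ?thesis unfolding ultra_space_iff using ultra_bnd_add by blast
qed

lemma ultra_space_mult:
  fixes f g :: "'a::euclidean_space \<Rightarrow> complex"
  assumes "f \<in> ultra_space \<omega>" "g \<in> ultra_space \<omega>" shows "(\<lambda>x. f x * g x) \<in> ultra_space \<omega>"
proof -
  obtain lam C D where "lam > 0" "ultra_bnd lam C f" "ultra_bnd lam D g" using ultra_space_common[OF assms] .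
  then have "ultra_bnd (lam / 2) (C * D) (\<lambda>x. f x * g x)" "lam / 2 > 0" by (auto intro: ultra_bnd_mult)
  moreover have "periodic_fn (\<lambda>x. f x * g x)" using assms by (simp add: ultra_space_def periodic_fn_def)
  ultimately show ?thesis unfolding ultra_space_iff by blast
qed

lemma ultra_space_pderiv:
  assumes "f \<in> ultra_space \<omega>" "e \<in> Basis" shows "pderiv_dir e f \<in> ultra_space \<omega>"
proof -
  obtain lam C where "lam > 0" "ultra_bnd lam C f" using assms(1) unfolding ultra_space_iff by blast
  then have "ultra_bnd (lam / 2) (C * M (lam / 2) 1) (pderiv_dir e f)" "lam / 2 > 0"
    using assms(2) ultra_bnd_pderiv by auto
  moreover have "periodic_fn (pderiv_dir e f)" using assms periodic_pderiv by (auto simp: ultra_space_def)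
  ultimately show ?thesis unfolding ultra_space_iff by blast
qed

lemma ultra_space_const: "(\<lambda>x. c) \<in> ultra_space \<omega>"
proof -
  have z: "iter_pderiv es (\<lambda>x. c) = (if es = [] then (\<lambda>x. c) else (\<lambda>x. 0))" for es :: "'a list"
    by (induction es) (auto simp: pderiv_dir_def)
  have "ultra_bnd 1 (norm c / M 1 0) (\<lambda>x::'a. c)"
    using M_pos[of 1 0] by (auto simp: ultra_bnd_def smooth_const z less_imp_neq[symmetric])
  moreover have "periodic_fn (\<lambda>x::'a. c)" by (simp add: periodic_fn_def)
  ultimately show ?thesis unfolding ultra_space_iff using zero_less_one by blast
qed

lemma ultra_space_cmult:
  fixes f :: "'a::euclidean_space \<Rightarrow> complex"
  assumes "f \<in> ultra_space \<omega>" shows "(\<lambda>x. c * f x) \<in> ultra_space \<omega>"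
  using ultra_space_mult[OF ultra_space_const assms] .

lemma ultra_space_sum:
  assumes "finite I" "\<And>i. i \<in> I \<Longrightarrow> f i \<in> ultra_space \<omega>"
  shows "(\<lambda>x. \<Sum>i\<in>I. f i x) \<in> ultra_space \<omega>"
  using assms by (induction I rule: finite_induct) (auto intro: ultra_space_add ultra_space_const)

lemma ultra_space_of_real:
  "f \<in> ultra_space \<omega> \<Longrightarrow> (\<lambda>x. complex_of_real (f x)) \<in> ultra_space \<omega>"
  unfolding ultra_space_iff using ultra_bnd_of_real by (fastforce simp: periodic_fn_def)

text \<open>Derivatives in t are still measured by \<open>M\<close>, while regularity in x survives
  as decay in the frequency. Coefficients of functions in the space satisfy this with constants
  common to all \<xi>, and any such family can be summed back.\<close>

definition coef_bound :: "real \<Rightarrow> real \<Rightarrow> real \<Rightarrow> ('n::finite \<Rightarrow> int) \<Rightarrow> (real \<Rightarrow> complex) \<Rightarrow> bool" where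
  "coef_bound lam A \<delta> \<xi> u \<longleftrightarrow> smooth_fn u \<and> periodic_fn u \<and>
     (\<forall>k t. norm (nderiv k u t) \<le> A * M lam k * exp (- \<delta> * \<omega> (nrm \<xi>)))"

lemma coef_bound_nonneg: assumes "coef_bound lam A \<delta> \<xi> u" shows "0 \<le> A"
proof -
  have "0 \<le> A * (M lam 0 * exp (- \<delta> * \<omega> (nrm \<xi>)))"
    using assms unfolding coef_bound_def by (metis mult.assoc norm_ge_zero order_trans)
  moreover have "0 < M lam 0 * exp (- \<delta> * \<omega> (nrm \<xi>))" by simp
  ultimately show ?thesis by (simp only: zero_le_mult_iff) linarith
qed

text \<open>Every derivative in x costs a factor of size at most |\<xi>|. Half of the decay rate
  pays for these powers through \<open>power_le_M\<close>; the other half remains and makes the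
  modes summable.\<close>

lemma ultra_bnd_sep:
  assumes "lam > 0" "\<delta> > 0" "coef_bound lam A \<delta> \<xi> u"
  shows "ultra_bnd (min lam (\<delta>/2)) (A * exp ((\<delta>/2) * \<omega> 1) * exp (- (\<delta>/2) * \<omega> (nrm \<xi>))) (sep u \<xi>)"
  unfolding ultra_bnd_def
proof safe
  have sm: "smooth_fn u" using assms(3) by (simp add: coef_bound_def)
  show "smooth_fn (sep u \<xi>)" by (rule smooth_sep[OF sm])
  fix es :: "(real \<times> (real^'a)) list" and t :: real and x :: "real^'a"
  assume es: "set es \<subseteq> Basis"
  \<comment> \<open>The order of the directions is irrelevant for a single mode: derivatives in x
    become numerical factors, and only the numbers k and l of t- and x-derivatives matter.\<close>
  have "\<exists>k l c. k + l = length es \<and> norm c \<le> nrm \<xi> ^ l \<and> iter_pderiv es (sep u \<xi>) = (\<lambda>p. c * sep (nderiv k u) \<xi> p)"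
    using es
  proof (induction es)
    case Nil
    then show ?case by (intro exI[of _ 0] exI[of _ 1]) auto
  next
    case (Cons e es)
    then obtain k l c where IH: "k + l = length es" "norm c \<le> nrm \<xi> ^ l"
      "iter_pderiv es (sep u \<xi>) = (\<lambda>p. c * sep (nderiv k u) \<xi> p)" by auto
    have snd: "smooth_fn (nderiv k u)" using sm by (rule smooth_nderiv)
    have *: "pderiv_dir e (\<lambda>p. c * sep (nderiv k u) \<xi> p) = (\<lambda>p. c * pderiv_dir e (sep (nderiv k u) \<xi>) p)"
      by (intro ext pderiv_bounded_linear[OF bounded_linear_mult_right] smooth_differentiable smooth_sep snd)
    from Cons.prems consider "e = (1, 0)" | j where "e = (0, axis j 1)" by (auto simp: Basis_prod_vec)
    then show ?case
    proof cases
      case 1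
      have "iter_pderiv (e # es) (sep u \<xi>) = (\<lambda>p. c * sep (nderiv (Suc k) u) \<xi> p)"
        using * pderiv_sep_t[OF snd, of \<xi>] 1 IH(3) by (simp add: nderiv_add)
      then show ?thesis using IH by (intro exI[of _ "Suc k"] exI[of _ l] exI[of _ c]) auto
    next
      case (2 j)
      have "iter_pderiv (e # es) (sep u \<xi>) = (\<lambda>p. (c * (\<i> * of_int (\<xi> j))) * sep (nderiv k u) \<xi> p)"
        using * pderiv_sep_x[OF snd, of j \<xi>] 2 IH(3) by (simp add: mult.assoc)
      moreover have "norm (c * (\<i> * of_int (\<xi> j))) \<le> nrm \<xi> ^ l * nrm \<xi>"
        unfolding norm_mult using IH(2) abs_le_nrm[of \<xi> j] by (intro mult_mono) auto
      ultimately show ?thesis using IH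
        by (intro exI[of _ k] exI[of _ "Suc l"] exI[of _ "c * (\<i> * of_int (\<xi> j))"]) (auto simp: mult.commute)
    qed
  qed
  then obtain k l c where kl: "k + l = length es" "norm c \<le> nrm \<xi> ^ l"
      "iter_pderiv es (sep u \<xi>) = (\<lambda>p. c * sep (nderiv k u) \<xi> p)" by blast
  let ?m = "min lam (\<delta>/2)" and ?w = "\<omega> (nrm \<xi>)"
  have m: "?m > 0" using assms by simp
  have pw: "nrm \<xi> ^ l \<le> M (\<delta>/2) l * exp ((\<delta>/2) * (\<omega> 1 + ?w))"
  proof -
    have "nrm \<xi> ^ l \<le> (1 + nrm \<xi>) ^ l" by (intro power_mono) auto
    also have "\<dots> = (1 + nrm \<xi>) ^ l * exp (- (\<delta>/2) * \<omega> (1 + nrm \<xi>)) * exp ((\<delta>/2) * \<omega> (1 + nrm \<xi>))"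
      by (simp add: exp_minus)
    also have "\<dots> \<le> M (\<delta>/2) l * exp ((\<delta>/2) * (\<omega> 1 + ?w))"
    proof (rule mult_mono)
      show "(1 + nrm \<xi>) ^ l * exp (- (\<delta>/2) * \<omega> (1 + nrm \<xi>)) \<le> M (\<delta>/2) l"
        using assms(2) by (intro power_le_M) auto
      show "exp ((\<delta>/2) * \<omega> (1 + nrm \<xi>)) \<le> exp ((\<delta>/2) * (\<omega> 1 + ?w))"
        using assms(2) omega_add[of 1 "nrm \<xi>"] by simp
    qed auto
    finally show ?thesis .
  qed
  have "norm (iter_pderiv es (sep u \<xi>) (t, x)) = norm c * norm (nderiv k u t)"
    using kl(3) by (simp add: sep_def norm_mult)
  also have "\<dots> \<le> (M (\<delta>/2) l * exp ((\<delta>/2) * (\<omega> 1 + ?w))) * (A * M lam k * exp (- \<delta> * ?w))"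
    using kl(2) pw assms(3) by (intro mult_mono) (auto simp: coef_bound_def)
  also have "\<dots> = A * (exp ((\<delta>/2) * \<omega> 1) * exp (- (\<delta>/2) * ?w)) * (M lam k * M (\<delta>/2) l)"
  proof -
    have "exp ((\<delta>/2) * (\<omega> 1 + ?w)) * exp (- \<delta> * ?w) = exp ((\<delta>/2) * \<omega> 1) * exp (- (\<delta>/2) * ?w)"
      by (simp add: algebra_simps flip: exp_add)
    then show ?thesis by (simp add: mult_ac)
  qed
  also have "\<dots> \<le> A * (exp ((\<delta>/2) * \<omega> 1) * exp (- (\<delta>/2) * ?w)) * M ?m (length es)"
  proof (rule mult_left_mono)
    have "M lam k * M (\<delta>/2) l \<le> M ?m k * M ?m l"
      using assms m by (intro mult_mono M_antimono) auto
    also have "\<dots> \<le> M ?m (length es)" using M_mult_le[OF m, of k l] kl(1) by simp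
    finally show "M lam k * M (\<delta>/2) l \<le> M ?m (length es)" .
  qed (use coef_bound_nonneg[OF assms(3)] in auto)
  finally show "norm (iter_pderiv es (sep u \<xi>) (t, x)) \<le> A * exp ((\<delta>/2) * \<omega> 1) * exp (- (\<delta>/2) * ?w) * M ?m (length es)"
    by (simp add: mult.assoc)
qed

lemma sep_ultra:
  assumes "u \<in> ultra_space \<omega>" shows "sep u \<xi> \<in> ultra_space \<omega>"
proof -
  obtain lam C where u: "lam > 0" "ultra_bnd lam C u" "periodic_fn u" using assms unfolding ultra_space_iff by blast
  have "norm (nderiv k u t) \<le> C * M lam k" for k t
    using bndD[OF u(2), of "replicate k 1" t] by (simp add: nderiv_def set_replicate_conv_if)
  then have "coef_bound lam (C * exp (\<omega> (nrm \<xi>))) 1 \<xi> u"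
    using u ultra_bnd_smooth by (auto simp: coef_bound_def exp_minus field_simps)
  note ultra_bnd_sep[OF u(1) zero_less_one this]
  moreover have "min lam (1/2) > 0" using u by simp
  ultimately show ?thesis unfolding ultra_space_iff using periodic_sep[OF u(3), of \<xi>] by blast
qed

text \<open>Continuity on each step is all that is known about the functional. The remainders of the
  series all lie in one step, chosen with 1/k \<le> lam, and their norms there are at most the tails
  of w.\<close>

lemma dual_sums:
  fixes v :: "nat \<Rightarrow> 'a::euclidean_space \<Rightarrow> complex"
  assumes mu: "\<mu> \<in> ultra_dual \<omega>" and lam: "lam > 0" and w: "summable w"
    and v: "\<And>n. ultra_bnd lam (w n) (v n)" "\<And>n. periodic_fn (v n)"
  shows "(\<lambda>n. \<mu> (v n)) sums \<mu> (\<lambda>x. \<Sum>n. v n x)"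
proof -
  have vu: "v n \<in> ultra_space \<omega>" for n using v lam unfolding ultra_space_iff by blast
  define R where "R m = (\<lambda>x. \<Sum>n. v (n + m) x)" for m
  have wR: "summable (\<lambda>n. w (n + m))" for m using w by (rule summable_ignore_initial_segment)
  have R: "ultra_bnd lam (\<Sum>n. w (n + m)) (R m)" for m
    unfolding R_def by (rule ultra_bnd_suminf(1)[OF wR v(1)])
  have Rper: "periodic_fn (R m)" for m
    using v(2) by (simp add: R_def periodic_fn_def)
  have Ru: "R m \<in> ultra_space \<omega>" for m
    using R Rper lam unfolding ultra_space_iff by blast
  have sv: "summable (\<lambda>n. v n x)" for x
  proof (rule summable_comparison_test')
    show "summable (\<lambda>n. w n * M lam 0)" using w by (rule summable_mult2)
  qed (use ultra_bnd_norm[OF v(1)] in auto)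
  have split: "(\<lambda>x. \<Sum>n. v n x) = (\<lambda>x. (\<Sum>n<m. v n x) + R m x)" for m
    unfolding R_def using suminf_split_initial_segment[OF sv, of _ m]
    by (intro ext) (simp add: add.commute[of "\<Sum>n. v (n + m) _"])
  have add: "\<mu> (\<lambda>x. f x + g x) = \<mu> f + \<mu> g" if "f \<in> ultra_space \<omega>" "g \<in> ultra_space \<omega>" for f g
    using mu that unfolding ultra_dual_def by blast
  have zero: "\<mu> (\<lambda>x. 0) = 0"
  proof -
    have "\<forall>f\<in>ultra_space \<omega>. \<forall>c. \<mu> (\<lambda>x. c * f x) = c * \<mu> f" using mu unfolding ultra_dual_def by blast
    from bspec[OF this ultra_space_const[of 0]] have "\<mu> (\<lambda>x. 0 * 0) = 0 * \<mu> (\<lambda>x. 0)" by blast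
    then show ?thesis by simp
  qed
  have fin: "\<mu> (\<lambda>x. \<Sum>n<m. v n x) = (\<Sum>n<m. \<mu> (v n))" for m
  proof (induction m)
    case (Suc m)
    have "(\<lambda>x. \<Sum>n<m. v n x) \<in> ultra_space \<omega>" using vu by (intro ultra_space_sum) auto
    then show ?case using add vu Suc by simp
  qed (simp add: zero)
  have eq: "\<mu> (\<lambda>x. \<Sum>n. v n x) = (\<Sum>n<m. \<mu> (v n)) + \<mu> (R m)" for m
    unfolding split[of m] using add[OF ultra_space_sum Ru, of "{..<m}" v m] vu fin by simp
  obtain k :: nat where k: "k \<ge> 1" "1 / real k \<le> lam"
  proof -
    obtain k where "1 / real (Suc k) < lam" using lam by (metis inverse_eq_divide reals_Archimedean)
    then show ?thesis using that[of "Suc k"] by simp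
  qed
  have k0: "0 < 1 / real k" using k by simp
  obtain C where C: "\<And>f. f \<in> ultra_step \<omega> k \<Longrightarrow> norm (\<mu> f) \<le> C * ultra_norm \<omega> (1 / real k) f"
    using mu k(1) unfolding ultra_dual_def by blast
  have bound: "norm (\<mu> (R m)) \<le> \<bar>C\<bar> * (\<Sum>n. w (n + m))" for m
  proof -
    have b: "ultra_bnd (1 / real k) (\<Sum>n. w (n + m)) (R m)" by (rule ultra_bnd_antimono[OF R k0 k(2)])
    have ub: "ultra_bounded \<omega> (1 / real k) (R m)"
      using ultra_bounded_iff[OF k0 ultra_bnd_smooth[OF b]] b by (simp only:) (rule exI)
    have un: "ultra_norm \<omega> (1 / real k) (R m) \<le> (\<Sum>n. w (n + m))" by (rule ultra_norm_le[OF k0 b])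
    have "norm (iter_pderiv [] (R m) 0) \<le> ultra_norm \<omega> (1 / real k) (R m) * M (1 / real k) (length ([]::'a list))"
      by (rule norm_le_ultra_norm[OF k0 ultra_bnd_smooth[OF b] ub]) simp
    then have "0 \<le> ultra_norm \<omega> (1 / real k) (R m) * M (1 / real k) 0"
      by (simp only: iter_pderiv.simps list.size) (rule order_trans[OF norm_ge_zero])
    then have u0: "0 \<le> ultra_norm \<omega> (1 / real k) (R m)" using M_pos[of "1 / real k" 0] by (auto simp: zero_le_mult_iff)
    have "norm (\<mu> (R m)) \<le> C * ultra_norm \<omega> (1 / real k) (R m)"
      using b ub Rper ultra_bnd_smooth by (intro C) (auto simp: ultra_step_def)
    also have "\<dots> \<le> \<bar>C\<bar> * (\<Sum>n. w (n + m))" using un u0 by (intro mult_mono) auto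
    finally show ?thesis .
  qed
  have "(\<lambda>m. \<bar>C\<bar> * (\<Sum>n. w (n + m))) \<longlonglongrightarrow> \<bar>C\<bar> * 0"
    by (intro tendsto_mult_left suminf_exist_split2 w)
  then have T: "(\<lambda>m. \<bar>C\<bar> * (\<Sum>n. w (n + m))) \<longlonglongrightarrow> 0" by (simp only: mult_zero_right)
  have "(\<lambda>m. \<mu> (R m)) \<longlonglongrightarrow> 0"
    by (rule Lim_null_comparison[OF always_eventually[OF allI[OF bound]] T])
  then have "(\<lambda>m. \<mu> (\<lambda>x. \<Sum>n. v n x) - \<mu> (R m)) \<longlonglongrightarrow> \<mu> (\<lambda>x. \<Sum>n. v n x) - 0"
    by (intro tendsto_intros)
  moreover have "\<mu> (\<lambda>x. \<Sum>n. v n x) - \<mu> (R m) = (\<Sum>n<m. \<mu> (v n))" for m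
    using eq[of m] by (simp only: add_diff_cancel_right')
  ultimately show ?thesis by (simp only: sums_def diff_zero)
qed

text \<open>The sup norm is the order-zero part of every step norm, so a single bound by the sup
  norm gives continuity on all steps at once.\<close>

lemma ultra_dualI:
  assumes "\<And>f g. f \<in> ultra_space \<omega> \<Longrightarrow> g \<in> ultra_space \<omega> \<Longrightarrow> \<mu> (\<lambda>x. f x + g x) = \<mu> f + \<mu> g"
    and "\<And>f c. f \<in> ultra_space \<omega> \<Longrightarrow> \<mu> (\<lambda>x. c * f x) = c * \<mu> f"
    and bd: "\<And>f B. f \<in> ultra_space \<omega> \<Longrightarrow> (\<And>x. norm (f x) \<le> B) \<Longrightarrow> norm (\<mu> f) \<le> K * B"
  shows "(\<mu> :: ('a::euclidean_space \<Rightarrow> complex) \<Rightarrow> complex) \<in> ultra_dual \<omega>"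
proof -
  have "\<exists>C. \<forall>f\<in>ultra_step \<omega> k. norm (\<mu> f) \<le> C * ultra_norm \<omega> (1 / real k) f" if k: "k \<ge> 1" for k
  proof (intro exI ballI)
    fix f :: "'a \<Rightarrow> complex" assume f: "f \<in> ultra_step \<omega> k"
    have k0: "1 / real k > 0" using k by simp
    have fu: "f \<in> ultra_space \<omega>" using f k0 unfolding ultra_space_def ultra_step_def by blast
    have "norm (f x) \<le> ultra_norm \<omega> (1 / real k) f * M (1 / real k) 0" for x
      using norm_le_ultra_norm[OF k0, of f "[]" x] f by (simp add: ultra_step_def)
    from bd[OF fu this] show "norm (\<mu> f) \<le> (K * M (1 / real k) 0) * ultra_norm \<omega> (1 / real k) f"
      by (simp add: mult_ac)
  qed
  then show ?thesis unfolding ultra_dual_def using assms(1,2) by blast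
qed

lemma coef_dual: "(\<lambda>f. coef \<xi> f t) \<in> ultra_dual \<omega>"
  by (rule ultra_dualI[where K = 1])
     (auto simp: coef_add coef_cmult ultra_space_smooth intro: norm_coef_le)

text \<open>For a coordinate j with |\<xi>_j| largest, derivatives of order l in x_j bound
  |\<xi>_j|^l times the coefficient for every l. \<open>decay_from_moments\<close> converts this
  into decay in |\<xi>_j|, and subadditivity carries it over to \<open>nrm\<close>.\<close>

lemma coef_decay:
  fixes f :: "real \<times> (real^'n) \<Rightarrow> complex"
  assumes "f \<in> ultra_space \<omega>"
  shows "\<exists>lam A \<delta>. lam > 0 \<and> \<delta> > 0 \<and> (\<forall>\<xi>. coef_bound lam A \<delta> \<xi> (coef \<xi> f))"
proof -
  obtain lam C where lam: "lam > 0" and f: "ultra_bnd lam C f" and per: "periodic_fn f"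
    using assms unfolding ultra_space_iff by blast
  note sm = ultra_bnd_smooth[OF f]
  have C0: "C \<ge> 0" by (rule ultra_bnd_nonneg[OF f])
  let ?N = "CARD('n)"
  obtain D where D: "D > 0" "\<And>x. x \<ge> 1 \<Longrightarrow> x ^ 1 \<le> D * exp ((lam/4) * \<omega> x)"
    using power_le_exp_omega[of "lam/4" 1] lam by auto
  \<comment> \<open>Separating t-orders from x-orders leaves the rate lam/2, absorbing the extra
    factor x leaves lam/4, and N compares \<open>nrm\<close> with the largest coordinate.\<close>
  define \<delta> where "\<delta> = lam / (4 * real ?N)"
  have \<delta>: "\<delta> > 0" using lam by (simp add: \<delta>_def)
  \<comment> \<open>The second summand serves \<xi> = 0, where no moments are available and exp(-
    \<delta> \<omega>(0)) has to be undone.\<close>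
  define A where "A = C * D + C * exp (\<delta> * \<omega> 0)"
  have bound: "norm (nderiv k (coef \<xi> f) t) \<le> A * M (lam/2) k * exp (- \<delta> * \<omega> (nrm \<xi>))" for \<xi> k t
  proof (cases "\<xi> = 0")
    case True
    have "norm (nderiv k (coef \<xi> f) t) \<le> C * M lam k"
      unfolding nderiv_coef(2)[OF sm]
      using bndD[OF f, of "replicate k (1, 0)"]
      by (intro norm_coef_le smooth_iter sm) (auto simp: set_replicate_conv_if)
    also have "\<dots> \<le> C * M (lam/2) k" using C0 lam by (intro mult_left_mono M_antimono) auto
    also have "\<dots> = (C * exp (\<delta> * \<omega> 0)) * M (lam/2) k * exp (- \<delta> * \<omega> (nrm \<xi>))"
      by (simp add: True nrm_def exp_minus)
    also have "\<dots> \<le> A * M (lam/2) k * exp (- \<delta> * \<omega> (nrm \<xi>))"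
      using C0 D(1) by (intro mult_right_mono) (auto simp: A_def)
    finally show ?thesis .
  next
    case False
    define j where "j = (SOME j. \<bar>\<xi> j\<bar> = Max (range (\<lambda>j. \<bar>\<xi> j\<bar>)))"
    have "Max (range (\<lambda>j. \<bar>\<xi> j\<bar>)) \<in> range (\<lambda>j. \<bar>\<xi> j\<bar>)" by (intro Max_in) auto
    then have j: "\<bar>\<xi> j\<bar> = Max (range (\<lambda>j. \<bar>\<xi> j\<bar>))" unfolding j_def
      by (intro someI_ex[of "\<lambda>j. \<bar>\<xi> j\<bar> = Max (range (\<lambda>j. \<bar>\<xi> j\<bar>))"]) (auto simp: image_iff eq_commute)
    have jmax: "\<bar>\<xi> i\<bar> \<le> \<bar>\<xi> j\<bar>" for i unfolding j by (intro Max_ge) auto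
    define x where "x = \<bar>real_of_int (\<xi> j)\<bar>"
    have "\<xi> j \<noteq> 0" using False jmax by (auto simp: fun_eq_iff)
    then have x1: "x \<ge> 1" unfolding x_def by linarith
    have nx: "nrm \<xi> \<le> real ?N * x"
    proof -
      have "nrm \<xi> \<le> (\<Sum>i\<in>(UNIV::'n set). x)"
        unfolding nrm_def x_def using jmax by (intro sum_mono) (metis of_int_abs of_int_le_iff)
      then show ?thesis by simp
    qed
    have "norm (nderiv k (coef \<xi> f) t) \<le> (C * M (lam/2) k) * (x * exp (- (lam/2) * \<omega> x))"
    proof (rule decay_from_moments)
      fix l
      let ?es = "replicate l (0, axis j 1) @ replicate k (1, 0) :: (real \<times> (real^'n)) list"
      have es: "set (replicate k (1, 0)) \<subseteq> (Basis :: (real \<times> (real^'n)) set)" "set ?es \<subseteq> Basis"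
        by (auto simp: set_replicate_conv_if)
      have "coef \<xi> (iter_pderiv ?es f) t = (\<i> * of_int (\<xi> j)) ^ l * nderiv k (coef \<xi> f) t"
        unfolding nderiv_coef(2)[OF sm] iter_pderiv_append
        by (rule coef_iter_x[OF smooth_iter[OF sm es(1)] periodic_iter[OF sm per es(1)]])
      then have "x ^ l * norm (nderiv k (coef \<xi> f) t) = norm (coef \<xi> (iter_pderiv ?es f) t)"
        by (simp add: norm_mult norm_power x_def)
      also have "\<dots> \<le> C * M lam (k + l)"
        using bndD[OF f es(2)] by (intro norm_coef_le smooth_iter sm es(2)) (simp add: add.commute)
      also have "\<dots> \<le> C * (M (lam/2) k * M (lam/2) l)"
        using M_add_le[OF lam] C0 by (intro mult_left_mono) auto
      finally show "x ^ l * norm (nderiv k (coef \<xi> f) t) \<le> (C * M (lam/2) k) * M (lam/2) l"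
        by (simp add: mult.assoc)
    qed (use lam x1 C0 in auto)
    also have "\<dots> \<le> (C * M (lam/2) k) * (D * exp ((lam/4) * \<omega> x) * exp (- (lam/2) * \<omega> x))"
      using D(2)[OF x1] C0 by (intro mult_left_mono mult_right_mono) auto
    also have "\<dots> = (C * M (lam/2) k) * (D * exp (- (lam/4) * \<omega> x))"
      by (simp add: mult.assoc flip: exp_add)
    also have "\<dots> \<le> (C * M (lam/2) k) * (D * exp (- \<delta> * \<omega> (nrm \<xi>)))"
    proof -
      have "\<omega> (nrm \<xi>) \<le> real ?N * \<omega> x"
        using omega_mono[OF nrm_nonneg nx] omega_mult_nat[of x ?N] x1 by simp
      then have "\<delta> * \<omega> (nrm \<xi>) \<le> \<delta> * (real ?N * \<omega> x)" using \<delta> by (intro mult_left_mono) auto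
      then have "- (lam/4) * \<omega> x \<le> - \<delta> * \<omega> (nrm \<xi>)" by (simp add: \<delta>_def)
      then show ?thesis using C0 D(1) by (intro mult_left_mono) auto
    qed
    also have "\<dots> = (C * D) * M (lam/2) k * exp (- \<delta> * \<omega> (nrm \<xi>))" by (simp add: mult_ac)
    also have "\<dots> \<le> A * M (lam/2) k * exp (- \<delta> * \<omega> (nrm \<xi>))"
      using C0 D(1) by (intro mult_right_mono) (auto simp: A_def)
    finally show ?thesis .
  qed
  have "coef_bound (lam/2) A \<delta> \<xi> (coef \<xi> f)" for \<xi>
    unfolding coef_bound_def using bound nderiv_coef(1)[OF sm] periodic_coef[OF per] by blast
  then show ?thesis using lam \<delta> by (intro exI[of _ "lam/2"] exI[of _ A] exI[of _ \<delta>]) auto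
qed

lemma synthesis_ultra_bnd:
  fixes \<xi> :: "nat \<Rightarrow> 'n::finite \<Rightarrow> int"
  assumes "lam > 0" "\<delta> > 0" "inj \<xi>" "\<And>n. coef_bound lam A \<delta> (\<xi> n) (u n)"
  shows "\<exists>lam'>0. \<exists>w. summable w \<and> (\<forall>n. ultra_bnd lam' (w n) (sep (u n) (\<xi> n)))"
proof (intro exI conjI allI)
  show "min lam (\<delta>/2) > 0" using assms by simp
  show "ultra_bnd (min lam (\<delta>/2)) (A * exp ((\<delta>/2) * \<omega> 1) * exp (- (\<delta>/2) * \<omega> (nrm (\<xi> n)))) (sep (u n) (\<xi> n))" for n
    by (rule ultra_bnd_sep[OF assms(1,2,4)])
  show "summable (\<lambda>n. A * exp ((\<delta>/2) * \<omega> 1) * exp (- (\<delta>/2) * \<omega> (nrm (\<xi> n))))"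
    using assms by (intro summable_mult summable_exp_omega) auto
qed

lemma synthesis:
  fixes \<xi> :: "nat \<Rightarrow> 'n::finite \<Rightarrow> int"
  assumes "lam > 0" "\<delta> > 0" "inj \<xi>" and u: "\<And>n. coef_bound lam A \<delta> (\<xi> n) (u n)"
  defines "U \<equiv> (\<lambda>p. \<Sum>n. sep (u n) (\<xi> n) p)"
  shows "U \<in> ultra_space \<omega>"
    and "\<mu> \<in> ultra_dual \<omega> \<Longrightarrow> (\<lambda>n. \<mu> (sep (u n) (\<xi> n))) sums \<mu> U"
    and "coef \<eta> U t = (\<Sum>n. if \<xi> n = \<eta> then u n t else 0)"
    and "coef (\<xi> m) U = u m"
proof -
  obtain lam' w where lw: "lam' > 0" "summable w" "\<And>n. ultra_bnd lam' (w n) (sep (u n) (\<xi> n))"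
    using synthesis_ultra_bnd[OF assms(1-4)] by blast
  have per: "periodic_fn (sep (u n) (\<xi> n))" for n using u by (auto simp: coef_bound_def intro: periodic_sep)
  have "periodic_fn U" using per by (simp add: U_def periodic_fn_def)
  then show "U \<in> ultra_space \<omega>"
    unfolding ultra_space_iff using ultra_bnd_suminf(1)[OF lw(2,3)] lw(1) unfolding U_def by blast
  show ds: "(\<lambda>n. \<mu> (sep (u n) (\<xi> n))) sums \<mu> U" if "\<mu> \<in> ultra_dual \<omega>" for \<mu>
    unfolding U_def by (rule dual_sums[OF that lw per])
  show c: "coef \<eta> U t = (\<Sum>n. if \<xi> n = \<eta> then u n t else 0)" for \<eta> t
    using ds[OF coef_dual, of \<eta> t] by (simp add: coef_sep sums_iff)
  show "coef (\<xi> m) U = u m"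
  proof
    fix t
    have "(\<lambda>n. if \<xi> n = \<xi> m then u n t else 0) = (\<lambda>n. if n = m then u m t else 0)"
      using \<open>inj \<xi>\<close> by (auto simp: inj_eq)
    then show "coef (\<xi> m) U t = u m t" unfolding c using sums_single[of m "\<lambda>n. u m t"] by (simp add: sums_iff)
  qed
qed

end

subsection \<open>The operator on a Fourier mode\<close>

text \<open>These are the formal derivatives of a solution of u' = f - q u, read off from the
  equation by the Leibniz rule. They make sense before u is known to be smooth.\<close>

fun ode_seq :: "(real \<Rightarrow> complex) \<Rightarrow> (real \<Rightarrow> complex) \<Rightarrow> (real \<Rightarrow> complex) \<Rightarrow> nat \<Rightarrow> real \<Rightarrow> complex" where
  "ode_seq f q u 0 = u"
| "ode_seq f q u (Suc k) = (\<lambda>t. nderiv k f t - (\<Sum>l\<le>k. of_nat (k choose l) * (nderiv l q t * ode_seq f q u (k - l) t)))"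

text \<open>One derivative of u suffices as hypothesis: by strong induction each formal derivative
  is differentiated into the next, Pascal's rule collecting the two Leibniz sums.\<close>

lemma ode_smooth:
  fixes f q u :: "real \<Rightarrow> complex"
  assumes "smooth_fn f" "smooth_fn q"
    and u: "\<And>t. (u has_vector_derivative f t - q t * u t) (at t)"
  shows "smooth_fn u"
    and "nderiv (Suc k) u t = nderiv k f t - (\<Sum>l\<le>k. of_nat (k choose l) * (nderiv l q t * nderiv (k - l) u t))"
proof -
  let ?D = "ode_seq f q u"
  have D: "(?D k has_vector_derivative ?D (Suc k) t) (at t)" for k t
  proof (induction k arbitrary: t rule: less_induct)
    case (less k)
    show ?case
    proof (cases k)
      case 0
      then show ?thesis using u by simp
    next
      case (Suc j)
      have IH: "(?D (j - l) has_vector_derivative ?D (Suc (j - l)) t) (at t)" for l t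
        using less[of "j - l" t] Suc by (simp del: ode_seq.simps)
      have "(?D k has_vector_derivative (nderiv (Suc j) f t -
         (\<Sum>l\<le>j. of_nat (j choose l) * (nderiv l q t * ?D (Suc (j - l)) t + nderiv (Suc l) q t * ?D (j - l) t)))) (at t)"
        unfolding Suc ode_seq.simps(2)[of f q u j]
        by (intro has_vector_derivative_diff has_vector_derivative_sum has_vector_derivative_mult_right
            has_vector_derivative_mult IH nderiv_has_vector_derivative assms(1,2))
      moreover have "(\<Sum>l\<le>j. of_nat (j choose l) * (nderiv l q t * ?D (Suc (j - l)) t + nderiv (Suc l) q t * ?D (j - l) t))
        = (\<Sum>l\<le>Suc j. of_nat (Suc j choose l) * (nderiv l q t * ?D (Suc j - l) t))"
        unfolding pascal_sum[of j "\<lambda>l. nderiv l q t" "\<lambda>l. ?D l t", symmetric] distrib_left sum.distrib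
        by (rule add.commute)
      ultimately show ?thesis unfolding Suc by simp
    qed
  qed
  from nderiv_eqI[of ?D, OF D]
  have nderiv: "smooth_fn u" "\<And>k. nderiv k u = ?D k" by auto
  show "smooth_fn u" by (rule nderiv(1))
  show "nderiv (Suc k) u t = nderiv k f t - (\<Sum>l\<le>k. of_nat (k choose l) * (nderiv l q t * nderiv (k - l) u t))"
    unfolding nderiv(2) by simp
qed

section \<open>A majorant for the derivatives of solutions\<close>

text \<open>For m k = M k / k! and after multiplication by k!, this is the sum over j of the squared
  binomial (k choose j)^2 times X^j M(k - j). The exponent j counts factors q, each of size
  X.\<close>

definition ode_majorant :: "(nat \<Rightarrow> real) \<Rightarrow> real \<Rightarrow> nat \<Rightarrow> real" where
  "ode_majorant m X k = (\<Sum>j\<le>k. X ^ j / fact j * real (k choose j) * m (k - j))"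

text \<open>The majorant reproduces itself under the recursion for derivatives after division by
  factorials. Supermultiplicativity merges \<open>m l\<close> with \<open>m (k - l - j)\<close>, the
  hockey-stick identity sums the binomials, and the factor j + 1 created by passing to (j + 1)! is
  at most k + 1.\<close>

lemma ode_majorant_step:
  assumes m0: "\<And>k. 0 \<le> m k" and sub: "\<And>j k. m j * m k \<le> m (j + k)" and inc: "\<And>k. m k \<le> real (Suc k) * m (Suc k)"
    and X: "0 \<le> X"
  shows "m k + X * (\<Sum>l\<le>k. m l * ode_majorant m X (k - l)) \<le> real (Suc k) * ode_majorant m X (Suc k)"
proof -
  have ext: "ode_majorant m X (k - l) = (\<Sum>j\<le>k. X ^ j / fact j * real ((k - l) choose j) * m (k - l - j))" for l
    unfolding ode_majorant_def by (rule sum.mono_neutral_left) (auto simp: binomial_eq_0)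
  have hs: "(\<Sum>l\<le>k. real ((k - l) choose j)) = real (Suc k choose Suc j)" for j
  proof -
    have "(\<Sum>l\<le>k. (k - l) choose j) = (\<Sum>i\<le>k. i choose j)"
      by (rule sum.reindex_bij_witness[of _ "\<lambda>i. k - i" "\<lambda>i. k - i"]) auto
    then show ?thesis using sum_choose_upper[of j k] by (metis of_nat_sum)
  qed
  have "X * (\<Sum>l\<le>k. m l * ode_majorant m X (k - l))
     = (\<Sum>l\<le>k. \<Sum>j\<le>k. X ^ Suc j / fact j * real ((k - l) choose j) * (m l * m (k - l - j)))"
    unfolding ext by (simp add: sum_distrib_left mult_ac)
  also have "\<dots> \<le> (\<Sum>l\<le>k. \<Sum>j\<le>k. X ^ Suc j / fact j * real ((k - l) choose j) * m (k - j))"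
  proof (intro sum_mono)
    fix l j assume "l \<in> {..k}" "j \<in> {..k}"
    show "X ^ Suc j / fact j * real ((k - l) choose j) * (m l * m (k - l - j)) \<le> X ^ Suc j / fact j * real ((k - l) choose j) * m (k - j)"
    proof (cases "j \<le> k - l")
      case True
      then have "m l * m (k - l - j) \<le> m (k - j)" using sub[of l "k - l - j"] \<open>l \<in> {..k}\<close> by simp
      then show ?thesis using X by (intro mult_left_mono) auto
    next
      case False
      then show ?thesis by (simp add: binomial_eq_0)
    qed
  qed
  also have "\<dots> = (\<Sum>j\<le>k. X ^ Suc j / fact j * (\<Sum>l\<le>k. real ((k - l) choose j)) * m (k - j))"
    by (subst sum.swap) (simp add: sum_distrib_left sum_distrib_right)
  also have "\<dots> = (\<Sum>j\<le>k. real (Suc j) * (X ^ Suc j / fact (Suc j) * real (Suc k choose Suc j) * m (k - j)))"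
  proof -
    have "real (Suc j) * (y / fact (Suc j)) = y / fact j" for j and y :: real
      by (simp add: fact_Suc del: of_nat_Suc)
    then have "real (Suc j) * (X ^ Suc j / fact (Suc j) * y * z) = X ^ Suc j / fact j * y * z" for j y z
      by (metis mult.assoc)
    then show ?thesis unfolding hs by simp
  qed
  also have "\<dots> \<le> (\<Sum>j\<le>k. real (Suc k) * (X ^ Suc j / fact (Suc j) * real (Suc k choose Suc j) * m (k - j)))"
    using X m0 by (intro sum_mono mult_right_mono) auto
  also have "\<dots> = real (Suc k) * (\<Sum>j\<le>k. X ^ Suc j / fact (Suc j) * real (Suc k choose Suc j) * m (Suc k - Suc j))"
    by (simp add: sum_distrib_left)
  finally have *: "X * (\<Sum>l\<le>k. m l * ode_majorant m X (k - l)) \<le>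
     real (Suc k) * (\<Sum>j\<le>k. X ^ Suc j / fact (Suc j) * real (Suc k choose Suc j) * m (Suc k - Suc j))" .
  have "ode_majorant m X (Suc k) = m (Suc k) + (\<Sum>j\<le>k. X ^ Suc j / fact (Suc j) * real (Suc k choose Suc j) * m (Suc k - Suc j))"
    unfolding ode_majorant_def by (subst sum.atMost_Suc_shift) simp
  then show ?thesis using * inc[of k] by (simp only: distrib_left add_mono)
qed

context subadd_weight begin

lemma nrm_power_le:
  assumes "\<mu> > 0" shows "nrm \<xi> ^ l \<le> M \<mu> l * exp (\<mu> * (\<omega> 1 + \<omega> (nrm \<xi>)))"
proof -
  have "nrm \<xi> ^ l \<le> (1 + nrm \<xi>) ^ l" by (intro power_mono) auto
  also have "\<dots> = (1 + nrm \<xi>) ^ l * exp (- \<mu> * \<omega> (1 + nrm \<xi>)) * exp (\<mu> * \<omega> (1 + nrm \<xi>))"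
    by (simp add: exp_minus)
  also have "\<dots> \<le> M \<mu> l * exp (\<mu> * (\<omega> 1 + \<omega> (nrm \<xi>)))"
  proof (rule mult_mono)
    show "(1 + nrm \<xi>) ^ l * exp (- \<mu> * \<omega> (1 + nrm \<xi>)) \<le> M \<mu> l"
      using assms by (intro power_le_M) auto
    show "exp (\<mu> * \<omega> (1 + nrm \<xi>)) \<le> exp (\<mu> * (\<omega> 1 + \<omega> (nrm \<xi>)))"
      using assms omega_add[of 1 "nrm \<xi>"] by simp
  qed auto
  finally show ?thesis .
qed

text \<open>All estimates are made at one point t, so that |u(t)| itself may later serve as D. With
  X = |\<xi>| C in the majorant, powers of |\<xi>| are paid for by \<open>M \<mu>\<close> and
  exp(\<mu> \<omega>(|\<xi>|)), one of the two binomial factors by \<open>M_submult\<close>, and the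
  other sums to (1 + C)^k. The quantities lam' and K are chosen before \<xi>, u and t, which is what
  makes the estimate summable over modes.\<close>

lemma ode_bound:
  assumes lam: "lam > 0" and \<mu>: "\<mu> > 0" and C: "C \<ge> 0"
  shows "\<exists>lam'>0. \<exists>K>0. \<forall>(\<xi>::'n::finite \<Rightarrow> int) (f::real \<Rightarrow> complex) q u t D. smooth_fn f \<longrightarrow> smooth_fn q \<longrightarrow>
     (\<forall>t. (u has_vector_derivative f t - q t * u t) (at t)) \<longrightarrow>
     (\<forall>l. norm (nderiv l q t) \<le> nrm \<xi> * C * M lam l) \<longrightarrow> (\<forall>l. norm (nderiv l f t) \<le> D * M lam l) \<longrightarrow> norm (u t) \<le> D \<longrightarrow>
     (\<forall>k. norm (nderiv k u t) \<le> K * D * exp (\<mu> * \<omega> (nrm \<xi>)) * M lam' k)"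
proof -
  define \<nu> where "\<nu> = min \<mu> lam"
  have \<nu>: "\<nu> > 0" using lam \<mu> by (simp add: \<nu>_def)
  \<comment> \<open>An integer at least 1 + C, so that \<open>M_power_mult\<close> absorbs (1 +
    C)^k.\<close>
  define B where "B = nat \<lceil>1 + C\<rceil>"
  have B: "1 + C \<le> real B" "1 \<le> B" using C unfolding B_def by linarith+
  \<comment> \<open>\<open>M lam 0\<close> may be smaller than 1; the factor R lets the induction
    start from |u(t)| \<le> D.\<close>
  define R where "R = max 1 (1 / M lam 0)"
  have R: "R \<ge> 1" "R * M lam 0 \<ge> 1"
    by (auto simp: R_def max_def) (metis M_pos divide_le_eq_1_pos linorder_not_le mult_1 order_less_imp_le)
  define K where "K = R * exp (\<mu> * \<omega> 1)"
  define m where "m k = M lam k / fact k" for k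
  have m0: "0 \<le> m k" for k by (simp add: m_def)
  have sub: "m j * m k \<le> m (j + k)" for j k
  proof -
    have "real (fact j * fact k * ((j + k) choose j)) = real (fact (j + k))"
      using binomial_fact_lemma[of j "j + k"] by simp
    then have F: "(fact (j + k) :: real) = fact j * fact k * real ((j + k) choose j)" by simp
    have "M lam j * M lam k \<le> M lam (j + k) / real ((j + k) choose j)"
      using M_submult[OF lam, of j k] by (simp add: pos_le_divide_eq mult.commute)
    then have "M lam j * M lam k / (fact j * fact k) \<le> M lam (j + k) / real ((j + k) choose j) / (fact j * fact k)"
      by (rule divide_right_mono) simp
    then show ?thesis unfolding m_def F by (simp add: mult_ac)
  qed
  have inc: "m k \<le> real (Suc k) * m (Suc k)" for k
    using M_Suc_mono[OF lam, of k] by (simp add: m_def divide_right_mono)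
  have main: "norm (nderiv k u t) \<le> K * D * exp (\<mu> * \<omega> (nrm \<xi>)) * M (\<nu> / real B) k"
    if f: "smooth_fn f" and q: "smooth_fn q" and u: "\<And>t. (u has_vector_derivative f t - q t * u t) (at t)"
      and bq: "\<And>l. norm (nderiv l q t) \<le> nrm \<xi> * C * M lam l" and bf: "\<And>l. norm (nderiv l f t) \<le> D * M lam l"
      and bu: "norm (u t) \<le> D"
    for \<xi> :: "'n \<Rightarrow> int" and f q u :: "real \<Rightarrow> complex" and t D k
  proof -
    let ?X = "nrm \<xi> * C"
    have X: "?X \<ge> 0" using C by simp
    have D0: "D \<ge> 0" using bu norm_ge_zero order_trans by blast
    let ?Q = "ode_majorant m ?X"
    have Q0: "0 \<le> ?Q k" for k unfolding ode_majorant_def using X m0 by (intro sum_nonneg) auto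
    have maj: "norm (nderiv k u t) \<le> fact k * (R * D * ?Q k)" for k
    proof (induction k rule: less_induct)
      case (less k)
      show ?case
      proof (cases k)
        case 0
        have "norm (u t) \<le> D * 1" using bu by simp
        also have "\<dots> \<le> D * (R * M lam 0)" using R D0 by (intro mult_left_mono) auto
        finally show ?thesis using 0 by (simp add: ode_majorant_def m_def mult_ac)
      next
        case (Suc j)
        have "norm (nderiv (Suc j) u t) \<le> norm (nderiv j f t) + (\<Sum>l\<le>j. norm (of_nat (j choose l) * (nderiv l q t * nderiv (j - l) u t)))"
          unfolding ode_smooth(2)[OF f q u]
          by (rule order_trans[OF norm_triangle_ineq4 add_left_mono[OF norm_sum]])
        also have "\<dots> \<le> fact j * (R * D * m j) + (\<Sum>l\<le>j. fact j * (R * D * (?X * (m l * ?Q (j - l)))))"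
        proof (rule add_mono)
          have "norm (nderiv j f t) \<le> 1 * (D * M lam j)" using bf by simp
          also have "\<dots> \<le> R * (D * M lam j)" using R D0 by (intro mult_right_mono) auto
          finally show "norm (nderiv j f t) \<le> fact j * (R * D * m j)" by (simp add: m_def)
          show "(\<Sum>l\<le>j. norm (of_nat (j choose l) * (nderiv l q t * nderiv (j - l) u t))) \<le> (\<Sum>l\<le>j. fact j * (R * D * (?X * (m l * ?Q (j - l)))))"
          proof (rule sum_mono)
            fix l assume l: "l \<in> {..j}"
            have "norm (of_nat (j choose l) * (nderiv l q t * nderiv (j - l) u t)) = real (j choose l) * (norm (nderiv l q t) * norm (nderiv (j - l) u t))"
              by (simp add: norm_mult)
            also have "\<dots> \<le> real (j choose l) * ((?X * M lam l) * (fact (j - l) * (R * D * ?Q (j - l))))"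
              using less[of "j - l"] Suc bq[of l] X by (intro mult_left_mono mult_mono) auto
            also have "\<dots> = fact j * (R * D * (?X * (m l * ?Q (j - l))))"
            proof -
              have "real (j choose l) = fact j / (fact l * fact (j - l))"
                using l by (intro binomial_fact) auto
              then show ?thesis by (simp add: m_def field_simps)
            qed
            finally show "norm (of_nat (j choose l) * (nderiv l q t * nderiv (j - l) u t)) \<le> fact j * (R * D * (?X * (m l * ?Q (j - l))))" .
          qed
        qed
        also have "\<dots> = fact j * (R * D) * (m j + ?X * (\<Sum>l\<le>j. m l * ?Q (j - l)))"
          by (simp add: sum_distrib_left algebra_simps)
        also have "\<dots> \<le> fact j * (R * D) * (real (Suc j) * ?Q (Suc j))"
          using D0 R by (intro mult_left_mono ode_majorant_step m0 sub inc X) auto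
        finally show ?thesis unfolding Suc by (simp add: algebra_simps)
      qed
    qed
    have Qb: "fact k * ?Q k \<le> exp (\<mu> * (\<omega> 1 + \<omega> (nrm \<xi>))) * M (\<nu> / real B) k"
    proof -
      let ?E = "exp (\<mu> * (\<omega> 1 + \<omega> (nrm \<xi>)))"
      have "fact k * ?Q k = (\<Sum>j\<le>k. fact k * (?X ^ j / fact j * real (k choose j) * m (k - j)))"
        by (simp add: ode_majorant_def sum_distrib_left)
      also have "\<dots> \<le> (\<Sum>j\<le>k. ?E * M \<nu> k * (real (k choose j) * C ^ j))"
      proof (rule sum_mono)
        fix j assume j: "j \<in> {..k}"
        have "?X ^ j * M lam (k - j) \<le> (C ^ j * (M \<nu> j * ?E)) * M \<nu> (k - j)"
        proof (rule mult_mono)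
          have "?X ^ j = C ^ j * nrm \<xi> ^ j" by (simp add: power_mult_distrib)
          also have "\<dots> \<le> C ^ j * (M \<mu> j * ?E)" using nrm_power_le[OF \<mu>, of \<xi> j] C by (intro mult_left_mono) auto
          also have "\<dots> \<le> C ^ j * (M \<nu> j * ?E)" using C \<nu> by (intro mult_left_mono mult_right_mono M_antimono) (auto simp: \<nu>_def)
          finally show "?X ^ j \<le> C ^ j * (M \<nu> j * ?E)" .
          show "M lam (k - j) \<le> M \<nu> (k - j)" using \<nu> by (intro M_antimono) (auto simp: \<nu>_def)
        qed (use C in auto)
        then have "real (k choose j) * (?X ^ j * M lam (k - j)) \<le> real (k choose j) * ((C ^ j * (M \<nu> j * ?E)) * M \<nu> (k - j))"
          by (intro mult_left_mono) auto
        also have "\<dots> = (C ^ j * ?E) * (real (k choose j) * (M \<nu> j * M \<nu> (k - j)))" by (simp add: mult_ac)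
        also have "\<dots> \<le> (C ^ j * ?E) * M \<nu> k"
          using M_submult[OF \<nu>, of j "k - j"] j C by (intro mult_left_mono) auto
        finally have 1: "real (k choose j) * (?X ^ j * M lam (k - j)) \<le> (C ^ j * ?E) * M \<nu> k" .
        have bf: "real (k choose j) = fact k / (fact j * fact (k - j))" using j by (intro binomial_fact) auto
        have "fact k * (?X ^ j / fact j * real (k choose j) * m (k - j)) = (fact k / (fact j * fact (k - j))) * (real (k choose j) * (?X ^ j * M lam (k - j)))"
          by (simp add: m_def)
        also have "\<dots> \<le> (fact k / (fact j * fact (k - j))) * ((C ^ j * ?E) * M \<nu> k)"
          by (rule mult_left_mono[OF 1]) simp
        also have "\<dots> = ?E * M \<nu> k * (real (k choose j) * C ^ j)" unfolding bf by simp
        finally show "fact k * (?X ^ j / fact j * real (k choose j) * m (k - j)) \<le> ?E * M \<nu> k * (real (k choose j) * C ^ j)" .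
      qed
      also have "\<dots> = ?E * M \<nu> k * (\<Sum>j\<le>k. real (k choose j) * C ^ j)" by (simp add: sum_distrib_left)
      also have "(\<Sum>j\<le>k. real (k choose j) * C ^ j) = (C + 1) ^ k" by (simp add: binomial_ring)
      also have "?E * M \<nu> k * (C + 1) ^ k \<le> ?E * M \<nu> k * real B ^ k"
        using B C by (intro mult_left_mono power_mono) auto
      also have "\<dots> = ?E * (real B ^ k * M \<nu> k)" by simp
      also have "\<dots> \<le> ?E * M (\<nu> / real B) k" using M_power_mult[OF \<nu> B(2)] by (intro mult_left_mono) auto
      finally show ?thesis .
    qed
    have "norm (nderiv k u t) \<le> R * D * (fact k * ?Q k)" using maj[of k] by (simp add: mult_ac)
    also have "\<dots> \<le> R * D * (exp (\<mu> * (\<omega> 1 + \<omega> (nrm \<xi>))) * M (\<nu> / real B) k)"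
      using Qb R D0 by (intro mult_left_mono) auto
    also have "\<dots> = K * D * exp (\<mu> * \<omega> (nrm \<xi>)) * M (\<nu> / real B) k"
      by (simp add: K_def distrib_left exp_add)
    finally show ?thesis .
  qed
  have pos: "\<nu> / real B > 0" "K > 0" using \<nu> B R by (auto simp: K_def)
  show ?thesis
    by (rule exI[of _ "\<nu> / real B"], rule conjI[OF pos(1)], rule exI[of _ K], rule conjI[OF pos(2)],
        intro allI impI, rule main) blast+
qed

end

section \<open>The operator and the reduction of solvability to its modes\<close>

locale torus_operator = subadd_weight +
  fixes a b :: "'n::finite \<Rightarrow> real \<Rightarrow> real"
  assumes a: "a j \<in> ultra_space \<omega>" and b: "b j \<in> ultra_space \<omega>"
begin

definition c :: "'n \<Rightarrow> real \<Rightarrow> complex" where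
  "c j t = complex_of_real (a j t) + \<i> * complex_of_real (b j t)"

definition q :: "('n \<Rightarrow> int) \<Rightarrow> real \<Rightarrow> complex" where
  "q \<xi> t = \<i> * (\<Sum>j\<in>UNIV. of_int (\<xi> j) * c j t)"

definition mode_op :: "('n \<Rightarrow> int) \<Rightarrow> (real \<Rightarrow> complex) \<Rightarrow> real \<Rightarrow> complex" where
  "mode_op \<xi> u t = nderiv 1 u t + q \<xi> t * u t"

lemma c_ultra: "c j \<in> ultra_space \<omega>"
  unfolding c_def using ultra_space_add[OF ultra_space_of_real[OF a] ultra_space_cmult[OF ultra_space_of_real[OF b]]] .

lemma q_ultra: "q \<xi> \<in> ultra_space \<omega>"
  unfolding q_def by (intro ultra_space_cmult ultra_space_sum c_ultra) auto

lemma c_common: "\<exists>lam>0. \<exists>C\<ge>0. \<forall>j. ultra_bnd lam C (c j)"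
proof -
  have "\<exists>lam>0. \<exists>C. ultra_bnd lam C (c j)" for j using c_ultra[of j] unfolding ultra_space_iff by blast
  then obtain l C where l: "\<And>j. l j > 0" "\<And>j. ultra_bnd (l j) (C j) (c j)" by metis
  define lam where "lam = Min (range l)"
  define K where "K = Max (range C)"
  have "lam > 0" using l by (simp add: lam_def)
  moreover have "ultra_bnd lam K (c j)" for j
    by (rule ultra_bnd_mono[OF ultra_bnd_antimono[OF l(2)]]) (use \<open>lam > 0\<close> in \<open>auto simp: lam_def K_def\<close>)
  ultimately show ?thesis using ultra_bnd_nonneg by blast
qed

lemma q_ultra_bnd: "\<exists>lam>0. \<exists>C\<ge>0. \<forall>\<xi>. ultra_bnd lam (nrm \<xi> * C) (q \<xi>)"
proof -
  obtain lam C where lam: "lam > 0" "C \<ge> 0" "\<And>j. ultra_bnd lam C (c j)" using c_common by blast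
  have "ultra_bnd lam (norm \<i> * (\<Sum>j\<in>UNIV. norm (complex_of_int (\<xi> j)) * C)) (q \<xi>)" for \<xi>
    unfolding q_def by (intro ultra_bnd_cmult ultra_bnd_sum lam(3)) auto
  then have "ultra_bnd lam (nrm \<xi> * C) (q \<xi>)" for \<xi>
    by (simp add: nrm_def sum_distrib_right)
  then show ?thesis using lam by blast
qed

lemma ultra_bnd_nderiv: "ultra_bnd lam C u \<Longrightarrow> norm (nderiv k u t) \<le> C * M lam k"
  using bndD[of lam C u "replicate k 1" t] by (simp add: nderiv_def set_replicate_conv_if)

lemma opL_eq: "opL a b u = (\<lambda>p. pderiv_dir (1, 0) u p + (\<Sum>j\<in>UNIV. sep (c j) 0 p * pderiv_dir (0, axis j 1) u p))"
  by (auto simp: opL_def c_def sep_def)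

lemma opL_ultra: "\<phi> \<in> ultra_space \<omega> \<Longrightarrow> opL a b \<phi> \<in> ultra_space \<omega>"
  unfolding opL_eq
  by (intro ultra_space_add ultra_space_pderiv ultra_space_sum ultra_space_mult sep_ultra c_ultra) auto

lemma mode_op_ultra:
  assumes "u \<in> ultra_space \<omega>" shows "mode_op \<xi> u \<in> ultra_space \<omega>"
proof -
  have "nderiv 1 u \<in> ultra_space \<omega>" using ultra_space_pderiv[OF assms, of 1] by (simp add: nderiv_def)
  then show ?thesis unfolding mode_op_def by (intro ultra_space_add ultra_space_mult q_ultra assms)
qed

lemma opL_sep: "smooth_fn u \<Longrightarrow> opL a b (sep u \<xi>) = sep (mode_op \<xi> u) \<xi>"
  unfolding opL_eq pderiv_sep_t pderiv_sep_x
  by (auto simp: sep_def mode_op_def q_def algebra_simps sum_distrib_left sum_distrib_right)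

lemma coef_sum:
  assumes "finite I" "\<And>i. i \<in> I \<Longrightarrow> g i \<in> ultra_space \<omega>"
  shows "coef \<xi> (\<lambda>p. \<Sum>i\<in>I. g i p) t = (\<Sum>i\<in>I. coef \<xi> (g i) t)"
  using assms
proof (induction I rule: finite_induct)
  case empty
  then show ?case by (simp add: coef_def)
next
  case (insert i I)
  then have "(\<lambda>p. \<Sum>i\<in>I. g i p) \<in> ultra_space \<omega>" by (intro ultra_space_sum) auto
  then show ?case using insert coef_add[of "g i" "\<lambda>p. \<Sum>i\<in>I. g i p" \<xi> t] ultra_space_smooth by auto
qed

lemma coef_opL:
  assumes \<phi>: "\<phi> \<in> ultra_space \<omega>" shows "coef \<xi> (opL a b \<phi>) = mode_op \<xi> (coef \<xi> \<phi>)"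
proof
  fix t
  note sm = ultra_space_smooth[OF \<phi>] and per = ultra_space_periodic[OF \<phi>]
  have t: "coef \<xi> (\<lambda>p. sep u 0 p * g p) t = u t * coef \<xi> g t" for u g
    by (simp add: coef_def sep_def mult.assoc)
  have u1: "(\<lambda>p. sep (c j) 0 p * pderiv_dir (0, axis j 1) \<phi> p) \<in> ultra_space \<omega>" for j
    by (intro ultra_space_mult ultra_space_pderiv sep_ultra c_ultra \<phi>) auto
  have u2: "pderiv_dir (1, 0) \<phi> \<in> ultra_space \<omega>" by (intro ultra_space_pderiv \<phi>) auto
  have u3: "(\<lambda>p. \<Sum>j\<in>UNIV. sep (c j) 0 p * pderiv_dir (0, axis j 1) \<phi> p) \<in> ultra_space \<omega>"
    by (intro ultra_space_sum u1) auto
  have "coef \<xi> (opL a b \<phi>) t = coef \<xi> (pderiv_dir (1, 0) \<phi>) t +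
      (\<Sum>j\<in>UNIV. coef \<xi> (\<lambda>p. sep (c j) 0 p * pderiv_dir (0, axis j 1) \<phi> p) t)"
    unfolding opL_eq coef_add[OF ultra_space_smooth[OF u2] ultra_space_smooth[OF u3]]
    by (subst coef_sum) (auto intro: u1)
  also have "coef \<xi> (pderiv_dir (1, 0) \<phi>) t = nderiv 1 (coef \<xi> \<phi>) t"
    using nderiv_coef(2)[OF sm, of 1 \<xi>] by simp
  also have "(\<Sum>j\<in>UNIV. coef \<xi> (\<lambda>p. sep (c j) 0 p * pderiv_dir (0, axis j 1) \<phi> p) t) = q \<xi> t * coef \<xi> \<phi> t"
    unfolding t q_def coef_pderiv_x[OF sm per] by (simp add: sum_distrib_left sum_distrib_right mult_ac)
  finally show "coef \<xi> (opL a b \<phi>) t = mode_op \<xi> (coef \<xi> \<phi>) t" by (simp add: mode_op_def)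
qed

lemma opL_annihilator: "\<phi> \<in> ultra_space \<omega> \<Longrightarrow> opL a b \<phi> \<in> annihilator_ker \<omega> a b"
  by (auto simp: annihilator_ker_def ker_transpose_def opL_ultra)

text \<open>The range always lies in the annihilator by \<open>opL_annihilator\<close>. For the
  other inclusion the solutions of the single modes are summed, which their uniform bounds permit,
  and L of the sum is identified with f through its Fourier coefficients.\<close>

lemma solvableI:
  assumes "\<And>f. f \<in> annihilator_ker \<omega> a b \<Longrightarrow>
     \<exists>lam A \<delta> u. lam > 0 \<and> \<delta> > 0 \<and> (\<forall>\<xi>. coef_bound lam A \<delta> \<xi> (u \<xi>) \<and> mode_op \<xi> (u \<xi>) = coef \<xi> f)"
  shows "globally_solvable \<omega> a b"
  unfolding globally_solvable_def
proof (intro equalityI subsetI)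
  fix f assume "f \<in> opL a b ` ultra_space \<omega>"
  then show "f \<in> annihilator_ker \<omega> a b" using opL_annihilator by blast
next
  fix f assume f: "f \<in> annihilator_ker \<omega> a b"
  then obtain lam A \<delta> u where u: "lam > 0" "\<delta> > 0" "\<And>\<xi>. coef_bound lam A \<delta> \<xi> (u \<xi>)" "\<And>\<xi>. mode_op \<xi> (u \<xi>) = coef \<xi> f"
    using assms by metis
  have fu: "f \<in> ultra_space \<omega>" using f by (simp add: annihilator_ker_def)
  obtain en :: "nat \<Rightarrow> 'n \<Rightarrow> int" where en: "bij en" using exists_enumeration by blast
  define U where "U = (\<lambda>p. \<Sum>n. sep (u (en n)) (en n) p)"
  note syn = synthesis[OF u(1,2) bij_is_inj[OF en] u(3), folded U_def]
  have "coef \<xi> U = u \<xi>" for \<xi>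
    using syn(4)[of "inv en \<xi>"] en by (simp add: bij_is_surj surj_f_inv_f)
  then have "coef \<xi> (opL a b U) = coef \<xi> f" for \<xi> using coef_opL[OF syn(1)] u(4) by simp
  then have "opL a b U = f"
    using syn(1) fu opL_ultra by (intro fourier_ext) (auto intro: ultra_space_smooth ultra_space_periodic)
  then show "f \<in> opL a b ` ultra_space \<omega>" using syn(1) by blast
qed

text \<open>The v n are the Fourier coefficients of a preimage of the series, and w is the decay
  that \<open>coef_decay\<close> grants them. Functionals in the kernel of the transpose vanish on
  the series because they may be evaluated term by term.\<close>

lemma solvable_imp:
  assumes "globally_solvable \<omega> a b" and "inj \<xi>" "lam > 0" "\<delta> > 0"
    and u: "\<And>n. u n \<in> ultra_space \<omega>" "\<And>n. coef_bound lam A \<delta> (\<xi> n) (mode_op (\<xi> n) (u n))"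
  shows "\<exists>v w. (\<forall>n. smooth_fn (v n) \<and> periodic_fn (v n) \<and> mode_op (\<xi> n) (v n) = mode_op (\<xi> n) (u n)) \<and>
     (\<forall>n t. norm (v n t) \<le> w n) \<and> w \<longlonglongrightarrow> 0"
proof -
  define F where "F = (\<lambda>p. \<Sum>n. sep (mode_op (\<xi> n) (u n)) (\<xi> n) p)"
  note syn = synthesis[OF assms(3,4,2) u(2), folded F_def]
  have "\<mu> F = 0" if \<mu>: "\<mu> \<in> ker_transpose \<omega> a b" for \<mu>
  proof -
    have "\<mu> (sep (mode_op (\<xi> n) (u n)) (\<xi> n)) = 0" for n
      using \<mu> sep_ultra[OF u(1)[of n]] opL_sep[OF ultra_space_smooth[OF u(1)[of n]]]
      unfolding ker_transpose_def by (metis (mono_tags, lifting) mem_Collect_eq)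
    then show ?thesis using syn(2)[of \<mu>] \<mu> by (simp add: ker_transpose_def sums_iff)
  qed
  then have "F \<in> annihilator_ker \<omega> a b" using syn(1) by (simp add: annihilator_ker_def)
  then have "F \<in> opL a b ` ultra_space \<omega>"
    using assms(1) by (simp add: globally_solvable_def)
  then obtain \<phi> where \<phi>: "\<phi> \<in> ultra_space \<omega>" "opL a b \<phi> = F" by auto
  obtain l A' \<delta>' where d: "l > 0" "\<delta>' > 0" "\<And>\<xi>. coef_bound l A' \<delta>' \<xi> (coef \<xi> \<phi>)"
    using coef_decay[OF \<phi>(1)] by blast
  define w where "w n = A' * M l 0 * exp (- \<delta>' * \<omega> (nrm (\<xi> n)))" for n
  have "w \<longlonglongrightarrow> 0" unfolding w_def
    by (intro tendsto_mult_right_zero summable_LIMSEQ_zero summable_exp_omega d assms)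
  moreover have "norm (coef (\<xi> n) \<phi> t) \<le> w n" for n t
    using d(3)[of "\<xi> n"] unfolding coef_bound_def w_def by (metis nderiv_0)
  moreover have "mode_op (\<xi> n) (coef (\<xi> n) \<phi>) = mode_op (\<xi> n) (u n)" for n
    using coef_opL[OF \<phi>(1), of "\<xi> n"] \<phi>(2) syn(4)[of n] by simp
  ultimately show ?thesis using d(3) unfolding coef_bound_def
    by (intro exI[of _ "\<lambda>n. coef (\<xi> n) \<phi>"] exI[of _ w]) auto
qed

text \<open>Integration against E and the conjugate wave is a functional in the kernel of the
  transpose: E (v' + q v) is the derivative of E v, which takes equal values at both ends of the
  period.\<close>

lemma compatibility:
  assumes f: "f \<in> annihilator_ker \<omega> a b"
    and E: "\<And>t. (E has_vector_derivative q \<xi> t * E t) (at t)" "E (2 * pi) = E 0"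
  shows "integral {0..2*pi} (\<lambda>t. E t * coef \<xi> f t) = 0"
proof -
  define \<mu> where "\<mu> f = integral {0..2*pi} (\<lambda>t. E t * coef \<xi> f t)" for f
  have cE: "continuous_on {0..2*pi} E"
    by (rule continuous_on_vector_derivative[OF has_vector_derivative_at_within[OF E(1)]])
  have int: "(\<lambda>t. E t * coef \<xi> f t) integrable_on {0..2*pi}" if "smooth_fn f" for f
    by (intro integrable_continuous_interval continuous_intros cE smooth_continuous nderiv_coef(1) that)
  obtain B where B: "\<And>t. t \<in> {0..2*pi} \<Longrightarrow> norm (E t) \<le> B"
    using compact_imp_bounded[OF compact_continuous_image[OF cE compact_Icc]] unfolding bounded_iff by blast
  have B0: "B \<ge> 0" by (rule order_trans[OF norm_ge_zero B[of 0]]) simp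
  have "\<mu> \<in> ultra_dual \<omega>"
  proof (rule ultra_dualI[where K = "B * (2 * pi)"])
    fix f g :: "real \<times> (real^'n) \<Rightarrow> complex" assume fg: "f \<in> ultra_space \<omega>" "g \<in> ultra_space \<omega>"
    note sm = fg[THEN ultra_space_smooth]
    show "\<mu> (\<lambda>x. f x + g x) = \<mu> f + \<mu> g"
      unfolding \<mu>_def coef_add[OF sm] distrib_left by (intro integral_add int sm)
  next
    fix f :: "real \<times> (real^'n) \<Rightarrow> complex" and d assume "f \<in> ultra_space \<omega>"
    have "integral {0..2*pi} (\<lambda>t. E t * (d * coef \<xi> f t)) = integral {0..2*pi} (\<lambda>t. d * (E t * coef \<xi> f t))"
      by (simp add: mult_ac)
    then show "\<mu> (\<lambda>x. d * f x) = d * \<mu> f" by (simp add: \<mu>_def coef_cmult)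
  next
    fix f :: "real \<times> (real^'n) \<Rightarrow> complex" and D assume f: "f \<in> ultra_space \<omega>" "\<And>x. norm (f x) \<le> D"
    have D0: "D \<ge> 0" using f(2) norm_ge_zero order_trans by blast
    have "norm (\<mu> f) \<le> (B * D) * (2 * pi - 0)"
      unfolding \<mu>_def
    proof (rule integral_bound)
      show "continuous_on {0..2*pi} (\<lambda>t. E t * coef \<xi> f t)"
        by (intro continuous_intros cE smooth_continuous nderiv_coef(1) ultra_space_smooth f(1))
      show "norm (E t * coef \<xi> f t) \<le> B * D" if "t \<in> {0..2*pi}" for t
        unfolding norm_mult using B[OF that] B0 norm_coef_le[OF ultra_space_smooth[OF f(1)] f(2)]
        by (intro mult_mono) auto
    qed simp
    then show "norm (\<mu> f) \<le> B * (2 * pi) * D" by (simp add: mult_ac)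
  qed
  moreover have "\<mu> (opL a b \<phi>) = 0" if \<phi>: "\<phi> \<in> ultra_space \<omega>" for \<phi>
  proof -
    let ?v = "coef \<xi> \<phi>"
    have v: "smooth_fn ?v" by (rule nderiv_coef(1)[OF ultra_space_smooth[OF \<phi>]])
    have "((\<lambda>t. E t * coef \<xi> (opL a b \<phi>) t) has_integral E (2 * pi) * ?v (2 * pi) - E 0 * ?v 0) {0..2*pi}"
    proof (rule fundamental_theorem_of_calculus)
      fix t assume "t \<in> {0..2*pi}"
      have "((\<lambda>t. E t * ?v t) has_vector_derivative E t * nderiv 1 ?v t + (q \<xi> t * E t) * ?v t) (at t)"
        using nderiv_has_vector_derivative[OF v, of 0] by (intro has_vector_derivative_mult E) simp
      then show "((\<lambda>t. E t * ?v t) has_vector_derivative E t * coef \<xi> (opL a b \<phi>) t) (at t within {0..2*pi})"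
        unfolding coef_opL[OF \<phi>] mode_op_def by (rule has_vector_derivative_at_within[OF has_vector_derivative_eq_rhs]) (simp add: algebra_simps)
    qed simp
    moreover have "?v (2 * pi) = ?v 0"
      using periodic_coef[OF ultra_space_periodic[OF \<phi>], of \<xi>] unfolding periodic_real by (metis add_0)
    ultimately show ?thesis using E(2) by (simp add: \<mu>_def integral_unique)
  qed
  ultimately have "\<mu> \<in> ker_transpose \<omega> a b" by (simp only: ker_transpose_def mem_Collect_eq) blast
  then have "\<mu> f = 0" using f by (simp only: annihilator_ker_def mem_Collect_eq)
  then show ?thesis by (simp add: \<mu>_def)
qed

text \<open>By \<open>ode_bound\<close> the sup norm of u controls all its derivatives; the
  arbitrary loss in the frequency is fixed at half of the decay rate.\<close>

lemma regularity:
  assumes "lam > 0" "\<delta> > 0" "A \<ge> 0"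
  shows "\<exists>lam'>0. \<exists>A'. \<forall>\<xi> u g. coef_bound lam A \<delta> \<xi> g \<longrightarrow> periodic_fn u \<longrightarrow>
    (\<forall>t. (u has_vector_derivative g t - q \<xi> t * u t) (at t)) \<longrightarrow>
    (\<forall>t. norm (u t) \<le> A * exp (- \<delta> * \<omega> (nrm \<xi>))) \<longrightarrow> coef_bound lam' A' (\<delta>/2) \<xi> u \<and> mode_op \<xi> u = g"
proof -
  obtain l C where l: "l > 0" "C \<ge> 0" "\<And>\<xi>. ultra_bnd l (nrm \<xi> * C) (q \<xi>)" using q_ultra_bnd by blast
  define m where "m = min l lam"
  have m: "m > 0" using l assms by (simp add: m_def)
  have "\<delta>/2 > 0" using assms by simp
  from ode_bound[OF m this l(2), where 'n='n]
  obtain lam' K where K: "lam' > 0" "K > 0" and ob: "\<forall>(\<xi>::'n \<Rightarrow> int) (f::real \<Rightarrow> complex) q u t D. smooth_fn f \<longrightarrow> smooth_fn q \<longrightarrow>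
     (\<forall>t. (u has_vector_derivative f t - q t * u t) (at t)) \<longrightarrow>
     (\<forall>l. norm (nderiv l q t) \<le> nrm \<xi> * C * M m l) \<longrightarrow> (\<forall>l. norm (nderiv l f t) \<le> D * M m l) \<longrightarrow> norm (u t) \<le> D \<longrightarrow>
     (\<forall>k. norm (nderiv k u t) \<le> K * D * exp (\<delta>/2 * \<omega> (nrm \<xi>)) * M lam' k)"
    by (elim exE conjE)
  have "coef_bound lam' (K * A) (\<delta>/2) \<xi> u \<and> mode_op \<xi> u = g"
    if g: "coef_bound lam A \<delta> \<xi> g" and per: "periodic_fn u" and u: "\<And>t. (u has_vector_derivative g t - q \<xi> t * u t) (at t)"
      and bu: "\<And>t. norm (u t) \<le> A * exp (- \<delta> * \<omega> (nrm \<xi>))" for \<xi> u g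
  proof
    let ?D = "A * exp (- \<delta> * \<omega> (nrm \<xi>))"
    have smg: "smooth_fn g" using g by (simp add: coef_bound_def)
    have smq: "smooth_fn (q \<xi>)" using l(3) by (rule ultra_bnd_smooth)
    note os = ode_smooth[OF smg smq u]
    have 1: "norm (nderiv j (q \<xi>) t) \<le> nrm \<xi> * C * M m j" for j t
      by (rule ultra_bnd_nderiv[OF ultra_bnd_antimono[OF l(3)]]) (use m in \<open>auto simp: m_def\<close>)
    have 2: "norm (nderiv j g t) \<le> ?D * M m j" for j t
    proof -
      have "norm (nderiv j g t) \<le> A * M lam j * exp (- \<delta> * \<omega> (nrm \<xi>))" using g by (simp add: coef_bound_def)
      also have "\<dots> \<le> A * M m j * exp (- \<delta> * \<omega> (nrm \<xi>))"
        using assms m by (intro mult_right_mono mult_left_mono M_antimono) (auto simp: m_def)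
      finally show ?thesis by (simp add: mult_ac)
    qed
    have bd: "norm (nderiv k u t) \<le> K * ?D * exp (\<delta>/2 * \<omega> (nrm \<xi>)) * M lam' k" for k t
      using 1 2 u bu by (intro ob[rule_format, OF smg smq]) auto
    have eq: "K * ?D * exp (\<delta>/2 * \<omega> (nrm \<xi>)) * M lam' k = (K * A) * M lam' k * exp (- (\<delta>/2) * \<omega> (nrm \<xi>))" for k
    proof -
      have "exp (- \<delta> * \<omega> (nrm \<xi>)) * exp (\<delta>/2 * \<omega> (nrm \<xi>)) = exp (- (\<delta>/2) * \<omega> (nrm \<xi>))"
        by (simp flip: exp_add)
      then show ?thesis by (simp add: mult_ac)
    qed
    show "coef_bound lam' (K * A) (\<delta>/2) \<xi> u" unfolding coef_bound_def using os(1) per bd[unfolded eq] by blast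
    show "mode_op \<xi> u = g" using os(2)[of 0] by (auto simp: mode_op_def)
  qed
  then show ?thesis using K by blast
qed

end

subsection \<open>Sufficiency\<close>

lemma vector_derivative_zero_const:
  fixes f :: "real \<Rightarrow> 'b::real_normed_vector"
  assumes "\<And>t. (f has_vector_derivative 0) (at t)" shows "f x = f y"
  by (rule has_derivative_zero_unique[of UNIV]) (use assms in \<open>auto simp: has_vector_derivative_def\<close>)

text \<open>The difference of two integrals gives a primitive on the whole line: for either sign of
  t one of the two intervals is empty or a point.\<close>

definition prim :: "(real \<Rightarrow> 'b::euclidean_space) \<Rightarrow> real \<Rightarrow> 'b" where
  "prim f t = integral {0..t} f - integral {t..0} f"

lemma prim_0[simp]: "prim f 0 = 0" by (simp add: prim_def)

lemma prim_nonneg: "0 \<le> t \<Longrightarrow> prim f t = integral {0..t} f"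
  by (cases "t = 0") (auto simp: prim_def)

lemma prim_has_vector_derivative:
  fixes f :: "real \<Rightarrow> 'b::euclidean_space"
  assumes f: "continuous_on UNIV f" shows "(prim f has_vector_derivative f t) (at t)"
proof -
  define R where "R = \<bar>t\<bar> + 1"
  have int: "f integrable_on {x..y}" for x y
    using f continuous_on_subset integrable_continuous_interval by blast
  have eq: "integral {-R..u} f - integral {-R..0} f = prim f u" if "u \<in> {-R<..<R}" for u
  proof (cases "u \<ge> 0")
    case True
    then show ?thesis
      using Henstock_Kurzweil_Integration.integral_combine[of "-R" 0 u f] int that
      by (simp add: prim_nonneg R_def algebra_simps)
  next
    case False
    then show ?thesis
      using Henstock_Kurzweil_Integration.integral_combine[of "-R" u 0 f] int that
      by (simp add: prim_def algebra_simps)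
  qed
  have "((\<lambda>u. integral {-R..u} f) has_vector_derivative f t) (at t within {-R..R})"
    by (rule integral_has_vector_derivative) (use f continuous_on_subset in \<open>auto simp: R_def\<close>)
  then have "((\<lambda>u. integral {-R..u} f) has_vector_derivative f t) (at t)"
    by (subst (asm) at_within_interior) (auto simp: R_def)
  then have "((\<lambda>u. integral {-R..u} f - integral {-R..0} f) has_vector_derivative f t) (at t)"
    by (auto intro!: derivative_eq_intros)
  then show ?thesis
    by (rule has_vector_derivative_transform_within_open[of _ _ _ "{-R<..<R}"]) (use eq in \<open>auto simp: R_def\<close>)
qed

lemma prim_real_derivative:
  "continuous_on UNIV f \<Longrightarrow> (prim f has_real_derivative f t) (at t)"
  unfolding has_real_derivative_iff_has_vector_derivative by (rule prim_has_vector_derivative)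

lemma prim_unique:
  fixes f :: "real \<Rightarrow> 'b::euclidean_space"
  assumes "continuous_on UNIV f" "\<And>t. (F has_vector_derivative f t) (at t)"
  shows "F t - F s = prim f t - prim f s"
proof -
  have "((\<lambda>t. F t - prim f t) has_vector_derivative f t - f t) (at t)" for t
    by (intro has_vector_derivative_diff prim_has_vector_derivative assms)
  then have "F t - prim f t = F s - prim f s" by (intro vector_derivative_zero_const) simp
  then show ?thesis by (simp add: algebra_simps)
qed

lemma norm_increment_le:
  fixes F :: "real \<Rightarrow> 'b::real_normed_vector"
  assumes "x \<le> y" "\<And>t. (F has_vector_derivative f t) (at t)" "\<And>t. t \<in> {x..y} \<Longrightarrow> norm (f t) \<le> K"
  shows "norm (F y - F x) \<le> K * (y - x)"
proof -
  have "norm (F y - F x) \<le> K * norm (y - x)"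
  proof (rule differentiable_bound[of "{x..y}" F "\<lambda>t h. h *\<^sub>R f t"])
    show "(F has_derivative (\<lambda>h. h *\<^sub>R f t)) (at t within {x..y})" for t
      using assms(2)[of t] unfolding has_vector_derivative_def by (rule has_derivative_at_withinI)
    show "onorm (\<lambda>h. h *\<^sub>R f t) \<le> K" if "t \<in> {x..y}" for t
      using assms(3)[OF that] by (intro onorm_bound) (auto simp: mult.commute[of K] intro!: mult_left_mono intro: order_trans[OF norm_ge_zero])
  qed (use assms(1) in auto)
  then show ?thesis using assms(1) by simp
qed

lemma periodic_real_int:
  assumes "periodic_fn (u :: real \<Rightarrow> 'b)" shows "u (t + 2 * pi * of_int k) = u t"
proof (induction k rule: int_induct[of _ 0])
  case base then show ?case by simp
next
  case (step1 i)
  have "u (t + 2 * pi * of_int (i + 1)) = u (t + 2 * pi * of_int i + 2 * pi)" by (simp add: algebra_simps)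
  then show ?case using step1 assms by (simp add: periodic_real)
next
  case (step2 i)
  have "u (t + 2 * pi * of_int (i - 1) + 2 * pi) = u (t + 2 * pi * of_int i)" by (simp add: algebra_simps)
  then show ?case using step2 assms by (simp add: periodic_real)
qed

lemma real_representative: "\<exists>s\<in>{t0..<t0 + 2 * pi}. \<exists>k::int. t = s + 2 * pi * of_int k"
proof -
  define k where "k = \<lfloor>(t - t0) / (2 * pi)\<rfloor>"
  have "of_int k \<le> (t - t0) / (2 * pi)" "(t - t0) / (2 * pi) < of_int k + 1" unfolding k_def by linarith+
  then have "t - 2 * pi * of_int k \<in> {t0..<t0 + 2 * pi}" by (simp add: field_simps)
  then show ?thesis by (intro bexI[of _ "t - 2 * pi * of_int k"] exI[of _ k]) auto
qed

text \<open>Either exp W is at distance at least 1/2 from 1, or the principal logarithm of exp W has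
  modulus at most 2 |1 - exp W| and differs from W by a multiple of 2 pi i.\<close>

lemma norm_one_minus_exp:
  fixes W :: complex
  shows "\<exists>n::int. norm (1 - exp W) \<ge> min 1 (norm (W - 2 * pi * of_int n * \<i>)) / 2"
proof (cases "norm (1 - exp W) < 1/2")
  case True
  define z where "z = exp W - 1"
  have z: "norm z < 1/2" using True by (simp add: z_def norm_minus_commute)
  have "1 + z = exp W" by (simp add: z_def)
  then have "exp W = exp (Ln (1 + z))" by simp
  then obtain n :: int where "W = Ln (1 + z) + (of_int (2 * n) * pi) * \<i>" unfolding exp_eq by blast
  then have "norm (W - 2 * pi * of_int n * \<i>) \<le> 2 * norm z"
    using norm_Ln_le[OF z] by simp
  then show ?thesis by (intro exI[of _ n]) (auto simp: z_def norm_minus_commute)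
next
  case False
  then show ?thesis by (intro exI[of _ 0]) auto
qed

lemma prim_period:
  fixes f :: "real \<Rightarrow> 'b::euclidean_space"
  assumes "continuous_on UNIV f" "\<And>t. f (t + 2 * pi) = f t"
  shows "prim f (t + 2 * pi) = prim f t + prim f (2 * pi)"
proof -
  have "((\<lambda>t. prim f (t + 2 * pi)) has_vector_derivative f t) (at t)" for t
  proof -
    have "((\<lambda>t. t + 2 * pi) has_vector_derivative 1) (at t)" by (auto intro!: derivative_eq_intros)
    from vector_diff_chain_at[OF this prim_has_vector_derivative[OF assms(1)]]
    show ?thesis using assms(2) by (simp add: o_def)
  qed
  from prim_unique[OF assms(1) this, of t 0] show ?thesis by (simp add: algebra_simps)
qed

section \<open>Explicit periodic solutions of the mode equations\<close>

context torus_operator begin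

definition Q :: "('n \<Rightarrow> int) \<Rightarrow> real \<Rightarrow> complex" where
  "Q \<xi> t = \<i> * (\<Sum>j\<in>UNIV. of_int (\<xi> j) * (of_real (prim (a j) t) + \<i> * of_real (prim (b j) t)))"

definition \<beta> :: "('n \<Rightarrow> int) \<Rightarrow> real \<Rightarrow> real" where
  "\<beta> \<xi> t = (\<Sum>j\<in>UNIV. real_of_int (\<xi> j) * b j t)"

definition Bf :: "('n \<Rightarrow> int) \<Rightarrow> real \<Rightarrow> real" where
  "Bf \<xi> t = (\<Sum>j\<in>UNIV. real_of_int (\<xi> j) * prim (b j) t)"

definition z0 :: "('n \<Rightarrow> int) \<Rightarrow> complex" where
  "z0 \<xi> = (\<Sum>j\<in>UNIV. of_int (\<xi> j) * Complex (mean (a j)) (mean (b j)))"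

lemma cont_ab: "continuous_on S (a j)" "continuous_on S (b j)"
  using a b ultra_space_smooth smooth_continuous by blast+

lemma per_ab: "a j (t + 2 * pi) = a j t" "b j (t + 2 * pi) = b j t"
  using a[of j] b[of j] ultra_space_periodic periodic_real by blast+

lemma Q_deriv: "(Q \<xi> has_vector_derivative q \<xi> t) (at t)"
  unfolding Q_def q_def c_def
  by (intro has_vector_derivative_mult_right has_vector_derivative_sum has_vector_derivative_add
      has_vector_derivative_of_real prim_real_derivative cont_ab)

lemma Bf_deriv: "(Bf \<xi> has_vector_derivative \<beta> \<xi> t) (at t)"
  unfolding Bf_def \<beta>_def
  by (intro has_vector_derivative_mult_right has_vector_derivative_sum prim_has_vector_derivative cont_ab)

lemma Q_0[simp]: "Q \<xi> 0 = 0" by (simp add: Q_def)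
lemma Bf_0[simp]: "Bf \<xi> 0 = 0" by (simp add: Bf_def)

lemma Re_Q: "Re (Q \<xi> t) = - Bf \<xi> t"
  by (simp add: Q_def Bf_def)

lemma norm_exp_Q: "norm (exp (Q \<xi> t)) = exp (- Bf \<xi> t)" "norm (exp (- Q \<xi> t)) = exp (Bf \<xi> t)"
  by (simp_all add: Re_Q)

lemma Q_period: "Q \<xi> (t + 2 * pi) = Q \<xi> t + Q \<xi> (2 * pi)"
  using prim_period[OF cont_ab(1) per_ab(1), of _ t] prim_period[OF cont_ab(2) per_ab(2), of _ t]
  unfolding Q_def by (simp add: algebra_simps sum.distrib)

lemma Bf_period: "Bf \<xi> (t + 2 * pi) = Bf \<xi> t + Bf \<xi> (2 * pi)"
  using Q_period[of \<xi> t] Re_Q by (metis minus_add_distrib minus_equation_iff plus_complex.simps(1))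

lemma prim_2pi: "prim f (2 * pi) = 2 * pi * mean f" for f :: "real \<Rightarrow> real"
  by (simp add: prim_nonneg mean_def)

lemma Q_2pi: "Q \<xi> (2 * pi) = 2 * pi * \<i> * z0 \<xi>"
proof -
  have "of_real (prim (a j) (2 * pi)) + \<i> * of_real (prim (b j) (2 * pi)) = 2 * pi * Complex (mean (a j)) (mean (b j))" for j
    by (simp add: prim_2pi complex_eq_iff)
  then show ?thesis unfolding Q_def z0_def by (simp add: sum_distrib_left mult_ac)
qed

lemma Bf_2pi: "Bf \<xi> (2 * pi) = 2 * pi * (\<Sum>j\<in>UNIV. real_of_int (\<xi> j) * mean (b j))"
  unfolding Bf_def prim_2pi by (simp add: sum_distrib_left mult_ac)

lemma sublevel_eq:
  assumes "Bf \<xi> (2 * pi) = 0"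
  shows "sublevel b \<xi> r = {cis t | t. Bf \<xi> t < r}"
proof -
  have cb: "continuous_on UNIV (\<beta> \<xi>)" unfolding \<beta>_def by (intro continuous_intros cont_ab)
  have I: "integral {0..t} (\<lambda>\<tau>. \<Sum>j\<in>UNIV. real_of_int (\<xi> j) * b j \<tau>) = Bf \<xi> t" if "t \<ge> 0" for t
    using prim_unique[OF cb Bf_deriv, of t 0] that by (simp add: prim_nonneg \<beta>_def[abs_def])
  have per: "periodic_fn (Bf \<xi>)" using Bf_period assms by (simp add: periodic_real)
  show ?thesis
  proof (intro equalityI subsetI)
    fix z assume "z \<in> {cis t | t. Bf \<xi> t < r}"
    then obtain t where t: "z = cis t" "Bf \<xi> t < r" by blast
    obtain s k where s: "s \<in> {0..<0 + 2 * pi}" "t = s + 2 * pi * of_int k" using real_representative by blast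
    have "Bf \<xi> s < r" using t s periodic_real_int[OF per, of s k] by simp
    moreover have "cis t = cis s" using s(2) sin_cos_eq_iff[of t s] by (auto simp: complex_eq_iff)
    ultimately show "z \<in> sublevel b \<xi> r" using t s I by (force simp: sublevel_def)
  qed (use I in \<open>auto simp: sublevel_def\<close>)
qed

lemma ode_solution:
  assumes J: "\<And>t. (J has_vector_derivative exp (Q \<xi> t) * g t) (at t)"
  shows "((\<lambda>t. exp (- Q \<xi> t) * (\<kappa> + d * J t)) has_vector_derivative d * g t - q \<xi> t * (exp (- Q \<xi> t) * (\<kappa> + d * J t))) (at t)"
proof -
  have "((\<lambda>t. exp (- Q \<xi> t)) has_vector_derivative - q \<xi> t * exp (- Q \<xi> t)) (at t)"
    using field_vector_diff_chain_at[OF has_vector_derivative_minus[OF Q_deriv, of \<xi> t] DERIV_exp]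
    by (simp add: o_def mult.commute)
  from has_vector_derivative_mult[OF this has_vector_derivative_add[OF has_vector_derivative_const has_vector_derivative_mult_right[OF J, of d]], of \<kappa>]
  show ?thesis
    by (rule has_vector_derivative_eq_rhs) (simp add: algebra_simps exp_minus)
qed

lemma E_deriv: "((\<lambda>t. exp (Q \<xi> t)) has_vector_derivative q \<xi> t * exp (Q \<xi> t)) (at t)"
  using field_vector_diff_chain_at[OF Q_deriv DERIV_exp, of \<xi> t] by (simp add: o_def mult.commute)

text \<open>The number exp(Q(2 pi)) is the monodromy: a shift by one period multiplies the integrand
  by it. Both solution formulas rest on this relation.\<close>

lemma J_period:
  fixes \<xi> :: "'n \<Rightarrow> int"
  assumes cg: "continuous_on UNIV g" and per: "periodic_fn g"
  defines "J \<equiv> prim (\<lambda>t. exp (Q \<xi> t) * g t)"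
  shows "(J has_vector_derivative exp (Q \<xi> t) * g t) (at t)"
    and "J (t + 2 * pi) = J (2 * pi) + exp (Q \<xi> (2 * pi)) * J t"
proof -
  have cQ: "continuous_on UNIV (Q \<xi>)"
    by (rule continuous_on_vector_derivative[OF has_vector_derivative_at_within[OF Q_deriv]])
  have cE: "continuous_on UNIV (\<lambda>t. exp (Q \<xi> t) * g t)" by (intro continuous_intros cQ cg)
  show J: "(J has_vector_derivative exp (Q \<xi> t) * g t) (at t)" for t
    unfolding J_def by (rule prim_has_vector_derivative[OF cE])
  have "((\<lambda>t. J (t + 2 * pi) - exp (Q \<xi> (2 * pi)) * J t) has_vector_derivative 0) (at t)" for t
  proof -
    have "((\<lambda>t. t + 2 * pi) has_vector_derivative 1) (at t)" by (auto intro!: derivative_eq_intros)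
    from vector_diff_chain_at[OF this J]
    have "((\<lambda>t. J (t + 2 * pi)) has_vector_derivative exp (Q \<xi> (t + 2 * pi)) * g (t + 2 * pi)) (at t)"
      by (simp add: o_def)
    then have "((\<lambda>t. J (t + 2 * pi) - exp (Q \<xi> (2 * pi)) * J t) has_vector_derivative
       exp (Q \<xi> (t + 2 * pi)) * g (t + 2 * pi) - exp (Q \<xi> (2 * pi)) * (exp (Q \<xi> t) * g t)) (at t)"
      by (intro has_vector_derivative_diff has_vector_derivative_mult_right J)
    then show ?thesis using per by (simp add: Q_period periodic_real exp_add)
  qed
  from vector_derivative_zero_const[OF this, of t 0]
  show "J (t + 2 * pi) = J (2 * pi) + exp (Q \<xi> (2 * pi)) * J t"
    by (simp add: J_def algebra_simps)
qed

text \<open>The periodic solution is \<open>e^{-Q(t)} \<integral>_t^{t+2\<pi>} e^Q g / (e^{Q(2\<pi>)} - 1)\<close>, and also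
  \<open>e^{-Q(t)} \<integral>_{t-2\<pi>}^t e^Q g / (1 - e^{-Q(2\<pi>)})\<close>; the sign of \<open>\<beta>\<close> decides which of the two
  kernels is bounded by 1.\<close>
lemma solve_nonresonant:
  assumes cg: "continuous_on UNIV g" and per: "periodic_fn g" and F: "\<And>t. norm (g t) \<le> F"
    and ne: "exp (Q \<xi> (2 * pi)) \<noteq> 1"
    and W: "(\<forall>t. \<beta> \<xi> t \<ge> 0) \<and> W = Q \<xi> (2 * pi) \<or> (\<forall>t. \<beta> \<xi> t \<le> 0) \<and> W = - Q \<xi> (2 * pi)"
  shows "\<exists>u. periodic_fn u \<and> (\<forall>t. (u has_vector_derivative g t - q \<xi> t * u t) (at t)) \<and>
      (\<forall>t. norm (u t) \<le> 2 * pi * F / norm (1 - exp W))"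
proof -
  define J where "J = prim (\<lambda>t. exp (Q \<xi> t) * g t)"
  note J = J_period[where \<xi> = \<xi>, OF cg per, folded J_def]
  let ?e = "exp (Q \<xi> (2 * pi))"
  define \<kappa> where "\<kappa> = J (2 * pi) / (?e - 1)"
  define u where "u t = exp (- Q \<xi> t) * (\<kappa> + 1 * J t)" for t
  have ue: "\<kappa> + 1 * J t = (J (t + 2 * pi) - J t) / (?e - 1)" for t
  proof -
    have "J (t + 2 * pi) - J t = J (2 * pi) + (?e - 1) * J t" unfolding J(2)[of t] by (simp add: algebra_simps)
    then show ?thesis using ne by (simp add: \<kappa>_def add_divide_distrib)
  qed
  have upw: "u t = exp (- Q \<xi> t) * ((J (t + 2 * pi) - J t) / (?e - 1))" for t
    unfolding u_def ue ..
  have deriv: "(u has_vector_derivative g t - q \<xi> t * u t) (at t)" for t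
    unfolding u_def using ode_solution[where d = 1, OF J(1)] by simp
  have up: "periodic_fn u"
  proof -
    have "J (t + 2 * pi + 2 * pi) - J (t + 2 * pi) = ?e * (J (t + 2 * pi) - J t)" for t
      unfolding J(2)[of "t + 2 * pi"] using J(2)[of t] by (simp add: algebra_simps)
    then show ?thesis unfolding periodic_real upw Q_period by (simp add: exp_diff exp_minus)
  qed
  have Bm: "Bf \<xi> s \<le> Bf \<xi> t" if "s \<le> t" "\<forall>t. \<beta> \<xi> t \<ge> 0" for s t
    using DERIV_nonneg_imp_nondecreasing[of s t "Bf \<xi>"] that Bf_deriv
    by (auto simp: has_real_derivative_iff_has_vector_derivative)
  have Bd: "Bf \<xi> t \<le> Bf \<xi> s" if "s \<le> t" "\<forall>t. \<beta> \<xi> t \<le> 0" for s t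
    using DERIV_nonpos_imp_nonincreasing[of s t "Bf \<xi>"] that Bf_deriv
    by (auto simp: has_real_derivative_iff_has_vector_derivative)
  have F0: "F \<ge> 0" using F[of 0] norm_ge_zero order_trans by blast
  have "norm (u t) \<le> 2 * pi * F / norm (1 - exp W)" for t
    using W
  proof (elim disjE conjE)
    assume pos: "\<forall>t. \<beta> \<xi> t \<ge> 0" and W: "W = Q \<xi> (2 * pi)"
    have "norm (J (t + 2 * pi) - J t) \<le> (exp (- Bf \<xi> t) * F) * (t + 2 * pi - t)"
    proof (rule norm_increment_le[OF _ J(1)])
      fix s assume "s \<in> {t..t + 2 * pi}"
      then show "norm (exp (Q \<xi> s) * g s) \<le> exp (- Bf \<xi> t) * F"
        unfolding norm_mult norm_exp_Q using Bm[OF _ pos, of t s] F by (intro mult_mono) auto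
    qed simp
    then have "exp (Bf \<xi> t) * norm (J (t + 2 * pi) - J t) \<le> exp (Bf \<xi> t) * ((exp (- Bf \<xi> t) * F) * (2 * pi))"
      by (intro mult_left_mono) auto
    also have "\<dots> = 2 * pi * F" by (simp add: exp_minus)
    finally have "exp (Bf \<xi> t) * norm (J (t + 2 * pi) - J t) / norm (1 - exp W) \<le> 2 * pi * F / norm (1 - exp W)"
      by (rule divide_right_mono) simp
    then show ?thesis unfolding upw norm_mult norm_divide norm_exp_Q W by (simp add: norm_minus_commute)
  next
    assume neg: "\<forall>t. \<beta> \<xi> t \<le> 0" and W: "W = - Q \<xi> (2 * pi)"
    have e: "J (t + 2 * pi) - J t = ?e * (J t - J (t - 2 * pi))"
      using J(2)[of t] J(2)[of "t - 2 * pi"] by (simp add: algebra_simps)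
    have u': "u t = exp (- Q \<xi> t) * ((J t - J (t - 2 * pi)) / (1 - exp W))"
    proof -
      have "1 - exp W = (?e - 1) / ?e" by (simp add: W exp_minus field_simps)
      then show ?thesis unfolding upw e by simp
    qed
    have "norm (J t - J (t - 2 * pi)) \<le> (exp (- Bf \<xi> t) * F) * (t - (t - 2 * pi))"
    proof (rule norm_increment_le[OF _ J(1)])
      fix s assume "s \<in> {t - 2 * pi..t}"
      then show "norm (exp (Q \<xi> s) * g s) \<le> exp (- Bf \<xi> t) * F"
        unfolding norm_mult norm_exp_Q using Bd[OF _ neg, of s t] F by (intro mult_mono) auto
    qed simp
    then have "exp (Bf \<xi> t) * norm (J t - J (t - 2 * pi)) \<le> exp (Bf \<xi> t) * ((exp (- Bf \<xi> t) * F) * (2 * pi))"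
      by (intro mult_left_mono) auto
    also have "\<dots> = 2 * pi * F" by (simp add: exp_minus)
    finally have "exp (Bf \<xi> t) * norm (J t - J (t - 2 * pi)) / norm (1 - exp W) \<le> 2 * pi * F / norm (1 - exp W)"
      by (rule divide_right_mono) simp
    then show ?thesis unfolding u' norm_mult norm_divide norm_exp_Q by simp
  qed
  then show ?thesis using up deriv by blast
qed

text \<open>The solution that vanishes at t0 is taken. Compatibility makes J periodic, so the value
  at t is equally an integral from t0 forwards or from t0 + 2 pi backwards; \<open>arcs\<close>
  provides a direction along which \<open>Bf\<close> stays above its value at t, and there the
  kernel is at most 1.\<close>

lemma solve_resonant:
  assumes cg: "continuous_on UNIV g" and per: "periodic_fn g" and F: "\<And>t. norm (g t) \<le> F"
    and res: "exp (Q \<xi> (2 * pi)) = 1"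
    and I: "integral {0..2*pi} (\<lambda>t. exp (Q \<xi> t) * g t) = 0"
    and arcs: "\<And>t. t \<in> {t0..t0 + 2 * pi} \<Longrightarrow> (\<forall>s\<in>{t0..t}. Bf \<xi> t \<le> Bf \<xi> s) \<or> (\<forall>s\<in>{t..t0 + 2 * pi}. Bf \<xi> t \<le> Bf \<xi> s)"
  shows "\<exists>u. periodic_fn u \<and> (\<forall>t. (u has_vector_derivative g t - q \<xi> t * u t) (at t)) \<and>
      (\<forall>t. norm (u t) \<le> 2 * pi * F)"
proof -
  define J where "J = prim (\<lambda>t. exp (Q \<xi> t) * g t)"
  note J = J_period[where \<xi> = \<xi>, OF cg per, folded J_def]
  have "J (2 * pi) = 0" using I by (simp add: J_def prim_nonneg)
  then have Jp: "J (t + 2 * pi) = J t" for t using J(2)[of t] res by simp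
  define u where "u t = exp (- Q \<xi> t) * (- J t0 + 1 * J t)" for t
  have deriv: "(u has_vector_derivative g t - q \<xi> t * u t) (at t)" for t
    unfolding u_def using ode_solution[where d = 1 and \<kappa> = "- J t0", OF J(1)] by simp
  have up: "periodic_fn u"
    unfolding periodic_real u_def Q_period by (simp add: Jp exp_diff exp_minus res)
  have F0: "F \<ge> 0" using F[of 0] norm_ge_zero order_trans by blast
  have bd: "norm (u t) \<le> 2 * pi * F" if t: "t \<in> {t0..t0 + 2 * pi}" for t
  proof -
    have g: "norm (exp (Q \<xi> s) * g s) \<le> exp (- Bf \<xi> t) * F" if "Bf \<xi> t \<le> Bf \<xi> s" for s
      unfolding norm_mult norm_exp_Q using that F by (intro mult_mono) auto
    have "norm (- J t0 + 1 * J t) \<le> (exp (- Bf \<xi> t) * F) * (2 * pi)"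
      using arcs[OF t]
    proof
      assume s: "\<forall>s\<in>{t0..t}. Bf \<xi> t \<le> Bf \<xi> s"
      have "norm (J t - J t0) \<le> (exp (- Bf \<xi> t) * F) * (t - t0)"
        by (rule norm_increment_le[OF _ J(1)]) (use t s g in auto)
      also have "\<dots> \<le> (exp (- Bf \<xi> t) * F) * (2 * pi)" using t F0 by (intro mult_left_mono) auto
      finally show ?thesis by simp
    next
      assume s: "\<forall>s\<in>{t..t0 + 2 * pi}. Bf \<xi> t \<le> Bf \<xi> s"
      have "norm (J (t0 + 2 * pi) - J t) \<le> (exp (- Bf \<xi> t) * F) * (t0 + 2 * pi - t)"
        by (rule norm_increment_le[OF _ J(1)]) (use t s g in auto)
      also have "\<dots> \<le> (exp (- Bf \<xi> t) * F) * (2 * pi)" using t F0 by (intro mult_left_mono) auto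
      finally show ?thesis by (simp add: Jp norm_minus_commute)
    qed
    then have "exp (Bf \<xi> t) * norm (- J t0 + 1 * J t) \<le> exp (Bf \<xi> t) * ((exp (- Bf \<xi> t) * F) * (2 * pi))"
      by (intro mult_left_mono) auto
    also have "\<dots> = 2 * pi * F" by (simp add: exp_minus)
    finally show ?thesis unfolding u_def norm_mult norm_exp_Q .
  qed
  have "norm (u t) \<le> 2 * pi * F" for t
  proof -
    obtain s k where "s \<in> {t0..<t0 + 2 * pi}" "t = s + 2 * pi * of_int k" using real_representative by blast
    then show ?thesis using bd[of s] periodic_real_int[OF up, of s k] by simp
  qed
  then show ?thesis using up deriv by blast
qed

text \<open>Suppose that both arcs from the maximum t0 to t dip below the level of t. The straight
  line through cis t0 and cis t separates the two dips, so a connected sublevel set would have to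
  meet it. It meets the circle in these two points alone, and there \<open>Bf\<close> is not below
  its value at t.\<close>

lemma superlevel_arcs:
  assumes per: "Bf \<xi> (2 * pi) = 0" and conn: "\<And>r. connected (sublevel b \<xi> r)"
    and max: "\<And>t. Bf \<xi> t \<le> Bf \<xi> t0" and t: "t \<in> {t0..t0 + 2 * pi}"
  shows "(\<forall>s\<in>{t0..t}. Bf \<xi> t \<le> Bf \<xi> s) \<or> (\<forall>s\<in>{t..t0 + 2 * pi}. Bf \<xi> t \<le> Bf \<xi> s)"
proof (rule ccontr)
  assume "\<not> ?thesis"
  then obtain s1 s2 where s: "s1 \<in> {t0..t}" "Bf \<xi> s1 < Bf \<xi> t" "s2 \<in> {t..t0 + 2 * pi}" "Bf \<xi> s2 < Bf \<xi> t"
    by (auto simp: not_le)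
  have pB: "periodic_fn (Bf \<xi>)" using Bf_period per by (simp add: periodic_real)
  \<comment> \<open>With m the midpoint and h half the length of the arc, the chord is the set where
    the inner product with cis m equals cos h.\<close>
  define m where "m = (t0 + t) / 2"
  define h where "h = (t - t0) / 2"
  have mh: "m - h = t0" "m + h = t" by (auto simp: m_def h_def field_simps)
  have "s1 \<noteq> t0" using s(2) max[of t] by auto
  moreover have "s2 \<noteq> t0 + 2 * pi" using s(4) max[of t] pB by (auto simp: periodic_real)
  moreover have "s1 \<noteq> t" "s2 \<noteq> t" using s by auto
  ultimately have st: "t0 < s1" "s1 < t" "t < s2" "s2 < t0 + 2 * pi" using s by auto
  have h: "0 < h" "h < pi" using st by (auto simp: h_def)
  have c1: "cos h < cos (s1 - m)"
  proof -
    have "cos h < cos \<bar>s1 - m\<bar>" using st h mh by (intro cos_monotone_0_pi) auto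
    then show ?thesis by simp
  qed
  have c2: "cos (s2 - m) < cos h"
  proof (cases "s2 - m \<le> pi")
    case True
    then show ?thesis using st h mh by (intro cos_monotone_0_pi) auto
  next
    case False
    have "cos (2 * pi - (s2 - m)) < cos h" using False st h mh by (intro cos_monotone_0_pi) auto
    then show ?thesis by (simp add: cos_diff)
  qed
  have inn: "cis m \<bullet> cis s = cos (s - m)" for s
    by (simp add: inner_complex_def cos_diff mult.commute)
  have S: "sublevel b \<xi> (Bf \<xi> t) = {cis s | s. Bf \<xi> s < Bf \<xi> t}" by (rule sublevel_eq[OF per])
  have "\<exists>z\<in>sublevel b \<xi> (Bf \<xi> t). cis m \<bullet> z = cos h"
  proof (rule connected_ivt_hyperplane[OF conn])
    show "cis s2 \<in> sublevel b \<xi> (Bf \<xi> t)" "cis s1 \<in> sublevel b \<xi> (Bf \<xi> t)" using s S by auto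
    show "cis m \<bullet> cis s2 \<le> cos h" "cos h \<le> cis m \<bullet> cis s1" using c1 c2 inn by auto
  qed
  then obtain s where "Bf \<xi> s < Bf \<xi> t" "cos (s - m) = cos h" unfolding S using inn by auto
  then obtain n :: int where "s - m = h + 2 * of_int n * pi \<or> s - m = - h + 2 * of_int n * pi"
    unfolding cos_eq by (auto elim: Ints_cases)
  then have "s = t + 2 * pi * of_int n \<or> s = t0 + 2 * pi * of_int n"
    unfolding mh[symmetric] by (auto simp: algebra_simps)
  then show False
    using \<open>Bf \<xi> s < Bf \<xi> t\<close> periodic_real_int[OF pB] max[of t] by auto
qed

section \<open>Sufficient conditions for solvability\<close>

lemma annihilator_coef:
  assumes "f \<in> annihilator_ker \<omega> a b"
  shows "\<exists>lam>0. \<exists>\<delta>>0. \<exists>A\<ge>0. \<forall>\<xi>. coef_bound lam A \<delta> \<xi> (coef \<xi> f) \<and> continuous_on UNIV (coef \<xi> f) \<and> periodic_fn (coef \<xi> f) \<and>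
     (\<forall>t. norm (coef \<xi> f t) \<le> A * M lam 0 * exp (- \<delta> * \<omega> (nrm \<xi>))) \<and>
     (exp (Q \<xi> (2 * pi)) = 1 \<longrightarrow> integral {0..2*pi} (\<lambda>t. exp (Q \<xi> t) * coef \<xi> f t) = 0)"
proof -
  have fu: "f \<in> ultra_space \<omega>" using assms by (simp add: annihilator_ker_def)
  obtain lam A \<delta> where lam: "lam > 0" "\<delta> > 0" and cb: "\<And>\<xi>. coef_bound lam A \<delta> \<xi> (coef \<xi> f)"
    using coef_decay[OF fu] by blast
  have "norm (coef \<xi> f t) \<le> A * M lam 0 * exp (- \<delta> * \<omega> (nrm \<xi>))" for \<xi> t
    using cb[of \<xi>] unfolding coef_bound_def by (metis nderiv_0)
  moreover have "exp (Q \<xi> (2 * pi)) = 1 \<longrightarrow> integral {0..2*pi} (\<lambda>t. exp (Q \<xi> t) * coef \<xi> f t) = 0" for \<xi>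
    using compatibility[OF assms E_deriv] by simp
  moreover have "continuous_on UNIV (coef \<xi> f)" "periodic_fn (coef \<xi> f)" for \<xi>
    using cb[of \<xi>] smooth_continuous by (auto simp: coef_bound_def)
  ultimately show ?thesis using lam cb coef_bound_nonneg[OF cb] by blast
qed

lemma solvable_from_solutions:
  assumes "\<And>f lam \<delta> A. f \<in> annihilator_ker \<omega> a b \<Longrightarrow> \<delta> > 0 \<Longrightarrow> A \<ge> 0 \<Longrightarrow>
     (\<And>\<xi>. continuous_on UNIV (coef \<xi> f)) \<Longrightarrow> (\<And>\<xi>. periodic_fn (coef \<xi> f)) \<Longrightarrow>
     (\<And>\<xi> t. norm (coef \<xi> f t) \<le> A * exp (- \<delta> * \<omega> (nrm \<xi>))) \<Longrightarrow>
     (\<And>\<xi>. exp (Q \<xi> (2 * pi)) = 1 \<Longrightarrow> integral {0..2*pi} (\<lambda>t. exp (Q \<xi> t) * coef \<xi> f t) = 0) \<Longrightarrow>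
     \<exists>\<delta>'>0. \<exists>A'. \<forall>\<xi>. \<exists>u. periodic_fn u \<and> (\<forall>t. (u has_vector_derivative coef \<xi> f t - q \<xi> t * u t) (at t)) \<and>
      (\<forall>t. norm (u t) \<le> A' * exp (- \<delta>' * \<omega> (nrm \<xi>)))"
  shows "globally_solvable \<omega> a b"
proof (rule solvableI)
  fix f assume f: "f \<in> annihilator_ker \<omega> a b"
  obtain lam \<delta> A where l: "lam > 0" "\<delta> > 0" "A \<ge> 0" and
    p: "\<And>\<xi>. coef_bound lam A \<delta> \<xi> (coef \<xi> f)" "\<And>\<xi>. continuous_on UNIV (coef \<xi> f)" "\<And>\<xi>. periodic_fn (coef \<xi> f)"
     "\<And>\<xi> t. norm (coef \<xi> f t) \<le> (A * M lam 0) * exp (- \<delta> * \<omega> (nrm \<xi>))"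
     "\<And>\<xi>. exp (Q \<xi> (2 * pi)) = 1 \<Longrightarrow> integral {0..2*pi} (\<lambda>t. exp (Q \<xi> t) * coef \<xi> f t) = 0"
    using annihilator_coef[OF f] by blast
  have "A * M lam 0 \<ge> 0" using l by simp
  from assms[OF f l(2) this p(2-5)] obtain \<delta>' A' where d: "\<delta>' > 0" and
    "\<forall>\<xi>. \<exists>u. periodic_fn u \<and> (\<forall>t. (u has_vector_derivative coef \<xi> f t - q \<xi> t * u t) (at t)) \<and>
      (\<forall>t. norm (u t) \<le> A' * exp (- \<delta>' * \<omega> (nrm \<xi>)))"
    by blast
  then obtain u where u: "\<And>\<xi>. periodic_fn (u \<xi>)" "\<And>\<xi> t. (u \<xi> has_vector_derivative coef \<xi> f t - q \<xi> t * u \<xi> t) (at t)"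
      "\<And>\<xi> t. norm (u \<xi> t) \<le> A' * exp (- \<delta>' * \<omega> (nrm \<xi>))"
    by metis
  \<comment> \<open>Data and solution are brought under one common pair of constants, as
    \<open>regularity\<close> requires.\<close>
  define d where "d = min \<delta> \<delta>'"
  define B where "B = max A A'"
  have dp: "d > 0" "B \<ge> 0" using l d by (auto simp: d_def B_def)
  have ed: "exp (- \<delta> * \<omega> (nrm \<xi>)) \<le> exp (- d * \<omega> (nrm \<xi>))" "exp (- \<delta>' * \<omega> (nrm \<xi>)) \<le> exp (- d * \<omega> (nrm \<xi>))" for \<xi> :: "'n \<Rightarrow> int"
    using omega_nonneg[of "nrm \<xi>"] by (auto simp: d_def intro: mult_right_mono)
  have cb: "coef_bound lam B d \<xi> (coef \<xi> f)" for \<xi>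
    unfolding coef_bound_def
  proof (intro conjI allI)
    show "smooth_fn (coef \<xi> f)" "periodic_fn (coef \<xi> f)" using p(1)[of \<xi>] by (auto simp: coef_bound_def)
    fix k t
    have "norm (nderiv k (coef \<xi> f) t) \<le> A * M lam k * exp (- \<delta> * \<omega> (nrm \<xi>))" using p(1)[of \<xi>] by (auto simp: coef_bound_def)
    also have "\<dots> \<le> B * M lam k * exp (- d * \<omega> (nrm \<xi>))"
      using ed l dp by (intro mult_mono mult_right_mono) (auto simp: B_def)
    finally show "norm (nderiv k (coef \<xi> f) t) \<le> B * M lam k * exp (- d * \<omega> (nrm \<xi>))" .
  qed
  have bu: "norm (u \<xi> t) \<le> B * exp (- d * \<omega> (nrm \<xi>))" for \<xi> t
  proof -
    have "norm (u \<xi> t) \<le> A' * exp (- \<delta>' * \<omega> (nrm \<xi>))" by (rule u)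
    also have "\<dots> \<le> B * exp (- \<delta>' * \<omega> (nrm \<xi>))" by (intro mult_right_mono) (auto simp: B_def)
    also have "\<dots> \<le> B * exp (- d * \<omega> (nrm \<xi>))" using ed dp by (intro mult_left_mono) auto
    finally show ?thesis .
  qed
  from regularity[OF l(1) dp] obtain lam' A'' where r: "lam' > 0"
    "\<And>\<xi> u g. coef_bound lam B d \<xi> g \<Longrightarrow> periodic_fn u \<Longrightarrow>
    (\<forall>t. (u has_vector_derivative g t - q \<xi> t * u t) (at t)) \<Longrightarrow>
    (\<forall>t. norm (u t) \<le> B * exp (- d * \<omega> (nrm \<xi>))) \<Longrightarrow> coef_bound lam' A'' (d/2) \<xi> u \<and> mode_op \<xi> u = g" by blast
  have "coef_bound lam' A'' (d/2) \<xi> (u \<xi>) \<and> mode_op \<xi> (u \<xi>) = coef \<xi> f" for \<xi>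
    using cb u bu by (intro r(2)) auto
  then show "\<exists>lam A \<delta> u. lam > 0 \<and> \<delta> > 0 \<and> (\<forall>\<xi>. coef_bound lam A \<delta> \<xi> (u \<xi>) \<and> mode_op \<xi> (u \<xi>) = coef \<xi> f)"
    using r(1) dp(1) by (intro exI[of _ lam'] exI[of _ A''] exI[of _ "d/2"] exI[of _ u]) auto
qed

text \<open>With integer means z0 is an integer for every frequency, so all modes are resonant and
  no small divisor occurs; the bound of \<open>solve_resonant\<close> keeps the full decay of the
  data.\<close>

theorem solvable_if_connected:
  assumes b0: "\<And>j. mean (b j) = 0" and a0: "\<And>j. mean (a j) \<in> \<int>"
    and conn: "\<And>r \<xi>. connected (sublevel b \<xi> r)"
  shows "globally_solvable \<omega> a b"
proof (rule solvable_from_solutions)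
  fix f lam \<delta> A
  assume f: "\<delta> > (0::real)" "\<And>\<xi>. continuous_on UNIV (coef \<xi> f)" "\<And>\<xi>. periodic_fn (coef \<xi> f)"
    "\<And>\<xi> t. norm (coef \<xi> f t) \<le> A * exp (- \<delta> * \<omega> (nrm \<xi>))"
    "\<And>\<xi>. exp (Q \<xi> (2 * pi)) = 1 \<Longrightarrow> integral {0..2*pi} (\<lambda>t. exp (Q \<xi> t) * coef \<xi> f t) = 0"
  have per: "Bf \<xi> (2 * pi) = 0" for \<xi> using b0 by (simp add: Bf_2pi)
  have res: "exp (Q \<xi> (2 * pi)) = 1" for \<xi>
  proof -
    have "\<forall>j. \<exists>k. mean (a j) = real_of_int k" using a0 by (auto elim: Ints_cases)
    then obtain k where k: "\<And>j. mean (a j) = real_of_int (k j)" by metis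
    have "Complex (real_of_int (k j)) 0 = of_int (k j)" for j by (simp add: complex_eq_iff)
    then have "z0 \<xi> = of_int (\<Sum>j\<in>UNIV. \<xi> j * k j)" using b0 k by (simp add: z0_def)
    then have "Q \<xi> (2 * pi) = 0 + (of_int (2 * (\<Sum>j\<in>UNIV. \<xi> j * k j)) * pi) * \<i>"
      unfolding Q_2pi by (simp add: mult_ac)
    then have "exp (Q \<xi> (2 * pi)) = exp 0" unfolding exp_eq by blast
    then show ?thesis by simp
  qed
  have "\<exists>u. periodic_fn u \<and> (\<forall>t. (u has_vector_derivative coef \<xi> f t - q \<xi> t * u t) (at t)) \<and>
      (\<forall>t. norm (u t) \<le> 2 * pi * (A * exp (- \<delta> * \<omega> (nrm \<xi>))))" for \<xi>
  proof -
    have pB: "periodic_fn (Bf \<xi>)" using Bf_period per by (simp add: periodic_real)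
    have "continuous_on {0..2*pi} (Bf \<xi>)"
      by (rule continuous_on_vector_derivative[OF has_vector_derivative_at_within[OF Bf_deriv]])
    then obtain t0 where t0: "\<forall>t\<in>{0..2*pi}. Bf \<xi> t \<le> Bf \<xi> t0"
      using continuous_attains_sup[of "{0..2*pi}" "Bf \<xi>"] by auto
    have max: "Bf \<xi> t \<le> Bf \<xi> t0" for t
    proof -
      obtain s k where "s \<in> {0..<0 + 2 * pi}" "t = s + 2 * pi * of_int k" using real_representative by blast
      then show ?thesis using t0 periodic_real_int[OF pB, of s k] by simp
    qed
    show ?thesis
      by (rule solve_resonant[where ?t0.0 = t0, OF f(2,3,4) res f(5)[OF res] superlevel_arcs[OF per conn max]])
  qed
  then show "\<exists>\<delta>'>0. \<exists>A'. \<forall>\<xi>. \<exists>u. periodic_fn u \<and> (\<forall>t. (u has_vector_derivative coef \<xi> f t - q \<xi> t * u t) (at t)) \<and>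
      (\<forall>t. norm (u t) \<le> A' * exp (- \<delta>' * \<omega> (nrm \<xi>)))"
    unfolding mult.assoc[symmetric] using f(1) by blast
qed

lemma norm_z0_le: "\<exists>m\<ge>0. \<forall>\<xi>. norm (z0 \<xi>) \<le> m * nrm \<xi>"
proof -
  define m where "m = (\<Sum>j\<in>UNIV. norm (Complex (mean (a j)) (mean (b j))))"
  have m0: "m \<ge> 0" unfolding m_def by (intro sum_nonneg) auto
  have z0m: "norm (z0 \<xi>) \<le> m * nrm \<xi>" for \<xi>
  proof -
    have "norm (z0 \<xi>) \<le> (\<Sum>j\<in>UNIV. \<bar>real_of_int (\<xi> j)\<bar> * norm (Complex (mean (a j)) (mean (b j))))"
      unfolding z0_def by (rule order_trans[OF norm_sum]) (simp add: norm_mult)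
    also have "\<dots> \<le> (\<Sum>j\<in>UNIV. nrm \<xi> * norm (Complex (mean (a j)) (mean (b j))))"
      by (intro sum_mono mult_right_mono abs_le_nrm) auto
    finally show ?thesis by (simp add: m_def sum_distrib_left mult.commute)
  qed
  then show ?thesis using m0 by blast
qed

text \<open>|1 - exp W| is compared with the distance of z0 to the integers. If an integer \<tau>
  satisfies |\<tau> + z0| < 1, then |\<tau>| \<le> 1 + m |\<xi>|, so (\<tau>, \<xi>) has norm at
  most 1 + P |\<xi>|, and the Diophantine condition with \<epsilon>/P yields the rate
  \<epsilon>.\<close>

lemma small_divisors:
  assumes edc: "EDC2 \<omega> (\<lambda>j. mean (a j)) (\<lambda>j. mean (b j))" and "\<epsilon> > 0"
  shows "\<exists>C>0. \<forall>\<xi> W. (W = Q \<xi> (2 * pi) \<or> W = - Q \<xi> (2 * pi)) \<longrightarrow> exp (Q \<xi> (2 * pi)) \<noteq> 1 \<longrightarrow>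
     norm (1 - exp W) \<ge> C * exp (- \<epsilon> * \<omega> (nrm \<xi>))"
proof -
  obtain m where m0: "m \<ge> 0" and z0m: "\<And>\<xi>. norm (z0 \<xi>) \<le> m * nrm \<xi>" using norm_z0_le by blast
  define P where "P = nat \<lceil>m + 1\<rceil>"
  have P: "m + 1 \<le> real P" "1 \<le> P" using m0 unfolding P_def by linarith+
  define e where "e = \<epsilon> / real P"
  have e: "e > 0" using assms(2) P by (simp add: e_def)
  obtain C where C: "C > 0" and lower: "\<And>(\<tau>::int) \<xi>. of_int \<tau> + z0 \<xi> \<noteq> 0 \<Longrightarrow>
      norm (of_int \<tau> + z0 \<xi>) \<ge> C * exp (- e * \<omega> (sqrt (real_of_int (\<tau>\<^sup>2) + (\<Sum>j\<in>UNIV. real_of_int ((\<xi> j)\<^sup>2)))))"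
    using edc[unfolded EDC2_def Let_def, rule_format, OF e] unfolding z0_def by blast
  \<comment> \<open>The value 1/2 serves the case of distance at least 1; exp(- e \<omega>(1)) pays
    for the summand 1 in 1 + P |\<xi>|.\<close>
  define D where "D = min (1/2) (C * exp (- e * \<omega> 1))"
  have D: "D > 0" "D \<le> 1/2" "D \<le> C * exp (- e * \<omega> 1)" using C by (auto simp: D_def)
  have "norm (1 - exp W) \<ge> D * exp (- \<epsilon> * \<omega> (nrm \<xi>))"
    if W: "W = Q \<xi> (2 * pi) \<or> W = - Q \<xi> (2 * pi)" and ne: "exp (Q \<xi> (2 * pi)) \<noteq> 1" for \<xi> W
  proof -
    obtain n :: int where n: "norm (1 - exp W) \<ge> min 1 (norm (W - 2 * pi * of_int n * \<i>)) / 2"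
      using norm_one_minus_exp by blast
    have small: "exp (- \<epsilon> * \<omega> (nrm \<xi>)) \<le> 1" using assms(2) omega_nonneg[of "nrm \<xi>"] by simp
    \<comment> \<open>The sign reduces both choices of W to the same expression \<tau> + z0.\<close>
    define \<tau> where "\<tau> = (if W = Q \<xi> (2 * pi) then - n else n)"
    have Wn: "norm (W - 2 * pi * of_int n * \<i>) = 2 * pi * norm (of_int \<tau> + z0 \<xi>)"
    proof (cases "W = Q \<xi> (2 * pi)")
      case True
      have "W - 2 * pi * of_int n * \<i> = 2 * pi * \<i> * (of_int \<tau> + z0 \<xi>)"
        using True unfolding \<tau>_def Q_2pi by (simp add: algebra_simps)
      then show ?thesis by (simp add: norm_mult)
    next
      case False
      have "W - 2 * pi * of_int n * \<i> = - (2 * pi * \<i> * (of_int \<tau> + z0 \<xi>))"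
        using False W unfolding \<tau>_def Q_2pi by (auto simp: algebra_simps)
      then show ?thesis by (simp add: norm_mult)
    qed
    have nz: "of_int \<tau> + z0 \<xi> \<noteq> 0"
    proof
      assume "of_int \<tau> + z0 \<xi> = 0"
      then have "z0 \<xi> = of_int (- \<tau>)" by (metis add.commute add_eq_0_iff of_int_minus)
      then have "Q \<xi> (2 * pi) = 0 + (of_int (2 * (- \<tau>)) * pi) * \<i>" unfolding Q_2pi by (simp add: mult_ac)
      then have "exp (Q \<xi> (2 * pi)) = exp 0" unfolding exp_eq by blast
      then show False using ne by simp
    qed
    show ?thesis
    proof (cases "norm (of_int \<tau> + z0 \<xi>) \<ge> 1")
      case True
      have "2 * pi * norm (of_int \<tau> + z0 \<xi>) \<ge> 1 * 1" using True pi_gt3 by (intro mult_mono) auto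
      then have "norm (1 - exp W) \<ge> 1/2" using n Wn by simp
      moreover have "D * exp (- \<epsilon> * \<omega> (nrm \<xi>)) \<le> (1/2) * 1" using D small by (intro mult_mono) auto
      ultimately show ?thesis by linarith
    next
      case False
      let ?s = "sqrt (real_of_int (\<tau>\<^sup>2) + (\<Sum>j\<in>UNIV. real_of_int ((\<xi> j)\<^sup>2)))"
      have "\<bar>real_of_int \<tau>\<bar> = norm (of_int \<tau> :: complex)" by simp
      also have "\<dots> = norm ((of_int \<tau> + z0 \<xi>) - z0 \<xi>)" by simp
      also have "\<dots> \<le> norm (of_int \<tau> + z0 \<xi>) + norm (z0 \<xi>)" by (rule norm_triangle_ineq4)
      also have "\<dots> \<le> 1 + m * nrm \<xi>" using False z0m by (intro add_mono) auto
      finally have \<tau>b: "\<bar>real_of_int \<tau>\<bar> \<le> 1 + m * nrm \<xi>" .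
      have "?s \<le> sqrt ((\<bar>real_of_int \<tau>\<bar> + nrm \<xi>)\<^sup>2)"
      proof (rule real_sqrt_le_mono)
        have "(\<Sum>j\<in>UNIV. real_of_int ((\<xi> j)\<^sup>2)) \<le> (\<Sum>j\<in>UNIV. \<bar>real_of_int (\<xi> j)\<bar> * nrm \<xi>)"
        proof (rule sum_mono)
          fix j
          have "real_of_int ((\<xi> j)\<^sup>2) = \<bar>real_of_int (\<xi> j)\<bar> * \<bar>real_of_int (\<xi> j)\<bar>"
            by (simp add: power2_eq_square)
          also have "\<dots> \<le> \<bar>real_of_int (\<xi> j)\<bar> * nrm \<xi>" by (intro mult_left_mono abs_le_nrm) auto
          finally show "real_of_int ((\<xi> j)\<^sup>2) \<le> \<bar>real_of_int (\<xi> j)\<bar> * nrm \<xi>" .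
        qed
        also have "\<dots> = nrm \<xi> * nrm \<xi>" by (subst (2) nrm_def) (simp add: sum_distrib_right)
        finally have 1: "(\<Sum>j\<in>UNIV. real_of_int ((\<xi> j)\<^sup>2)) \<le> nrm \<xi> * nrm \<xi>" .
        have "(\<bar>real_of_int \<tau>\<bar> + nrm \<xi>)\<^sup>2 = real_of_int (\<tau>\<^sup>2) + nrm \<xi> * nrm \<xi> + 2 * (\<bar>real_of_int \<tau>\<bar> * nrm \<xi>)"
          by (simp add: power2_eq_square algebra_simps)
        moreover have "0 \<le> \<bar>real_of_int \<tau>\<bar> * nrm \<xi>" by simp
        ultimately show "real_of_int (\<tau>\<^sup>2) + (\<Sum>j\<in>UNIV. real_of_int ((\<xi> j)\<^sup>2)) \<le> (\<bar>real_of_int \<tau>\<bar> + nrm \<xi>)\<^sup>2"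
          using 1 by linarith
      qed
      also have "\<dots> = \<bar>real_of_int \<tau>\<bar> + nrm \<xi>" by (simp add: abs_of_nonneg)
      also have "\<dots> \<le> 1 + (m + 1) * nrm \<xi>" using \<tau>b by (simp add: algebra_simps)
      also have "\<dots> \<le> 1 + real P * nrm \<xi>" using P by (intro add_left_mono mult_right_mono) auto
      finally have "?s \<le> 1 + real P * nrm \<xi>" .
      moreover have "0 \<le> ?s" by (intro real_sqrt_ge_zero add_nonneg_nonneg sum_nonneg) auto
      ultimately have "\<omega> ?s \<le> \<omega> (1 + real P * nrm \<xi>)" by (intro omega_mono)
      also have "\<dots> \<le> \<omega> 1 + \<omega> (real P * nrm \<xi>)" by (intro omega_add) auto
      also have "\<dots> \<le> \<omega> 1 + real P * \<omega> (nrm \<xi>)" using omega_mult_nat[OF nrm_nonneg P(2)] by simp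
      finally have "e * \<omega> ?s \<le> e * (\<omega> 1 + real P * \<omega> (nrm \<xi>))" using e by (intro mult_left_mono) auto
      also have "\<dots> = e * \<omega> 1 + \<epsilon> * \<omega> (nrm \<xi>)" using P by (simp add: e_def distrib_left)
      finally have "exp (- e * \<omega> 1) * exp (- \<epsilon> * \<omega> (nrm \<xi>)) \<le> exp (- e * \<omega> ?s)" by (simp flip: exp_add)
      then have "C * (exp (- e * \<omega> 1) * exp (- \<epsilon> * \<omega> (nrm \<xi>))) \<le> norm (of_int \<tau> + z0 \<xi>)"
        using lower[OF nz] C mult_left_mono[of "exp (- e * \<omega> 1) * exp (- \<epsilon> * \<omega> (nrm \<xi>))" "exp (- e * \<omega> ?s)" C] by linarith
      moreover have "D * exp (- \<epsilon> * \<omega> (nrm \<xi>)) \<le> C * exp (- e * \<omega> 1) * exp (- \<epsilon> * \<omega> (nrm \<xi>))"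
        using D by (intro mult_right_mono) auto
      ultimately have 1: "D * exp (- \<epsilon> * \<omega> (nrm \<xi>)) \<le> norm (of_int \<tau> + z0 \<xi>)"
        by (simp only: mult.assoc)
      have 2: "1 * norm (of_int \<tau> + z0 \<xi>) \<le> pi * norm (of_int \<tau> + z0 \<xi>)"
        using pi_gt3 by (intro mult_right_mono) auto
      have 3: "D * exp (- \<epsilon> * \<omega> (nrm \<xi>)) \<le> (1/2) * 1" using D small by (intro mult_mono) auto
      have "D * exp (- \<epsilon> * \<omega> (nrm \<xi>)) \<le> min 1 (2 * pi * norm (of_int \<tau> + z0 \<xi>)) / 2"
        using 1 2 3 by (simp only: min_def mult.assoc split: if_split) linarith
      then show ?thesis by (rule order_trans[OF _ n[unfolded Wn]])
    qed
  qed
  then show ?thesis using D(1) by blast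
qed

text \<open>Half of the decay of the data pays for the small divisor and the other half is left for
  the solution; the sign condition supplies the bounded kernel in every nonresonant mode.\<close>

theorem solvable_if_EDC2:
  assumes edc: "EDC2 \<omega> (\<lambda>j. mean (a j)) (\<lambda>j. mean (b j))"
    and sgn: "\<And>\<xi>. (\<forall>t. \<beta> \<xi> t \<ge> 0) \<or> (\<forall>t. \<beta> \<xi> t \<le> 0)"
  shows "globally_solvable \<omega> a b"
proof (rule solvable_from_solutions)
  fix f lam \<delta> A
  assume f: "\<delta> > (0::real)" "A \<ge> 0" "\<And>\<xi>. continuous_on UNIV (coef \<xi> f)" "\<And>\<xi>. periodic_fn (coef \<xi> f)"
    "\<And>\<xi> t. norm (coef \<xi> f t) \<le> A * exp (- \<delta> * \<omega> (nrm \<xi>))"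
    "\<And>\<xi>. exp (Q \<xi> (2 * pi)) = 1 \<Longrightarrow> integral {0..2*pi} (\<lambda>t. exp (Q \<xi> t) * coef \<xi> f t) = 0"
  have "\<delta>/2 > 0" using f(1) by simp
  from small_divisors[OF edc this] obtain C where C: "C > 0"
    "\<And>\<xi> W. W = Q \<xi> (2 * pi) \<or> W = - Q \<xi> (2 * pi) \<Longrightarrow> exp (Q \<xi> (2 * pi)) \<noteq> 1 \<Longrightarrow>
       norm (1 - exp W) \<ge> C * exp (- (\<delta>/2) * \<omega> (nrm \<xi>))" by blast
  \<comment> \<open>The two entries of the maximum belong to the resonant and to the nonresonant
    modes.\<close>
  define A' where "A' = 2 * pi * A * max 1 (1 / C)"
  have "\<exists>u. periodic_fn u \<and> (\<forall>t. (u has_vector_derivative coef \<xi> f t - q \<xi> t * u t) (at t)) \<and>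
      (\<forall>t. norm (u t) \<le> A' * exp (- (\<delta>/2) * \<omega> (nrm \<xi>)))" for \<xi>
  proof (cases "exp (Q \<xi> (2 * pi)) = 1")
    case True
    have "norm (exp (Q \<xi> (2 * pi))) = 1" using True by simp
    then have "Bf \<xi> (2 * pi) = 0" unfolding norm_exp_Q by simp
    then have pB: "periodic_fn (Bf \<xi>)" using Bf_period by (simp add: periodic_real)
    have inc: "Bf \<xi> s \<le> Bf \<xi> t" if "s \<le> t" "\<forall>t. \<beta> \<xi> t \<ge> 0" for s t
      using DERIV_nonneg_imp_nondecreasing[of s t "Bf \<xi>"] that Bf_deriv
      by (auto simp: has_real_derivative_iff_has_vector_derivative)
    have dec: "Bf \<xi> t \<le> Bf \<xi> s" if "s \<le> t" "\<forall>t. \<beta> \<xi> t \<le> 0" for s t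
      using DERIV_nonpos_imp_nonincreasing[of s t "Bf \<xi>"] that Bf_deriv
      by (auto simp: has_real_derivative_iff_has_vector_derivative)
    \<comment> \<open>A monotone \<open>Bf\<close> satisfies one of the two alternatives at every t,
      so 0 can serve as base point.\<close>
    have "(\<forall>s\<in>{0..t}. Bf \<xi> t \<le> Bf \<xi> s) \<or> (\<forall>s\<in>{t..0 + 2 * pi}. Bf \<xi> t \<le> Bf \<xi> s)"
      if "t \<in> {0..0 + 2 * pi}" for t
      using sgn[of \<xi>] inc dec by auto
    from solve_resonant[where ?t0.0 = 0, OF f(3,4,5) True f(6)[OF True] this]
    obtain u where u: "periodic_fn u" "\<And>t. (u has_vector_derivative coef \<xi> f t - q \<xi> t * u t) (at t)"
      "\<And>t. norm (u t) \<le> 2 * pi * (A * exp (- \<delta> * \<omega> (nrm \<xi>)))" by blast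
    have "2 * pi * (A * exp (- \<delta> * \<omega> (nrm \<xi>))) \<le> A' * exp (- (\<delta>/2) * \<omega> (nrm \<xi>))"
    proof -
      have "exp (- \<delta> * \<omega> (nrm \<xi>)) \<le> exp (- (\<delta>/2) * \<omega> (nrm \<xi>))" using f(1) omega_nonneg[of "nrm \<xi>"] by simp
      moreover have "2 * pi * A * 1 \<le> A'" unfolding A'_def using f(2) by (intro mult_left_mono) auto
      ultimately show ?thesis using f(2) by (simp only: mult.assoc[symmetric]) (intro mult_mono, auto simp: A'_def)
    qed
    then show ?thesis using u order_trans by blast
  next
    case False
    obtain W where W: "(\<forall>t. \<beta> \<xi> t \<ge> 0) \<and> W = Q \<xi> (2 * pi) \<or> (\<forall>t. \<beta> \<xi> t \<le> 0) \<and> W = - Q \<xi> (2 * pi)"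
      using sgn[of \<xi>] by blast
    then have lo: "norm (1 - exp W) \<ge> C * exp (- (\<delta>/2) * \<omega> (nrm \<xi>))" using C(2)[of W \<xi>] False by blast
    from solve_nonresonant[OF f(3,4,5) False W]
    obtain u where u: "periodic_fn u" "\<And>t. (u has_vector_derivative coef \<xi> f t - q \<xi> t * u t) (at t)"
      "\<And>t. norm (u t) \<le> 2 * pi * (A * exp (- \<delta> * \<omega> (nrm \<xi>))) / norm (1 - exp W)" by blast
    have "2 * pi * (A * exp (- \<delta> * \<omega> (nrm \<xi>))) / norm (1 - exp W) \<le>
        2 * pi * (A * exp (- \<delta> * \<omega> (nrm \<xi>))) / (C * exp (- (\<delta>/2) * \<omega> (nrm \<xi>)))"
    proof (rule divide_left_mono[OF lo])
      have p: "0 < C * exp (- (\<delta>/2) * \<omega> (nrm \<xi>))" using C(1) by simp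
      show "0 < norm (1 - exp W) * (C * exp (- (\<delta>/2) * \<omega> (nrm \<xi>)))"
        by (rule mult_pos_pos[OF order_less_le_trans[OF p lo] p])
    qed (use f(2) in simp)
    also have "\<dots> = 2 * pi * A * (1 / C) * (exp (- \<delta> * \<omega> (nrm \<xi>)) / exp (- (\<delta>/2) * \<omega> (nrm \<xi>)))"
      by simp
    also have "exp (- \<delta> * \<omega> (nrm \<xi>)) / exp (- (\<delta>/2) * \<omega> (nrm \<xi>)) = exp (- (\<delta>/2) * \<omega> (nrm \<xi>))"
      by (simp flip: exp_diff)
    also have "2 * pi * A * (1 / C) * exp (- (\<delta>/2) * \<omega> (nrm \<xi>)) \<le> A' * exp (- (\<delta>/2) * \<omega> (nrm \<xi>))"
      unfolding A'_def using f(2) by (intro mult_right_mono mult_left_mono) auto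
    finally show ?thesis using u order_trans by blast
  qed
  then show "\<exists>\<delta>'>0. \<exists>A'. \<forall>\<xi>. \<exists>u. periodic_fn u \<and> (\<forall>t. (u has_vector_derivative coef \<xi> f t - q \<xi> t * u t) (at t)) \<and>
      (\<forall>t. norm (u t) \<le> A' * exp (- \<delta>' * \<omega> (nrm \<xi>)))"
    using f(1) by (intro exI[of _ "\<delta>/2"] exI[of _ A']) auto
qed

end

subsection \<open>Ultradifferentiable cutoff functions\<close>

text \<open>This is the mean of g over [x - d, x], that is, convolution with the normalised
  indicator function of [0, d].\<close>

definition avg :: "real \<Rightarrow> (real \<Rightarrow> real) \<Rightarrow> real \<Rightarrow> real" where
  "avg d g x = (prim g x - prim g (x - d)) / d"

lemma avg_diff_le:
  assumes "d > 0" "continuous_on UNIV g" "continuous_on UNIV h" "\<And>y. y \<in> {x - d..x} \<Longrightarrow> \<bar>g y - h y\<bar> \<le> e"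
  shows "\<bar>avg d g x - avg d h x\<bar> \<le> e"
proof -
  have "norm ((prim g x - prim h x) - (prim g (x - d) - prim h (x - d))) \<le> e * (x - (x - d))"
    using assms by (intro norm_increment_le[where f = "\<lambda>t. g t - h t"] has_vector_derivative_diff prim_has_vector_derivative) auto
  moreover have "avg d g x - avg d h x = ((prim g x - prim h x) - (prim g (x - d) - prim h (x - d))) / d"
    by (simp add: avg_def diff_divide_distrib)
  ultimately show ?thesis using assms(1) by (simp add: divide_le_eq)
qed

lemma avg_const: "d > 0 \<Longrightarrow> avg d (\<lambda>_. v) x = v"
proof -
  assume d: "d > 0"
  have "((\<lambda>t. v * t) has_vector_derivative v) (at t)" for t by (auto intro!: derivative_eq_intros)
  from prim_unique[OF continuous_on_const this, of x "x - d"]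
  have "prim (\<lambda>_. v) x - prim (\<lambda>_. v) (x - d) = v * d" by (simp add: algebra_simps)
  then show ?thesis using d by (simp add: avg_def)
qed

lemma avg_near:
  assumes "d > 0" "continuous_on UNIV g" "\<And>y. y \<in> {x - d..x} \<Longrightarrow> \<bar>g y - v\<bar> \<le> e"
  shows "\<bar>avg d g x - v\<bar> \<le> e"
  using avg_diff_le[OF assms(1,2) continuous_on_const, of x v e] assms avg_const by simp

lemma avg_has_vector_derivative:
  assumes "continuous_on UNIV g"
  shows "(avg d g has_vector_derivative (g x - g (x - d)) / d) (at x)"
proof -
  have "((\<lambda>x. x - d) has_vector_derivative 1) (at x)" by (auto intro!: derivative_eq_intros)
  from vector_diff_chain_at[OF this prim_has_vector_derivative[OF assms]]
  have "((\<lambda>x. prim g (x - d)) has_vector_derivative g (x - d)) (at x)" by (simp add: o_def)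
  then show ?thesis unfolding avg_def
    by (intro has_vector_derivative_divide has_vector_derivative_diff prim_has_vector_derivative assms)
qed

lemma avg_continuous: "continuous_on UNIV g \<Longrightarrow> continuous_on UNIV (avg d g)"
  by (rule continuous_on_vector_derivative[OF has_vector_derivative_at_within[OF avg_has_vector_derivative]])

lemma avg_periodic:
  assumes "continuous_on UNIV g" "\<And>x. g (x + 2 * pi) = g x" shows "avg d g (x + 2 * pi) = avg d g x"
  using prim_period[OF assms, of x] prim_period[OF assms, of "x - d"] by (simp add: avg_def algebra_simps)

text \<open>Mollification by successive averages over intervals of lengths \<open>d 0, d 1, \<dots>\<close> with summable
  lengths: the \<open>k\<close>-th derivative costs at most \<open>\<Prod>j<k. 2 / d j\<close>.\<close>
locale mollifier =
  fixes d :: "nat \<Rightarrow> real" and f0 :: "real \<Rightarrow> real" and K :: real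
  assumes d: "\<And>k. d k > 0" "summable d"
    and lip: "\<And>x y. \<bar>f0 x - f0 y\<bar> \<le> K * \<bar>x - y\<bar>"
    and per: "\<And>x. f0 (x + 2 * pi) = f0 x"
    and range: "\<And>x. 0 \<le> f0 x \<and> f0 x \<le> 1"
begin

text \<open>The average over \<open>d m\<close> is outermost, and increasing n inserts a new average
  next to f0. This nesting is what gives G m = avg (d m) (G (m + 1)) in the limit.\<close>

fun stage :: "nat \<Rightarrow> nat \<Rightarrow> real \<Rightarrow> real" where
  "stage m 0 = f0"
| "stage m (Suc n) = avg (d m) (stage (Suc m) n)"

lemma K_nonneg: "K \<ge> 0" using lip[of 1 0] by simp

lemma f0_cont: "continuous_on UNIV f0"
proof (rule lipschitz_on_continuous_on)
  show "K-lipschitz_on UNIV f0" using lip K_nonneg by (intro lipschitz_onI) (auto simp: dist_real_def)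
qed

lemma stage_cont: "continuous_on UNIV (stage m n)"
  by (induction n arbitrary: m) (auto intro: f0_cont avg_continuous)

lemma stage_periodic: "stage m n (x + 2 * pi) = stage m n x"
  by (induction n arbitrary: m x) (auto intro: per avg_periodic stage_cont)

text \<open>The value at x involves f0 only on a window reaching back by the total length of the
  averages. The case e = 0 preserves plateaus, and v = e = 1/2 gives the range [0, 1].\<close>

lemma stage_near:
  assumes "\<And>y. y \<in> {x - (\<Sum>k<n. d (m + k))..x} \<Longrightarrow> \<bar>f0 y - v\<bar> \<le> e"
  shows "\<bar>stage m n x - v\<bar> \<le> e"
  using assms
proof (induction n arbitrary: m x)
  case (Suc n)
  have "\<bar>stage (Suc m) n y - v\<bar> \<le> e" if y: "y \<in> {x - d m..x}" for y
  proof (rule Suc.IH)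
    fix z assume "z \<in> {y - (\<Sum>k<n. d (Suc m + k))..y}"
    moreover have "(\<Sum>k<Suc n. d (m + k)) = d m + (\<Sum>k<n. d (Suc m + k))"
      by (subst sum.lessThan_Suc_shift) simp
    ultimately show "\<bar>f0 z - v\<bar> \<le> e"
      using y by (intro Suc.prems) (simp del: sum.lessThan_Suc)
  qed
  then show ?case unfolding stage.simps by (rule avg_near[OF d(1) stage_cont])
qed simp

text \<open>The new innermost average moves a K-Lipschitz function by at most K times its length,
  and the outer averages do not enlarge uniform distances.\<close>

lemma stage_Suc_diff: "\<bar>stage m (Suc n) x - stage m n x\<bar> \<le> K * d (m + n)"
proof (induction n arbitrary: m x)
  case 0
  have "\<bar>avg (d m) f0 x - f0 x\<bar> \<le> K * d m"
  proof (rule avg_near[OF d(1) f0_cont])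
    fix y assume "y \<in> {x - d m..x}"
    then have "\<bar>y - x\<bar> \<le> d m" by auto
    then show "\<bar>f0 y - f0 x\<bar> \<le> K * d m"
      using lip[of y x] mult_left_mono[OF _ K_nonneg] order_trans by blast
  qed
  then show ?case by simp
next
  case (Suc n)
  have "\<bar>avg (d m) (stage (Suc m) (Suc n)) x - avg (d m) (stage (Suc m) n) x\<bar> \<le> K * d (Suc m + n)"
    by (rule avg_diff_le[OF d(1) stage_cont stage_cont Suc])
  then show ?case by simp
qed

definition G :: "nat \<Rightarrow> real \<Rightarrow> real" where
  "G m x = f0 x + (\<Sum>n. stage m (Suc n) x - stage m n x)"

lemma d_shift: "summable (\<lambda>n. K * d (m + n))"
  using d(2) by (intro summable_mult) (simp add: summable_iff_shift add.commute)

lemma G_uniform: "uniform_limit UNIV (stage m) (G m) sequentially"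
proof -
  have "uniform_limit UNIV (\<lambda>n x. \<Sum>i<n. stage m (Suc i) x - stage m i x) (\<lambda>x. \<Sum>i. stage m (Suc i) x - stage m i x) sequentially"
    by (rule Weierstrass_m_test[where M = "\<lambda>n. K * d (m + n)"])
       (simp_all only: real_norm_def stage_Suc_diff d_shift)
  from uniform_limit_add[OF uniform_limit_const this, of f0]
  moreover have "f0 x + (\<Sum>i<n. stage m (Suc i) x - stage m i x) = stage m n x" for n x
    using sum_lessThan_telescope[of "\<lambda>i. stage m i x" n] by (simp del: stage.simps(2))
  ultimately show ?thesis by (simp only: G_def[abs_def])
qed

lemma G_lim: "(\<lambda>n. stage m n x) \<longlonglongrightarrow> G m x"
  by (rule tendsto_uniform_limitI[OF G_uniform]) simp

lemma G_cont: "continuous_on UNIV (G m)"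
  by (rule uniform_limit_theorem[OF _ G_uniform]) (auto simp: stage_cont)

lemma G_avg: "G m x = avg (d m) (G (Suc m)) x"
proof (rule LIMSEQ_unique)
  show "(\<lambda>n. stage m (Suc n) x) \<longlonglongrightarrow> G m x" using G_lim by (rule LIMSEQ_Suc)
  show "(\<lambda>n. stage m (Suc n) x) \<longlonglongrightarrow> avg (d m) (G (Suc m)) x"
  proof (rule tendstoI)
    fix e :: real assume e: "e > 0"
    have "\<forall>\<^sub>F n in sequentially. \<forall>y\<in>UNIV. dist (stage (Suc m) n y) (G (Suc m) y) < e/2"
      using G_uniform[of "Suc m", unfolded uniform_limit_iff, rule_format, of "e/2"] e by simp
    then show "\<forall>\<^sub>F n in sequentially. dist (stage m (Suc n) x) (avg (d m) (G (Suc m)) x) < e"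
    proof eventually_elim
      case (elim n)
      then have "\<bar>avg (d m) (stage (Suc m) n) x - avg (d m) (G (Suc m)) x\<bar> \<le> e/2"
        by (intro avg_diff_le d stage_cont G_cont) (auto simp: dist_real_def intro: less_imp_le)
      then show ?case using e by (simp add: dist_real_def)
    qed
  qed
qed

lemma G_near:
  assumes "\<And>y. y \<in> {x - suminf d..x} \<Longrightarrow> \<bar>f0 y - v\<bar> \<le> e"
  shows "\<bar>G 0 x - v\<bar> \<le> e"
proof (rule tendsto_upperbound)
  show "(\<lambda>n. \<bar>stage 0 n x - v\<bar>) \<longlonglongrightarrow> \<bar>G 0 x - v\<bar>" by (intro tendsto_intros G_lim)
  have "(\<Sum>k<n. d (0 + k)) \<le> suminf d" for n
    using sum_le_suminf[OF d(2), of "{..<n}"] d(1) less_imp_le by auto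
  then have "\<bar>stage 0 n x - v\<bar> \<le> e" for n
    by (intro stage_near assms) (auto intro: order_trans[rotated] diff_left_mono)
  then show "\<forall>\<^sub>F n in sequentially. \<bar>stage 0 n x - v\<bar> \<le> e" by simp
qed simp

lemma G_range: "0 \<le> G m x \<and> G m x \<le> 1"
proof -
  have "\<bar>stage m n x - 1/2\<bar> \<le> 1/2" for n using range by (intro stage_near) (auto simp: abs_le_iff field_simps)
  then have "0 \<le> stage m n x" "stage m n x \<le> 1" for n by (auto simp: abs_le_iff field_simps)
  then show ?thesis using LIMSEQ_le_const[OF G_lim] LIMSEQ_le_const2[OF G_lim] by blast
qed

lemma G_periodic: "G m (x + 2 * pi) = G m x"
  using LIMSEQ_unique[OF G_lim[of m "x + 2 * pi"]] G_lim[of m x] by (simp add: stage_periodic)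

text \<open>An iterated difference quotient with steps d (k - 1), ..., d 0. Differentiating an
  average gives a difference quotient, so \<open>dq k (G k)\<close> is the k-th derivative of
  \<open>G 0\<close>.\<close>

fun dq :: "nat \<Rightarrow> (real \<Rightarrow> real) \<Rightarrow> real \<Rightarrow> real" where
  "dq 0 h = h"
| "dq (Suc k) h = dq k (\<lambda>x. (h x - h (x - d k)) / d k)"

lemma dq_deriv:
  assumes "\<And>x. (h has_vector_derivative h' x) (at x)"
  shows "(dq k h has_vector_derivative dq k h' x) (at x)"
  using assms
proof (induction k arbitrary: h h' x)
  case (Suc k)
  have "((\<lambda>x. (h x - h (x - d k)) / d k) has_vector_derivative (h' x - h' (x - d k)) / d k) (at x)" for x
  proof -
    have "((\<lambda>x. x - d k) has_vector_derivative 1) (at x)" by (auto intro!: derivative_eq_intros)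
    from vector_diff_chain_at[OF this Suc.prems]
    have "((\<lambda>x. h (x - d k)) has_vector_derivative h' (x - d k)) (at x)" by (simp add: o_def)
    then show ?thesis by (intro has_vector_derivative_divide has_vector_derivative_diff Suc.prems)
  qed
  then show ?case using Suc.IH by simp
qed simp

lemma dq_bound:
  assumes "\<And>x. \<bar>h x\<bar> \<le> B" shows "\<bar>dq k h x\<bar> \<le> (\<Prod>j<k. 2 / d j) * B"
  using assms
proof (induction k arbitrary: h B x)
  case (Suc k)
  have "\<bar>(h x - h (x - d k)) / d k\<bar> \<le> 2 / d k * B" for x
  proof -
    have "\<bar>h x - h (x - d k)\<bar> \<le> 2 * B" using Suc.prems[of x] Suc.prems[of "x - d k"] by linarith
    then show ?thesis using d(1)[of k] by (simp add: abs_divide divide_right_mono)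
  qed
  from Suc.IH[of "\<lambda>x. (h x - h (x - d k)) / d k", OF this] show ?case by (simp add: mult_ac)
qed simp

lemma G_smooth: "smooth_fn (G 0)" and nderiv_G_bound: "\<bar>nderiv k (G 0) x\<bar> \<le> (\<Prod>j<k. 2 / d j)"
proof -
  have Gd: "(G k has_vector_derivative (G (Suc k) x - G (Suc k) (x - d k)) / d k) (at x)" for k x
  proof -
    have "G k = avg (d k) (G (Suc k))" using G_avg by blast
    then show ?thesis using avg_has_vector_derivative[OF G_cont] by simp
  qed
  have "(dq k (G k) has_vector_derivative dq (Suc k) (G (Suc k)) x) (at x)" for k x
    using dq_deriv[OF Gd] by simp
  from nderiv_eqI[of "\<lambda>k. dq k (G k)", OF this]
  have nderiv: "smooth_fn (G 0)" "\<And>k. nderiv k (G 0) = dq k (G k)" by auto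
  show "smooth_fn (G 0)" by (rule nderiv(1))
  have "\<bar>G k x\<bar> \<le> 1" for x using G_range[of k x] by simp
  from dq_bound[of "G k", OF this] show "\<bar>nderiv k (G 0) x\<bar> \<le> (\<Prod>j<k. 2 / d j)" by (simp add: nderiv(2))
qed

end

section \<open>Averaging lengths adapted to the weight\<close>

context subadd_weight begin

lemma omega_unbounded: "\<exists>r\<ge>1. \<omega> r \<ge> X"
proof -
  obtain C where C: "\<And>x. x \<ge> 1 \<Longrightarrow> ln x \<le> C + 1 * \<omega> x" using ln_le_omega[of 1] by auto
  let ?x = "exp (\<bar>C + X\<bar>)"
  have "?x \<ge> 1" by simp
  from C[OF this] have "\<omega> ?x \<ge> X" by simp
  then show ?thesis using \<open>?x \<ge> 1\<close> by blast
qed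

lemma omega_cont: "continuous_on {0..} \<omega>"
  using weight unfolding weight_function_def by auto

text \<open>On these levels exp(- \<omega>(r k)) is a geometric sequence, which will turn the powers
  of r k into \<open>M\<close>. They exist because \<omega> is continuous and unbounded.\<close>

lemma omega_levels: "\<exists>r. \<forall>k. r k \<ge> 1 \<and> \<omega> (r k) = \<omega> 1 + real (Suc k)"
proof -
  have "\<exists>r\<ge>1. \<omega> r = \<omega> 1 + real (Suc k)" for k
  proof -
    obtain R where R: "R \<ge> 1" "\<omega> R \<ge> \<omega> 1 + real (Suc k)" using omega_unbounded by blast
    have "\<exists>x\<ge>1. x \<le> R \<and> \<omega> x = \<omega> 1 + real (Suc k)"
      using R by (intro IVT' continuous_on_subset[OF omega_cont]) auto
    then show ?thesis by blast
  qed
  then show ?thesis by metis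
qed

text \<open>Abel summation compares the series with the integral of \<omega>(t)/t^2: on
  [r n, r (n + 1)] the weight is at least n + 1. The boundary term n / r n is controlled by the
  integral over [r n, 2 r n], which explains the constant 3 = 1 + 2.\<close>

lemma levels_summable:
  assumes nq: "non_quasianalytic \<omega>" and r: "\<And>k. r k \<ge> 1" "\<And>k. \<omega> (r k) = \<omega> 1 + real (Suc k)"
  shows "summable (\<lambda>k. 1 / r k)"
proof -
  define w where "w t = \<omega> t / t\<^sup>2" for t
  have w: "w integrable_on {1..}" using nq unfolding non_quasianalytic_def w_def .
  define I where "I = integral {1..} w"
  have w0: "w t \<ge> 0" if "t \<ge> 1" for t using that omega_nonneg[of t] by (simp add: w_def)
  have wi: "w integrable_on {x..y}" if "x \<ge> 1" for x y
    using integrable_on_subinterval[OF w] that by auto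
  have le_I: "integral {x..y} w \<le> I" if "x \<ge> 1" for x y
    unfolding I_def using that w0 by (intro integral_subset_le wi w) auto
  have lower: "c * (1 / x - 1 / y) \<le> integral {x..y} w" if xy: "1 \<le> x" "x \<le> y" and c: "c \<le> \<omega> x" for x y c
  proof -
    have "((\<lambda>t. c / t\<^sup>2) has_integral (- c / y) - (- c / x)) {x..y}"
    proof (rule fundamental_theorem_of_calculus[OF xy(2)])
      fix t assume "t \<in> {x..y}"
      then have "t > 0" using xy by auto
      then show "((\<lambda>t. - c / t) has_vector_derivative c / t\<^sup>2) (at t within {x..y})"
        unfolding has_real_derivative_iff_has_vector_derivative[symmetric]
        by (auto intro!: derivative_eq_intros simp: power2_eq_square)
    qed
    then have "(- c / y) - (- c / x) \<le> integral {x..y} w"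
    proof (rule has_integral_le[OF _ integrable_integral[OF wi[OF xy(1)]]])
      fix t assume t: "t \<in> {x..y}"
      then have "c \<le> \<omega> t" using c omega_mono[of x t] xy by auto
      then show "c / t\<^sup>2 \<le> w t" unfolding w_def by (rule divide_right_mono) simp
    qed
    then show ?thesis by (simp add: algebra_simps)
  qed
  have inc: "r k \<le> r (Suc k)" for k
  proof (rule ccontr)
    assume "\<not> ?thesis"
    then have "\<omega> (r (Suc k)) \<le> \<omega> (r k)" using r(1)[of "Suc k"] by (intro omega_mono) auto
    then show False using r(2)[of k] r(2)[of "Suc k"] by simp
  qed
  have w1: "0 \<le> \<omega> 1" by (rule omega_nonneg) simp
  have sum: "(\<Sum>k<n. 1 / r k) - real n / r n \<le> integral {r 0..r n} w" for n
  proof (induction n)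
    case 0
    then show ?case by simp
  next
    case (Suc n)
    have mono: "r 0 \<le> r n" using inc lift_Suc_mono_le by blast
    have "real (Suc n) * (1 / r n - 1 / r (Suc n)) \<le> integral {r n..r (Suc n)} w"
      using r inc w1 by (intro lower) auto
    moreover have "integral {r 0..r n} w + integral {r n..r (Suc n)} w = integral {r 0..r (Suc n)} w"
      using mono inc r(1)[of 0] by (intro Henstock_Kurzweil_Integration.integral_combine wi) auto
    moreover have "(\<Sum>k<Suc n. 1 / r k) - real (Suc n) / r (Suc n) = ((\<Sum>k<n. 1 / r k) - real n / r n) + real (Suc n) * (1 / r n - 1 / r (Suc n))"
      by (simp add: algebra_simps add_divide_distrib)
    ultimately show ?case using Suc by linarith
  qed
  have "(\<Sum>k<n. 1 / r k) \<le> 3 * I" for n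
  proof -
    have "real n * (1 / r n - 1 / (2 * r n)) \<le> integral {r n..2 * r n} w"
      using r(1)[of n] r(2)[of n] w1 by (intro lower) auto
    also have "\<dots> \<le> I" by (rule le_I[OF r(1)])
    finally have "real n / r n \<le> 2 * I" using r(1)[of n] by (simp add: field_simps)
    then show ?thesis using sum[of n] le_I[OF r(1), of 0 "r n"] by linarith
  qed
  then show ?thesis
    using r(1) by (intro summableI_nonneg_bounded[of _ "3 * I"]) (auto intro: order_trans[OF zero_le_one])
qed

text \<open>The averaging lengths are multiples of 1 / r k. The k-th derivative is then at most
  (2/c)^k times the product of r 0, ..., r (k - 1), hence times r (k - 1)^k; as \<omega>(r (k - 1))
  = \<omega>(1) + k, this power is at most exp(\<omega>(1)) e^k M 1 k. What remains is a geometric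
  factor.\<close>

lemma cutoff:
  assumes nq: "non_quasianalytic \<omega>" and t: "t1 < t2" "t2 < t1 + 2 * pi" and e: "e > 0"
    "t1 + e \<le> t2 - e" "t2 + e \<le> t1 + 2 * pi - e"
  shows "\<exists>\<psi>\<in>ultra_space \<omega>. (\<forall>x. \<exists>y\<in>{0..1}. \<psi> x = complex_of_real y) \<and> (\<forall>x\<in>{t1 + e..t2 - e}. \<psi> x = 1) \<and>
     (\<forall>x\<in>{t2 + e..t1 + 2 * pi - e}. \<psi> x = 0)"
proof -
  obtain r where r: "\<And>k. r k \<ge> 1" "\<And>k. \<omega> (r k) = \<omega> 1 + real (Suc k)" using omega_levels by blast
  define S where "S = (\<Sum>k. 1 / r k)"
  have sm: "summable (\<lambda>k. 1 / r k)" by (rule levels_summable[OF nq r])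
  have S: "S > 0" unfolding S_def using r(1) by (intro suminf_pos sm) (auto intro: less_le_trans[OF zero_less_one])
  \<comment> \<open>The averages have total length e/2; with the margins e/2 of f0 the plateaus of
    the result keep the distance e from t1 and t2.\<close>
  define c where "c = e / (2 * S)"
  have c: "c > 0" using e S by (simp add: c_def)
  define d where "d k = c * (1 / r k)" for k
  have d: "d k > 0" for k using c r(1)[of k] by (simp add: d_def)
  have dsum: "summable d" "suminf d = e / 2"
  proof -
    show "summable d" unfolding d_def by (rule summable_mult[OF sm])
    have "suminf d = c * S" unfolding d_def S_def by (rule suminf_mult[OF sm])
    then show "suminf d = e / 2" using S by (simp add: c_def)
  qed
  define m where "m = (t1 + t2) / 2"
  define h where "h = (t2 - t1) / 2"
  have mh: "m - h = t1" "m + h = t2" by (auto simp: m_def h_def field_simps)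
  have c1: "cos (h - e/2) > cos h" using mh t e by (intro cos_monotone_0_pi) auto
  have c2: "cos (h + e/2) < cos h" using mh t e by (intro cos_monotone_0_pi) auto
  define \<gamma> where "\<gamma> = min (cos (h - e/2) - cos h) (cos h - cos (h + e/2))"
  have \<gamma>: "\<gamma> > 0" using c1 c2 by (simp add: \<gamma>_def)
  define K where "K = 1 / (2 * \<gamma>)"
  have K: "K > 0" using \<gamma> by (simp add: K_def)
  \<comment> \<open>The arc from t1 to t2 is where cos (x - m) exceeds cos h, so a clipped affine
    function of this cosine is periodic and Lipschitz. The slope 1/(2 \<gamma>) makes it reach 1 and
    0 within e/2 of the end points.\<close>
  define f0 where "f0 x = max 0 (min 1 (1/2 + K * (cos (x - m) - cos h)))" for x
  have cl: "\<bar>cos x - cos y\<bar> \<le> \<bar>x - y\<bar>" for x y :: real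
  proof -
    have dc: "(cos has_vector_derivative - sin t) (at t)" for t :: real
      using DERIV_cos[of t] by (simp add: has_real_derivative_iff_has_vector_derivative)
    have *: "\<bar>cos y - cos x\<bar> \<le> 1 * (y - x)" if "x \<le> y" for x y :: real
      using norm_increment_le[OF that dc, of 1] by simp
    show ?thesis using *[of x y] *[of y x] by (cases "x \<le> y") (auto simp: abs_minus_commute)
  qed
  have lip: "\<bar>f0 x - f0 y\<bar> \<le> K * \<bar>x - y\<bar>" for x y
  proof -
    have "\<bar>f0 x - f0 y\<bar> \<le> \<bar>K * (cos (x - m) - cos h) - K * (cos (y - m) - cos h)\<bar>"
      unfolding f0_def by (auto simp: max_def min_def)
    also have "\<dots> = K * \<bar>cos (x - m) - cos (y - m)\<bar>" using K by (simp add: abs_mult flip: right_diff_distrib)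
    also have "\<dots> \<le> K * \<bar>x - y\<bar>" using cl[of "x - m" "y - m"] K by (intro mult_left_mono) auto
    finally show ?thesis .
  qed
  interpret mollifier d f0 K
  proof
    show "f0 (x + 2 * pi) = f0 x" for x
    proof -
      have "cos (x + 2 * pi - m) = cos (x - m + 2 * pi)" by (simp add: algebra_simps)
      then show ?thesis unfolding f0_def by simp
    qed
    show "0 \<le> f0 x \<and> f0 x \<le> 1" for x by (auto simp: f0_def)
  qed (use d dsum lip in auto)
  have one: "f0 y = 1" if "t1 + e/2 \<le> y" "y \<le> t2 - e/2" for y
  proof -
    have "cos (h - e/2) \<le> cos \<bar>y - m\<bar>" using that mh t e by (intro cos_monotone_0_pi_le) auto
    then have "\<gamma> \<le> cos (y - m) - cos h" by (simp add: \<gamma>_def)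
    then have "K * \<gamma> \<le> K * (cos (y - m) - cos h)" using K by (intro mult_left_mono) auto
    moreover have "K * \<gamma> = 1/2" using \<gamma> by (simp add: K_def)
    ultimately have "1 \<le> 1/2 + K * (cos (y - m) - cos h)" by linarith
    then show ?thesis by (simp only: f0_def min_absorb1)
  qed
  have zero: "f0 y = 0" if "t2 + e/2 \<le> y" "y \<le> t1 + 2 * pi - e/2" for y
  proof -
    have "cos (y - m) \<le> cos (h + e/2)"
    proof (cases "y - m \<le> pi")
      case True
      then show ?thesis using that mh t e by (intro cos_monotone_0_pi_le) auto
    next
      case False
      have "cos (2 * pi - (y - m)) \<le> cos (h + e/2)" using False that mh t e by (intro cos_monotone_0_pi_le) auto
      then show ?thesis by (simp add: cos_diff)
    qed
    then have "\<gamma> \<le> cos h - cos (y - m)" by (simp add: \<gamma>_def)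
    then have "K * \<gamma> \<le> K * (cos h - cos (y - m))" using K by (intro mult_left_mono) auto
    moreover have "K * \<gamma> = 1/2" using \<gamma> by (simp add: K_def)
    moreover have "K * (cos h - cos (y - m)) = - (K * (cos (y - m) - cos h))" by (simp add: algebra_simps)
    ultimately have "1/2 + K * (cos (y - m) - cos h) \<le> 0" by linarith
    then show ?thesis by (simp add: f0_def)
  qed
  have inc: "j \<le> k \<Longrightarrow> r j \<le> r k" for j k
  proof (rule ccontr)
    assume "j \<le> k" "\<not> r j \<le> r k"
    then have "\<omega> (r k) \<le> \<omega> (r j)" using r(1)[of k] by (intro omega_mono) auto
    then have "k \<le> j" using r(2)[of k] r(2)[of j] by simp
    then show False using \<open>j \<le> k\<close> \<open>\<not> r j \<le> r k\<close> by simp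
  qed
  \<comment> \<open>An integer bound for the geometric ratio 2 e / c, with e here the base of the
    exponential, so that \<open>M_power_mult\<close> applies.\<close>
  define B where "B = nat \<lceil>2 * exp 1 / c\<rceil> + 1"
  have B: "2 * exp 1 / c \<le> real B" "1 \<le> B" unfolding B_def by linarith+
  have "ultra_bnd (1 / real B) (exp (\<omega> 1)) (G 0)"
    unfolding ultra_bnd_def
  proof safe
    show "smooth_fn (G 0)" by (rule G_smooth)
    fix es :: "real list" and x assume es: "set es \<subseteq> Basis"
    let ?k = "length es"
    have pr: "(\<Prod>j<k. r j) \<le> exp (\<omega> 1) * exp 1 ^ k * M 1 k" for k
    proof (cases k)
      case 0
      have "1 ^ 0 * exp (- 1 * \<omega> 1) \<le> M 1 0" by (rule power_le_M) auto
      then have "exp (\<omega> 1) * exp (- \<omega> 1) \<le> exp (\<omega> 1) * M 1 0" by (intro mult_left_mono) auto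
      then show ?thesis using 0 by (simp add: exp_minus)
    next
      case (Suc i)
      have "(\<Prod>j<k. r j) \<le> (\<Prod>j<k. r i)"
        using inc r(1) Suc by (intro prod_mono) (auto intro: order_trans[OF zero_le_one])
      also have "\<dots> = r i ^ k" by simp
      also have "\<dots> = exp (\<omega> 1) * exp 1 ^ k * (r i ^ k * exp (- 1 * \<omega> (r i)))"
      proof -
        have "exp 1 ^ k = exp (real k)" by (simp flip: exp_of_nat_mult)
        then have "exp (\<omega> 1) * exp 1 ^ k * exp (- 1 * \<omega> (r i)) = 1"
          unfolding r(2) Suc by (simp flip: exp_add)
        then show ?thesis by (metis mult.assoc mult.commute mult_1)
      qed
      also have "\<dots> \<le> exp (\<omega> 1) * exp 1 ^ k * M 1 k"
        using r(1) by (intro mult_left_mono power_le_M) auto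
      finally show ?thesis .
    qed
    have "norm (iter_pderiv es (G 0) x) \<le> (\<Prod>j<?k. 2 / d j)"
      unfolding iter_pderiv_real[OF es] using nderiv_G_bound by simp
    also have "\<dots> = (2 / c) ^ ?k * (\<Prod>j<?k. r j)"
    proof -
      have "(\<Prod>j<?k. 2 / d j) = (\<Prod>j<?k. (2 / c) * r j)"
        by (intro prod.cong) (auto simp: d_def)
      then show ?thesis unfolding prod.distrib by simp
    qed
    also have "\<dots> \<le> (2 / c) ^ ?k * (exp (\<omega> 1) * exp 1 ^ ?k * M 1 ?k)"
      using pr c by (intro mult_left_mono) auto
    also have "\<dots> = exp (\<omega> 1) * ((2 * exp 1 / c) ^ ?k * M 1 ?k)"
      by (simp add: power_mult_distrib power_divide)
    also have "\<dots> \<le> exp (\<omega> 1) * (real B ^ ?k * M 1 ?k)"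
      using B c by (intro mult_left_mono mult_right_mono power_mono) auto
    also have "\<dots> \<le> exp (\<omega> 1) * M (1 / real B) ?k"
      using M_power_mult[of 1 B ?k] B by (intro mult_left_mono) auto
    finally show "norm (iter_pderiv es (G 0) x) \<le> exp (\<omega> 1) * M (1 / real B) ?k" .
  qed
  then have "ultra_bnd (1 / real B) (exp (\<omega> 1)) (\<lambda>x. complex_of_real (G 0 x))" by (rule ultra_bnd_of_real)
  moreover have "1 / real B > 0" using B by simp
  moreover have "periodic_fn (\<lambda>x. complex_of_real (G 0 x))" by (simp add: periodic_real G_periodic)
  ultimately have "(\<lambda>x. complex_of_real (G 0 x)) \<in> ultra_space \<omega>" unfolding ultra_space_iff by blast
  moreover have "G 0 x = 1" if "x \<in> {t1 + e..t2 - e}" for x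
  proof -
    have "\<bar>G 0 x - 1\<bar> \<le> 0" using one that e by (intro G_near) (auto simp: dsum(2))
    then show ?thesis by simp
  qed
  moreover have "G 0 x = 0" if "x \<in> {t2 + e..t1 + 2 * pi - e}" for x
  proof -
    have "\<bar>G 0 x - 0\<bar> \<le> 0" using zero that e by (intro G_near) (auto simp: dsum(2))
    then show ?thesis by simp
  qed
  ultimately show ?thesis using G_range by (intro bexI[of _ "\<lambda>x. complex_of_real (G 0 x)"]) auto
qed

end

subsection \<open>Necessity of the Diophantine condition\<close>

lemma continuous_periodic_bounded:
  fixes g :: "real \<Rightarrow> complex"
  assumes "continuous_on UNIV g" "periodic_fn g"
  shows "\<exists>T. \<forall>t. norm (g t) \<le> norm (g T)"
proof -
  have "continuous_on {0..2*pi} (\<lambda>t. norm (g t))"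
    using assms(1) continuous_on_subset by (intro continuous_intros) blast
  then obtain T where T: "\<forall>t\<in>{0..2*pi}. norm (g t) \<le> norm (g T)"
    using continuous_attains_sup[of "{0..2*pi}" "\<lambda>t. norm (g t)"] by auto
  have "norm (g t) \<le> norm (g T)" for t
  proof -
    obtain s k where "s \<in> {0..<0 + 2 * pi}" "t = s + 2 * pi * of_int k" using real_representative by blast
    then show ?thesis using T periodic_real_int[OF assms(2), of s k] by simp
  qed
  then show ?thesis by blast
qed

lemma nderiv_locally_const:
  assumes sm: "smooth_fn \<psi>" and c: "\<And>t. t \<in> {p<..<q} \<Longrightarrow> \<psi> t = c" and t: "t \<in> {p<..<q}"
  shows "nderiv (Suc l) \<psi> t = 0"
  using t
proof (induction l arbitrary: t)
  case 0
  have "(\<psi> has_vector_derivative 0) (at t)"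
    by (rule has_vector_derivative_transform_within_open[of "\<lambda>_. c" _ _ "{p<..<q}"]) (use 0 c in auto)
  moreover have "(\<psi> has_vector_derivative nderiv 1 \<psi> t) (at t)"
    using nderiv_has_vector_derivative[OF sm, of 0] by simp
  ultimately show ?case using vector_derivative_unique_at by fastforce
next
  case (Suc l)
  have "(nderiv (Suc l) \<psi> has_vector_derivative 0) (at t)"
    by (rule has_vector_derivative_transform_within_open[of "\<lambda>_. 0" _ _ "{p<..<q}"]) (use Suc in auto)
  then show ?case using nderiv_has_vector_derivative[OF sm, of "Suc l" t] vector_derivative_unique_at by blast
qed

lemma norm_nderiv_mult_le:
  fixes f g :: "real \<Rightarrow> complex"
  assumes "smooth_fn f" "smooth_fn g"
    and "\<And>k. norm (nderiv k f t) \<le> F k" "\<And>k. norm (nderiv k g t) \<le> G k"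
  shows "norm (nderiv k (\<lambda>x. f x * g x) t) \<le> (\<Sum>j\<le>k. real (k choose j) * (F j * G (k - j)))"
proof -
  have B: "set (replicate k 1) \<subseteq> (Basis :: real set)" by auto
  have "norm (iter_pderiv (replicate k 1) (\<lambda>x. f x * g x) t)
      \<le> (\<Sum>j\<le>length (replicate k (1::real)). real (length (replicate k (1::real)) choose j) * (F j * G (length (replicate k (1::real)) - j)))"
    by (rule norm_iter_pderiv_mult_le[OF assms(1,2) B]) (simp_all only: iter_pderiv_real assms(3,4))
  then show ?thesis by (simp add: nderiv_def)
qed

section \<open>Null solutions of the mode equations and their perturbations\<close>

context torus_operator begin

text \<open>The difference of u and v, multiplied by exp(Q), has derivative zero; the null space of
  the mode operator is thus spanned by exp(- Q).\<close>

lemma mode_op_eq_imp: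
  assumes "smooth_fn u" "smooth_fn v" "mode_op \<xi> v = mode_op \<xi> u"
  shows "\<exists>C. \<forall>t. v t = u t + C * exp (- Q \<xi> t)"
proof -
  let ?w = "\<lambda>t. (v t - u t) * exp (Q \<xi> t)"
  have "(?w has_vector_derivative 0) (at t)" for t
  proof -
    have "(v has_vector_derivative nderiv 1 v t) (at t)" "(u has_vector_derivative nderiv 1 u t) (at t)"
      using nderiv_has_vector_derivative[of _ 0] assms by auto
    then have "(?w has_vector_derivative (v t - u t) * (q \<xi> t * exp (Q \<xi> t)) + (nderiv 1 v t - nderiv 1 u t) * exp (Q \<xi> t)) (at t)"
      by (intro has_vector_derivative_mult has_vector_derivative_diff E_deriv)
    moreover have "(v t - u t) * (q \<xi> t * exp (Q \<xi> t)) + (nderiv 1 v t - nderiv 1 u t) * exp (Q \<xi> t)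
        = (mode_op \<xi> v t - mode_op \<xi> u t) * exp (Q \<xi> t)"
      by (simp add: mode_op_def algebra_simps)
    ultimately show ?thesis using assms(3) by simp
  qed
  from vector_derivative_zero_const[OF this, of _ 0]
  have "(v t - u t) * exp (Q \<xi> t) = v 0 - u 0" for t by simp
  then have "v t = u t + (v 0 - u 0) * exp (- Q \<xi> t)" for t
    by (metis (no_types, lifting) add_diff_cancel_left' diff_add_cancel exp_minus_inverse mult.assoc mult.commute mult_1)
  then show ?thesis by blast
qed

lemma mode_op_unique:
  assumes "smooth_fn u" "smooth_fn v" "mode_op \<xi> v = mode_op \<xi> u" "periodic_fn u" "periodic_fn v" "exp (Q \<xi> (2 * pi)) \<noteq> 1"
  shows "v = u"
proof -
  obtain C where C: "\<And>t. v t = u t + C * exp (- Q \<xi> t)" using mode_op_eq_imp[OF assms(1-3)] by blast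
  have "v (0 + 2 * pi) = v 0" "u (0 + 2 * pi) = u 0" using assms(4,5) unfolding periodic_real by blast+
  then have "C * exp (- Q \<xi> (2 * pi)) = C * 1" using C[of "2 * pi"] C[of 0] by simp
  then have "C = 0" using assms(6) by (auto simp: exp_minus)
  then show ?thesis using C by auto
qed

text \<open>The function g solves the homogeneous equation with coefficient q - i z \<theta>, so
  \<open>ode_bound\<close> applies with f = 0 and D = |g(t)|. The resulting bounds are relative to
  |g(t)| and remain useful where g is tiny. The choice \<theta> = 1 gives eigenfunctions; a \<theta>
  supported away from a cutoff gives periodic functions that are null solutions on the support of
  the cutoff.\<close>

lemma twisted_bound:
  assumes \<theta>: "\<theta> \<in> ultra_space \<omega>" and \<mu>: "\<mu> > 0" and P: "P \<ge> 0"
  shows "\<exists>lam'>0. \<exists>K>0. \<forall>\<xi> z \<kappa> \<Theta>. nrm \<xi> \<ge> 1 \<longrightarrow> norm z \<le> P * nrm \<xi> \<longrightarrow>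
     (\<forall>t. (\<Theta> has_vector_derivative \<theta> t) (at t)) \<longrightarrow>
     (let g = (\<lambda>t. \<kappa> * exp (- Q \<xi> t + \<i> * z * \<Theta> t)) in
       smooth_fn g \<and> (\<forall>t. nderiv 1 g t = - ((q \<xi> t - \<i> * z * \<theta> t) * g t)) \<and>
       (\<forall>k t. norm (nderiv k g t) \<le> K * norm (g t) * exp (\<mu> * \<omega> (nrm \<xi>)) * M lam' k))"
proof -
  obtain l1 C1 where l1: "l1 > 0" "C1 \<ge> 0" "\<And>\<xi>. ultra_bnd l1 (nrm \<xi> * C1) (q \<xi>)" using q_ultra_bnd by blast
  obtain l2 C2 where l2: "l2 > 0" "ultra_bnd l2 C2 \<theta>" using \<theta> unfolding ultra_space_iff by blast
  note C2 = ultra_bnd_nonneg[OF l2(2)]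
  define l where "l = min l1 l2"
  have l: "l > 0" using l1 l2 by (simp add: l_def)
  define C where "C = C1 + P * C2"
  have C: "C \<ge> 0" using l1 C2 P by (simp add: C_def)
  from ode_bound[OF l \<mu> C, where 'n='n]
  obtain lam' K where K: "lam' > 0" "K > 0" and ob: "\<forall>(\<xi>::'n \<Rightarrow> int) (f::real \<Rightarrow> complex) q u t D. smooth_fn f \<longrightarrow> smooth_fn q \<longrightarrow>
     (\<forall>t. (u has_vector_derivative f t - q t * u t) (at t)) \<longrightarrow>
     (\<forall>l'. norm (nderiv l' q t) \<le> nrm \<xi> * C * M l l') \<longrightarrow> (\<forall>l'. norm (nderiv l' f t) \<le> D * M l l') \<longrightarrow> norm (u t) \<le> D \<longrightarrow>
     (\<forall>k. norm (nderiv k u t) \<le> K * D * exp (\<mu> * \<omega> (nrm \<xi>)) * M lam' k)"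
    by (elim exE conjE)
  have main: "smooth_fn g \<and> (\<forall>t. nderiv 1 g t = - ((q \<xi> t - \<i> * z * \<theta> t) * g t)) \<and>
       (\<forall>k t. norm (nderiv k g t) \<le> K * norm (g t) * exp (\<mu> * \<omega> (nrm \<xi>)) * M lam' k)"
    if n: "nrm \<xi> \<ge> 1" and z: "norm z \<le> P * nrm \<xi>" and \<Theta>: "\<And>t. (\<Theta> has_vector_derivative \<theta> t) (at t)"
      and g: "g = (\<lambda>t. \<kappa> * exp (- Q \<xi> t + \<i> * z * \<Theta> t))" for \<xi> z \<kappa> \<Theta> g
  proof -
    define p where "p t = q \<xi> t + (- \<i> * z) * \<theta> t" for t
    have "ultra_bnd l (nrm \<xi> * C1 + norm (- \<i> * z) * C2) p"
      unfolding p_def by (intro ultra_bnd_add ultra_bnd_cmult ultra_bnd_antimono[OF l1(3)] ultra_bnd_antimono[OF l2(2)] l) (auto simp: l_def)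
    moreover have "nrm \<xi> * C1 + norm (- \<i> * z) * C2 \<le> nrm \<xi> * C"
    proof -
      have "norm z * C2 \<le> (P * nrm \<xi>) * C2" using z C2 by (rule mult_right_mono)
      then show ?thesis by (simp add: C_def norm_mult algebra_simps)
    qed
    ultimately have p: "ultra_bnd l (nrm \<xi> * C) p" by (rule ultra_bnd_mono)
    have dg: "(g has_vector_derivative 0 - p t * g t) (at t)" for t
    proof -
      have "((\<lambda>t. - Q \<xi> t + \<i> * z * \<Theta> t) has_vector_derivative - q \<xi> t + \<i> * z * \<theta> t) (at t)"
        by (intro has_vector_derivative_add has_vector_derivative_minus has_vector_derivative_mult_right Q_deriv \<Theta>)
      from field_vector_diff_chain_at[OF this DERIV_exp]
      have "((\<lambda>t. exp (- Q \<xi> t + \<i> * z * \<Theta> t)) has_vector_derivative (- q \<xi> t + \<i> * z * \<theta> t) * exp (- Q \<xi> t + \<i> * z * \<Theta> t)) (at t)"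
        by (simp add: o_def)
      from has_vector_derivative_mult_right[OF this, of \<kappa>] show ?thesis
        unfolding g p_def by (rule has_vector_derivative_eq_rhs) (simp add: algebra_simps)
    qed
    have z: "nderiv j (\<lambda>_. 0 :: complex) t = 0" for j t
    proof -
      have "nderiv j (\<lambda>_. 0 :: complex) = (\<lambda>_. 0)"
        using nderiv_eqI(2)[of "\<lambda>_ _. 0 :: complex"] by simp
      then show ?thesis by simp
    qed
    note os = ode_smooth[OF smooth_const ultra_bnd_smooth[OF p] dg]
    have "norm (nderiv k g t) \<le> K * norm (g t) * exp (\<mu> * \<omega> (nrm \<xi>)) * M lam' k" for k t
    proof (rule ob[rule_format, OF smooth_const[of 0] ultra_bnd_smooth[OF p]])
      show "(g has_vector_derivative 0 - p t * g t) (at t)" for t by (rule dg)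
      show "norm (nderiv j p t) \<le> nrm \<xi> * C * M l j" for j by (rule ultra_bnd_nderiv[OF p])
      show "norm (nderiv j (\<lambda>_. 0 :: complex) t) \<le> norm (g t) * M l j" for j by (simp add: z)
    qed simp
    moreover have "nderiv 1 g t = - ((q \<xi> t - \<i> * z * \<theta> t) * g t)" for t
      using os(2)[of 0 t] by (simp add: z p_def algebra_simps)
    ultimately show ?thesis using os(1) by blast
  qed
  show ?thesis
    by (rule exI[of _ lam'], rule conjI[OF K(1)], rule exI[of _ K], rule conjI[OF K(2)], unfold Let_def,
        intro allI impI, rule main[OF _ _ _ refl]) blast+
qed

lemma ultra_from_bound:
  fixes g :: "real \<Rightarrow> complex"
  assumes "smooth_fn g" "periodic_fn g" "lam > 0" "K \<ge> 0"
    "\<And>k t. norm (nderiv k g t) \<le> K * norm (g t) * M lam k"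
  shows "g \<in> ultra_space \<omega>"
proof -
  obtain T where T: "\<And>t. norm (g t) \<le> norm (g T)"
    using continuous_periodic_bounded[OF smooth_continuous[OF assms(1)] assms(2)] by blast
  have "ultra_bnd lam (K * norm (g T)) g"
    unfolding ultra_bnd_def
  proof safe
    fix es :: "real list" and x assume es: "set es \<subseteq> Basis"
    have "norm (nderiv (length es) g x) \<le> K * norm (g x) * M lam (length es)" by (rule assms)
    also have "\<dots> \<le> K * norm (g T) * M lam (length es)" using T assms by (intro mult_right_mono mult_left_mono) auto
    finally show "norm (iter_pderiv es g x) \<le> K * norm (g T) * M lam (length es)" unfolding iter_pderiv_real[OF es] .
  qed (rule assms)
  then show ?thesis unfolding ultra_space_iff using assms by blast
qed

text \<open>For fixed \<xi> only finitely many integers \<tau> satisfy |\<tau> + z0| < 1, so the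
  nonzero values of |\<tau> + z0| have a positive lower bound. If finitely many frequencies were
  bad, a smaller constant C would cover them all.\<close>

lemma bad_frequencies_infinite:
  assumes "\<not> EDC2 \<omega> (\<lambda>j. mean (a j)) (\<lambda>j. mean (b j))"
  shows "\<exists>\<epsilon>>0. infinite {\<xi>. \<exists>\<tau>::int. of_int \<tau> + z0 \<xi> \<noteq> 0 \<and>
     norm (of_int \<tau> + z0 \<xi>) < exp (- \<epsilon> * \<omega> (sqrt (real_of_int (\<tau>\<^sup>2) + (\<Sum>j\<in>UNIV. real_of_int ((\<xi> j)\<^sup>2)))))}"
proof -
  let ?s = "\<lambda>\<tau> \<xi>. sqrt (real_of_int (\<tau>\<^sup>2) + (\<Sum>j\<in>UNIV. real_of_int ((\<xi> j)\<^sup>2)))"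
  have s0: "0 \<le> ?s \<tau> \<xi>" for \<tau> and \<xi> :: "'n \<Rightarrow> int" by (intro real_sqrt_ge_zero add_nonneg_nonneg sum_nonneg) auto
  obtain \<epsilon> where \<epsilon>: "\<epsilon> > 0" and bad: "\<And>C. C > 0 \<Longrightarrow> \<exists>(\<tau>::int) \<xi>. of_int \<tau> + z0 \<xi> \<noteq> 0 \<and>
      norm (of_int \<tau> + z0 \<xi>) < C * exp (- \<epsilon> * \<omega> (?s \<tau> \<xi>))"
    using assms unfolding EDC2_def Let_def z0_def by (auto simp: not_le)
  define B where "B = {\<xi>. \<exists>\<tau>::int. of_int \<tau> + z0 \<xi> \<noteq> 0 \<and> norm (of_int \<tau> + z0 \<xi>) < exp (- \<epsilon> * \<omega> (?s \<tau> \<xi>))}"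
  have pos: "\<exists>c>0. \<forall>\<tau>::int. of_int \<tau> + z0 \<xi> \<noteq> 0 \<longrightarrow> c \<le> norm (of_int \<tau> + z0 \<xi>)" for \<xi>
  proof -
    let ?T = "{\<tau>::int. of_int \<tau> + z0 \<xi> \<noteq> 0 \<and> norm (of_int \<tau> + z0 \<xi>) < 1}"
    have "?T \<subseteq> {- \<lceil>1 + norm (z0 \<xi>)\<rceil>..\<lceil>1 + norm (z0 \<xi>)\<rceil>}"
    proof
      fix \<tau> assume "\<tau> \<in> ?T"
      then have "norm (of_int \<tau> + z0 \<xi>) < 1" by simp
      moreover have "norm (of_int \<tau> :: complex) \<le> norm (of_int \<tau> + z0 \<xi>) + norm (z0 \<xi>)"
        using norm_triangle_ineq4[of "of_int \<tau> + z0 \<xi>" "z0 \<xi>"] by simp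
      ultimately have "\<bar>real_of_int \<tau>\<bar> \<le> 1 + norm (z0 \<xi>)" by simp
      then show "\<tau> \<in> {- \<lceil>1 + norm (z0 \<xi>)\<rceil>..\<lceil>1 + norm (z0 \<xi>)\<rceil>}" by simp linarith
    qed
    then have fin: "finite ?T" using finite_subset by blast
    define c where "c = Min (insert 1 ((\<lambda>\<tau>. norm (of_int \<tau> + z0 \<xi>)) ` ?T))"
    have "c > 0" unfolding c_def using fin by (subst Min_gr_iff) auto
    moreover have "c \<le> norm (of_int \<tau> + z0 \<xi>)" if "of_int \<tau> + z0 \<xi> \<noteq> 0" for \<tau> :: int
    proof (cases "norm (of_int \<tau> + z0 \<xi>) < 1")
      case True
      then show ?thesis unfolding c_def using fin that by (intro Min_le) auto
    next
      case False
      have "c \<le> 1" unfolding c_def using fin by (intro Min_le) auto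
      then show ?thesis using False by linarith
    qed
    ultimately show ?thesis by blast
  qed
  then obtain c where c: "\<And>\<xi>. c \<xi> > 0" "\<And>\<xi> (\<tau>::int). of_int \<tau> + z0 \<xi> \<noteq> 0 \<Longrightarrow> c \<xi> \<le> norm (of_int \<tau> + z0 \<xi>)" by metis
  have "infinite B"
  proof
    assume fin: "finite B"
    define C where "C = Min (insert 1 (c ` B))"
    have C: "C > 0" unfolding C_def using fin c(1) by (subst Min_gr_iff) auto
    have C1: "C \<le> 1" unfolding C_def using fin by (intro Min_le) auto
    obtain \<tau> :: int and \<xi> where x: "of_int \<tau> + z0 \<xi> \<noteq> 0" "norm (of_int \<tau> + z0 \<xi>) < C * exp (- \<epsilon> * \<omega> (?s \<tau> \<xi>))"
      using bad[OF C] by blast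
    have "C * exp (- \<epsilon> * \<omega> (?s \<tau> \<xi>)) \<le> 1 * exp (- \<epsilon> * \<omega> (?s \<tau> \<xi>))" using C1 by (intro mult_right_mono) auto
    then have "norm (of_int \<tau> + z0 \<xi>) < exp (- \<epsilon> * \<omega> (?s \<tau> \<xi>))" using x(2) by linarith
    then have "\<xi> \<in> B" using x(1) unfolding B_def by blast
    then have "C \<le> c \<xi>" unfolding C_def using fin by (intro Min_le) auto
    moreover have "c \<xi> \<le> norm (of_int \<tau> + z0 \<xi>)" by (rule c(2)[OF x(1)])
    moreover have "C * exp (- \<epsilon> * \<omega> (?s \<tau> \<xi>)) \<le> C * 1"
      using C mult_nonneg_nonneg[OF less_imp_le[OF \<epsilon>] omega_nonneg[OF s0[of \<tau> \<xi>]]] by (intro mult_left_mono) auto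
    ultimately show False using x(2) by linarith
  qed
  then show ?thesis using \<epsilon> unfolding B_def by blast
qed

text \<open>The function exp(- Q + i z t) with z = \<tau> + z0 is periodic, since its exponent grows
  by 2 pi i \<tau> over a period, and the mode operator multiplies it by i z. Absence of resonance
  makes it the only periodic solution for its right-hand side, so it cannot be exchanged for a small
  one after normalisation to maximum 1.\<close>

theorem EDC2_if_solvable:
  assumes sol: "globally_solvable \<omega> a b"
  shows "EDC2 \<omega> (\<lambda>j. mean (a j)) (\<lambda>j. mean (b j))"
proof (rule ccontr)
  assume "\<not> ?thesis"
  let ?s = "\<lambda>\<tau> \<xi>. sqrt (real_of_int (\<tau>\<^sup>2) + (\<Sum>j\<in>UNIV. real_of_int ((\<xi> j)\<^sup>2)))"
  from bad_frequencies_infinite[OF \<open>\<not> ?thesis\<close>] obtain \<epsilon> where \<epsilon>: "\<epsilon> > 0" and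
    inf: "infinite {\<xi>. \<exists>\<tau>::int. of_int \<tau> + z0 \<xi> \<noteq> 0 \<and> norm (of_int \<tau> + z0 \<xi>) < exp (- \<epsilon> * \<omega> (?s \<tau> \<xi>))}" (is "infinite ?B")
    by blast
  obtain \<xi> :: "nat \<Rightarrow> 'n \<Rightarrow> int" where inj: "inj \<xi>" and "range \<xi> \<subseteq> ?B"
    using infinite_countable_subset[OF inf] by blast
  then have "\<forall>n. \<exists>\<tau>::int. of_int \<tau> + z0 (\<xi> n) \<noteq> 0 \<and> norm (of_int \<tau> + z0 (\<xi> n)) < exp (- \<epsilon> * \<omega> (?s \<tau> (\<xi> n)))" by auto
  then obtain \<tau> :: "nat \<Rightarrow> int" where \<tau>: "\<And>n. of_int (\<tau> n) + z0 (\<xi> n) \<noteq> 0"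
    "\<And>n. norm (of_int (\<tau> n) + z0 (\<xi> n)) < exp (- \<epsilon> * \<omega> (?s (\<tau> n) (\<xi> n)))" by metis
  define z where "z n = of_int (\<tau> n) + z0 (\<xi> n)" for n
  have s0: "0 \<le> ?s \<tau> \<xi>" for \<tau> and \<xi> :: "'n \<Rightarrow> int" by (intro real_sqrt_ge_zero add_nonneg_nonneg sum_nonneg) auto
  have z1: "norm (z n) < 1" for n
  proof -
    have "exp (- \<epsilon> * \<omega> (?s (\<tau> n) (\<xi> n))) \<le> 1"
      using mult_nonneg_nonneg[OF less_imp_le[OF \<epsilon>] omega_nonneg[OF s0[of "\<tau> n" "\<xi> n"]]] by simp
    then show ?thesis using \<tau>(2)[of n] unfolding z_def by linarith
  qed
  \<comment> \<open>If z0 were an integer, z would be a nonzero integer and could not have modulus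
    below 1.\<close>
  have nores: "z0 (\<xi> n) \<noteq> of_int m" for n m
  proof
    assume "z0 (\<xi> n) = of_int m"
    then have "z n = of_int (\<tau> n + m)" by (simp add: z_def)
    moreover have "z n \<noteq> 0" using \<tau>(1) by (simp add: z_def)
    ultimately have "1 \<le> norm (z n)" by (simp del: of_int_add)
    then show False using z1[of n] by simp
  qed
  have ne: "exp (Q (\<xi> n) (2 * pi)) \<noteq> 1" for n
  proof
    assume "exp (Q (\<xi> n) (2 * pi)) = 1"
    then have "exp (Q (\<xi> n) (2 * pi)) = exp 0" by simp
    then obtain m :: int where "2 * pi * \<i> * z0 (\<xi> n) = 0 + (of_int (2 * m) * pi) * \<i>"
      unfolding exp_eq Q_2pi by blast
    then have "(2 * pi * \<i>) * z0 (\<xi> n) = (2 * pi * \<i>) * of_int m" by (simp add: mult_ac)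
    then show False using nores[of n m] by simp
  qed
  have "\<xi> n \<noteq> 0" for n using nores[of n 0] by (auto simp: z0_def)
  have n1: "nrm (\<xi> n) \<ge> 1" for n
  proof -
    obtain j where "\<xi> n j \<noteq> 0" using \<open>\<xi> n \<noteq> 0\<close> by (auto simp: fun_eq_iff)
    then have "1 \<le> \<bar>real_of_int (\<xi> n j)\<bar>" by linarith
    then show ?thesis using abs_le_nrm[of "\<xi> n" j] by linarith
  qed
  let ?N = "real CARD('n)"
  \<comment> \<open>N compares \<open>nrm\<close> with the Euclidean norm; the factor 2 leaves the
    rate \<mu> after \<open>twisted_bound\<close> has consumed another \<mu>.\<close>
  define \<mu> where "\<mu> = \<epsilon> / (2 * ?N)"
  have \<mu>: "\<mu> > 0" using \<epsilon> by (simp add: \<mu>_def)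
  have zs: "norm (z n) \<le> exp (- (2 * \<mu>) * \<omega> (nrm (\<xi> n)))" for n
  proof -
    have "\<bar>real_of_int (\<xi> n j)\<bar> \<le> ?s (\<tau> n) (\<xi> n)" for j
    proof -
      have "(\<bar>real_of_int (\<xi> n j)\<bar>)\<^sup>2 \<le> (\<Sum>j\<in>UNIV. real_of_int ((\<xi> n j)\<^sup>2))"
        by (simp add: member_le_sum[of j UNIV "\<lambda>j. (real_of_int (\<xi> n j))\<^sup>2"])
      then have "(\<bar>real_of_int (\<xi> n j)\<bar>)\<^sup>2 \<le> real_of_int ((\<tau> n)\<^sup>2) + (\<Sum>j\<in>UNIV. real_of_int ((\<xi> n j)\<^sup>2))"
        by (simp add: add_increasing)
      then show ?thesis by (rule real_le_rsqrt)
    qed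
    then have "nrm (\<xi> n) \<le> (\<Sum>j\<in>(UNIV::'n set). ?s (\<tau> n) (\<xi> n))" unfolding nrm_def by (intro sum_mono)
    then have "nrm (\<xi> n) \<le> ?N * ?s (\<tau> n) (\<xi> n)" by simp
    then have "\<omega> (nrm (\<xi> n)) \<le> \<omega> (?N * ?s (\<tau> n) (\<xi> n))" by (rule omega_mono[OF nrm_nonneg])
    also have "\<dots> \<le> ?N * \<omega> (?s (\<tau> n) (\<xi> n))" by (rule omega_mult_nat[OF s0]) (simp add: Suc_leI)
    finally have "\<omega> (nrm (\<xi> n)) \<le> ?N * \<omega> (?s (\<tau> n) (\<xi> n))" .
    then have "(2 * \<mu>) * \<omega> (nrm (\<xi> n)) \<le> (2 * \<mu>) * (?N * \<omega> (?s (\<tau> n) (\<xi> n)))" using \<mu> by (intro mult_left_mono) auto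
    also have "\<dots> = \<epsilon> * \<omega> (?s (\<tau> n) (\<xi> n))" by (simp add: \<mu>_def)
    finally have "exp (- \<epsilon> * \<omega> (?s (\<tau> n) (\<xi> n))) \<le> exp (- (2 * \<mu>) * \<omega> (nrm (\<xi> n)))" by simp
    then show ?thesis using \<tau>(2)[of n] unfolding z_def by linarith
  qed
  have one: "(\<lambda>t::real. 1 :: complex) \<in> ultra_space \<omega>" by (rule ultra_space_const)
  have Tid: "((\<lambda>t. complex_of_real t) has_vector_derivative 1) (at t)" for t
    by (auto intro!: derivative_eq_intros)
  from twisted_bound[OF one \<mu> zero_le_one]
  obtain lam K where lam: "lam > 0" "K > 0" and tw0: "\<forall>(\<xi>::'n \<Rightarrow> int) z \<kappa> \<Theta>. nrm \<xi> \<ge> 1 \<longrightarrow> norm z \<le> 1 * nrm \<xi> \<longrightarrow>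
     (\<forall>t. (\<Theta> has_vector_derivative 1) (at t)) \<longrightarrow>
     (let g = (\<lambda>t. \<kappa> * exp (- Q \<xi> t + \<i> * z * \<Theta> t)) in
       smooth_fn g \<and> (\<forall>t. nderiv 1 g t = - ((q \<xi> t - \<i> * z * 1) * g t)) \<and>
       (\<forall>k t. norm (nderiv k g t) \<le> K * norm (g t) * exp (\<mu> * \<omega> (nrm \<xi>)) * M lam k))"
    by (elim exE conjE)
  define g where "g \<kappa> n = (\<lambda>t. \<kappa> * exp (- Q (\<xi> n) t + \<i> * z n * of_real t))" for \<kappa> :: complex and n
  have zn: "norm (z n) \<le> 1 * nrm (\<xi> n)" for n using z1[of n] n1[of n] by simp
  have g: "smooth_fn (g \<kappa> n) \<and> (\<forall>t. nderiv 1 (g \<kappa> n) t = - ((q (\<xi> n) t - \<i> * z n * 1) * g \<kappa> n t)) \<and>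
       (\<forall>k t. norm (nderiv k (g \<kappa> n) t) \<le> K * norm (g \<kappa> n t) * exp (\<mu> * \<omega> (nrm (\<xi> n))) * M lam k)" for \<kappa> n
    using tw0[rule_format, OF n1 zn Tid] unfolding Let_def g_def .
  have gper: "periodic_fn (g \<kappa> n)" for \<kappa> n
  proof -
    have "- Q (\<xi> n) (t + 2 * pi) + \<i> * z n * of_real (t + 2 * pi) = (- Q (\<xi> n) t + \<i> * z n * of_real t) + (of_int (2 * \<tau> n) * pi) * \<i>" for t
      unfolding Q_period Q_2pi z_def by (simp add: algebra_simps)
    then have "exp (- Q (\<xi> n) (t + 2 * pi) + \<i> * z n * of_real (t + 2 * pi)) = exp (- Q (\<xi> n) t + \<i> * z n * of_real t)" for t
      unfolding exp_eq by blast
    then show ?thesis unfolding periodic_real g_def by simp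
  qed
  have "\<forall>n. \<exists>T. \<forall>t. norm (g 1 n t) \<le> norm (g 1 n T)"
    using continuous_periodic_bounded[OF smooth_continuous gper] g by blast
  then obtain T where T: "\<And>n t. norm (g 1 n t) \<le> norm (g 1 n (T n))" by metis
  define u where "u n = g (1 / norm (g 1 n (T n))) n" for n
  have gpos: "norm (g 1 n (T n)) > 0" for n by (simp add: g_def)
  have unorm: "norm (u n t) = norm (g 1 n t) / norm (g 1 n (T n))" for n t
    by (simp add: u_def g_def norm_mult norm_divide)
  have u1: "norm (u n t) \<le> 1" "norm (u n (T n)) = 1" for n t
    using T[of n t] gpos[of n] by (auto simp: unorm divide_le_eq)
  have sm: "smooth_fn (u n)" and per: "periodic_fn (u n)" and
    nd1: "nderiv 1 (u n) t = - ((q (\<xi> n) t - \<i> * z n * 1) * u n t)" and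
    ndk: "norm (nderiv k (u n) t) \<le> K * norm (u n t) * exp (\<mu> * \<omega> (nrm (\<xi> n))) * M lam k" for n k t
    using g gper unfolding u_def by blast+
  have ult: "u n \<in> ultra_space \<omega>" for n
    using ndk[of _ n] lam by (intro ultra_from_bound[OF sm per lam(1), of "K * exp (\<mu> * \<omega> (nrm (\<xi> n)))"]) (auto simp: mult_ac)
  have Lu: "mode_op (\<xi> n) (u n) = (\<lambda>t. (\<i> * z n) * u n t)" for n
    unfolding mode_op_def nd1 by (auto simp: algebra_simps)
  have "coef_bound lam K \<mu> (\<xi> n) (mode_op (\<xi> n) (u n))" for n
    unfolding coef_bound_def
  proof (intro conjI allI)
    have "mode_op (\<xi> n) (u n) \<in> ultra_space \<omega>" by (rule mode_op_ultra[OF ult])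
    then show "smooth_fn (mode_op (\<xi> n) (u n))" "periodic_fn (mode_op (\<xi> n) (u n))"
      by (auto intro: ultra_space_smooth ultra_space_periodic)
    fix k t
    have "nderiv k (mode_op (\<xi> n) (u n)) t = (\<i> * z n) * nderiv k (u n) t"
      unfolding Lu nderiv_def by (subst iter_pderiv_cmult[OF sm]) (auto simp: set_replicate_conv_if)
    then have "norm (nderiv k (mode_op (\<xi> n) (u n)) t) = norm (z n) * norm (nderiv k (u n) t)" by (simp add: norm_mult)
    also have "\<dots> \<le> exp (- (2 * \<mu>) * \<omega> (nrm (\<xi> n))) * (K * 1 * exp (\<mu> * \<omega> (nrm (\<xi> n))) * M lam k)"
    proof (rule mult_mono[OF zs])
      show "norm (nderiv k (u n) t) \<le> K * 1 * exp (\<mu> * \<omega> (nrm (\<xi> n))) * M lam k"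
        using u1(1)[of n t] lam by (intro order_trans[OF ndk] mult_right_mono mult_left_mono) auto
    qed auto
    also have "\<dots> = K * M lam k * (exp (- (2 * \<mu>) * \<omega> (nrm (\<xi> n))) * exp (\<mu> * \<omega> (nrm (\<xi> n))))"
      by (simp add: mult_ac)
    also have "exp (- (2 * \<mu>) * \<omega> (nrm (\<xi> n))) * exp (\<mu> * \<omega> (nrm (\<xi> n))) = exp (- \<mu> * \<omega> (nrm (\<xi> n)))"
      by (simp add: algebra_simps flip: exp_add)
    finally show "norm (nderiv k (mode_op (\<xi> n) (u n)) t) \<le> K * M lam k * exp (- \<mu> * \<omega> (nrm (\<xi> n)))" .
  qed
  note si = solvable_imp[where u = u, OF sol inj lam(1) \<mu> ult this]
  obtain v where "\<exists>w. (\<forall>n. smooth_fn (v n) \<and> periodic_fn (v n) \<and> mode_op (\<xi> n) (v n) = mode_op (\<xi> n) (u n)) \<and>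
     (\<forall>n t. norm (v n t) \<le> w n) \<and> w \<longlonglongrightarrow> 0"
    using si by (rule exE)
  then obtain w where vw0: "(\<forall>n. smooth_fn (v n) \<and> periodic_fn (v n) \<and> mode_op (\<xi> n) (v n) = mode_op (\<xi> n) (u n)) \<and>
     (\<forall>n t. norm (v n t) \<le> w n) \<and> w \<longlonglongrightarrow> 0"
    by (rule exE)
  note v = vw0[THEN conjunct1] and vw = vw0[THEN conjunct2, THEN conjunct1] and w = vw0[THEN conjunct2, THEN conjunct2]
  have "v n = u n" for n
  proof -
    have "smooth_fn (v n)" "periodic_fn (v n)" "mode_op (\<xi> n) (v n) = mode_op (\<xi> n) (u n)" using v by auto
    from mode_op_unique[OF sm this(1,3) per this(2) ne] show ?thesis .
  qed
  then have "1 \<le> w n" for n using vw[rule_format, of n "T n"] u1(2)[of n] by simp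
  moreover have "\<forall>\<^sub>F n in sequentially. w n < 1" using w by (rule order_tendstoD) simp
  then obtain n where "w n < 1" by (auto simp: eventually_sequentially)
  ultimately show False by (meson not_le)
qed

end

subsection \<open>Hills and disconnected sublevel sets\<close>

context torus_operator begin

text \<open>The factor \<open>\<Theta>\<close> grows by \<open>2\<pi>\<close> over a period but is constant on the support of \<open>\<psi>\<close>; it makes
  \<open>e^{-Q}\<close> periodic without affecting \<open>L(g \<psi>) = g \<psi>'\<close>.\<close>
lemma correction_phase:
  assumes nq: "non_quasianalytic \<omega>" and pq: "p < q'" "q' < p + 2 * pi" and s: "s \<in> {p..q'}"
  shows "\<exists>\<theta> \<Theta>. \<theta> \<in> ultra_space \<omega> \<and> (\<forall>t. (\<Theta> has_vector_derivative \<theta> t) (at t)) \<and>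
     (\<forall>t. \<Theta> (t + 2 * pi) = \<Theta> t + of_real (2 * pi)) \<and> (\<forall>t\<in>{p..q'}. \<theta> t = 0 \<and> \<Theta> t = (0 :: complex))"
proof -
  define L where "L = p + 2 * pi - q'"
  have L: "L > 0" "L < 2 * pi" using pq by (auto simp: L_def)
  \<comment> \<open>The bump occupies the middle third of the gap from q' to p + 2 pi, up to margins
    e, so it vanishes on {p..q'}.\<close>
  define t1 where "t1 = q' + L / 3"
  define t2 where "t2 = q' + 2 * L / 3"
  define e where "e = L / 12"
  have e: "e > 0" using L by (simp add: e_def)
  obtain \<theta> where \<theta>: "\<theta> \<in> ultra_space \<omega>" "\<forall>x. \<exists>y\<in>{0..1}. \<theta> x = complex_of_real y"
    "\<forall>x\<in>{t1 + e..t2 - e}. \<theta> x = 1" "\<forall>x\<in>{t2 + e..t1 + 2 * pi - e}. \<theta> x = 0"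
    using cutoff[OF nq, of t1 t2 e] L by (auto simp: t1_def t2_def e_def)
  have cont: "continuous_on UNIV \<theta>" using \<theta>(1) ultra_space_smooth smooth_continuous by blast
  have per: "periodic_fn \<theta>" using \<theta>(1) ultra_space_periodic by blast
  note pd = prim_has_vector_derivative[OF cont]
  have Red: "((\<lambda>t. Re (prim \<theta> t)) has_real_derivative Re (\<theta> t)) (at t)" for t
    using bounded_linear.has_vector_derivative[OF bounded_linear_Re pd]
    by (simp add: has_real_derivative_iff_has_vector_derivative)
  have R0: "Re (\<theta> t) \<ge> 0" for t using \<theta>(2)[rule_format, of t] by auto
  have mono: "Re (prim \<theta> x) \<le> Re (prim \<theta> y)" if "x \<le> y" for x y
    using DERIV_nonneg_imp_nondecreasing[of x y "\<lambda>t. Re (prim \<theta> t)"] that Red R0 by blast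
  have le: "t1 + e < t2 - e" using L by (simp add: t1_def t2_def e_def)
  have "Re (prim \<theta> (t1 + e)) < Re (prim \<theta> (t2 - e))"
    by (rule DERIV_pos_imp_increasing[OF le]) (use Red \<theta>(3) in \<open>auto intro!: exI\<close>)
  moreover have "Re (prim \<theta> t1) \<le> Re (prim \<theta> (t1 + e))" "Re (prim \<theta> (t2 - e)) \<le> Re (prim \<theta> (t1 + 2 * pi))"
    using e L by (auto intro!: mono simp: t1_def t2_def e_def)
  ultimately have "Re (prim \<theta> t1) < Re (prim \<theta> (t1 + 2 * pi))" by linarith
  moreover have pp: "prim \<theta> (t + 2 * pi) = prim \<theta> t + prim \<theta> (2 * pi)" for t
    using per by (intro prim_period cont) (simp add: periodic_real)
  ultimately have I: "prim \<theta> (2 * pi) \<noteq> 0" by auto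
  \<comment> \<open>The integral over a period is not zero because \<theta> is nonnegative and
    equals 1 on an interval; d scales the increment of \<Theta> to 2 pi.\<close>
  define d where "d = 2 * pi / prim \<theta> (2 * pi)"
  define \<Theta> where "\<Theta> t = d * (prim \<theta> t - prim \<theta> s)" for t
  have zero: "\<theta> t = 0" if "t \<in> {p..q'}" for t
  proof -
    have "t + 2 * pi \<in> {t2 + e..t1 + 2 * pi - e}" using that e by (auto simp: t1_def t2_def e_def L_def field_simps)
    then have "\<theta> (t + 2 * pi) = 0" using \<theta>(4) by blast
    then show ?thesis using per by (simp add: periodic_real)
  qed
  have const: "prim \<theta> x = prim \<theta> y" if "x \<le> y" "x \<in> {p..q'}" "y \<in> {p..q'}" for x y
  proof -
    have "norm (prim \<theta> y - prim \<theta> x) \<le> 0 * (y - x)"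
      by (rule norm_increment_le[OF that(1) pd]) (use zero that in auto)
    then show ?thesis by simp
  qed
  show ?thesis
  proof (rule exI[of _ "\<lambda>t. d * \<theta> t"], rule exI[of _ \<Theta>], intro conjI allI ballI)
    show "(\<lambda>t. d * \<theta> t) \<in> ultra_space \<omega>" by (rule ultra_space_cmult[OF \<theta>(1)])
    show "(\<Theta> has_vector_derivative d * \<theta> t) (at t)" for t
      unfolding \<Theta>_def using has_vector_derivative_mult_right[OF has_vector_derivative_diff[OF pd has_vector_derivative_const], of d]
      by simp
    show "\<Theta> (t + 2 * pi) = \<Theta> t + of_real (2 * pi)" for t
    proof -
      have "\<Theta> (t + 2 * pi) = \<Theta> t + d * prim \<theta> (2 * pi)" unfolding \<Theta>_def pp by (simp add: algebra_simps)
      then show ?thesis using I by (simp add: d_def)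
    qed
    show "d * \<theta> t = 0" "\<Theta> t = 0" if "t \<in> {p..q'}" for t
      using zero[OF that] const[of t s] const[of s t] s that by (auto simp: \<Theta>_def) (metis linear)
  qed
qed

text \<open>On the support of \<psi> the modulus of g is exp(N (B - r)), with B =
  \<open>Bf \<xi>0\<close>, up to the bounded contribution of \<eta>. It is at most about exp(- N D)
  in the two valleys, where \<psi> varies, and \<omega>(|\<xi> n|) grows at most linearly in N, so
  smallness in N is decay in the frequency. The shift by \<eta> leaves room for choosing frequencies
  without resonance.\<close>

lemma hill_functions:
  assumes nq: "non_quasianalytic \<omega>"
    and N: "\<And>n. n \<le> N n" and nz: "\<And>n. (\<lambda>j. int (N n) * \<xi>0 j + \<eta> j) \<noteq> 0"
    and ord: "t1 < s1" "s1 < t2" "t2 < s2" "s2 < t1 + 2 * pi"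
    and r: "Bf \<xi>0 t1 < r" "Bf \<xi>0 t2 < r"
  defines "\<xi> \<equiv> (\<lambda>n j. int (N n) * \<xi>0 j + \<eta> j)"
  shows "\<exists>u lam A \<delta>. lam > 0 \<and> \<delta> > 0 \<and> (\<forall>n. u n \<in> ultra_space \<omega> \<and> coef_bound lam A \<delta> (\<xi> n) (mode_op (\<xi> n) (u n)) \<and>
     u n s1 = exp (- Q (\<xi> n) s1 - of_real (N n * r + Bf \<eta> s1)) \<and> u n s2 = 0)"
proof -
  have cB: "continuous_on S (Bf \<xi>)" for S \<xi>
    by (rule continuous_on_vector_derivative[OF has_vector_derivative_at_within[OF Bf_deriv]])
  have near: "\<exists>e>0. \<exists>d>0. \<forall>t. \<bar>t - t0\<bar> \<le> e \<longrightarrow> Bf \<xi>0 t \<le> r - d" if "Bf \<xi>0 t0 < r" for t0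
  proof -
    define d where "d = (r - Bf \<xi>0 t0) / 2"
    have d: "d > 0" using that by (simp add: d_def)
    have "isCont (Bf \<xi>0) t0" using cB[of UNIV] by (simp add: continuous_on_eq_continuous_at)
    then obtain e where e: "e > 0" "\<And>t. dist t t0 < e \<Longrightarrow> dist (Bf \<xi>0 t) (Bf \<xi>0 t0) < d"
      using d unfolding continuous_at_eps_delta by blast
    have "Bf \<xi>0 t \<le> r - d" if "\<bar>t - t0\<bar> \<le> e / 2" for t
    proof -
      have "\<bar>Bf \<xi>0 t - Bf \<xi>0 t0\<bar> < d" using e(2)[of t] that e(1) by (auto simp: dist_real_def)
      then have "Bf \<xi>0 t < Bf \<xi>0 t0 + d" by linarith
      moreover have "Bf \<xi>0 t0 + d = r - d" by (simp add: d_def field_simps)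
      ultimately show ?thesis by linarith
    qed
    then show ?thesis using e(1) d by (intro exI[of _ "e/2"] exI[of _ d]) auto
  qed
  obtain e1 d1 where e1: "e1 > 0" "d1 > 0" "\<And>t. \<bar>t - t1\<bar> \<le> e1 \<Longrightarrow> Bf \<xi>0 t \<le> r - d1" using near[OF r(1)] by blast
  obtain e2 d2 where e2: "e2 > 0" "d2 > 0" "\<And>t. \<bar>t - t2\<bar> \<le> e2 \<Longrightarrow> Bf \<xi>0 t \<le> r - d2" using near[OF r(2)] by blast
  define D where "D = min d1 d2"
  have D: "D > 0" using e1 e2 by (simp add: D_def)
  define e where "e = Min {e1, e2, (s1 - t1) / 2, (t2 - s1) / 2, (s2 - t2) / 2, (t1 + 2 * pi - s2) / 2}"
  have e: "e > 0" using e1 e2 ord by (simp add: e_def)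
  have mem: "e \<le> x" if "x \<in> {e1, e2, (s1 - t1) / 2, (t2 - s1) / 2, (s2 - t2) / 2, (t1 + 2 * pi - s2) / 2}" for x
    unfolding e_def using that by (intro Min_le) auto
  have ee: "e \<le> e1" "e \<le> e2" "2 * e \<le> s1 - t1" "2 * e \<le> t2 - s1" "2 * e \<le> s2 - t2" "2 * e \<le> t1 + 2 * pi - s2"
    using mem[of e1] mem[of e2] mem[of "(s1 - t1) / 2"] mem[of "(t2 - s1) / 2"] mem[of "(s2 - t2) / 2"]
      mem[of "(t1 + 2 * pi - s2) / 2"] by auto
  have low: "Bf \<xi>0 t \<le> r - D" if "\<bar>t - t1\<bar> \<le> e \<or> \<bar>t - t2\<bar> \<le> e" for t
  proof (cases "\<bar>t - t1\<bar> \<le> e")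
    case True
    then have "Bf \<xi>0 t \<le> r - d1" using e1(3)[of t] ee(1) by linarith
    then show ?thesis by (simp add: D_def)
  next
    case False
    then have "Bf \<xi>0 t \<le> r - d2" using e2(3)[of t] ee(2) that by linarith
    then show ?thesis by (simp add: D_def)
  qed
  have c: "t1 < t2" "t2 < t1 + 2 * pi" "t1 + e \<le> t2 - e" "t2 + e \<le> t1 + 2 * pi - e" using ord e ee by auto
  obtain \<psi> :: "real \<Rightarrow> complex" where \<psi>0: "\<psi> \<in> ultra_space \<omega>" "\<forall>x\<in>{t1 + e..t2 - e}. \<psi> x = 1"
    "\<forall>x\<in>{t2 + e..t1 + 2 * pi - e}. \<psi> x = 0"
    using cutoff[OF nq c(1,2) e c(3,4)] by blast
  note \<psi> = \<psi>0(1) bspec[OF \<psi>0(2)] bspec[OF \<psi>0(3)]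
  have s1in: "s1 \<in> {t1 - e..t2 + e}" using ord e by auto
  have c': "t1 - e < t2 + e" "t2 + e < t1 - e + 2 * pi" using ord e ee by auto
  obtain \<theta> \<Theta> where \<theta>0: "\<theta> \<in> ultra_space \<omega> \<and> (\<forall>t. (\<Theta> has_vector_derivative \<theta> t) (at t)) \<and>
     (\<forall>t. \<Theta> (t + 2 * pi) = \<Theta> t + of_real (2 * pi)) \<and> (\<forall>t\<in>{t1 - e..t2 + e}. \<theta> t = 0 \<and> \<Theta> t = (0 :: complex))"
    using correction_phase[OF nq c' s1in] by (elim exE)
  then have \<theta>: "\<theta> \<in> ultra_space \<omega>" "\<And>t. (\<Theta> has_vector_derivative \<theta> t) (at t)"
     "\<And>t. \<Theta> (t + 2 * pi) = \<Theta> t + of_real (2 * pi)" "\<And>t. t \<in> {t1 - e..t2 + e} \<Longrightarrow> \<theta> t = 0 \<and> \<Theta> t = 0"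
    by auto
  have sm\<psi>: "smooth_fn \<psi>" and per\<psi>: "periodic_fn \<psi>" using \<psi>(1) ultra_space_smooth ultra_space_periodic by blast+
  have per\<theta>: "periodic_fn \<theta>" using \<theta>(1) ultra_space_periodic by blast
  \<comment> \<open>On {t1 - e..t2 + e} the factor \<theta> vanishes, and on the rest of the period
    \<psi> does.\<close>
  have \<theta>\<psi>: "\<theta> t * \<psi> t = 0" for t
  proof -
    obtain s k where s: "s \<in> {t1 - e..<t1 - e + 2 * pi}" "t = s + 2 * pi * of_int k" using real_representative by blast
    have "\<theta> s * \<psi> s = 0"
      using s(1) \<theta>(4)[of s] \<psi>(3)[of s] by (cases "s \<le> t2 + e") auto
    then show ?thesis using s(2) periodic_real_int[OF per\<theta>, of s k] periodic_real_int[OF per\<psi>, of s k] by simp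
  qed
  \<comment> \<open>P is the rate of the linear growth of \<omega> along the frequencies; the
    summand 1 keeps it positive.\<close>
  define P where "P = (nrm \<xi>0 + nrm \<eta> + 2) * \<omega> 1 + 1"
  have w1: "\<omega> 1 \<ge> 0" by (rule omega_nonneg) simp
  have P: "P > 0" using w1 by (simp add: P_def add_nonneg_pos)
  have growth: "\<omega> (nrm (\<xi> n)) \<le> P * (real (N n) + 1)" for n
  proof -
    have "nrm (\<xi> n) \<le> (\<Sum>j\<in>UNIV. real (N n) * \<bar>real_of_int (\<xi>0 j)\<bar> + \<bar>real_of_int (\<eta> j)\<bar>)"
      unfolding nrm_def \<xi>_def by (intro sum_mono) (simp add: abs_mult order_trans[OF abs_triangle_ineq])
    then have 1: "nrm (\<xi> n) \<le> real (N n) * nrm \<xi>0 + nrm \<eta>"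
      by (simp add: nrm_def sum.distrib sum_distrib_left)
    define m where "m = nat \<lceil>nrm (\<xi> n)\<rceil> + 1"
    have m: "nrm (\<xi> n) \<le> real m" "1 \<le> m" "real m \<le> nrm (\<xi> n) + 2" 
      using nrm_nonneg[of "\<xi> n"] unfolding m_def by linarith+
    have "\<omega> (nrm (\<xi> n)) \<le> \<omega> (real m * 1)" using m by (intro omega_mono) auto
    also have "\<dots> \<le> real m * \<omega> 1" using m by (intro omega_mult_nat) auto
    also have "\<dots> \<le> (real (N n) * nrm \<xi>0 + nrm \<eta> + 2) * \<omega> 1" using m 1 w1 by (intro mult_right_mono) auto
    also have "\<dots> \<le> ((nrm \<xi>0 + nrm \<eta> + 2) * (real (N n) + 1)) * \<omega> 1"
    proof (rule mult_right_mono[OF _ w1])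
      have "0 \<le> nrm \<xi>0" "0 \<le> nrm \<eta> * real (N n)" by auto
      then show "real (N n) * nrm \<xi>0 + nrm \<eta> + 2 \<le> (nrm \<xi>0 + nrm \<eta> + 2) * (real (N n) + 1)"
        by (simp add: algebra_simps)
    qed
    also have "\<dots> \<le> P * (real (N n) + 1)" by (simp add: P_def algebra_simps)
    finally show ?thesis .
  qed
  \<comment> \<open>The smallness exp(- N D) is worth the rate 2 \<mu>; one \<mu> is consumed by
    \<open>twisted_bound\<close>, the other is the decay that remains.\<close>
  define \<mu> where "\<mu> = D / (2 * P)"
  have \<mu>: "\<mu> > 0" using D P by (simp add: \<mu>_def)
  obtain m where m0: "m \<ge> 0" and zm: "\<And>\<xi>. norm (z0 \<xi>) \<le> m * nrm \<xi>" using norm_z0_le by blast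
  from twisted_bound[OF \<theta>(1) \<mu> m0]
  obtain l1 K where l1: "l1 > 0" "K > 0" and tw: "\<forall>(\<xi>::'n \<Rightarrow> int) z \<kappa> \<Theta>. nrm \<xi> \<ge> 1 \<longrightarrow> norm z \<le> m * nrm \<xi> \<longrightarrow>
     (\<forall>t. (\<Theta> has_vector_derivative \<theta> t) (at t)) \<longrightarrow>
     (let g = (\<lambda>t. \<kappa> * exp (- Q \<xi> t + \<i> * z * \<Theta> t)) in
       smooth_fn g \<and> (\<forall>t. nderiv 1 g t = - ((q \<xi> t - \<i> * z * \<theta> t) * g t)) \<and>
       (\<forall>k t. norm (nderiv k g t) \<le> K * norm (g t) * exp (\<mu> * \<omega> (nrm \<xi>)) * M l1 k))"
    by (elim exE conjE)
  have n1: "nrm (\<xi> n) \<ge> 1" for n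
  proof -
    obtain j where "\<xi> n j \<noteq> 0" using nz[of n] by (auto simp: \<xi>_def fun_eq_iff)
    then have "1 \<le> \<bar>real_of_int (\<xi> n j)\<bar>" by linarith
    then show ?thesis using abs_le_nrm[of "\<xi> n" j] by linarith
  qed
  define z where "z n = z0 (\<xi> n)" for n
  have zn: "norm (z n) \<le> m * nrm (\<xi> n)" for n using zm by (simp add: z_def)
  define \<rho> where "\<rho> = Bf \<eta> s1"
  \<comment> \<open>Subtracting N r places the level r at modulus 1, and \<rho> cancels the
    contribution of \<eta> at s1, so |u n s1| = exp(N (Bf \<xi>0 s1 - r)).\<close>
  define \<kappa> where "\<kappa> n = exp (- complex_of_real (real (N n) * r + \<rho>))" for n
  define g where "g n = (\<lambda>t. \<kappa> n * exp (- Q (\<xi> n) t + \<i> * z n * \<Theta> t))" for n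
  have g: "smooth_fn (g n) \<and> (\<forall>t. nderiv 1 (g n) t = - ((q (\<xi> n) t - \<i> * z n * \<theta> t) * g n t)) \<and>
       (\<forall>k t. norm (nderiv k (g n) t) \<le> K * norm (g n t) * exp (\<mu> * \<omega> (nrm (\<xi> n))) * M l1 k)" for n
    using tw[rule_format, OF n1 zn \<theta>(2)] unfolding Let_def g_def .
  have gper: "periodic_fn (g n)" for n
  proof -
    have "- Q (\<xi> n) (t + 2 * pi) + \<i> * z n * \<Theta> (t + 2 * pi) = - Q (\<xi> n) t + \<i> * z n * \<Theta> t" for t
      unfolding Q_period Q_2pi \<theta>(3) z_def by (simp add: algebra_simps)
    then show ?thesis unfolding periodic_real g_def by simp
  qed
  have gult: "g n \<in> ultra_space \<omega>" for n
  proof (rule ultra_from_bound[OF _ gper l1(1)])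
    show "smooth_fn (g n)" using g by blast
    show "norm (nderiv k (g n) t) \<le> (K * exp (\<mu> * \<omega> (nrm (\<xi> n)))) * norm (g n t) * M l1 k" for k t
      using g[of n] by (simp add: mult_ac)
  qed (use l1 in simp)
  define u where "u n = (\<lambda>t. g n t * \<psi> t)" for n
  have uult: "u n \<in> ultra_space \<omega>" for n unfolding u_def by (rule ultra_space_mult[OF gult \<psi>(1)])
  have Lu: "mode_op (\<xi> n) (u n) = (\<lambda>t. g n t * nderiv 1 \<psi> t)" for n
  proof
    fix t
    have "nderiv 1 (u n) t = nderiv 1 (g n) t * \<psi> t + g n t * nderiv 1 \<psi> t"
      unfolding u_def nderiv_def using g[of n] sm\<psi> by (simp add: pderiv_mult smooth_differentiable)
    moreover have "nderiv 1 (g n) t = - ((q (\<xi> n) t - \<i> * z n * \<theta> t) * g n t)" using g by blast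
    moreover have "mode_op (\<xi> n) (u n) t = nderiv 1 (u n) t + q (\<xi> n) t * (g n t * \<psi> t)"
      by (simp add: mode_op_def u_def mult_ac)
    ultimately have "mode_op (\<xi> n) (u n) t = \<i> * z n * g n t * (\<theta> t * \<psi> t) + g n t * nderiv 1 \<psi> t"
      by (simp only:) (simp add: algebra_simps)
    then show "mode_op (\<xi> n) (u n) t = g n t * nderiv 1 \<psi> t" using \<theta>\<psi> by simp
  qed
  obtain l2 C2 where l2: "l2 > 0" "ultra_bnd l2 C2 (nderiv 1 \<psi>)"
  proof -
    have "pderiv_dir 1 \<psi> \<in> ultra_space \<omega>" by (rule ultra_space_pderiv[OF \<psi>(1)]) simp
    then show ?thesis using that unfolding ultra_space_iff nderiv_def by auto
  qed
  note C2 = ultra_bnd_nonneg[OF l2(2)]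
  define l where "l = min l1 l2"
  have l: "l > 0" using l1 l2 by (simp add: l_def)
  have "compact (Bf \<eta> ` {t1 - e..t2 + e})" by (intro compact_continuous_image cB compact_Icc)
  then have "bounded (Bf \<eta> ` {t1 - e..t2 + e})" by (rule compact_imp_bounded)
  then obtain S where S: "\<And>t. t \<in> {t1 - e..t2 + e} \<Longrightarrow> \<bar>Bf \<eta> t\<bar> \<le> S"
    unfolding bounded_iff by (auto simp del: atLeastAtMost_iff)
  have Blin: "Bf (\<xi> n) t = real (N n) * Bf \<xi>0 t + Bf \<eta> t" for n t
    by (simp add: Bf_def \<xi>_def sum_distrib_left sum.distrib algebra_simps)
  have gsmall: "norm (g n t) \<le> exp (2 * S + D) * exp (- (2 * \<mu>) * \<omega> (nrm (\<xi> n)))"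
    if t: "t \<in> {t1 - e..t2 + e}" "\<bar>t - t1\<bar> \<le> e \<or> \<bar>t - t2\<bar> \<le> e" for n t
  proof -
    have "norm (g n t) = exp (- (real (N n) * r + \<rho>)) * exp (Bf (\<xi> n) t)"
      using \<theta>(4)[OF t(1)] by (simp add: g_def \<kappa>_def norm_mult Re_Q)
    also have "\<dots> = exp (real (N n) * (Bf \<xi>0 t - r) + Bf \<eta> t - \<rho>)"
      unfolding Blin by (simp add: algebra_simps flip: exp_add)
    also have "\<dots> \<le> exp (2 * S + D - (2 * \<mu>) * \<omega> (nrm (\<xi> n)))"
    proof -
      have "real (N n) * (Bf \<xi>0 t - r) \<le> real (N n) * (- D)" using low[OF t(2)] by (intro mult_left_mono) auto
      moreover have "(2 * \<mu>) * \<omega> (nrm (\<xi> n)) \<le> (2 * \<mu>) * (P * (real (N n) + 1))"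
        using growth[of n] \<mu> by (intro mult_left_mono) auto
      moreover have "(2 * \<mu>) * (P * (real (N n) + 1)) = D * real (N n) + D" using P by (simp add: \<mu>_def algebra_simps)
      moreover have "Bf \<eta> t \<le> S" "- \<rho> \<le> S" using S[OF t(1)] S[OF s1in] by (auto simp: \<rho>_def)
      ultimately show ?thesis unfolding exp_le_cancel_iff mult_minus_right mult.commute[of "real (N n)" D] by linarith
    qed
    finally show ?thesis by (simp add: exp_diff exp_minus divide_inverse)
  qed
  define A where "A = K * exp (2 * S + D) * C2"
  have A: "A \<ge> 0" using l1 C2 by (simp add: A_def)
  have smp: "smooth_fn (nderiv 1 \<psi>)" using l2(2) ultra_bnd_smooth by blast
  have main: "norm (nderiv k (\<lambda>t. g n t * nderiv 1 \<psi> t) t) \<le> A * M (l/2) k * exp (- \<mu> * \<omega> (nrm (\<xi> n)))"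
    if t: "t \<in> {t1 - e..<t1 - e + 2 * pi}" for n k t
  \<comment> \<open>In these two intervals \<psi> is constant and all its derivatives vanish; the
    remaining points of the period lie within e of t1 or t2.\<close>
  proof (cases "t \<in> {t1 + e<..<t2 - e} \<or> t \<in> {t2 + e<..<t1 + 2 * pi - e}")
    case True
    have z: "nderiv j (nderiv 1 \<psi>) t = 0" for j
    proof -
      have "nderiv (Suc j) \<psi> t = 0"
        using True nderiv_locally_const[OF sm\<psi>, of "t1 + e" "t2 - e" 1 t j] \<psi>(2)
          nderiv_locally_const[OF sm\<psi>, of "t2 + e" "t1 + 2 * pi - e" 0 t j] \<psi>(3) by auto
      then show ?thesis by (simp add: nderiv_add)
    qed
    have "norm (nderiv k (\<lambda>t. g n t * nderiv 1 \<psi> t) t) \<le> (\<Sum>j\<le>k. real (k choose j) * (norm (nderiv j (g n) t) * 0))"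
      using g[of n] by (intro norm_nderiv_mult_le smp) (auto simp: z[unfolded One_nat_def])
    moreover have "0 \<le> A * M (l/2) k * exp (- \<mu> * \<omega> (nrm (\<xi> n)))" using A by simp
    ultimately show ?thesis by simp
  next
    case False
    then have t': "t \<in> {t1 - e..t2 + e}" "\<bar>t - t1\<bar> \<le> e \<or> \<bar>t - t2\<bar> \<le> e" using t ord e ee by auto
    let ?E = "exp (\<mu> * \<omega> (nrm (\<xi> n)))"
    let ?C = "K * norm (g n t) * ?E"
    have C: "?C \<ge> 0" using l1 by simp
    have "norm (nderiv k (\<lambda>t. g n t * nderiv 1 \<psi> t) t) \<le> (\<Sum>j\<le>k. real (k choose j) * ((?C * M l j) * (C2 * M l (k - j))))"
    proof (rule norm_nderiv_mult_le[OF _ smp])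
      show "smooth_fn (g n)" using g by blast
      show "norm (nderiv j (g n) t) \<le> ?C * M l j" for j
      proof -
        have "norm (nderiv j (g n) t) \<le> ?C * M l1 j" using g by blast
        also have "\<dots> \<le> ?C * M l j" using C l by (intro mult_left_mono M_antimono) (auto simp: l_def)
        finally show ?thesis .
      qed
      show "norm (nderiv j (nderiv 1 \<psi>) t) \<le> C2 * M l j" for j
        by (rule ultra_bnd_nderiv[OF ultra_bnd_antimono[OF l2(2) l]]) (simp add: l_def)
    qed
    also have "\<dots> \<le> ?C * C2 * M (l/2) k" by (rule sum_binom_bound[OF l C C2])
    also have "\<dots> = norm (g n t) * (K * ?E * C2 * M (l/2) k)" by (simp add: mult_ac)
    also have "\<dots> \<le> (exp (2 * S + D) * exp (- (2 * \<mu>) * \<omega> (nrm (\<xi> n)))) * (K * ?E * C2 * M (l/2) k)"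
      using l1 C2 by (intro mult_right_mono gsmall t') auto
    also have "\<dots> = A * M (l/2) k * (exp (- (2 * \<mu>) * \<omega> (nrm (\<xi> n))) * ?E)" by (simp add: A_def mult_ac)
    also have "exp (- (2 * \<mu>) * \<omega> (nrm (\<xi> n))) * ?E = exp (- \<mu> * \<omega> (nrm (\<xi> n)))"
      by (simp add: algebra_simps flip: exp_add)
    finally show ?thesis .
  qed
  have "coef_bound (l/2) A \<mu> (\<xi> n) (mode_op (\<xi> n) (u n))" for n
    unfolding coef_bound_def
  proof (intro conjI allI)
    have L: "mode_op (\<xi> n) (u n) \<in> ultra_space \<omega>" by (rule mode_op_ultra[OF uult])
    then show sp: "smooth_fn (mode_op (\<xi> n) (u n))" "periodic_fn (mode_op (\<xi> n) (u n))"
      by (auto intro: ultra_space_smooth ultra_space_periodic)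
    fix k t
    obtain s i where s: "s \<in> {t1 - e..<t1 - e + 2 * pi}" "t = s + 2 * pi * of_int i" using real_representative by blast
    have "periodic_fn (nderiv k (mode_op (\<xi> n) (u n)))"
      unfolding nderiv_def by (rule periodic_iter[OF sp]) (auto simp: set_replicate_conv_if)
    then have "nderiv k (mode_op (\<xi> n) (u n)) t = nderiv k (mode_op (\<xi> n) (u n)) s" using s(2) periodic_real_int by blast
    then show "norm (nderiv k (mode_op (\<xi> n) (u n)) t) \<le> A * M (l/2) k * exp (- \<mu> * \<omega> (nrm (\<xi> n)))"
      using main[OF s(1)] unfolding Lu by simp
  qed
  moreover have "u n s1 = exp (- Q (\<xi> n) s1 - of_real (N n * r + Bf \<eta> s1))" for n
  proof -
    have "s1 \<in> {t1 + e..t2 - e}" using ee ord e by auto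
    then show ?thesis using \<psi>(2) \<theta>(4)[OF s1in] by (simp add: u_def g_def \<kappa>_def \<rho>_def exp_diff exp_minus field_simps exp_add)
  qed
  moreover have "u n s2 = 0" for n
  proof -
    have "s2 \<in> {t2 + e..t1 + 2 * pi - e}" using ee ord e by auto
    then show ?thesis using \<psi>(3) by (simp add: u_def)
  qed
  moreover have "l/2 > 0" using l by simp
  ultimately show ?thesis using uult \<mu> by blast
qed

text \<open>Without resonance v = u, whose modulus at s1 is at least 1. With resonance v = u + C
  exp(- Q); put R = N r. As both hills reach the level r, the values at s1 and s2 give exp(R) |exp(-
  R) + C| \<le> w and exp(R) |C| \<le> w, and the triangle inequality yields 1 \<le> 2 w. Either way
  w cannot tend to 0.\<close>

lemma hill_obstruction:
  assumes nq: "non_quasianalytic \<omega>"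
    and N: "\<And>n. n \<le> N n" and inj: "inj (\<lambda>n j. int (N n) * \<xi>0 j + \<eta> j)"
    and nz: "\<And>n. (\<lambda>j. int (N n) * \<xi>0 j + \<eta> j) \<noteq> 0"
    and ord: "t1 < s1" "s1 < t2" "t2 < s2" "s2 < t1 + 2 * pi"
    and r: "Bf \<xi>0 t1 < r" "Bf \<xi>0 t2 < r" "r \<le> Bf \<xi>0 s1"
    and alt: "(\<forall>n. exp (Q (\<lambda>j. int (N n) * \<xi>0 j + \<eta> j) (2 * pi)) \<noteq> 1) \<or> \<eta> = 0 \<and> r \<le> Bf \<xi>0 s2"
  shows "\<not> globally_solvable \<omega> a b"
proof
  assume sol: "globally_solvable \<omega> a b"
  define \<xi> where "\<xi> = (\<lambda>n j. int (N n) * \<xi>0 j + \<eta> j)"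
  obtain u lam A \<delta> where u: "lam > 0 \<and> \<delta> > 0 \<and> (\<forall>n. u n \<in> ultra_space \<omega> \<and> coef_bound lam A \<delta> (\<xi> n) (mode_op (\<xi> n) (u n)) \<and>
     u n s1 = exp (- Q (\<xi> n) s1 - of_real (N n * r + Bf \<eta> s1)) \<and> u n s2 = 0)"
    using hill_functions[OF nq N nz ord r(1,2)] unfolding \<xi>_def by (elim exE)
  have l: "lam > 0" "\<delta> > 0" and ult: "\<And>n. u n \<in> ultra_space \<omega>" and cb: "\<And>n. coef_bound lam A \<delta> (\<xi> n) (mode_op (\<xi> n) (u n))"
    and us1: "\<And>n. u n s1 = exp (- Q (\<xi> n) s1 - of_real (N n * r + Bf \<eta> s1))" and us2: "\<And>n. u n s2 = 0"
    using u by auto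
  have inj': "inj \<xi>" using inj unfolding \<xi>_def .
  note si = solvable_imp[where u = u, OF sol inj' l ult cb]
  obtain v where "\<exists>w. (\<forall>n. smooth_fn (v n) \<and> periodic_fn (v n) \<and> mode_op (\<xi> n) (v n) = mode_op (\<xi> n) (u n)) \<and>
     (\<forall>n t. norm (v n t) \<le> w n) \<and> w \<longlonglongrightarrow> 0"
    using si by (rule exE)
  then obtain w where vw0: "(\<forall>n. smooth_fn (v n) \<and> periodic_fn (v n) \<and> mode_op (\<xi> n) (v n) = mode_op (\<xi> n) (u n)) \<and>
     (\<forall>n t. norm (v n t) \<le> w n) \<and> w \<longlonglongrightarrow> 0"
    by (rule exE)
  then have vs: "\<And>n. smooth_fn (v n)" "\<And>n. periodic_fn (v n)" "\<And>n. mode_op (\<xi> n) (v n) = mode_op (\<xi> n) (u n)"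
    and vw: "\<And>n t. norm (v n t) \<le> w n" and w: "w \<longlonglongrightarrow> 0" by auto
  have Blin: "Bf (\<xi> n) t = real (N n) * Bf \<xi>0 t + Bf \<eta> t" for n t
    by (simp add: Bf_def \<xi>_def sum_distrib_left sum.distrib algebra_simps)
  have "1 \<le> 2 * w n" for n
    using alt
  proof
    assume nr: "\<forall>n. exp (Q (\<lambda>j. int (N n) * \<xi>0 j + \<eta> j) (2 * pi)) \<noteq> 1"
    then have "exp (Q (\<xi> n) (2 * pi)) \<noteq> 1" unfolding \<xi>_def by blast
    from mode_op_unique[OF ultra_space_smooth[OF ult] vs(1) vs(3) ultra_space_periodic[OF ult] vs(2) this]
    have "norm (u n s1) \<le> w n" using vw[of n s1] by simp
    moreover have "norm (u n s1) = exp (real (N n) * (Bf \<xi>0 s1 - r))"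
      unfolding us1 by (simp add: Re_Q Blin algebra_simps)
    moreover have "1 \<le> exp (real (N n) * (Bf \<xi>0 s1 - r))" using r(3) by simp
    ultimately show ?thesis by linarith
  next
    assume res: "\<eta> = 0 \<and> r \<le> Bf \<xi>0 s2"
    define R where "R = real (N n) * r"
    have B0: "Bf \<eta> t = 0" for t using res by (simp add: Bf_def)
    obtain C where C: "\<And>t. v n t = u n t + C * exp (- Q (\<xi> n) t)"
      using mode_op_eq_imp[OF ultra_space_smooth[OF ult] vs(1) vs(3)] by blast
    have "v n s1 = exp (- Q (\<xi> n) s1) * (exp (- of_real R) + C)"
      unfolding C us1 R_def B0 by (simp add: exp_diff exp_minus field_simps)
    then have "norm (v n s1) = exp (real (N n) * Bf \<xi>0 s1) * norm (exp (- of_real R) + C)"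
      by (simp add: norm_mult Re_Q Blin B0)
    moreover have "exp R \<le> exp (real (N n) * Bf \<xi>0 s1)" using r(3) by (simp add: R_def mult_left_mono)
    ultimately have 1: "exp R * norm (exp (- of_real R) + C) \<le> w n"
      using vw[of n s1] mult_right_mono[of "exp R" "exp (real (N n) * Bf \<xi>0 s1)" "norm (exp (- of_real R) + C)"] by simp
    have "v n s2 = exp (- Q (\<xi> n) s2) * C" unfolding C us2 by simp
    then have "norm (v n s2) = exp (real (N n) * Bf \<xi>0 s2) * norm C" by (simp add: norm_mult Re_Q Blin B0)
    moreover have "exp R \<le> exp (real (N n) * Bf \<xi>0 s2)" using res by (simp add: R_def mult_left_mono)
    ultimately have 2: "exp R * norm C \<le> w n"
      using vw[of n s2] mult_right_mono[of "exp R" "exp (real (N n) * Bf \<xi>0 s2)" "norm C"] by simp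
    have "norm (exp (- complex_of_real R)) \<le> norm (exp (- complex_of_real R) + C) + norm C"
      using norm_triangle_ineq4[of "exp (- complex_of_real R) + C" C] by simp
    then have "exp R * exp (- R) \<le> exp R * (norm (exp (- complex_of_real R) + C) + norm C)"
      by (intro mult_left_mono) auto
    then have "1 \<le> exp R * norm (exp (- complex_of_real R) + C) + exp R * norm C"
      by (simp add: distrib_left exp_minus)
    then show ?thesis using 1 2 by simp
  qed
  moreover have "\<forall>\<^sub>F n in sequentially. w n < 1 / 2" using w by (rule order_tendstoD) simp
  then obtain n where "w n < 1 / 2" by (auto simp: eventually_sequentially)
  ultimately show False by (smt (verit) field_sum_of_halves)
qed

section \<open>Hills from sign changes and from disconnected sublevel sets\<close>

text \<open>Between a point of positive slope and the next translate of a point of negative slope,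
  the maximum of \<open>Bf\<close> is interior and strictly higher than both ends.\<close>

lemma sign_change_hill:
  assumes p: "\<beta> \<xi> p > 0" and m: "\<beta> \<xi> m < 0"
  shows "\<exists>t1 s1 t2. t1 < s1 \<and> s1 < t2 \<and> t2 < t1 + 2 * pi \<and> Bf \<xi> t1 < Bf \<xi> s1 \<and> Bf \<xi> t2 < Bf \<xi> s1"
proof -
  obtain m' k where m': "m' \<in> {p..<p + 2 * pi}" "m = m' + 2 * pi * of_int k" using real_representative by blast
  have "periodic_fn (\<beta> \<xi>)" by (simp add: periodic_real \<beta>_def per_ab)
  then have bm: "\<beta> \<xi> m' < 0" using m m'(2) periodic_real_int[of "\<beta> \<xi>" m' k] by simp
  then have pm: "p < m'" using p m'(1) by (cases "p = m'") auto
  have D: "(Bf \<xi> has_real_derivative \<beta> \<xi> t) (at t)" for t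
    using Bf_deriv by (simp add: has_real_derivative_iff_has_vector_derivative)
  have "continuous_on {p..m'} (Bf \<xi>)" by (rule DERIV_continuous_on) (use D in \<open>auto intro: has_field_derivative_at_within\<close>)
  then obtain s where s: "s \<in> {p..m'}" "\<forall>t\<in>{p..m'}. Bf \<xi> t \<le> Bf \<xi> s"
    using continuous_attains_sup[of "{p..m'}" "Bf \<xi>"] pm by auto
  obtain d1 where d1: "d1 > 0" "\<And>h. 0 < h \<Longrightarrow> h < d1 \<Longrightarrow> Bf \<xi> p < Bf \<xi> (p + h)"
    using DERIV_pos_inc_right[OF D p] by blast
  obtain d2 where d2: "d2 > 0" "\<And>h. 0 < h \<Longrightarrow> h < d2 \<Longrightarrow> Bf \<xi> m' < Bf \<xi> (m' - h)"
    using DERIV_neg_dec_left[OF D bm] by blast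
  define h where "h = min (min d1 d2) (m' - p) / 2"
  have h: "0 < h" "h < d1" "h < d2" "h < m' - p" using d1(1) d2(1) pm by (auto simp: h_def min_def)
  have "Bf \<xi> p < Bf \<xi> (p + h)" "Bf \<xi> (p + h) \<le> Bf \<xi> s" using d1(2)[OF h(1,2)] s(2) h by auto
  then have 1: "Bf \<xi> p < Bf \<xi> s" by linarith
  have "Bf \<xi> m' < Bf \<xi> (m' - h)" "Bf \<xi> (m' - h) \<le> Bf \<xi> s" using d2(2)[OF h(1,3)] s(2) h by auto
  then have 2: "Bf \<xi> m' < Bf \<xi> s" by linarith
  have "p \<noteq> s" "s \<noteq> m'" using 1 2 by auto
  then show ?thesis using 1 2 s(1) m'(1) by (intro exI[of _ p] exI[of _ s] exI[of _ m']) auto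
qed

text \<open>Two points of different components are joined by two arcs of the circle. Each arc must
  leave the sublevel set, since otherwise it would connect the points inside it; this gives one hill
  on each side.\<close>

lemma sublevel_disconnected:
  assumes per: "Bf \<xi> (2 * pi) = 0" and nc: "\<not> connected (sublevel b \<xi> r)"
  shows "\<exists>t1 s1 t2 s2. t1 < s1 \<and> s1 < t2 \<and> t2 < s2 \<and> s2 < t1 + 2 * pi \<and> Bf \<xi> t1 < r \<and> Bf \<xi> t2 < r \<and>
     r \<le> Bf \<xi> s1 \<and> r \<le> Bf \<xi> s2"
proof -
  have S: "sublevel b \<xi> r = {cis t | t. Bf \<xi> t < r}" by (rule sublevel_eq[OF per])
  have pB: "periodic_fn (Bf \<xi>)" using Bf_period per by (simp add: periodic_real)
  obtain x y where xy: "x \<in> sublevel b \<xi> r" "y \<in> sublevel b \<xi> r" "\<not> connected_component (sublevel b \<xi> r) x y"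
    using nc unfolding connected_iff_connected_component by blast
  obtain t1 where t1: "x = cis t1" "Bf \<xi> t1 < r" using xy(1) S by auto
  obtain t where t: "y = cis t" "Bf \<xi> t < r" using xy(2) S by auto
  obtain t2 k where t2: "t2 \<in> {t1..<t1 + 2 * pi}" "t = t2 + 2 * pi * of_int k" using real_representative by blast
  have y: "y = cis t2" using t(1) t2(2) sin_cos_eq_iff[of t t2] by (auto simp: complex_eq_iff)
  have B2: "Bf \<xi> t2 < r" using t(2) t2(2) periodic_real_int[OF pB, of t2 k] by simp
  have cc: "continuous_on T cis" for T unfolding cis_conv_exp by (intro continuous_intros)
  have arc: "connected_component (sublevel b \<xi> r) (cis p) (cis q)"
    if "p \<le> q" "\<And>s. s \<in> {p..q} \<Longrightarrow> Bf \<xi> s < r" for p q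
  proof (rule connected_componentI)
    show "connected (cis ` {p..q})" by (intro connected_continuous_image cc) simp
    show "cis ` {p..q} \<subseteq> sublevel b \<xi> r" using that(2) S by auto
  qed (use that in auto)
  have "\<exists>s\<in>{t1..t2}. r \<le> Bf \<xi> s"
  proof (rule ccontr)
    assume "\<not> ?thesis"
    then have "connected_component (sublevel b \<xi> r) (cis t1) (cis t2)"
      by (intro arc) (use t2(1) in \<open>auto simp: not_le\<close>)
    then show False using xy(3) t1(1) y by simp
  qed
  then obtain s1 where s1: "s1 \<in> {t1..t2}" "r \<le> Bf \<xi> s1" by blast
  have "cis (t1 + 2 * pi) = cis t1" by (simp add: complex_eq_iff)
  have "\<exists>s\<in>{t2..t1 + 2 * pi}. r \<le> Bf \<xi> s"
  proof (rule ccontr)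
    assume "\<not> ?thesis"
    then have "connected_component (sublevel b \<xi> r) (cis t2) (cis (t1 + 2 * pi))"
      by (intro arc) (use t2(1) in \<open>auto simp: not_le\<close>)
    then show False using xy(3) t1(1) y \<open>cis (t1 + 2 * pi) = cis t1\<close> by (simp add: connected_component_sym_eq)
  qed
  then obtain s2 where s2: "s2 \<in> {t2..t1 + 2 * pi}" "r \<le> Bf \<xi> s2" by blast
  have "s1 \<noteq> t1" "s1 \<noteq> t2" "s2 \<noteq> t2" using s1 s2 t1 B2 by auto
  moreover have "s2 \<noteq> t1 + 2 * pi" using s2(2) t1(2) pB by (auto simp: periodic_real)
  ultimately show ?thesis using s1 s2 t1 B2
    by (intro exI[of _ t1] exI[of _ s1] exI[of _ t2] exI[of _ s2]) auto
qed

lemma exp_Q_eq_1: "exp (Q \<xi> (2 * pi)) = 1 \<longleftrightarrow> (\<exists>m::int. z0 \<xi> = of_int m)"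
proof -
  have "exp (Q \<xi> (2 * pi)) = 1 \<longleftrightarrow> exp (Q \<xi> (2 * pi)) = exp 0" by simp
  also have "\<dots> \<longleftrightarrow> (\<exists>m::int. 2 * pi * \<i> * z0 \<xi> = 2 * pi * \<i> * of_int m)"
    unfolding exp_eq Q_2pi by (simp add: mult_ac)
  also have "\<dots> \<longleftrightarrow> (\<exists>m::int. z0 \<xi> = of_int m)" by simp
  finally show ?thesis .
qed

section \<open>Geometric consequences of solvability\<close>

text \<open>The multiples (n + 1) \<xi> are used with \<eta> = 0. The two hills of a disconnected
  sublevel set meet the second alternative of \<open>hill_obstruction\<close>, so the modes may be
  resonant or not.\<close>

lemma connected_if_solvable:
  assumes nq: "non_quasianalytic \<omega>" and sol: "globally_solvable \<omega> a b" and b0: "\<And>j. mean (b j) = 0"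
  shows "connected (sublevel b \<xi> r)"
proof (rule ccontr)
  assume nc: "\<not> ?thesis"
  have "Bf \<xi> (2 * pi) = 0" using b0 by (simp add: Bf_2pi)
  from sublevel_disconnected[OF this nc] obtain t1 s1 t2 s2 where
    t: "t1 < s1" "s1 < t2" "t2 < s2" "s2 < t1 + 2 * pi" "Bf \<xi> t1 < r" "Bf \<xi> t2 < r" "r \<le> Bf \<xi> s1" "r \<le> Bf \<xi> s2"
    by blast
  have "\<xi> \<noteq> 0" using t(5,7) by (auto simp: Bf_def)
  then obtain j where j: "\<xi> j \<noteq> 0" by (auto simp: fun_eq_iff)
  have "\<not> globally_solvable \<omega> a b"
  proof (rule hill_obstruction[OF nq, where N = Suc and ?\<xi>0.0 = \<xi> and \<eta> = 0 and ?t1.0 = t1 and ?s1.0 = s1 and ?t2.0 = t2 and ?s2.0 = s2 and r = r])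
    show "inj (\<lambda>n i. int (Suc n) * \<xi> i + 0 i)"
    proof (rule injI)
      fix x y assume "(\<lambda>i. int (Suc x) * \<xi> i + 0 i) = (\<lambda>i. int (Suc y) * \<xi> i + 0 i)"
      from fun_cong[OF this, of j] show "x = y" using j by simp
    qed
    show "(\<lambda>i. int (Suc n) * \<xi> i + 0 i) \<noteq> 0" for n
      using j by (auto simp: fun_eq_iff intro!: exI[of _ j])
  qed (use t in auto)
  then show False using sol by blast
qed

text \<open>Without resonance one hill suffices: the level r is its height, and s2 is merely a point
  of the gap between the two valleys.\<close>

lemma nonresonant_obstruction:
  assumes nq: "non_quasianalytic \<omega>" and N: "\<And>n. n \<le> N n" and injN: "inj N"
    and nr: "\<And>n. exp (Q (\<lambda>j. int (N n) * \<xi>0 j + \<eta> j) (2 * pi)) \<noteq> 1"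
    and sgn: "\<beta> \<xi>0 p > 0" "\<beta> \<xi>0 m < 0"
  shows "\<not> globally_solvable \<omega> a b"
proof -
  obtain t1 s1 t2 where t: "t1 < s1" "s1 < t2" "t2 < t1 + 2 * pi" "Bf \<xi>0 t1 < Bf \<xi>0 s1" "Bf \<xi>0 t2 < Bf \<xi>0 s1"
    using sign_change_hill[OF sgn] by blast
  have "\<xi>0 \<noteq> 0" using t(4) by (auto simp: Bf_def)
  then obtain j where j: "\<xi>0 j \<noteq> 0" by (auto simp: fun_eq_iff)
  show ?thesis
  proof (rule hill_obstruction[OF nq N, where ?\<xi>0.0 = \<xi>0 and \<eta> = \<eta> and ?t1.0 = t1 and ?s1.0 = s1 and ?t2.0 = t2 and
        ?s2.0 = "(t2 + (t1 + 2 * pi)) / 2" and r = "Bf \<xi>0 s1"])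
    show "inj (\<lambda>n i. int (N n) * \<xi>0 i + \<eta> i)"
    proof (rule injI)
      fix x y assume "(\<lambda>i. int (N x) * \<xi>0 i + \<eta> i) = (\<lambda>i. int (N y) * \<xi>0 i + \<eta> i)"
      from fun_cong[OF this, of j] show "x = y" using j injN by (simp add: inj_eq)
    qed
    show "(\<lambda>i. int (N n) * \<xi>0 i + \<eta> i) \<noteq> 0" for n
    proof
      assume "(\<lambda>i. int (N n) * \<xi>0 i + \<eta> i) = 0"
      then show False using nr[of n] by (simp add: Q_def)
    qed
  qed (use t nr in auto)
qed

text \<open>A nonzero mean makes the modulus of exp(Q(2 pi)) different from 1 for every positive
  multiple of \<xi>, so none of these modes is resonant.\<close>

lemma no_sign_change_if_solvable:
  assumes nq: "non_quasianalytic \<omega>" and sol: "globally_solvable \<omega> a b" and "Bf \<xi> (2 * pi) \<noteq> 0"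
  shows "\<not> (\<beta> \<xi> p > 0 \<and> \<beta> \<xi> m < 0)"
proof
  assume *: "\<beta> \<xi> p > 0 \<and> \<beta> \<xi> m < 0"
  have "exp (Q (\<lambda>j. int (Suc n) * \<xi> j + 0 j) (2 * pi)) \<noteq> 1" for n
  proof
    assume "exp (Q (\<lambda>j. int (Suc n) * \<xi> j + 0 j) (2 * pi)) = 1"
    then have "norm (exp (Q (\<lambda>j. int (Suc n) * \<xi> j + 0 j) (2 * pi))) = 1" by simp
    then have "Bf (\<lambda>j. int (Suc n) * \<xi> j + 0 j) (2 * pi) = 0" unfolding norm_exp_Q by simp
    moreover have "Bf (\<lambda>j. int (Suc n) * \<xi> j + 0 j) (2 * pi) = real (Suc n) * Bf \<xi> (2 * pi)"
      by (simp add: Bf_def sum_distrib_left mult_ac del: of_nat_Suc)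
    ultimately show False using assms(3) by simp
  qed
  then have "\<not> globally_solvable \<omega> a b"
    by (rule nonresonant_obstruction[OF nq, where N = Suc and \<eta> = 0 and p = p and m = m, rotated 2])
      (use * in simp_all)
  then show False using sol by blast
qed

text \<open>A function of constant sign has a monotone primitive; when the primitive is periodic as
  well, it is constant and the function vanishes.\<close>

lemma zero_mean_changes_sign:
  fixes h :: "real \<Rightarrow> real"
  assumes h: "continuous_on UNIV h" "\<And>t. h (t + 2 * pi) = h t" "prim h (2 * pi) = 0" "h \<noteq> (\<lambda>t. 0)"
  shows "\<exists>p m. h p > 0 \<and> h m < 0"
proof -
  have per: "periodic_fn (prim h)" using prim_period[OF h(1,2)] h(3) by (simp add: periodic_real)
  note D = prim_real_derivative[OF h(1)]
  have zero: "h = (\<lambda>t. 0)" if "\<And>t. t \<in> {0..2*pi} \<Longrightarrow> prim h t = 0"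
  proof
    fix t
    have "prim h t = 0" for t
    proof -
      obtain s k where "s \<in> {0..<0 + 2 * pi}" "t = s + 2 * pi * of_int k" using real_representative by blast
      then show ?thesis using that[of s] periodic_real_int[OF per, of s k] by simp
    qed
    then have "prim h = (\<lambda>t. 0)" by blast
    then have "((\<lambda>t. 0) has_real_derivative h t) (at t)" using D[of t] by simp
    then show "h t = 0" using DERIV_unique DERIV_const by blast
  qed
  have "\<exists>p. h p > 0"
  proof (rule ccontr)
    assume "\<not> ?thesis"
    then have le: "h t \<le> 0" for t by (auto simp: not_less)
    have dec: "prim h y \<le> prim h x" if "x \<le> y" for x y
      using DERIV_nonpos_imp_nonincreasing[of x y "prim h"] that D le by blast
    have "prim h t = 0" if "t \<in> {0..2*pi}" for t
      using dec[of 0 t] dec[of t "2 * pi"] that h(3) by simp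
    then show False using zero h(4) by blast
  qed
  moreover have "\<exists>m. h m < 0"
  proof (rule ccontr)
    assume "\<not> ?thesis"
    then have ge: "h t \<ge> 0" for t by (auto simp: not_less)
    have inc: "prim h x \<le> prim h y" if "x \<le> y" for x y
      using DERIV_nonneg_imp_nondecreasing[of x y "prim h"] that D ge by blast
    have "prim h t = 0" if "t \<in> {0..2*pi}" for t
      using inc[of 0 t] inc[of t "2 * pi"] that h(3) by simp
    then show False using zero h(4) by blast
  qed
  ultimately show ?thesis by blast
qed

definition unit_freq :: "'n \<Rightarrow> 'n \<Rightarrow> int" where "unit_freq j i = (if i = j then 1 else 0)"

lemma sum_unit_freq: "(\<Sum>i\<in>UNIV. of_int (unit_freq j i) * f i) = (f j :: 'b :: ring_1)"
proof -
  have "(\<Sum>i\<in>UNIV. of_int (unit_freq j i) * f i) = (\<Sum>i\<in>UNIV. if i = j then f i else 0)"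
    by (rule sum.cong) (auto simp: unit_freq_def)
  then show ?thesis by simp
qed

text \<open>The values of z0 at n e_j and at n e_j + e_k, with e_i the unit frequencies, differ by
  the mean of a_k. If this is not an integer, at least one of the two frequencies is nonresonant for
  each n. Hence one of the shifts 0 and e_k works for infinitely many n, which are then enumerated;
  b_j changes sign and supplies the hill.\<close>

lemma integer_means_if_solvable:
  assumes nq: "non_quasianalytic \<omega>" and sol: "globally_solvable \<omega> a b" and b0: "\<And>j. mean (b j) = 0"
    and bj: "b j \<noteq> (\<lambda>t. 0)"
  shows "mean (a k) \<in> \<int>"
proof (rule ccontr)
  assume ak: "mean (a k) \<notin> \<int>"
  have "prim (b j) (2 * pi) = 0" using b0 by (simp add: prim_2pi)
  from zero_mean_changes_sign[OF cont_ab(2) per_ab(2) this bj] obtain p m where "b j p > 0" "b j m < 0" by blast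
  then have sgn: "\<beta> (unit_freq j) p > 0" "\<beta> (unit_freq j) m < 0" by (simp_all add: \<beta>_def sum_unit_freq)
  have zk: "z0 (unit_freq k) = of_real (mean (a k))"
    using b0 by (simp add: z0_def sum_unit_freq complex_eq_iff)
  define \<zeta> where "\<zeta> n \<eta> = (\<lambda>i. int n * unit_freq j i + \<eta> i)" for n and \<eta> :: "'n \<Rightarrow> int"
  have "exp (Q (\<zeta> n 0) (2 * pi)) \<noteq> 1 \<or> exp (Q (\<zeta> n (unit_freq k)) (2 * pi)) \<noteq> 1" for n
  proof (rule ccontr)
    assume "\<not> ?thesis"
    then obtain m1 m2 :: int where "z0 (\<zeta> n 0) = of_int m1" "z0 (\<zeta> n (unit_freq k)) = of_int m2" unfolding exp_Q_eq_1 by auto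
    moreover have "z0 (\<zeta> n (unit_freq k)) = z0 (\<zeta> n 0) + z0 (unit_freq k)"
      by (simp add: z0_def \<zeta>_def distrib_right sum.distrib)
    ultimately have "complex_of_real (mean (a k)) = complex_of_real (of_int (m2 - m1))"
      using zk by (simp add: eq_diff_eq add.commute)
    then have "mean (a k) = of_int (m2 - m1)" unfolding of_real_eq_iff .
    then show False using ak by simp
  qed
  then have "UNIV \<subseteq> {n. exp (Q (\<zeta> n 0) (2 * pi)) \<noteq> 1} \<union> {n. exp (Q (\<zeta> n (unit_freq k)) (2 * pi)) \<noteq> 1}" by blast
  then have "infinite {n. exp (Q (\<zeta> n 0) (2 * pi)) \<noteq> 1} \<or> infinite {n. exp (Q (\<zeta> n (unit_freq k)) (2 * pi)) \<noteq> 1}"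
    using infinite_UNIV_nat finite_subset[OF _ finite_UnI] by blast
  then obtain \<eta> where inf: "infinite {n. exp (Q (\<zeta> n \<eta>) (2 * pi)) \<noteq> 1}" (is "infinite ?A") by blast
  have "\<not> globally_solvable \<omega> a b"
  proof (rule nonresonant_obstruction[OF nq _ _ _ sgn, where N = "enumerate ?A" and \<eta> = \<eta>])
    show "n \<le> enumerate ?A n" for n by (rule le_enumerate[OF inf])
    show "inj (enumerate ?A)" using strict_mono_enumerate[OF inf] by (rule strict_mono_imp_inj_on)
    show "exp (Q (\<lambda>i. int (enumerate ?A n) * unit_freq j i + \<eta> i) (2 * pi)) \<noteq> 1" for n
      using enumerate_in_set[OF inf, of n] by (simp add: \<zeta>_def)
  qed
  then show False using sol by blast
qed

text \<open>With c the quotient of the means, b_k - c b_j has mean zero and changes sign unless it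
  vanishes. Replacing c by a nearby rational s > c keeps the change of sign and makes the mean
  nonzero; clearing denominators gives an integer frequency excluded by
  \<open>no_sign_change_if_solvable\<close>.\<close>

lemma proportional_if_solvable:
  assumes nq: "non_quasianalytic \<omega>" and sol: "globally_solvable \<omega> a b" and j: "mean (b j) \<noteq> 0"
  shows "\<exists>c. b k = (\<lambda>t. c * b j t)"
proof (rule ccontr)
  assume nc: "\<not> ?thesis"
  define c where "c = mean (b k) / mean (b j)"
  define h where "h t = b k t - c * b j t" for t
  have ch: "continuous_on UNIV h" unfolding h_def by (intro continuous_intros cont_ab)
  have "((\<lambda>t. prim (b k) t - c * prim (b j) t) has_vector_derivative h t) (at t)" for t
    unfolding h_def by (intro has_vector_derivative_diff has_vector_derivative_mult_right prim_has_vector_derivative cont_ab)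
  from prim_unique[OF ch this, of "2 * pi" 0] have "prim h (2 * pi) = 0"
    using j by (simp add: prim_2pi c_def)
  moreover have "h \<noteq> (\<lambda>t. 0)"
  proof
    assume "h = (\<lambda>t. 0)"
    then have "b k t = c * b j t" for t unfolding h_def by (metis eq_iff_diff_eq_0)
    then show False using nc by blast
  qed
  moreover have "h (t + 2 * pi) = h t" for t by (simp add: h_def per_ab)
  ultimately obtain p m where pm: "h p > 0" "h m < 0" using zero_mean_changes_sign[OF ch] by blast
  have "(\<lambda>s. b k p - s * b j p) \<midarrow>c\<rightarrow> h p" unfolding h_def by (intro tendsto_intros)
  then have p: "\<forall>\<^sub>F s in at c. b k p - s * b j p > 0" by (rule order_tendstoD(1)[OF _ pm(1)])
  have "(\<lambda>s. b k m - s * b j m) \<midarrow>c\<rightarrow> h m" unfolding h_def by (intro tendsto_intros)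
  then have "\<forall>\<^sub>F s in at c. b k m - s * b j m < 0" by (rule order_tendstoD(2)[OF _ pm(2)])
  with p have "\<forall>\<^sub>F s in at c. b k p - s * b j p > 0 \<and> b k m - s * b j m < 0" by (rule eventually_conj)
  then obtain d where d: "d > 0" "\<And>s. s \<noteq> c \<Longrightarrow> dist s c < d \<Longrightarrow> b k p - s * b j p > 0 \<and> b k m - s * b j m < 0"
    unfolding eventually_at by auto
  obtain s where s: "s \<in> \<rat>" "c < s" "s < c + d" using Rats_dense_in_real[of c "c + d"] d(1) by auto
  then have sd: "b k p - s * b j p > 0" "b k m - s * b j m < 0" using d(2)[of s] by (auto simp: dist_real_def)
  obtain x y :: int where xy: "y > 0" "s = of_int x / of_int y"
    using s(1) by (auto elim!: Rats_cases')
  define \<xi> where "\<xi> = (\<lambda>i. y * unit_freq k i - x * unit_freq j i)"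
  have lin: "(\<Sum>i\<in>UNIV. real_of_int (\<xi> i) * f i) = y * (f k - s * f j)" for f :: "'n \<Rightarrow> real"
  proof -
    have "(\<Sum>i\<in>UNIV. real_of_int (\<xi> i) * f i) = y * (\<Sum>i\<in>UNIV. of_int (unit_freq k i) * f i) - x * (\<Sum>i\<in>UNIV. of_int (unit_freq j i) * f i)"
      by (simp add: \<xi>_def algebra_simps sum_subtractf sum_distrib_left)
    then show ?thesis using xy by (simp add: sum_unit_freq right_diff_distrib)
  qed
  have "Bf \<xi> (2 * pi) = 2 * pi * (y * (mean (b k) - s * mean (b j)))" unfolding Bf_2pi lin ..
  moreover have "mean (b k) - s * mean (b j) = (c - s) * mean (b j)" using j by (simp add: c_def left_diff_distrib)
  ultimately have "Bf \<xi> (2 * pi) \<noteq> 0" using xy(1) s(2) j by simp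
  from no_sign_change_if_solvable[OF nq sol this, of p m] show False
    using sd xy(1) unfolding \<beta>_def lin by (simp add: mult_pos_pos mult_pos_neg)
qed

end

section \<open>One-dimensional span and the final equivalences\<close>

lemma dim_span_fun_eq_1:
  "dim_span_fun (range b) = 1 \<longleftrightarrow> (\<exists>j. b j \<noteq> (\<lambda>t. 0) \<and> (\<forall>k. \<exists>c. b k = (\<lambda>t. c * b j t)))"
proof -
  interpret V: vector_space "\<lambda>(c::real) (f::real \<Rightarrow> real) x. c * f x"
    by unfold_locales (auto simp: fun_eq_iff algebra_simps)
  have zero: "(0 :: real \<Rightarrow> real) = (\<lambda>t. 0)" by (simp add: fun_eq_iff)
  have dim: "dim_span_fun (range b) = V.dim (range b)"
    unfolding dim_span_fun_def by (rule V.dim_span)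
  show ?thesis
  proof
    assume "dim_span_fun (range b) = 1"
    then have d: "V.dim (range b) = 1" using dim by simp
    obtain B where B: "B \<subseteq> range b" "\<not> V.dependent B" "range b \<subseteq> V.span B" "card B = V.dim (range b)"
      using V.basis_exists[of "range b"] by blast
    then obtain f where f: "B = {f}" using d by (auto simp: card_1_singleton_iff)
    then obtain j where j: "f = b j" using B(1) by blast
    have "b j \<noteq> (\<lambda>t. 0)" using B(2) f j zero V.dependent_zero[of B] by auto
    moreover have "\<exists>c. b k = (\<lambda>t. c * b j t)" for k
      using B(3) f j by (auto simp: V.span_singleton)
    ultimately show "\<exists>j. b j \<noteq> (\<lambda>t. 0) \<and> (\<forall>k. \<exists>c. b k = (\<lambda>t. c * b j t))" by blast
  next
    assume "\<exists>j. b j \<noteq> (\<lambda>t. 0) \<and> (\<forall>k. \<exists>c. b k = (\<lambda>t. c * b j t))"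
    then obtain j where j: "b j \<noteq> (\<lambda>t. 0)" "\<And>k. \<exists>c. b k = (\<lambda>t. c * b j t)" by blast
    have "V.dim (range b) = 1"
    proof (rule V.dim_unique[of "{b j}"])
      show "range b \<subseteq> V.span {b j}" using j(2) by (auto simp: V.span_singleton)
      show "V.independent {b j}" using j(1) zero by (simp add: V.dependent_single)
    qed auto
    then show "dim_span_fun (range b) = 1" using dim by simp
  qed
qed

theorem theorem2p1:
  fixes \<omega> :: "real \<Rightarrow> real"
    and a b :: "'n::finite \<Rightarrow> real \<Rightarrow> real"
  assumes "weight_function \<omega>" and "subadditive_weight \<omega>" and "non_quasianalytic \<omega>"
    and "\<And>j. a j \<in> ultra_space \<omega>" and "\<And>j. b j \<in> ultra_space \<omega>"
  shows "((\<forall>j. mean (b j) = 0) \<longrightarrow>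
            ((\<forall>j. b j = (\<lambda>t. 0)) \<longrightarrow>
               (globally_solvable \<omega> a b \<longleftrightarrow> EDC2 \<omega> (\<lambda>j. mean (a j)) (\<lambda>j. 0))) \<and>
            ((\<exists>j. b j \<noteq> (\<lambda>t. 0)) \<longrightarrow>
               (globally_solvable \<omega> a b \<longleftrightarrow>
                  (\<forall>j. mean (a j) \<in> \<int>) \<and>
                  (\<forall>r \<xi>. connected (sublevel b \<xi> r)))))
       \<and> ((\<exists>j. mean (b j) \<noteq> 0) \<longrightarrow>
            (globally_solvable \<omega> a b \<longleftrightarrow>
               dim_span_fun (range b) = 1 \<and>
               (\<forall>j. \<not> changes_sign (b j)) \<and>
               EDC2 \<omega> (\<lambda>j. mean (a j)) (\<lambda>j. mean (b j))))"
proof -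
  interpret torus_operator \<omega> a b
    by unfold_locales (use assms in auto)
  note nq = assms(3)
  show ?thesis
  proof (intro conjI impI)
    assume b0: "\<forall>j. mean (b j) = 0"
    then have m0: "(\<lambda>j. mean (b j)) = (\<lambda>j. 0)" by auto
    assume z: "\<forall>j. b j = (\<lambda>t. 0)"
    show "globally_solvable \<omega> a b \<longleftrightarrow> EDC2 \<omega> (\<lambda>j. mean (a j)) (\<lambda>j. 0)"
    proof
      assume E: "EDC2 \<omega> (\<lambda>j. mean (a j)) (\<lambda>j. 0)"
      show "globally_solvable \<omega> a b"
      proof (rule solvable_if_EDC2)
        show "EDC2 \<omega> (\<lambda>j. mean (a j)) (\<lambda>j. mean (b j))" using E unfolding m0 .
        show "(\<forall>t. \<beta> \<xi> t \<ge> 0) \<or> (\<forall>t. \<beta> \<xi> t \<le> 0)" for \<xi> using z by (simp add: \<beta>_def)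
      qed
    next
      assume "globally_solvable \<omega> a b"
      then show "EDC2 \<omega> (\<lambda>j. mean (a j)) (\<lambda>j. 0)" using EDC2_if_solvable m0 by metis
    qed
  next
    assume b0: "\<forall>j. mean (b j) = 0" and "\<exists>j. b j \<noteq> (\<lambda>t. 0)"
    then obtain j where "b j \<noteq> (\<lambda>t. 0)" by blast
    then show "globally_solvable \<omega> a b \<longleftrightarrow> (\<forall>j. mean (a j) \<in> \<int>) \<and> (\<forall>r \<xi>. connected (sublevel b \<xi> r))"
      using b0 solvable_if_connected integer_means_if_solvable[OF nq] connected_if_solvable[OF nq] by blast
  next
    assume "\<exists>j. mean (b j) \<noteq> 0"
    then obtain j where j: "mean (b j) \<noteq> 0" by blast
    then have bj: "b j \<noteq> (\<lambda>t. 0)" by (auto simp: mean_def)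
    show "globally_solvable \<omega> a b \<longleftrightarrow> dim_span_fun (range b) = 1 \<and> (\<forall>j. \<not> changes_sign (b j)) \<and>
        EDC2 \<omega> (\<lambda>j. mean (a j)) (\<lambda>j. mean (b j))"
    proof
      assume sol: "globally_solvable \<omega> a b"
      have lin: "\<exists>c. b k = (\<lambda>t. c * b j t)" for k by (rule proportional_if_solvable[OF nq sol j])
      have "Bf (unit_freq j) (2 * pi) \<noteq> 0" using j by (simp add: Bf_2pi sum_unit_freq)
      from no_sign_change_if_solvable[OF nq sol this]
      have sj: "\<not> (b j p > 0 \<and> b j m < 0)" for p m by (simp add: \<beta>_def sum_unit_freq)
      have "\<not> changes_sign (b k)" for k
      proof -
        obtain c where "b k = (\<lambda>t. c * b j t)" using lin by blast
        then show ?thesis using sj by (auto simp: changes_sign_def zero_less_mult_iff mult_less_0_iff)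
      qed
      then show "dim_span_fun (range b) = 1 \<and> (\<forall>j. \<not> changes_sign (b j)) \<and> EDC2 \<omega> (\<lambda>j. mean (a j)) (\<lambda>j. mean (b j))"
        using dim_span_fun_eq_1 bj lin EDC2_if_solvable[OF sol] by blast
    next
      assume h: "dim_span_fun (range b) = 1 \<and> (\<forall>j. \<not> changes_sign (b j)) \<and> EDC2 \<omega> (\<lambda>j. mean (a j)) (\<lambda>j. mean (b j))"
      then obtain i where i: "\<And>k. \<exists>c. b k = (\<lambda>t. c * b i t)" using dim_span_fun_eq_1 by metis
      then obtain d where d: "\<And>k. b k = (\<lambda>t. d k * b i t)" by metis
      \<comment> \<open>All the functions \<open>\<beta> \<xi>\<close> are multiples of the single
        b_i, so each of them inherits a constant sign.\<close>
      have "\<beta> \<xi> t = (\<Sum>k\<in>UNIV. real_of_int (\<xi> k) * d k) * b i t" for \<xi> t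
        unfolding \<beta>_def by (subst d) (simp add: sum_distrib_right mult.assoc)
      moreover have "(\<forall>t. b i t \<ge> 0) \<or> (\<forall>t. b i t \<le> 0)"
        using h unfolding changes_sign_def by (metis not_le)
      ultimately have "(\<forall>t. \<beta> \<xi> t \<ge> 0) \<or> (\<forall>t. \<beta> \<xi> t \<le> 0)" for \<xi>
        by (auto simp: zero_le_mult_iff mult_le_0_iff)
      then show "globally_solvable \<omega> a b" using h solvable_if_EDC2 by blast
    qed
  qed
qed

end
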